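(* Let $\mathfrak{H}$ be a bicategorically complete 2-category and let $\mathcal{A}:\Delta\to\mathfrak{H}$ be a pseudofunctor. Then $\mathcal{D}esc(\mathcal{A})\simeq\mathrm{PsRan}_{\mathrm{j}}\mathcal{A}(\mathsf{0})$.
   Context: $\mathrm{j}:\Delta\to\dot\Delta$ is the full inclusion of the category of nonempty finite ordinals into the category of finite ordinals and order preserving functions ($\mathsf{n}$ is the ordinal with $n$ elements, so $\mathsf{0}$ is the empty ordinal), both regarded as locally discrete 2-categories. $[-,-]_{PS}$ denotes 2-categories of pseudofunctors, pseudonatural transformations and modifications. Weighted bilimit: for pseudofunctors $\mathcal{W}:\mathfrak{A}\to\mathsf{CAT}$ and $\mathcal{B}:\mathfrak{A}\to\mathfrak{H}$, $\mathrm{bilim}(\mathcal{W},\mathcal{B})$ is an object of $\mathfrak{H}$ with an equivalence $\mathfrak{H}(X,\mathrm{bilim}(\mathcal{W},\mathcal{B}))\simeq[\mathfrak{A},\mathsf{CAT}]_{PS}(\mathcal{W},\mathfrak{H}(X,\mathcal{B}-))$ pseudonatural in $X$; $\mathfrak{H}$ is bicategorically complete if it has all small weighted bilimits. $\mathrm{PsRan}_{\mathrm{j}}\mathcal{A}:\dot\Delta\to\mathfrak{H}$ is the right pseudo-Kan extension: a pseudofunctor with a pseudonatural transformation $\varepsilon_{\mathcal{A}}:(\mathrm{PsRan}_{\mathrm{j}}\mathcal{A})\circ\mathrm{j}\to\mathcal{A}$ such that $\alpha\mapsto\varepsilon_{\mathcal{A}}\,(\alpha\mathrm{j})$ defines a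 pseudonatural equivalence $[\dot\Delta,\mathfrak{H}]_{PS}(-,\mathrm{PsRan}_{\mathrm{j}}\mathcal{A})\to[\Delta,\mathfrak{H}]_{PS}(-\circ\mathrm{j},\mathcal{A})$. $\Delta_3$ is the category with objects $\mathsf{1},\mathsf{2},\mathsf{3}$ generated by $d^0,d^1:\mathsf{1}\to\mathsf{2}$, $s^0:\mathsf{2}\to\mathsf{1}$, $\partial^0,\partial^1,\partial^2:\mathsf{2}\to\mathsf{3}$ subject to $\partial^kd^i=\partial^id^{k-1}$ for $i<k$ and $s^0d^0=s^0d^1=\mathrm{id}$; $\mathrm{t}_3:\Delta_3\to\Delta$ is the evident inclusion, taking generators to the corresponding coface and codegeneracy maps. For an ordinal $\mathsf{n}$, $\nabla\mathsf{n}$ is the localization of the category $\mathsf{n}$ with respect to all its morphisms, and $\mathbb{W}:\Delta_3\to\mathsf{CAT}$ is the 2-functor $\mathsf{n}\mapsto\nabla\mathsf{n}$, with the functors induced by the coface and codegeneracy maps. Define $\mathcal{D}esc(\mathcal{A}):=\mathrm{bilim}(\mathbb{W},\mathcal{A}\circ\mathrm{t}_3)$. *)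

theory Defs
  imports Main "HOL-Library.FuncSet"
begin

section \<open>Categories, functors and natural transformations\<close>

text \<open>
  Functors, natural transformations, pseudofunctors, pseudonatural transformations and
  modifications are records of maps that are \<open>undefined\<close> outside the relevant carriers
  (as in \<^theory>\<open>HOL-Library.FuncSet\<close>), so that equality of records is the intended equality.
  Composites are written in the order of application: the cell on the right comes first.
\<close>

record ('o, 'm) cat =
  Ob :: "'o set"
  Ar :: "'m set"
  Dom :: "'m \<Rightarrow> 'o"
  Cod :: "'m \<Rightarrow> 'o"
  Id :: "'o \<Rightarrow> 'm"
  Comp :: "'m \<Rightarrow> 'm \<Rightarrow> 'm"  (infixr "\<cdot>\<index>" 70)

definition Hom :: "('o, 'm) cat \<Rightarrow> 'o \<Rightarrow> 'o \<Rightarrow> 'm set" where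
  "Hom C a b = {f \<in> Ar C. Dom C f = a \<and> Cod C f = b}"

locale category =
  fixes C :: "('o, 'm) cat"
  assumes dom_in: "f \<in> Ar C \<Longrightarrow> Dom C f \<in> Ob C"
    and cod_in: "f \<in> Ar C \<Longrightarrow> Cod C f \<in> Ob C"
    and id_in: "a \<in> Ob C \<Longrightarrow> Id C a \<in> Hom C a a"
    and comp_in: "f \<in> Hom C a b \<Longrightarrow> g \<in> Hom C b c \<Longrightarrow> g \<cdot>\<^bsub>C\<^esub> f \<in> Hom C a c"
    and comp_id: "f \<in> Hom C a b \<Longrightarrow> f \<cdot>\<^bsub>C\<^esub> Id C a = f"
    and id_comp: "f \<in> Hom C a b \<Longrightarrow> Id C b \<cdot>\<^bsub>C\<^esub> f = f"
    and comp_assoc: "f \<in> Hom C a b \<Longrightarrow> g \<in> Hom C b c \<Longrightarrow> h \<in> Hom C c d \<Longrightarrow>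
      (h \<cdot>\<^bsub>C\<^esub> g) \<cdot>\<^bsub>C\<^esub> f = h \<cdot>\<^bsub>C\<^esub> (g \<cdot>\<^bsub>C\<^esub> f)"

definition full_subcat :: "('o, 'm) cat \<Rightarrow> 'o set \<Rightarrow> ('o, 'm) cat" where
  "full_subcat C S = C\<lparr>Ob := Ob C \<inter> S, Ar := {f \<in> Ar C. Dom C f \<in> S \<and> Cod C f \<in> S}\<rparr>"

record ('o, 'm, 'p, 'n) fctr =
  FDom :: "('o, 'm) cat"
  FCod :: "('p, 'n) cat"
  FOb :: "'o \<Rightarrow> 'p"
  FAr :: "'m \<Rightarrow> 'n"

definition is_functor :: "('o, 'm, 'p, 'n) fctr \<Rightarrow> bool" where
  "is_functor F \<longleftrightarrow> (let C = FDom F; D = FCod F in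
     category C \<and> category D \<and>
     FOb F \<in> Ob C \<rightarrow>\<^sub>E Ob D \<and> FAr F \<in> Ar C \<rightarrow>\<^sub>E Ar D \<and>
     (\<forall>f\<in>Ar C. Dom D (FAr F f) = FOb F (Dom C f) \<and> Cod D (FAr F f) = FOb F (Cod C f)) \<and>
     (\<forall>a\<in>Ob C. FAr F (Id C a) = Id D (FOb F a)) \<and>
     (\<forall>f\<in>Ar C. \<forall>g\<in>Ar C. Cod C f = Dom C g \<longrightarrow>
        FAr F (g \<cdot>\<^bsub>C\<^esub> f) = FAr F g \<cdot>\<^bsub>D\<^esub> FAr F f))"

definition fid :: "('o, 'm) cat \<Rightarrow> ('o, 'm, 'o, 'm) fctr" where
  "fid C = \<lparr>FDom = C, FCod = C, FOb = restrict (\<lambda>a. a) (Ob C), FAr = restrict (\<lambda>f. f) (Ar C)\<rparr>"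

definition fcomp :: "('p, 'n, 'q, 'l) fctr \<Rightarrow> ('o, 'm, 'p, 'n) fctr \<Rightarrow> ('o, 'm, 'q, 'l) fctr"
    (infixr "\<circ>\<^sub>F" 70) where
  "G \<circ>\<^sub>F F = \<lparr>FDom = FDom F, FCod = FCod G,
     FOb = compose (Ob (FDom F)) (FOb G) (FOb F), FAr = compose (Ar (FDom F)) (FAr G) (FAr F)\<rparr>"

record ('o, 'm, 'p, 'n) ntrans =
  NDom :: "('o, 'm, 'p, 'n) fctr"
  NCod :: "('o, 'm, 'p, 'n) fctr"
  NAt :: "'o \<Rightarrow> 'n"

definition nat_trans :: "('o, 'm, 'p, 'n) ntrans \<Rightarrow> bool" where
  "nat_trans \<sigma> \<longleftrightarrow> (let F = NDom \<sigma>; G = NCod \<sigma>; C = FDom F; D = FCod F in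
     is_functor F \<and> is_functor G \<and> FDom G = C \<and> FCod G = D \<and>
     NAt \<sigma> \<in> (\<Pi>\<^sub>E a\<in>Ob C. Hom D (FOb F a) (FOb G a)) \<and>
     (\<forall>f\<in>Ar C. NAt \<sigma> (Cod C f) \<cdot>\<^bsub>D\<^esub> FAr F f = FAr G f \<cdot>\<^bsub>D\<^esub> NAt \<sigma> (Dom C f)))"

definition nid :: "('o, 'm, 'p, 'n) fctr \<Rightarrow> ('o, 'm, 'p, 'n) ntrans" where
  "nid F = \<lparr>NDom = F, NCod = F, NAt = (\<lambda>a\<in>Ob (FDom F). Id (FCod F) (FOb F a))\<rparr>"

definition nvcomp :: "('o, 'm, 'p, 'n) ntrans \<Rightarrow> ('o, 'm, 'p, 'n) ntrans \<Rightarrow> ('o, 'm, 'p, 'n) ntrans"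
    (infixr "\<bullet>\<^sub>N" 65) where
  "\<tau> \<bullet>\<^sub>N \<sigma> = \<lparr>NDom = NDom \<sigma>, NCod = NCod \<tau>,
     NAt = (\<lambda>a\<in>Ob (FDom (NDom \<sigma>)). NAt \<tau> a \<cdot>\<^bsub>FCod (NDom \<sigma>)\<^esub> NAt \<sigma> a)\<rparr>"

definition nhcomp :: "('p, 'n, 'q, 'l) ntrans \<Rightarrow> ('o, 'm, 'p, 'n) ntrans \<Rightarrow> ('o, 'm, 'q, 'l) ntrans"
    (infixr "\<star>\<^sub>N" 70) where
  "\<tau> \<star>\<^sub>N \<sigma> = \<lparr>NDom = NDom \<tau> \<circ>\<^sub>F NDom \<sigma>, NCod = NCod \<tau> \<circ>\<^sub>F NCod \<sigma>,
     NAt = (\<lambda>a\<in>Ob (FDom (NDom \<sigma>)).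
       NAt \<tau> (FOb (NCod \<sigma>) a) \<cdot>\<^bsub>FCod (NDom \<tau>)\<^esub> FAr (NDom \<tau>) (NAt \<sigma> a))\<rparr>"

definition nat_iso :: "('o, 'm, 'p, 'n) ntrans \<Rightarrow> bool" where
  "nat_iso \<sigma> \<longleftrightarrow> nat_trans \<sigma> \<and> (\<exists>\<tau>. nat_trans \<tau> \<and> NDom \<tau> = NCod \<sigma> \<and> NCod \<tau> = NDom \<sigma> \<and>
     \<tau> \<bullet>\<^sub>N \<sigma> = nid (NDom \<sigma>) \<and> \<sigma> \<bullet>\<^sub>N \<tau> = nid (NCod \<sigma>))"

definition cat_equivalence :: "('o, 'm, 'p, 'n) fctr \<Rightarrow> bool" where
  "cat_equivalence F \<longleftrightarrow> is_functor F \<and>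
     (\<exists>G \<eta> \<epsilon>. is_functor G \<and> FDom G = FCod F \<and> FCod G = FDom F \<and>
        nat_iso \<eta> \<and> NDom \<eta> = fid (FDom F) \<and> NCod \<eta> = G \<circ>\<^sub>F F \<and>
        nat_iso \<epsilon> \<and> NDom \<epsilon> = F \<circ>\<^sub>F G \<and> NCod \<epsilon> = fid (FCod F))"


section \<open>2-categories\<close>

record ('o, 'a, 'c) twocat =
  Obj :: "'o set"
  Arr :: "'a set"
  Cel :: "'c set"
  Src :: "'a \<Rightarrow> 'o"
  Tgt :: "'a \<Rightarrow> 'o"
  Dm :: "'c \<Rightarrow> 'a"
  Cd :: "'c \<Rightarrow> 'a"
  One :: "'o \<Rightarrow> 'a"
  Cmp :: "'a \<Rightarrow> 'a \<Rightarrow> 'a"  (infixr "\<odot>\<index>" 70)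
  Idc :: "'a \<Rightarrow> 'c"
  VC :: "'c \<Rightarrow> 'c \<Rightarrow> 'c"  (infixr "\<bullet>\<index>" 65)
  HC :: "'c \<Rightarrow> 'c \<Rightarrow> 'c"  (infixr "\<star>\<index>" 70)

definition Hom1 :: "('o, 'a, 'c) twocat \<Rightarrow> 'o \<Rightarrow> 'o \<Rightarrow> 'a set" where
  "Hom1 H X Y = {f \<in> Arr H. Src H f = X \<and> Tgt H f = Y}"

definition Hom2 :: "('o, 'a, 'c) twocat \<Rightarrow> 'a \<Rightarrow> 'a \<Rightarrow> 'c set" where
  "Hom2 H f g = {\<alpha> \<in> Cel H. Dm H \<alpha> = f \<and> Cd H \<alpha> = g}"

definition HomC :: "('o, 'a, 'c) twocat \<Rightarrow> 'o \<Rightarrow> 'o \<Rightarrow> ('a, 'c) cat" where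
  "HomC H X Y = \<lparr>Ob = Hom1 H X Y, Ar = {\<alpha> \<in> Cel H. Dm H \<alpha> \<in> Hom1 H X Y}, Dom = Dm H, Cod = Cd H,
     Id = Idc H, Comp = VC H\<rparr>"

locale two_category =
  fixes H :: "('o, 'a, 'c) twocat"
  assumes src_in: "f \<in> Arr H \<Longrightarrow> Src H f \<in> Obj H"
    and tgt_in: "f \<in> Arr H \<Longrightarrow> Tgt H f \<in> Obj H"
    and cell_parallel: "\<alpha> \<in> Cel H \<Longrightarrow> Dm H \<alpha> \<in> Hom1 H X Y \<longleftrightarrow> Cd H \<alpha> \<in> Hom1 H X Y"
    and cell_dom: "\<alpha> \<in> Cel H \<Longrightarrow> Dm H \<alpha> \<in> Arr H"
    and hom_category: "X \<in> Obj H \<Longrightarrow> Y \<in> Obj H \<Longrightarrow> category (HomC H X Y)"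
    and one_in: "X \<in> Obj H \<Longrightarrow> One H X \<in> Hom1 H X X"
    and cmp_in: "f \<in> Hom1 H X Y \<Longrightarrow> g \<in> Hom1 H Y Z \<Longrightarrow> g \<odot>\<^bsub>H\<^esub> f \<in> Hom1 H X Z"
    and cmp_one: "f \<in> Hom1 H X Y \<Longrightarrow> f \<odot>\<^bsub>H\<^esub> One H X = f"
    and one_cmp: "f \<in> Hom1 H X Y \<Longrightarrow> One H Y \<odot>\<^bsub>H\<^esub> f = f"
    and cmp_assoc: "f \<in> Hom1 H X Y \<Longrightarrow> g \<in> Hom1 H Y Z \<Longrightarrow> h \<in> Hom1 H Z W \<Longrightarrow>
      (h \<odot>\<^bsub>H\<^esub> g) \<odot>\<^bsub>H\<^esub> f = h \<odot>\<^bsub>H\<^esub> (g \<odot>\<^bsub>H\<^esub> f)"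
    and hc_in: "\<alpha> \<in> Hom2 H f f' \<Longrightarrow> \<beta> \<in> Hom2 H g g' \<Longrightarrow> Tgt H f = Src H g \<Longrightarrow>
      \<beta> \<star>\<^bsub>H\<^esub> \<alpha> \<in> Hom2 H (g \<odot>\<^bsub>H\<^esub> f) (g' \<odot>\<^bsub>H\<^esub> f')"
    and hc_one: "\<alpha> \<in> Hom2 H f f' \<Longrightarrow> \<alpha> \<star>\<^bsub>H\<^esub> Idc H (One H (Src H f)) = \<alpha>"
    and one_hc: "\<alpha> \<in> Hom2 H f f' \<Longrightarrow> Idc H (One H (Tgt H f)) \<star>\<^bsub>H\<^esub> \<alpha> = \<alpha>"
    and hc_assoc: "\<alpha> \<in> Hom2 H f f' \<Longrightarrow> \<beta> \<in> Hom2 H g g' \<Longrightarrow> \<gamma> \<in> Hom2 H h h' \<Longrightarrow>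
      Tgt H f = Src H g \<Longrightarrow> Tgt H g = Src H h \<Longrightarrow>
      (\<gamma> \<star>\<^bsub>H\<^esub> \<beta>) \<star>\<^bsub>H\<^esub> \<alpha> = \<gamma> \<star>\<^bsub>H\<^esub> (\<beta> \<star>\<^bsub>H\<^esub> \<alpha>)"
    and hc_idc: "f \<in> Hom1 H X Y \<Longrightarrow> g \<in> Hom1 H Y Z \<Longrightarrow>
      Idc H g \<star>\<^bsub>H\<^esub> Idc H f = Idc H (g \<odot>\<^bsub>H\<^esub> f)"
    and interchange: "\<alpha> \<in> Hom2 H f f' \<Longrightarrow> \<alpha>' \<in> Hom2 H f' f'' \<Longrightarrow>
      \<beta> \<in> Hom2 H g g' \<Longrightarrow> \<beta>' \<in> Hom2 H g' g'' \<Longrightarrow> Tgt H f = Src H g \<Longrightarrow>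
      (\<beta>' \<bullet>\<^bsub>H\<^esub> \<beta>) \<star>\<^bsub>H\<^esub> (\<alpha>' \<bullet>\<^bsub>H\<^esub> \<alpha>) = (\<beta>' \<star>\<^bsub>H\<^esub> \<alpha>') \<bullet>\<^bsub>H\<^esub> (\<beta> \<star>\<^bsub>H\<^esub> \<alpha>)"

definition inv_cell :: "('o, 'a, 'c) twocat \<Rightarrow> 'c \<Rightarrow> bool" where
  "inv_cell H \<alpha> \<longleftrightarrow> \<alpha> \<in> Cel H \<and> (\<exists>\<beta>\<in>Hom2 H (Cd H \<alpha>) (Dm H \<alpha>).
     \<beta> \<bullet>\<^bsub>H\<^esub> \<alpha> = Idc H (Dm H \<alpha>) \<and> \<alpha> \<bullet>\<^bsub>H\<^esub> \<beta> = Idc H (Cd H \<alpha>))"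

definition equivalent_in :: "('o, 'a, 'c) twocat \<Rightarrow> 'o \<Rightarrow> 'o \<Rightarrow> bool" where
  "equivalent_in H X Y \<longleftrightarrow> X \<in> Obj H \<and> Y \<in> Obj H \<and>
     (\<exists>f\<in>Hom1 H X Y. \<exists>g\<in>Hom1 H Y X.
        (\<exists>\<eta>\<in>Hom2 H (One H X) (g \<odot>\<^bsub>H\<^esub> f). inv_cell H \<eta>) \<and>
        (\<exists>\<epsilon>\<in>Hom2 H (f \<odot>\<^bsub>H\<^esub> g) (One H Y). inv_cell H \<epsilon>))"

text \<open>\<open>OpT H\<close> reverses the 1-cells but not the 2-cells.\<close>

definition OpT :: "('o, 'a, 'c) twocat \<Rightarrow> ('o, 'a, 'c) twocat" where
  "OpT H = H\<lparr>Src := Tgt H, Tgt := Src H, Cmp := (\<lambda>g f. f \<odot>\<^bsub>H\<^esub> g), HC := (\<lambda>\<beta> \<alpha>. \<alpha> \<star>\<^bsub>H\<^esub> \<beta>)\<rparr>"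

text \<open>The locally discrete 2-category on a category: the only 2-cells are identities, and the
  identity 2-cell of \<open>f\<close> is \<open>f\<close> itself.\<close>

definition LD :: "('o, 'm) cat \<Rightarrow> ('o, 'm, 'm) twocat" where
  "LD C = \<lparr>Obj = Ob C, Arr = Ar C, Cel = Ar C, Src = Dom C, Tgt = Cod C, Dm = (\<lambda>f. f), Cd = (\<lambda>f. f),
     One = Id C, Cmp = Comp C, Idc = (\<lambda>f. f), VC = (\<lambda>g f. f), HC = Comp C\<rparr>"

text \<open>The 2-category of all categories with objects in \<open>'x\<close> and arrows in \<open>'y\<close>.\<close>

definition CAT :: "(('x, 'y) cat, ('x, 'y, 'x, 'y) fctr, ('x, 'y, 'x, 'y) ntrans) twocat" where
  "CAT = \<lparr>Obj = {C. category C}, Arr = {F. is_functor F}, Cel = {\<sigma>. nat_trans \<sigma>},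
     Src = FDom, Tgt = FCod, Dm = NDom, Cd = NCod, One = fid, Cmp = fcomp, Idc = nid,
     VC = nvcomp, HC = nhcomp\<rparr>"


section \<open>Pseudofunctors\<close>

text \<open>\<open>PU F X\<close> is the constraint \<open>1 \<Rightarrow> F 1\<close> at \<open>X\<close>, and \<open>PM F g f\<close> is the constraint
  \<open>F g \<odot> F f \<Rightarrow> F (g \<odot> f)\<close>.\<close>

record ('o, 'a, 'c, 'p, 'b, 'd) psf =
  PO :: "'o \<Rightarrow> 'p"
  PA :: "'a \<Rightarrow> 'b"
  PC :: "'c \<Rightarrow> 'd"
  PU :: "'o \<Rightarrow> 'd"
  PM :: "'a \<Rightarrow> 'a \<Rightarrow> 'd"

definition restrict2 :: "('o, 'a, 'c) twocat \<Rightarrow> ('a \<Rightarrow> 'a \<Rightarrow> 'd) \<Rightarrow> 'a \<Rightarrow> 'a \<Rightarrow> 'd" where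
  "restrict2 A m g f =
     (if g \<in> Arr A \<and> f \<in> Arr A \<and> Tgt A f = Src A g then m g f else undefined)"

locale pseudofunctor =
  fixes A :: "('o, 'a, 'c) twocat" and B :: "('p, 'b, 'd) twocat"
    and F :: "('o, 'a, 'c, 'p, 'b, 'd) psf"
  assumes po_ext: "PO F \<in> extensional (Obj A)"
    and pa_ext: "PA F \<in> extensional (Arr A)"
    and pc_ext: "PC F \<in> extensional (Cel A)"
    and pu_ext: "PU F \<in> extensional (Obj A)"
    and pm_ext: "PM F = restrict2 A (PM F)"
    and po_in: "X \<in> Obj A \<Longrightarrow> PO F X \<in> Obj B"
    and pa_in: "f \<in> Hom1 A X Y \<Longrightarrow> PA F f \<in> Hom1 B (PO F X) (PO F Y)"
    and pc_in: "\<theta> \<in> Hom2 A f g \<Longrightarrow> PC F \<theta> \<in> Hom2 B (PA F f) (PA F g)"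
    and pc_idc: "f \<in> Arr A \<Longrightarrow> PC F (Idc A f) = Idc B (PA F f)"
    and pc_vc: "\<theta> \<in> Hom2 A f g \<Longrightarrow> \<xi> \<in> Hom2 A g h \<Longrightarrow>
      PC F (\<xi> \<bullet>\<^bsub>A\<^esub> \<theta>) = PC F \<xi> \<bullet>\<^bsub>B\<^esub> PC F \<theta>"
    and pu_in: "X \<in> Obj A \<Longrightarrow> PU F X \<in> Hom2 B (One B (PO F X)) (PA F (One A X))"
    and pu_inv: "X \<in> Obj A \<Longrightarrow> inv_cell B (PU F X)"
    and pm_in: "f \<in> Hom1 A X Y \<Longrightarrow> g \<in> Hom1 A Y Z \<Longrightarrow>
      PM F g f \<in> Hom2 B (PA F g \<odot>\<^bsub>B\<^esub> PA F f) (PA F (g \<odot>\<^bsub>A\<^esub> f))"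
    and pm_inv: "f \<in> Hom1 A X Y \<Longrightarrow> g \<in> Hom1 A Y Z \<Longrightarrow> inv_cell B (PM F g f)"
    and pm_natural: "\<theta> \<in> Hom2 A f f' \<Longrightarrow> \<xi> \<in> Hom2 A g g' \<Longrightarrow> Tgt A f = Src A g \<Longrightarrow>
      PC F (\<xi> \<star>\<^bsub>A\<^esub> \<theta>) \<bullet>\<^bsub>B\<^esub> PM F g f = PM F g' f' \<bullet>\<^bsub>B\<^esub> (PC F \<xi> \<star>\<^bsub>B\<^esub> PC F \<theta>)"
    and pm_assoc: "f \<in> Hom1 A X Y \<Longrightarrow> g \<in> Hom1 A Y Z \<Longrightarrow> h \<in> Hom1 A Z W \<Longrightarrow>
      PM F h (g \<odot>\<^bsub>A\<^esub> f) \<bullet>\<^bsub>B\<^esub> (Idc B (PA F h) \<star>\<^bsub>B\<^esub> PM F g f) =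
      PM F (h \<odot>\<^bsub>A\<^esub> g) f \<bullet>\<^bsub>B\<^esub> (PM F h g \<star>\<^bsub>B\<^esub> Idc B (PA F f))"
    and pm_unit_right: "f \<in> Hom1 A X Y \<Longrightarrow>
      PM F f (One A X) \<bullet>\<^bsub>B\<^esub> (Idc B (PA F f) \<star>\<^bsub>B\<^esub> PU F X) = Idc B (PA F f)"
    and pm_unit_left: "f \<in> Hom1 A X Y \<Longrightarrow>
      PM F (One A Y) f \<bullet>\<^bsub>B\<^esub> (PU F Y \<star>\<^bsub>B\<^esub> Idc B (PA F f)) = Idc B (PA F f)"

text \<open>The pseudofunctor with identity constraints on given 2-functorial data.\<close>

definition strict_psf :: "('o, 'a, 'c) twocat \<Rightarrow> ('p, 'b, 'd) twocat \<Rightarrow>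
    ('o \<Rightarrow> 'p) \<Rightarrow> ('a \<Rightarrow> 'b) \<Rightarrow> ('c \<Rightarrow> 'd) \<Rightarrow> ('o, 'a, 'c, 'p, 'b, 'd) psf" where
  "strict_psf A B po pa pc =
     \<lparr>PO = restrict po (Obj A), PA = restrict pa (Arr A), PC = restrict pc (Cel A),
      PU = (\<lambda>X\<in>Obj A. Idc B (pa (One A X))),
      PM = restrict2 A (\<lambda>g f. Idc B (pa (g \<odot>\<^bsub>A\<^esub> f)))\<rparr>"

text \<open>\<open>psf_comp A C G F\<close> is \<open>G \<circ> F\<close>, where \<open>A\<close> is the domain of \<open>F\<close> and \<open>C\<close> the codomain of \<open>G\<close>.\<close>

definition psf_comp :: "('o, 'a, 'c) twocat \<Rightarrow> ('q, 'e, 'k) twocat \<Rightarrow>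
    ('p, 'b, 'd, 'q, 'e, 'k) psf \<Rightarrow> ('o, 'a, 'c, 'p, 'b, 'd) psf \<Rightarrow> ('o, 'a, 'c, 'q, 'e, 'k) psf" where
  "psf_comp A C G F =
     \<lparr>PO = compose (Obj A) (PO G) (PO F), PA = compose (Arr A) (PA G) (PA F),
      PC = compose (Cel A) (PC G) (PC F),
      PU = (\<lambda>X\<in>Obj A. PC G (PU F X) \<bullet>\<^bsub>C\<^esub> PU G (PO F X)),
      PM = restrict2 A (\<lambda>g f. PC G (PM F g f) \<bullet>\<^bsub>C\<^esub> PM G (PA F g) (PA F f))\<rparr>"

text \<open>The representable 2-functor \<open>K(X, -)\<close>. Since \<open>K(Y, L)\<close> is the hom-category from \<open>L\<close> to \<open>Y\<close>
  in \<open>OpT K\<close>, the contravariant one \<open>K(-, L)\<close> is \<open>yo (OpT K) L\<close>.\<close>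

definition yo :: "('o, 'a, 'c) twocat \<Rightarrow> 'o \<Rightarrow>
    ('o, 'a, 'c, ('a, 'c) cat, ('a, 'c, 'a, 'c) fctr, ('a, 'c, 'a, 'c) ntrans) psf" where
  "yo K X =
    (let pa = (\<lambda>g. \<lparr>FDom = HomC K X (Src K g), FCod = HomC K X (Tgt K g),
                FOb = (\<lambda>f\<in>Ob (HomC K X (Src K g)). g \<odot>\<^bsub>K\<^esub> f),
                FAr = (\<lambda>\<alpha>\<in>Ar (HomC K X (Src K g)). Idc K g \<star>\<^bsub>K\<^esub> \<alpha>)\<rparr>)
     in strict_psf K CAT (HomC K X) pa
       (\<lambda>\<theta>. \<lparr>NDom = pa (Dm K \<theta>), NCod = pa (Cd K \<theta>),
              NAt = (\<lambda>f\<in>Ob (HomC K X (Src K (Dm K \<theta>))). \<theta> \<star>\<^bsub>K\<^esub> Idc K f)\<rparr>))"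


section \<open>Pseudonatural transformations and modifications\<close>

text \<open>A pseudonatural transformation \<open>t : F \<rightarrow> G\<close> has 1-cells \<open>TO t X : F X \<rightarrow> G X\<close> and invertible
  2-cells \<open>TA t f : G f \<odot> TO t X \<Rightarrow> TO t Y \<odot> F f\<close> for \<open>f : X \<rightarrow> Y\<close>.\<close>

record ('f, 'g, 'o, 'a, 'u, 'v) psn =
  TDom :: 'f
  TCod :: 'g
  TO :: "'o \<Rightarrow> 'u"
  TA :: "'a \<Rightarrow> 'v"

record ('t, 'o, 'v) mdf =
  MDom :: 't
  MCod :: 't
  MO :: "'o \<Rightarrow> 'v"

type_synonym ('o, 'a, 'c, 'p, 'b, 'd) psnt =
  "(('o, 'a, 'c, 'p, 'b, 'd) psf, ('o, 'a, 'c, 'p, 'b, 'd) psf, 'o, 'a, 'b, 'd) psn"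

definition psnat :: "('o, 'a, 'c) twocat \<Rightarrow> ('p, 'b, 'd) twocat \<Rightarrow>
    ('o, 'a, 'c, 'p, 'b, 'd) psnt \<Rightarrow> bool" where
  "psnat A B t \<longleftrightarrow> (let F = TDom t; G = TCod t in
     pseudofunctor A B F \<and> pseudofunctor A B G \<and>
     TO t \<in> (\<Pi>\<^sub>E X\<in>Obj A. Hom1 B (PO F X) (PO G X)) \<and>
     TA t \<in> (\<Pi>\<^sub>E f\<in>Arr A.
       Hom2 B (PA G f \<odot>\<^bsub>B\<^esub> TO t (Src A f)) (TO t (Tgt A f) \<odot>\<^bsub>B\<^esub> PA F f)) \<and>
     (\<forall>f\<in>Arr A. inv_cell B (TA t f)) \<and>
     (\<forall>X\<in>Obj A. \<forall>Y\<in>Obj A. \<forall>f\<in>Hom1 A X Y. \<forall>g\<in>Hom1 A X Y. \<forall>\<theta>\<in>Hom2 A f g.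
       (Idc B (TO t Y) \<star>\<^bsub>B\<^esub> PC F \<theta>) \<bullet>\<^bsub>B\<^esub> TA t f =
       TA t g \<bullet>\<^bsub>B\<^esub> (PC G \<theta> \<star>\<^bsub>B\<^esub> Idc B (TO t X))) \<and>
     (\<forall>X\<in>Obj A. \<forall>Y\<in>Obj A. \<forall>Z\<in>Obj A. \<forall>f\<in>Hom1 A X Y. \<forall>g\<in>Hom1 A Y Z.
       TA t (g \<odot>\<^bsub>A\<^esub> f) \<bullet>\<^bsub>B\<^esub> (PM G g f \<star>\<^bsub>B\<^esub> Idc B (TO t X)) =
       (Idc B (TO t Z) \<star>\<^bsub>B\<^esub> PM F g f) \<bullet>\<^bsub>B\<^esub> (TA t g \<star>\<^bsub>B\<^esub> Idc B (PA F f)) \<bullet>\<^bsub>B\<^esub>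
         (Idc B (PA G g) \<star>\<^bsub>B\<^esub> TA t f)) \<and>
     (\<forall>X\<in>Obj A. TA t (One A X) \<bullet>\<^bsub>B\<^esub> (PU G X \<star>\<^bsub>B\<^esub> Idc B (TO t X)) =
       Idc B (TO t X) \<star>\<^bsub>B\<^esub> PU F X))"

definition modification :: "('o, 'a, 'c) twocat \<Rightarrow> ('p, 'b, 'd) twocat \<Rightarrow>
    (('o, 'a, 'c, 'p, 'b, 'd) psnt, 'o, 'd) mdf \<Rightarrow> bool" where
  "modification A B \<Gamma> \<longleftrightarrow> (let s = MDom \<Gamma>; t = MCod \<Gamma>; F = TDom s; G = TCod s in
     psnat A B s \<and> psnat A B t \<and> TDom t = F \<and> TCod t = G \<and>
     MO \<Gamma> \<in> (\<Pi>\<^sub>E X\<in>Obj A. Hom2 B (TO s X) (TO t X)) \<and>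
     (\<forall>X\<in>Obj A. \<forall>Y\<in>Obj A. \<forall>f\<in>Hom1 A X Y.
       (MO \<Gamma> Y \<star>\<^bsub>B\<^esub> Idc B (PA F f)) \<bullet>\<^bsub>B\<^esub> TA s f =
       TA t f \<bullet>\<^bsub>B\<^esub> (Idc B (PA G f) \<star>\<^bsub>B\<^esub> MO \<Gamma> X)))"

definition psn_comp :: "('o, 'a, 'c) twocat \<Rightarrow> ('p, 'b, 'd) twocat \<Rightarrow>
    ('o, 'a, 'c, 'p, 'b, 'd) psnt \<Rightarrow> ('o, 'a, 'c, 'p, 'b, 'd) psnt \<Rightarrow> ('o, 'a, 'c, 'p, 'b, 'd) psnt" where
  "psn_comp A B s t = \<lparr>TDom = TDom t, TCod = TCod s,
     TO = (\<lambda>X\<in>Obj A. TO s X \<odot>\<^bsub>B\<^esub> TO t X),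
     TA = (\<lambda>f\<in>Arr A. (Idc B (TO s (Tgt A f)) \<star>\<^bsub>B\<^esub> TA t f) \<bullet>\<^bsub>B\<^esub> (TA s f \<star>\<^bsub>B\<^esub> Idc B (TO t (Src A f))))\<rparr>"

text \<open>The 2-category \<open>[A, B]\<close> of pseudofunctors, pseudonatural transformations and modifications.\<close>

definition PsFun :: "('o, 'a, 'c) twocat \<Rightarrow> ('p, 'b, 'd) twocat \<Rightarrow>
    (('o, 'a, 'c, 'p, 'b, 'd) psf, ('o, 'a, 'c, 'p, 'b, 'd) psnt,
     (('o, 'a, 'c, 'p, 'b, 'd) psnt, 'o, 'd) mdf) twocat" where
  "PsFun A B = \<lparr>Obj = {F. pseudofunctor A B F}, Arr = {t. psnat A B t}, Cel = {\<Gamma>. modification A B \<Gamma>},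
     Src = TDom, Tgt = TCod, Dm = MDom, Cd = MCod,
     One = (\<lambda>F. \<lparr>TDom = F, TCod = F, TO = (\<lambda>X\<in>Obj A. One B (PO F X)),
                  TA = (\<lambda>f\<in>Arr A. Idc B (PA F f))\<rparr>),
     Cmp = psn_comp A B,
     Idc = (\<lambda>t. \<lparr>MDom = t, MCod = t, MO = (\<lambda>X\<in>Obj A. Idc B (TO t X))\<rparr>),
     VC = (\<lambda>\<Delta> \<Gamma>. \<lparr>MDom = MDom \<Gamma>, MCod = MCod \<Delta>, MO = (\<lambda>X\<in>Obj A. MO \<Delta> X \<bullet>\<^bsub>B\<^esub> MO \<Gamma> X)\<rparr>),
     HC = (\<lambda>\<Delta> \<Gamma>. \<lparr>MDom = psn_comp A B (MDom \<Delta>) (MDom \<Gamma>), MCod = psn_comp A B (MCod \<Delta>) (MCod \<Gamma>),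
                   MO = (\<lambda>X\<in>Obj A. MO \<Delta> X \<star>\<^bsub>B\<^esub> MO \<Gamma> X)\<rparr>)\<rparr>"

text \<open>Precomposition with \<open>J : A \<rightarrow> A'\<close> as a 2-functor \<open>[A', B] \<rightarrow> [A, B]\<close>. Its action on cells is the
  same with all 1-cells reversed, which is how it is used for the opposite 2-categories.\<close>

definition psn_pre :: "('o, 'a, 'c) twocat \<Rightarrow> ('p, 'b, 'd) twocat \<Rightarrow> ('o, 'a, 'c, 'q, 'e, 'k) psf \<Rightarrow>
    ('q, 'e, 'k, 'p, 'b, 'd) psnt \<Rightarrow> ('o, 'a, 'c, 'p, 'b, 'd) psnt" where
  "psn_pre A B J t = \<lparr>TDom = psf_comp A B (TDom t) J, TCod = psf_comp A B (TCod t) J,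
     TO = compose (Obj A) (TO t) (PO J), TA = compose (Arr A) (TA t) (PA J)\<rparr>"

definition mdf_pre :: "('o, 'a, 'c) twocat \<Rightarrow> ('p, 'b, 'd) twocat \<Rightarrow> ('o, 'a, 'c, 'q, 'e, 'k) psf \<Rightarrow>
    (('q, 'e, 'k, 'p, 'b, 'd) psnt, 'q, 'd) mdf \<Rightarrow> (('o, 'a, 'c, 'p, 'b, 'd) psnt, 'o, 'd) mdf" where
  "mdf_pre A B J \<Gamma> = \<lparr>MDom = psn_pre A B J (MDom \<Gamma>), MCod = psn_pre A B J (MCod \<Gamma>),
     MO = compose (Obj A) (MO \<Gamma>) (PO J)\<rparr>"


subsection \<open>Transformations between CAT-valued pseudofunctors\<close>

text \<open>For a pseudofunctor \<open>F\<close> into \<^term>\<open>CAT\<close> over types \<open>'x, 'y\<close> and a pseudofunctor \<open>G\<close> into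
  \<^term>\<open>CAT\<close> over other types \<open>'p, 'q\<close>, the components of a transformation \<open>F \<rightarrow> G\<close> are functors
  between categories over different types, so the two notions above are restated with the
  type-heterogeneous composition of functors and natural transformations in place of that of a
  2-category. For equal types they are the notions above (\<open>cat_psnat_eq\<close>, \<open>cat_modification_eq\<close>).\<close>

type_synonym ('o, 'a, 'c, 'x, 'y) catpsf =
  "('o, 'a, 'c, ('x, 'y) cat, ('x, 'y, 'x, 'y) fctr, ('x, 'y, 'x, 'y) ntrans) psf"

type_synonym ('o, 'a, 'c, 'x, 'y, 'p, 'q) catpsnt =
  "(('o, 'a, 'c, 'x, 'y) catpsf, ('o, 'a, 'c, 'p, 'q) catpsf, 'o, 'a,
    ('x, 'y, 'p, 'q) fctr, ('x, 'y, 'p, 'q) ntrans) psn"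

type_synonym ('o, 'a, 'c, 'x, 'y, 'p, 'q) catmdf =
  "(('o, 'a, 'c, 'x, 'y, 'p, 'q) catpsnt, 'o, ('x, 'y, 'p, 'q) ntrans) mdf"

definition cat_psnat :: "('o, 'a, 'c) twocat \<Rightarrow> ('o, 'a, 'c, 'x, 'y, 'p, 'q) catpsnt \<Rightarrow> bool" where
  "cat_psnat A t \<longleftrightarrow> (let F = TDom t; G = TCod t in
     pseudofunctor A CAT F \<and> pseudofunctor A CAT G \<and>
     TO t \<in> (\<Pi>\<^sub>E X\<in>Obj A. {S. is_functor S \<and> FDom S = PO F X \<and> FCod S = PO G X}) \<and>
     TA t \<in> (\<Pi>\<^sub>E f\<in>Arr A. {\<sigma>. nat_trans \<sigma> \<and>
       NDom \<sigma> = PA G f \<circ>\<^sub>F TO t (Src A f) \<and> NCod \<sigma> = TO t (Tgt A f) \<circ>\<^sub>F PA F f}) \<and>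
     (\<forall>f\<in>Arr A. nat_iso (TA t f)) \<and>
     (\<forall>X\<in>Obj A. \<forall>Y\<in>Obj A. \<forall>f\<in>Hom1 A X Y. \<forall>g\<in>Hom1 A X Y. \<forall>\<theta>\<in>Hom2 A f g.
       (nid (TO t Y) \<star>\<^sub>N PC F \<theta>) \<bullet>\<^sub>N TA t f = TA t g \<bullet>\<^sub>N (PC G \<theta> \<star>\<^sub>N nid (TO t X))) \<and>
     (\<forall>X\<in>Obj A. \<forall>Y\<in>Obj A. \<forall>Z\<in>Obj A. \<forall>f\<in>Hom1 A X Y. \<forall>g\<in>Hom1 A Y Z.
       TA t (g \<odot>\<^bsub>A\<^esub> f) \<bullet>\<^sub>N (PM G g f \<star>\<^sub>N nid (TO t X)) =
       (nid (TO t Z) \<star>\<^sub>N PM F g f) \<bullet>\<^sub>N (TA t g \<star>\<^sub>N nid (PA F f)) \<bullet>\<^sub>N (nid (PA G g) \<star>\<^sub>N TA t f)) \<and>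
     (\<forall>X\<in>Obj A. TA t (One A X) \<bullet>\<^sub>N (PU G X \<star>\<^sub>N nid (TO t X)) = nid (TO t X) \<star>\<^sub>N PU F X))"

definition cat_modification :: "('o, 'a, 'c) twocat \<Rightarrow> ('o, 'a, 'c, 'x, 'y, 'p, 'q) catmdf \<Rightarrow> bool" where
  "cat_modification A \<Gamma> \<longleftrightarrow> (let s = MDom \<Gamma>; t = MCod \<Gamma>; F = TDom s; G = TCod s in
     cat_psnat A s \<and> cat_psnat A t \<and> TDom t = F \<and> TCod t = G \<and>
     MO \<Gamma> \<in> (\<Pi>\<^sub>E X\<in>Obj A. {\<sigma>. nat_trans \<sigma> \<and> NDom \<sigma> = TO s X \<and> NCod \<sigma> = TO t X}) \<and>
     (\<forall>X\<in>Obj A. \<forall>Y\<in>Obj A. \<forall>f\<in>Hom1 A X Y.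
       (MO \<Gamma> Y \<star>\<^sub>N nid (PA F f)) \<bullet>\<^sub>N TA s f = TA t f \<bullet>\<^sub>N (nid (PA G f) \<star>\<^sub>N MO \<Gamma> X)))"

lemma cat_psnat_eq: "cat_psnat A t \<longleftrightarrow> psnat A CAT t"
proof -
  have hom1: "Hom1 CAT X Y = {S. is_functor S \<and> FDom S = X \<and> FCod S = Y}"
    for X Y :: "('x, 'y) cat" by (simp add: Hom1_def CAT_def)
  have hom2: "Hom2 CAT S T = {\<sigma>. nat_trans \<sigma> \<and> NDom \<sigma> = S \<and> NCod \<sigma> = T}"
    for S T :: "('x, 'y, 'x, 'y) fctr" by (simp add: Hom2_def CAT_def)
  have inv: "inv_cell CAT \<sigma> \<longleftrightarrow> nat_iso \<sigma>" for \<sigma> :: "('x, 'y, 'x, 'y) ntrans"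
    unfolding inv_cell_def nat_iso_def by (auto simp: Hom2_def CAT_def)
  have ops: "Cmp CAT = (fcomp :: ('x, 'y, 'x, 'y) fctr \<Rightarrow> _)" "Idc CAT = (nid :: ('x, 'y, 'x, 'y) fctr \<Rightarrow> _)"
    "VC CAT = (nvcomp :: ('x, 'y, 'x, 'y) ntrans \<Rightarrow> _)" "HC CAT = (nhcomp :: ('x, 'y, 'x, 'y) ntrans \<Rightarrow> _)"
    by (simp_all add: CAT_def)
  show ?thesis unfolding cat_psnat_def psnat_def hom1 hom2 inv ops ..
qed

lemma cat_modification_eq: "cat_modification A \<Gamma> \<longleftrightarrow> modification A CAT \<Gamma>"
  unfolding cat_modification_def modification_def cat_psnat_eq
  by (simp add: CAT_def Hom2_def)

text \<open>The category \<open>[A, CAT](F, G)\<close>.\<close>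

definition CatPsHom :: "('o, 'a, 'c) twocat \<Rightarrow> ('o, 'a, 'c, 'x, 'y) catpsf \<Rightarrow> ('o, 'a, 'c, 'p, 'q) catpsf \<Rightarrow>
    (('o, 'a, 'c, 'x, 'y, 'p, 'q) catpsnt, ('o, 'a, 'c, 'x, 'y, 'p, 'q) catmdf) cat" where
  "CatPsHom A F G =
     \<lparr>Ob = {t. cat_psnat A t \<and> TDom t = F \<and> TCod t = G},
      Ar = {\<Gamma>. cat_modification A \<Gamma> \<and> TDom (MDom \<Gamma>) = F \<and> TCod (MDom \<Gamma>) = G},
      Dom = MDom, Cod = MCod,
      Id = (\<lambda>t. \<lparr>MDom = t, MCod = t, MO = (\<lambda>X\<in>Obj A. nid (TO t X))\<rparr>),
      Comp = (\<lambda>\<Delta> \<Gamma>. \<lparr>MDom = MDom \<Gamma>, MCod = MCod \<Delta>, MO = (\<lambda>X\<in>Obj A. MO \<Delta> X \<bullet>\<^sub>N MO \<Gamma> X)\<rparr>)\<rparr>"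

definition cat_psn_comp :: "('o, 'a, 'c) twocat \<Rightarrow> ('o, 'a, 'c, 'p, 'q, 'r, 's) catpsnt \<Rightarrow>
    ('o, 'a, 'c, 'x, 'y, 'p, 'q) catpsnt \<Rightarrow> ('o, 'a, 'c, 'x, 'y, 'r, 's) catpsnt" where
  "cat_psn_comp A s t = \<lparr>TDom = TDom t, TCod = TCod s,
     TO = (\<lambda>X\<in>Obj A. TO s X \<circ>\<^sub>F TO t X),
     TA = (\<lambda>f\<in>Arr A. (nid (TO s (Tgt A f)) \<star>\<^sub>N TA t f) \<bullet>\<^sub>N (TA s f \<star>\<^sub>N nid (TO t (Src A f))))\<rparr>"

definition cat_mdf_hcomp :: "('o, 'a, 'c) twocat \<Rightarrow> ('o, 'a, 'c, 'p, 'q, 'r, 's) catmdf \<Rightarrow>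
    ('o, 'a, 'c, 'x, 'y, 'p, 'q) catmdf \<Rightarrow> ('o, 'a, 'c, 'x, 'y, 'r, 's) catmdf" where
  "cat_mdf_hcomp A \<Delta> \<Gamma> = \<lparr>MDom = cat_psn_comp A (MDom \<Delta>) (MDom \<Gamma>),
     MCod = cat_psn_comp A (MCod \<Delta>) (MCod \<Gamma>), MO = (\<lambda>X\<in>Obj A. MO \<Delta> X \<star>\<^sub>N MO \<Gamma> X)\<rparr>"

text \<open>A pseudonatural equivalence of CAT-valued pseudofunctors.\<close>

definition cat_psnat_equivalence ::
    "('o, 'a, 'c) twocat \<Rightarrow> ('o, 'a, 'c, 'x, 'y, 'p, 'q) catpsnt \<Rightarrow> bool" where
  "cat_psnat_equivalence A t \<longleftrightarrow> cat_psnat A t \<and> (\<forall>X\<in>Obj A. cat_equivalence (TO t X))"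


section \<open>Weighted bilimits\<close>

text \<open>\<open>H(X, B-)\<close> for \<open>B : A \<rightarrow> H\<close>.\<close>

definition hom_into :: "('o, 'a, 'c) twocat \<Rightarrow> ('p, 'b, 'd) twocat \<Rightarrow> ('o, 'a, 'c, 'p, 'b, 'd) psf \<Rightarrow>
    'p \<Rightarrow> ('o, 'a, 'c, 'b, 'd) catpsf" where
  "hom_into A H B X = psf_comp A CAT (yo H X) B"

text \<open>The strict transformation \<open>H(u, B-) : H(X, B-) \<rightarrow> H(X', B-)\<close> for \<open>u : X' \<rightarrow> X\<close>, and the
  modification \<open>H(\<theta>, B-)\<close> for a 2-cell \<open>\<theta>\<close>.\<close>

definition hom_into_arr :: "('o, 'a, 'c) twocat \<Rightarrow> ('p, 'b, 'd) twocat \<Rightarrow> ('o, 'a, 'c, 'p, 'b, 'd) psf \<Rightarrow>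
    'b \<Rightarrow> ('o, 'a, 'c, 'b, 'd, 'b, 'd) catpsnt" where
  "hom_into_arr A H B u = \<lparr>TDom = hom_into A H B (Tgt H u), TCod = hom_into A H B (Src H u),
     TO = (\<lambda>a\<in>Obj A. PA (yo (OpT H) (PO B a)) u),
     TA = (\<lambda>f\<in>Arr A. nid (PA (yo (OpT H) (PO B (Tgt A f))) u \<circ>\<^sub>F PA (yo H (Tgt H u)) (PA B f)))\<rparr>"

definition hom_into_cell :: "('o, 'a, 'c) twocat \<Rightarrow> ('p, 'b, 'd) twocat \<Rightarrow> ('o, 'a, 'c, 'p, 'b, 'd) psf \<Rightarrow>
    'd \<Rightarrow> ('o, 'a, 'c, 'b, 'd, 'b, 'd) catmdf" where
  "hom_into_cell A H B \<theta> = \<lparr>MDom = hom_into_arr A H B (Dm H \<theta>), MCod = hom_into_arr A H B (Cd H \<theta>),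
     MO = (\<lambda>a\<in>Obj A. PC (yo (OpT H) (PO B a)) \<theta>)\<rparr>"

text \<open>The 2-functor \<open>X \<mapsto> [A, CAT](W, H(X, B-))\<close> on \<open>OpT H\<close>.\<close>

definition weighted_cones :: "('o, 'a, 'c) twocat \<Rightarrow> ('p, 'b, 'd) twocat \<Rightarrow>
    ('o, 'a, 'c, 'x, 'y) catpsf \<Rightarrow> ('o, 'a, 'c, 'p, 'b, 'd) psf \<Rightarrow>
    ('p, 'b, 'd, ('o, 'a, 'c, 'x, 'y, 'b, 'd) catpsnt, ('o, 'a, 'c, 'x, 'y, 'b, 'd) catmdf) catpsf" where
  "weighted_cones A H W B =
    (let cones = (\<lambda>X. CatPsHom A W (hom_into A H B X));
         pa = (\<lambda>u. \<lparr>FDom = cones (Tgt H u), FCod = cones (Src H u),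
                FOb = (\<lambda>t\<in>Ob (cones (Tgt H u)). cat_psn_comp A (hom_into_arr A H B u) t),
                FAr = (\<lambda>\<Gamma>\<in>Ar (cones (Tgt H u)). cat_mdf_hcomp A (hom_into_cell A H B (Idc H u)) \<Gamma>)\<rparr>)
     in strict_psf (OpT H) CAT cones pa
       (\<lambda>\<theta>. \<lparr>NDom = pa (Dm H \<theta>), NCod = pa (Cd H \<theta>),
              NAt = (\<lambda>t\<in>Ob (cones (Tgt H (Dm H \<theta>))).
                cat_mdf_hcomp A (hom_into_cell A H B \<theta>) (Id (cones (Tgt H (Dm H \<theta>))) t))\<rparr>))"

definition is_bilim :: "('o, 'a, 'c) twocat \<Rightarrow> ('p, 'b, 'd) twocat \<Rightarrow>
    ('o, 'a, 'c, 'x, 'y) catpsf \<Rightarrow> ('o, 'a, 'c, 'p, 'b, 'd) psf \<Rightarrow> 'p \<Rightarrow> bool" where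
  "is_bilim A H W B L \<longleftrightarrow> L \<in> Obj H \<and>
     (\<exists>e. cat_psnat_equivalence (OpT H) e \<and>
          TDom e = yo (OpT H) L \<and> TCod e = weighted_cones A H W B)"

text \<open>The type \<open>'s\<close> plays the role of the universe of small sets: a 2-category or category is small
  if its objects and cells are elements of \<open>'s\<close>. No bound is imposed on the hom-categories of \<open>H\<close>.\<close>

definition bicategorically_complete :: "'s itself \<Rightarrow> ('p, 'b, 'd) twocat \<Rightarrow> bool" where
  "bicategorically_complete _ H \<longleftrightarrow>
     (\<forall>(A :: ('s, 's, 's) twocat) (W :: ('s, 's, 's, 's, 's) catpsf) (B :: ('s, 's, 's, 'p, 'b, 'd) psf).
        two_category A \<longrightarrow> pseudofunctor A CAT W \<longrightarrow> pseudofunctor A H B \<longrightarrow>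
        (\<exists>L. is_bilim A H W B L))"


section \<open>Right pseudo-Kan extensions\<close>

text \<open>The transformation \<open>[A', H](-, R) \<rightarrow> [A, H](- \<circ> J, \<A>)\<close>, \<open>\<alpha> \<mapsto> \<epsilon> (\<alpha> J)\<close>, which is strictly
  2-natural. Both sides are CAT-valued 2-functors on the opposite of \<open>[A', H]\<close>.\<close>

definition ran_transf :: "('o, 'a, 'c) twocat \<Rightarrow> ('q, 'e, 'k) twocat \<Rightarrow> ('p, 'b, 'd) twocat \<Rightarrow>
    ('o, 'a, 'c, 'q, 'e, 'k) psf \<Rightarrow> ('o, 'a, 'c, 'p, 'b, 'd) psf \<Rightarrow>
    ('q, 'e, 'k, 'p, 'b, 'd) psf \<Rightarrow> ('o, 'a, 'c, 'p, 'b, 'd) psnt \<Rightarrow>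
    (('q, 'e, 'k, 'p, 'b, 'd) psf, ('q, 'e, 'k, 'p, 'b, 'd) psnt, (('q, 'e, 'k, 'p, 'b, 'd) psnt, 'q, 'd) mdf,
     ('q, 'e, 'k, 'p, 'b, 'd) psnt, (('q, 'e, 'k, 'p, 'b, 'd) psnt, 'q, 'd) mdf,
     ('o, 'a, 'c, 'p, 'b, 'd) psnt, (('o, 'a, 'c, 'p, 'b, 'd) psnt, 'o, 'd) mdf) catpsnt" where
  "ran_transf A A' H J \<A> R \<epsilon> =
    (let K = PsFun A H; K' = PsFun A' H;
         dom = yo (OpT K') R;
         cod = psf_comp (OpT K') CAT (yo (OpT K) \<A>)
                 (strict_psf (OpT K') (OpT K) (\<lambda>S. psf_comp A H S J) (psn_pre A H J) (mdf_pre A H J));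
         \<Phi> = (\<lambda>S. \<lparr>FDom = PO dom S, FCod = PO cod S,
                    FOb = (\<lambda>\<alpha>\<in>Ob (PO dom S). \<epsilon> \<odot>\<^bsub>K\<^esub> psn_pre A H J \<alpha>),
                    FAr = (\<lambda>\<Gamma>\<in>Ar (PO dom S). Idc K \<epsilon> \<star>\<^bsub>K\<^esub> mdf_pre A H J \<Gamma>)\<rparr>)
     in \<lparr>TDom = dom, TCod = cod, TO = restrict \<Phi> (Obj K'),
         TA = (\<lambda>\<beta>\<in>Arr K'. nid (PA cod \<beta> \<circ>\<^sub>F \<Phi> (TCod \<beta>)))\<rparr>)"

definition is_PsRan :: "('o, 'a, 'c) twocat \<Rightarrow> ('q, 'e, 'k) twocat \<Rightarrow> ('p, 'b, 'd) twocat \<Rightarrow>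
    ('o, 'a, 'c, 'q, 'e, 'k) psf \<Rightarrow> ('o, 'a, 'c, 'p, 'b, 'd) psf \<Rightarrow>
    ('q, 'e, 'k, 'p, 'b, 'd) psf \<Rightarrow> ('o, 'a, 'c, 'p, 'b, 'd) psnt \<Rightarrow> bool" where
  "is_PsRan A A' H J \<A> R \<epsilon> \<longleftrightarrow>
     pseudofunctor A' H R \<and> \<epsilon> \<in> Hom1 (PsFun A H) (psf_comp A H R J) \<A> \<and>
     cat_psnat_equivalence (OpT (PsFun A' H)) (ran_transf A A' H J \<A> R \<epsilon>)"


section \<open>The simplex categories\<close>

text \<open>The ordinal with \<open>n\<close> elements is \<open>{..<n}\<close>; an order-preserving map carries its domain and
  codomain.\<close>

type_synonym omap = "nat \<times> nat \<times> (nat \<Rightarrow> nat)"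

definition Simplex_aug :: "(nat, omap) cat" where
  "Simplex_aug = \<lparr>Ob = UNIV, Ar = {(m, n, \<phi>). \<phi> \<in> {..<m} \<rightarrow>\<^sub>E {..<n} \<and> mono_on {..<m} \<phi>},
     Dom = fst, Cod = fst \<circ> snd, Id = (\<lambda>n. (n, n, \<lambda>i\<in>{..<n}. i)),
     Comp = (\<lambda>(m', n, \<psi>) (l, m, \<phi>). (l, n, compose {..<l} \<psi> \<phi>))\<rparr>"

definition Simplex :: "(nat, omap) cat" where
  "Simplex = full_subcat Simplex_aug {1..}"

definition incl_j :: "(nat, omap, omap, nat, omap, omap) psf" where
  "incl_j = strict_psf (LD Simplex) (LD Simplex_aug) (\<lambda>n. n) (\<lambda>\<phi>. \<phi>) (\<lambda>\<phi>. \<phi>)"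

text \<open>The coface map \<open>n \<rightarrow> n + 1\<close> omitting \<open>i\<close>, and the codegeneracy map \<open>n + 1 \<rightarrow> n\<close> repeating \<open>i\<close>.\<close>

definition coface :: "nat \<Rightarrow> nat \<Rightarrow> omap" where
  "coface n i = (n, n + 1, \<lambda>k\<in>{..<n}. if k < i then k else k + 1)"

definition codegen :: "nat \<Rightarrow> nat \<Rightarrow> omap" where
  "codegen n i = (n + 1, n, \<lambda>k\<in>{..<n + 1}. if k \<le> i then k else k - 1)"


section \<open>Categories given by generators and relations\<close>

text \<open>A path is the list of its edges, the first edge to be traversed coming first.\<close>

fun is_path :: "'v set \<Rightarrow> 'e set \<Rightarrow> ('e \<Rightarrow> 'v) \<Rightarrow> ('e \<Rightarrow> 'v) \<Rightarrow> 'v \<Rightarrow> 'e list \<Rightarrow> 'v \<Rightarrow> bool" where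
  "is_path V E s t a [] b \<longleftrightarrow> a \<in> V \<and> a = b"
| "is_path V E s t a (e # p) b \<longleftrightarrow> a \<in> V \<and> e \<in> E \<and> s e = a \<and> is_path V E s t (t e) p b"

inductive path_cong :: "'v set \<Rightarrow> 'e set \<Rightarrow> ('e \<Rightarrow> 'v) \<Rightarrow> ('e \<Rightarrow> 'v) \<Rightarrow> ('e list \<times> 'e list) set \<Rightarrow>
    'v \<Rightarrow> 'v \<Rightarrow> 'e list \<Rightarrow> 'e list \<Rightarrow> bool" for V E s t R where
  rel: "(p, q) \<in> R \<Longrightarrow> is_path V E s t a p b \<Longrightarrow> is_path V E s t a q b \<Longrightarrow> path_cong V E s t R a b p q"
| refl: "is_path V E s t a p b \<Longrightarrow> path_cong V E s t R a b p p"
| sym: "path_cong V E s t R a b p q \<Longrightarrow> path_cong V E s t R a b q p"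
| trans: "path_cong V E s t R a b p q \<Longrightarrow> path_cong V E s t R a b q r \<Longrightarrow> path_cong V E s t R a b p r"
| append: "path_cong V E s t R a b p p' \<Longrightarrow> path_cong V E s t R b c q q' \<Longrightarrow>
    path_cong V E s t R a c (p @ q) (p' @ q')"

text \<open>An arrow from \<open>a\<close> to \<open>b\<close> is \<open>(a, b, P)\<close> with \<open>P\<close> a congruence class of paths from \<open>a\<close> to \<open>b\<close>.\<close>

definition presented :: "'v set \<Rightarrow> 'e set \<Rightarrow> ('e \<Rightarrow> 'v) \<Rightarrow> ('e \<Rightarrow> 'v) \<Rightarrow> ('e list \<times> 'e list) set \<Rightarrow>
    ('v, 'v \<times> 'v \<times> 'e list set) cat" where
  "presented V E s t R =
     \<lparr>Ob = V, Ar = {(a, b, {q. path_cong V E s t R a b p q}) |a b p. is_path V E s t a p b},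
      Dom = fst, Cod = fst \<circ> snd,
      Id = (\<lambda>a. (a, a, {q. path_cong V E s t R a a [] q})),
      Comp = (\<lambda>(b', c, Q) (a, b, P). (a, c, {r. \<exists>p\<in>P. \<exists>q\<in>Q. path_cong V E s t R a c (p @ q) r}))\<rparr>"

text \<open>\<open>Face1 i\<close>, \<open>Degen1\<close> and \<open>Face2 k\<close> stand for $d^i$, $s^0$ and $\partial^k$.\<close>

datatype gen3 = Face1 nat | Degen1 | Face2 nat

fun gen3_src :: "gen3 \<Rightarrow> nat" where
  "gen3_src (Face1 i) = 1" | "gen3_src Degen1 = 2" | "gen3_src (Face2 k) = 2"

fun gen3_tgt :: "gen3 \<Rightarrow> nat" where
  "gen3_tgt (Face1 i) = 2" | "gen3_tgt Degen1 = 1" | "gen3_tgt (Face2 k) = 3"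

definition Simplex3 :: "(nat, nat \<times> nat \<times> gen3 list set) cat" where
  "Simplex3 = presented {1, 2, 3} {Face1 0, Face1 1, Degen1, Face2 0, Face2 1, Face2 2} gen3_src gen3_tgt
     ({([Face1 i, Face2 k], [Face1 (k - 1), Face2 i]) |i k. i < k \<and> k \<le> 2} \<union>
      {([Face1 0, Degen1], []), ([Face1 1, Degen1], [])})"

fun gen3_map :: "gen3 \<Rightarrow> omap" where
  "gen3_map (Face1 i) = coface 1 i" | "gen3_map Degen1 = codegen 1 0" | "gen3_map (Face2 k) = coface 2 k"

text \<open>The composite of the images of the edges of any representing path; it does not depend on the
  representative, because the coface and codegeneracy maps satisfy the relations.\<close>

definition t3_arr :: "nat \<times> nat \<times> gen3 list set \<Rightarrow> omap" where
  "t3_arr = (\<lambda>(a, b, P). fold (\<lambda>e \<phi>. gen3_map e \<cdot>\<^bsub>Simplex\<^esub> \<phi>) (SOME p. p \<in> P) (Id Simplex a))"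

definition incl_t3 ::
    "(nat, nat \<times> nat \<times> gen3 list set, nat \<times> nat \<times> gen3 list set, nat, omap, omap) psf" where
  "incl_t3 = strict_psf (LD Simplex3) (LD Simplex) (\<lambda>n. n) t3_arr t3_arr"


section \<open>Localization and the weight\<close>

text \<open>The localization of \<open>C\<close> at \<open>S\<close> is generated by the arrows of \<open>C\<close> and formal inverses \<open>Bwd f\<close> of
  the arrows \<open>f \<in> S\<close>.\<close>

datatype 'm zig = Fwd 'm | Bwd 'm

definition loc_rels :: "('o, 'm) cat \<Rightarrow> 'm set \<Rightarrow> ('m zig list \<times> 'm zig list) set" where
  "loc_rels C S =
     {([Fwd (Id C a)], []) |a. a \<in> Ob C} \<union>
     {([Fwd f, Fwd g], [Fwd (g \<cdot>\<^bsub>C\<^esub> f)]) |f g. f \<in> Ar C \<and> g \<in> Ar C \<and> Cod C f = Dom C g} \<union>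
     {([Fwd f, Bwd f], []) |f. f \<in> S} \<union>
     {([Bwd f, Fwd f], []) |f. f \<in> S}"

definition loc_cong :: "('o, 'm) cat \<Rightarrow> 'm set \<Rightarrow> 'o \<Rightarrow> 'o \<Rightarrow> 'm zig list \<Rightarrow> 'm zig list \<Rightarrow> bool" where
  "loc_cong C S = path_cong (Ob C) (Fwd ` Ar C \<union> Bwd ` S)
     (case_zig (Dom C) (Cod C)) (case_zig (Cod C) (Dom C)) (loc_rels C S)"

definition localization :: "('o, 'm) cat \<Rightarrow> 'm set \<Rightarrow> ('o, 'o \<times> 'o \<times> 'm zig list set) cat" where
  "localization C S = presented (Ob C) (Fwd ` Ar C \<union> Bwd ` S)
     (case_zig (Dom C) (Cod C)) (case_zig (Cod C) (Dom C)) (loc_rels C S)"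

text \<open>The functor between localizations induced by a functor \<open>F\<close> that maps \<open>S\<close> into \<open>T\<close>.\<close>

definition localization_map :: "('o, 'm, 'p, 'n) fctr \<Rightarrow> 'm set \<Rightarrow> 'n set \<Rightarrow>
    ('o, 'o \<times> 'o \<times> 'm zig list set, 'p, 'p \<times> 'p \<times> 'n zig list set) fctr" where
  "localization_map F S T =
     \<lparr>FDom = localization (FDom F) S, FCod = localization (FCod F) T, FOb = FOb F,
      FAr = (\<lambda>(a, b, P)\<in>Ar (localization (FDom F) S). (FOb F a, FOb F b,
        {q. \<exists>p\<in>P. loc_cong (FCod F) T (FOb F a) (FOb F b) (map (map_zig (FAr F)) p) q}))\<rparr>"

definition ordinal_cat :: "nat \<Rightarrow> (nat, nat \<times> nat) cat" where
  "ordinal_cat n = \<lparr>Ob = {..<n}, Ar = {(i, j). i \<le> j \<and> j < n}, Dom = fst, Cod = snd,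
     Id = (\<lambda>i. (i, i)), Comp = (\<lambda>(j', k) (i, j). (i, k))\<rparr>"

definition ordinal_functor :: "omap \<Rightarrow> (nat, nat \<times> nat, nat, nat \<times> nat) fctr" where
  "ordinal_functor = (\<lambda>(m, n, \<phi>). \<lparr>FDom = ordinal_cat m, FCod = ordinal_cat n, FOb = \<phi>,
     FAr = restrict (map_prod \<phi> \<phi>) (Ar (ordinal_cat m))\<rparr>)"

type_synonym nabla_arr = "nat \<times> nat \<times> (nat \<times> nat) zig list set"

definition nabla :: "nat \<Rightarrow> (nat, nabla_arr) cat" where
  "nabla n = localization (ordinal_cat n) (Ar (ordinal_cat n))"

definition nabla_map :: "omap \<Rightarrow> (nat, nabla_arr, nat, nabla_arr) fctr" where
  "nabla_map = (\<lambda>(m, n, \<phi>).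
     localization_map (ordinal_functor (m, n, \<phi>)) (Ar (ordinal_cat m)) (Ar (ordinal_cat n)))"

definition weight_W ::
    "(nat, nat \<times> nat \<times> gen3 list set, nat \<times> nat \<times> gen3 list set, nat, nabla_arr) catpsf" where
  "weight_W = strict_psf (LD Simplex3) CAT nabla (\<lambda>g. nabla_map (t3_arr g)) (\<lambda>g. nid (nabla_map (t3_arr g)))"


section \<open>The descent object\<close>

definition is_Desc :: "('o, 'a, 'c) twocat \<Rightarrow> (nat, omap, omap, 'o, 'a, 'c) psf \<Rightarrow> 'o \<Rightarrow> bool" where
  "is_Desc H \<A> D \<longleftrightarrow>
     is_bilim (LD Simplex3) H weight_W (psf_comp (LD Simplex3) H \<A> incl_t3) D"

end

theory Submission
  imports Defs "HOL-Library.Countable"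
begin

text \<open>
  Both objects represent pseudocones on \<open>\<A>\<close>. Every \<open>nabla n\<close> with \<open>n \<ge> 1\<close> is nonempty and indiscrete, so that a cone
  weighted by \<open>weight_W\<close> is, up to unique isomorphism, a conical pseudocone over \<open>Simplex3\<close>. On the other side there is a
  unique arrow \<open>0 \<rightarrow> n\<close> in the augmented simplex category, so that a pseudofunctor on it is its restriction to \<open>Simplex\<close>
  together with a pseudocone over \<open>Simplex\<close> whose vertex is the value at \<open>0\<close>; hence the Kan extension has the
  conical bilimit of \<open>\<A>\<close> as its value at \<open>0\<close>. Finally a pseudocone over \<open>Simplex\<close> is determined by its restriction to
  \<open>Simplex3\<close>: its value at \<open>n\<close> is transported along a point \<open>1 \<rightarrow> n\<close>, two points are compared along an edge \<open>2 \<rightarrow> n\<close>, and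
  these comparisons are coherent because of the triangles \<open>3 \<rightarrow> n\<close>.

  By the bicategorical Yoneda lemma a representing pseudonatural equivalence amounts to a universal element, and
  universal elements are unique up to equivalence. The conical bilimit over \<open>Simplex\<close> exists because \<open>Simplex\<close> is
  countable, hence isomorphic to a category whose objects and arrows lie in \<open>'s\<close>.
\<close>

section \<open>Categories, functors and natural transformations\<close>

text \<open>Both defining properties are pseudonatural equivalences of CAT-valued pseudofunctors
  whose values live over different types, so they cannot be composed or inverted inside one
  2-category. A universal element replaces them: essential surjectivity and bijectivity on hom-sets
  concern one category at a time. The way back to a transformation is short because the CAT-valued
  pseudofunctors concerned have identity constraints, so that evaluation at the element commutes
  strictly with reindexing. The main difficulty is the passage from Simplex3 to Simplex. A cone over
  Simplex3 has no components at n > 3, and its cells are coherent only up to the constraints of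
  \<A>. The comparison of two points of n is therefore built from cone cells whiskered with \<A> e,
  for e an edge of n, and corrected by constraints; the unit and cocycle laws of these comparisons
  then come from the relations of Simplex3. On the Kan side, the pseudofunctor made from \<A> and a
  cone restricts to \<A> on the nose, so that an identity serves as counit.\<close>

lemma Hom_iff [simp]: "f\<in>Hom C a b \<longleftrightarrow> f\<in>Ar C \<and> Dom C f = a \<and> Cod C f = b"
 by (simp add: Hom_def)

lemma cat_ob [simp]: "category C ==> f\<in>Ar C ==> Dom C f\<in>Ob C"
 "category C ==> f\<in>Ar C ==> Cod C f\<in>Ob C"
 by (simp_all add: category.dom_in category.cod_in)

lemma cat_id [simp]:
 assumes "category C" "a\<in>Ob C"
 shows "Id C a\<in>Ar C" "Dom C (Id C a) = a" "Cod C (Id C a) = a"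
 using category.id_in[OF assms] by simp_all

lemma cat_comp [simp]:
 assumes "category C" "f\<in>Ar C" "g\<in>Ar C" "Cod C f = Dom C g"
 shows "g\<cdot>\<^bsub>C\<^esub>f\<in>Ar C" "Dom C (g\<cdot>\<^bsub>C\<^esub>f) = Dom C f" "Cod C (g\<cdot>\<^bsub>C\<^esub>f) = Cod C g"
 using category.comp_in[OF assms(1), of f "Dom C f" "Cod C f" g "Cod C g"] assms by simp_all

lemma cat_unit [simp]:
 assumes "category C" "f\<in>Ar C"
 shows "Dom C f = a ==> f\<cdot>\<^bsub>C\<^esub>Id C a = f" "Cod C f = b ==> Id C b\<cdot>\<^bsub>C\<^esub>f = f"
 using category.comp_id[OF assms(1), of f] category.id_comp[OF assms(1), of f] assms by simp_all

lemma cat_assoc [simp]: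
 assumes "category C" "f\<in>Ar C" "g\<in>Ar C" "h\<in>Ar C" "Cod C f = Dom C g" "Cod C g = Dom C h"
 shows "(h\<cdot>\<^bsub>C\<^esub>g)\<cdot>\<^bsub>C\<^esub>f = h\<cdot>\<^bsub>C\<^esub>(g\<cdot>\<^bsub>C\<^esub>f)"
 using category.comp_assoc[OF assms(1), of f "Dom C f" "Cod C f" g "Cod C g" h "Cod C h"] assms by simp

lemma categoryI:
 assumes "!!f. f\<in>Ar C ==> Dom C f\<in>Ob C \<and> Cod C f\<in>Ob C"
  and "!!a. a\<in>Ob C ==> Id C a\<in>Ar C \<and> Dom C (Id C a) = a \<and> Cod C (Id C a) = a"
  and "!!f g. f\<in>Ar C ==> g\<in>Ar C ==> Cod C f = Dom C g ==>
   g\<cdot>\<^bsub>C\<^esub>f\<in>Ar C \<and> Dom C (g\<cdot>\<^bsub>C\<^esub>f) = Dom C f \<and> Cod C (g\<cdot>\<^bsub>C\<^esub>f) = Cod C g"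
  and "!!f. f\<in>Ar C ==> f\<cdot>\<^bsub>C\<^esub>Id C (Dom C f) = f \<and> Id C (Cod C f)\<cdot>\<^bsub>C\<^esub>f = f"
  and "!!f g h. f\<in>Ar C ==> g\<in>Ar C ==> h\<in>Ar C ==> Cod C f = Dom C g ==> Cod C g = Dom C h ==>
   (h\<cdot>\<^bsub>C\<^esub>g)\<cdot>\<^bsub>C\<^esub>f = h\<cdot>\<^bsub>C\<^esub>(g\<cdot>\<^bsub>C\<^esub>f)"
 shows "category C"
 using assms by unfold_locales auto

section \<open>Isomorphisms and chosen inverses\<close>

definition cat_iso :: "('o, 'm) cat => 'm => bool" where
 "cat_iso C f \<longleftrightarrow> f\<in>Ar C \<and> (\<exists>g\<in>Ar C. Dom C g = Cod C f \<and> Cod C g = Dom C f \<and>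
   g\<cdot>\<^bsub>C\<^esub>f = Id C (Dom C f) \<and> f\<cdot>\<^bsub>C\<^esub>g = Id C (Cod C f))"

text \<open>Choosing an inverse turns invertibility into an operation on arrows, so that inverses
  can take part in equational rewriting.\<close>

definition cat_inv :: "('o, 'm) cat => 'm => 'm" where
 "cat_inv C f = (SOME g. g\<in>Ar C \<and> Dom C g = Cod C f \<and> Cod C g = Dom C f \<and>
   g\<cdot>\<^bsub>C\<^esub>f = Id C (Dom C f) \<and> f\<cdot>\<^bsub>C\<^esub>g = Id C (Cod C f))"

lemma cat_inv:
 assumes "cat_iso C f"
 shows "cat_inv C f\<in>Ar C" "Dom C (cat_inv C f) = Cod C f" "Cod C (cat_inv C f) = Dom C f"
  "cat_inv C f\<cdot>\<^bsub>C\<^esub>f = Id C (Dom C f)" "f\<cdot>\<^bsub>C\<^esub>cat_inv C f = Id C (Cod C f)"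
 using someI_ex[of "\<lambda>g. g\<in>Ar C \<and> Dom C g = Cod C f \<and> Cod C g = Dom C f \<and>
   g\<cdot>\<^bsub>C\<^esub>f = Id C (Dom C f) \<and> f\<cdot>\<^bsub>C\<^esub>g = Id C (Cod C f)"] assms
 unfolding cat_iso_def cat_inv_def by blast+

lemma cat_isoI:
 assumes "f\<in>Ar C" "g\<in>Ar C" "Dom C g = Cod C f" "Cod C g = Dom C f"
  and "g\<cdot>\<^bsub>C\<^esub>f = Id C (Dom C f)" "f\<cdot>\<^bsub>C\<^esub>g = Id C (Cod C f)"
 shows "cat_iso C f"
 unfolding cat_iso_def using assms by blast

lemma cat_iso_ar [simp]: "cat_iso C f ==> f\<in>Ar C"
 by (simp add: cat_iso_def)

text \<open>Composites are normalised to right-nested form, in which an arrow and its inverse meet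
  at the head of a longer composite; hence the extra factor \<open>h\<close>.\<close>

lemma cat_inv_comp [simp]:
 assumes "category C" "cat_iso C f" "h\<in>Ar C"
 shows "Cod C h = Dom C f ==> cat_inv C f\<cdot>\<^bsub>C\<^esub>(f\<cdot>\<^bsub>C\<^esub>h) = h"
  "Cod C h = Cod C f ==> f\<cdot>\<^bsub>C\<^esub>(cat_inv C f\<cdot>\<^bsub>C\<^esub>h) = h"
 using assms cat_inv[OF assms(2)] by (simp_all flip: cat_assoc)

lemma cat_iso_inv [simp]: "cat_iso C f ==> cat_iso C (cat_inv C f)"
 using cat_inv[of C f] by (intro cat_isoI[of _ _ f]) auto

lemma cat_iso_id [simp]: "category C ==> a\<in>Ob C ==> cat_iso C (Id C a)"
 by (intro cat_isoI[of _ _ "Id C a"]) auto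

lemma cat_iso_comp [simp]:
 assumes "category C" "cat_iso C f" "cat_iso C g" "Cod C f = Dom C g"
 shows "cat_iso C (g\<cdot>\<^bsub>C\<^esub>f)"
 using assms cat_inv[of C f] cat_inv[of C g]
 by (intro cat_isoI[of _ _ "cat_inv C f\<cdot>\<^bsub>C\<^esub>cat_inv C g"]) auto

definition isomorphic_in :: "('o, 'm) cat => 'o => 'o => bool" where
 "isomorphic_in C a b \<longleftrightarrow> (\<exists>f. cat_iso C f \<and> Dom C f = a \<and> Cod C f = b)"

lemma isomorphic_sym: "isomorphic_in C a b ==> isomorphic_in C b a"
 unfolding isomorphic_in_def using cat_inv[of C] cat_iso_inv[of C] by metis

lemma isomorphic_trans:
 "category C ==> isomorphic_in C a b ==> isomorphic_in C b c ==> isomorphic_in C a c"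
 unfolding isomorphic_in_def using cat_iso_comp[of C] cat_comp[of C] cat_iso_ar[of C] by metis

lemma isomorphic_refl: "category C ==> a\<in>Ob C ==> isomorphic_in C a a"
 unfolding isomorphic_in_def by (auto intro: exI[of _ "Id C a"])

section \<open>Functors\<close>

lemma functor_cat:
 "is_functor F ==> FDom F = C ==> category C" "is_functor F ==> FCod F = D ==> category D"
 by (auto simp: is_functor_def Let_def)

lemma functor_cat':
 "is_functor F ==> category (FDom F)" "is_functor F ==> category (FCod F)"
 by (simp_all add: functor_cat)

lemma functor_ob: "is_functor F ==> FCod F = D ==> a\<in>Ob (FDom F) ==> FOb F a\<in>Ob D"
 by (auto simp: is_functor_def Let_def)

lemma functor_ar: "is_functor F ==> FCod F = D ==> f\<in>Ar (FDom F) ==> FAr F f\<in>Ar D"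
 by (auto simp: is_functor_def Let_def)

lemma functor_dom_cod:
 "is_functor F ==> FCod F = D ==> f\<in>Ar (FDom F) ==> Dom D (FAr F f) = FOb F (Dom (FDom F) f)"
 "is_functor F ==> FCod F = D ==> f\<in>Ar (FDom F) ==> Cod D (FAr F f) = FOb F (Cod (FDom F) f)"
 by (auto simp: is_functor_def Let_def)

lemma functor_id:
 "is_functor F ==> FDom F = C ==> a\<in>Ob C ==> FAr F (Id C a) = Id (FCod F) (FOb F a)"
 by (auto simp: is_functor_def Let_def)

lemma functor_comp:
 "is_functor F ==> FDom F = C ==> f\<in>Ar C ==> g\<in>Ar C ==> Cod C f = Dom C g ==>
  FAr F (g\<cdot>\<^bsub>C\<^esub>f) = FAr F g\<cdot>\<^bsub>FCod F\<^esub>FAr F f"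
 by (auto simp: is_functor_def Let_def)

lemmas functor_simps [simp] = functor_cat' functor_ob functor_ar functor_dom_cod functor_id functor_comp

lemma functor_iso [simp]:
 assumes "is_functor F" "FDom F = C" "FCod F = D" "cat_iso C f"
 shows "cat_iso D (FAr F f)"
proof -
 have "FAr F (cat_inv C f)\<cdot>\<^bsub>D\<^esub>FAr F f = Id D (FOb F (Dom C f))"
  "FAr F f\<cdot>\<^bsub>D\<^esub>FAr F (cat_inv C f) = Id D (FOb F (Cod C f))"
  using assms cat_inv[OF assms(4)] functor_comp[OF assms(1,2), of f "cat_inv C f"]
   functor_comp[OF assms(1,2), of "cat_inv C f" f] by auto
 then show ?thesis
  using assms cat_inv[OF assms(4)] by (intro cat_isoI[of _ _ "FAr F (cat_inv C f)"]) auto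
qed

lemma functorI:
 assumes "category (FDom F)" "category (FCod F)"
  and "FOb F\<in>extensional (Ob (FDom F))" "FAr F\<in>extensional (Ar (FDom F))"
  and "!!a. a\<in>Ob (FDom F) ==> FOb F a\<in>Ob (FCod F)"
  and "!!f. f\<in>Ar (FDom F) ==> FAr F f\<in>Ar (FCod F) \<and>
   Dom (FCod F) (FAr F f) = FOb F (Dom (FDom F) f) \<and> Cod (FCod F) (FAr F f) = FOb F (Cod (FDom F) f)"
  and "!!a. a\<in>Ob (FDom F) ==> FAr F (Id (FDom F) a) = Id (FCod F) (FOb F a)"
  and "!!f g. f\<in>Ar (FDom F) ==> g\<in>Ar (FDom F) ==> Cod (FDom F) f = Dom (FDom F) g ==>
   FAr F (g\<cdot>\<^bsub>FDom F\<^esub>f) = FAr F g\<cdot>\<^bsub>FCod F\<^esub>FAr F f"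
 shows "is_functor F"
 unfolding is_functor_def Let_def PiE_def using assms by blast

lemma functor_ext:
 "is_functor F ==> FOb F\<in>extensional (Ob (FDom F))" "is_functor F ==> FAr F\<in>extensional (Ar (FDom F))"
 unfolding is_functor_def Let_def PiE_def by blast+

text \<open>The maps of a functor are \<open>undefined\<close> outside the carriers, so agreement on
  objects and arrows is equality.\<close>

lemma functor_eqI:
 fixes F G :: "('o, 'm, 'p, 'n) fctr"
 assumes "is_functor F" "is_functor G" "FDom F = FDom G" "FCod F = FCod G"
  and "!!a. a\<in>Ob (FDom F) ==> FOb F a = FOb G a" "!!f. f\<in>Ar (FDom F) ==> FAr F f = FAr G f"
 shows "F = G"
proof -
 have "FOb F = FOb G" "FAr F = FAr G"
  using assms functor_ext[of F] functor_ext[of G] by (auto intro!: extensionalityI)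
 then show ?thesis using assms by simp
qed

lemma fcomp_simps [simp]:
 "FDom (G \<circ>\<^sub>F F) = FDom F" "FCod (G \<circ>\<^sub>F F) = FCod G"
 "a\<in>Ob (FDom F) ==> FOb (G \<circ>\<^sub>F F) a = FOb G (FOb F a)"
 "f\<in>Ar (FDom F) ==> FAr (G \<circ>\<^sub>F F) f = FAr G (FAr F f)"
 by (simp_all add: fcomp_def compose_def)

lemma fid_simps [simp]:
 "FDom (fid C) = C" "FCod (fid C) = C"
 "a\<in>Ob C ==> FOb (fid C) a = a" "f\<in>Ar C ==> FAr (fid C) f = f"
 by (simp_all add: fid_def)

lemma fid_functor [simp]: "category C ==> is_functor (fid C)"
 by (rule functorI) (auto simp: fid_def)

lemma fcomp_functor [simp]:
 "is_functor F ==> is_functor G ==> FCod F = FDom G ==> is_functor (G \<circ>\<^sub>F F)"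
 by (rule functorI) (auto simp: fcomp_def compose_def)

lemma fcomp_assoc [simp]:
 assumes "is_functor F" "is_functor G" "is_functor K" "FCod F = FDom G" "FCod G = FDom K"
 shows "(K \<circ>\<^sub>F G) \<circ>\<^sub>F F = K \<circ>\<^sub>F (G \<circ>\<^sub>F F)"
 by (rule functor_eqI) (use assms in auto)

lemma fcomp_fid [simp]:
 assumes "is_functor F"
 shows "FDom F = C ==> F \<circ>\<^sub>F fid C = F" "FCod F = D ==> fid D \<circ>\<^sub>F F = F"
 by (rule functor_eqI; use assms in auto)+

section \<open>Natural transformations\<close>

lemma nat_trans_functor:
 "nat_trans sig ==> NDom sig = F ==> is_functor F" "nat_trans sig ==> NCod sig = F ==> is_functor F"
 by (auto simp: nat_trans_def Let_def)

lemma nat_trans_parallel: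
 assumes "nat_trans sig"
 shows "FDom (NCod sig) = FDom (NDom sig)" "FCod (NCod sig) = FCod (NDom sig)"
 using assms by (auto simp: nat_trans_def Let_def)

lemma nat_trans_at:
 assumes "nat_trans sig" "FCod (NDom sig) = D" "a\<in>Ob (FDom (NDom sig))"
 shows "NAt sig a\<in>Ar D" "Dom D (NAt sig a) = FOb (NDom sig) a" "Cod D (NAt sig a) = FOb (NCod sig) a"
 using assms by (auto simp: nat_trans_def Let_def PiE_iff)

lemma nat_trans_natural:
 "nat_trans sig ==> f\<in>Ar (FDom (NDom sig)) ==>
  NAt sig (Cod (FDom (NDom sig)) f)\<cdot>\<^bsub>FCod (NDom sig)\<^esub>FAr (NDom sig) f =
  FAr (NCod sig) f\<cdot>\<^bsub>FCod (NDom sig)\<^esub>NAt sig (Dom (FDom (NDom sig)) f)"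
 by (auto simp: nat_trans_def Let_def)

lemma nat_trans_ext: "nat_trans sig ==> NAt sig\<in>extensional (Ob (FDom (NDom sig)))"
 by (auto simp: nat_trans_def Let_def PiE_def)

lemma nat_transI:
 assumes "is_functor (NDom sig)" "is_functor (NCod sig)"
  and "FDom (NCod sig) = FDom (NDom sig)" "FCod (NCod sig) = FCod (NDom sig)"
  and "NAt sig\<in>extensional (Ob (FDom (NDom sig)))"
  and "!!a. a\<in>Ob (FDom (NDom sig)) ==> NAt sig a\<in>Ar (FCod (NDom sig)) \<and>
   Dom (FCod (NDom sig)) (NAt sig a) = FOb (NDom sig) a \<and> Cod (FCod (NDom sig)) (NAt sig a) = FOb (NCod sig) a"
  and "!!f. f\<in>Ar (FDom (NDom sig)) ==>
   NAt sig (Cod (FDom (NDom sig)) f)\<cdot>\<^bsub>FCod (NDom sig)\<^esub>FAr (NDom sig) f =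
   FAr (NCod sig) f\<cdot>\<^bsub>FCod (NDom sig)\<^esub>NAt sig (Dom (FDom (NDom sig)) f)"
 shows "nat_trans sig"
 unfolding nat_trans_def Let_def PiE_def Pi_def Hom_def using assms by blast

lemma nat_trans_cat:
 "nat_trans sig ==> category (FDom (NDom sig))" "nat_trans sig ==> category (FCod (NDom sig))"
 using nat_trans_functor functor_cat by blast+

lemmas nat_trans_simps [simp] = nat_trans_cat nat_trans_functor nat_trans_at

lemma nat_trans_eqI:
 fixes sig tu :: "('o, 'm, 'p, 'n) ntrans"
 assumes "nat_trans sig" "nat_trans tu" "NDom sig = NDom tu" "NCod sig = NCod tu"
  and "!!a. a\<in>Ob (FDom (NDom sig)) ==> NAt sig a = NAt tu a"
 shows "sig = tu"
proof -
 have "NAt sig = NAt tu"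
  using assms nat_trans_ext[of sig] nat_trans_ext[of tu] by (auto intro!: extensionalityI)
 then show ?thesis using assms by simp
qed

lemma nid_simps [simp]: "NDom (nid F) = F" "NCod (nid F) = F"
 "a\<in>Ob (FDom F) ==> NAt (nid F) a = Id (FCod F) (FOb F a)"
 by (simp_all add: nid_def)

lemma nvcomp_simps [simp]: "NDom (tu \<bullet>\<^sub>N sig) = NDom sig" "NCod (tu \<bullet>\<^sub>N sig) = NCod tu"
 "a\<in>Ob (FDom (NDom sig)) ==> NAt (tu \<bullet>\<^sub>N sig) a = NAt tu a\<cdot>\<^bsub>FCod (NDom sig)\<^esub>NAt sig a"
 by (simp_all add: nvcomp_def)

lemma nhcomp_simps [simp]: "NDom (tu \<star>\<^sub>N sig) = NDom tu \<circ>\<^sub>F NDom sig" "NCod (tu \<star>\<^sub>N sig) = NCod tu \<circ>\<^sub>F NCod sig"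
 "a\<in>Ob (FDom (NDom sig)) ==> NAt (tu \<star>\<^sub>N sig) a =
  NAt tu (FOb (NCod sig) a)\<cdot>\<^bsub>FCod (NDom tu)\<^esub>FAr (NDom tu) (NAt sig a)"
 by (simp_all add: nhcomp_def)

lemma nid_trans [simp]: "is_functor F ==> nat_trans (nid F)"
 by (rule nat_transI) (auto simp: nid_def)

lemma nvcomp_trans [simp]:
 assumes "nat_trans sig" "nat_trans tu" "NCod sig = NDom tu"
 shows "nat_trans (tu \<bullet>\<^sub>N sig)"
proof (rule nat_transI)
 let ?x = "tu \<bullet>\<^sub>N sig"
 note p = nat_trans_parallel[OF assms(1)] nat_trans_parallel[OF assms(2)]
 show "NAt ?x\<in>extensional (Ob (FDom (NDom ?x)))" by (simp add: nvcomp_def)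
 fix f assume f: "f\<in>Ar (FDom (NDom ?x))"
 let ?C = "FDom (NDom sig)" let ?D = "FCod (NDom sig)"
 have c: "category ?C" "category ?D" using assms(1) by simp_all
 have s: "NAt sig (Cod ?C f)\<cdot>\<^bsub>?D\<^esub>FAr (NDom sig) f = FAr (NCod sig) f\<cdot>\<^bsub>?D\<^esub>NAt sig (Dom ?C f)"
  using nat_trans_natural[OF assms(1)] f by simp
 have t: "NAt tu (Cod ?C f)\<cdot>\<^bsub>?D\<^esub>FAr (NCod sig) f = FAr (NCod tu) f\<cdot>\<^bsub>?D\<^esub>NAt tu (Dom ?C f)"
  using nat_trans_natural[OF assms(2)] f assms p by simp
 have "NAt ?x (Cod ?C f)\<cdot>\<^bsub>?D\<^esub>FAr (NDom sig) f =
   NAt tu (Cod ?C f)\<cdot>\<^bsub>?D\<^esub>(FAr (NCod sig) f\<cdot>\<^bsub>?D\<^esub>NAt sig (Dom ?C f))"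
  using f assms p c by (simp add: s)
 also have "... = (NAt tu (Cod ?C f)\<cdot>\<^bsub>?D\<^esub>FAr (NCod sig) f)\<cdot>\<^bsub>?D\<^esub>NAt sig (Dom ?C f)"
  using f assms p c by simp
 also have "... = FAr (NCod tu) f\<cdot>\<^bsub>?D\<^esub>NAt ?x (Dom ?C f)"
  unfolding t using f assms p c by simp
 finally show "NAt ?x (Cod (FDom (NDom ?x)) f)\<cdot>\<^bsub>FCod (NDom ?x)\<^esub>FAr (NDom ?x) f =
  FAr (NCod ?x) f\<cdot>\<^bsub>FCod (NDom ?x)\<^esub>NAt ?x (Dom (FDom (NDom ?x)) f)"
  by simp
qed (use assms nat_trans_parallel[OF assms(1)] nat_trans_parallel[OF assms(2)] in auto)

lemma nhcomp_trans [simp]: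
 assumes "nat_trans sig" "nat_trans tu" "FCod (NDom sig) = FDom (NDom tu)"
 shows "nat_trans (tu \<star>\<^sub>N sig)"
proof (rule nat_transI)
 let ?x = "tu \<star>\<^sub>N sig"
 note p = nat_trans_parallel[OF assms(1)] nat_trans_parallel[OF assms(2)]
 show "NAt ?x\<in>extensional (Ob (FDom (NDom ?x)))" by (simp add: nhcomp_def)
 fix f assume f: "f\<in>Ar (FDom (NDom ?x))"
 let ?C = "FDom (NDom sig)" let ?D = "FCod (NDom sig)" let ?E = "FCod (NDom tu)"
 have c: "category ?C" "category ?D" "category ?E" using assms by simp_all
 have s: "NAt sig (Cod ?C f)\<cdot>\<^bsub>?D\<^esub>FAr (NDom sig) f = FAr (NCod sig) f\<cdot>\<^bsub>?D\<^esub>NAt sig (Dom ?C f)"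
  using nat_trans_natural[OF assms(1)] f by simp
 have t: "NAt tu (Cod ?D g)\<cdot>\<^bsub>?E\<^esub>FAr (NDom tu) g = FAr (NCod tu) g\<cdot>\<^bsub>?E\<^esub>NAt tu (Dom ?D g)"
  if "g\<in>Ar ?D" for g
  using nat_trans_natural[OF assms(2)] that assms p by simp
 have "NAt ?x (Cod ?C f)\<cdot>\<^bsub>?E\<^esub>FAr (NDom tu) (FAr (NDom sig) f) =
   NAt tu (FOb (NCod sig) (Cod ?C f))\<cdot>\<^bsub>?E\<^esub>FAr (NDom tu) (NAt sig (Cod ?C f)\<cdot>\<^bsub>?D\<^esub>FAr (NDom sig) f)"
  using f assms p c by simp
 also have "... = NAt tu (FOb (NCod sig) (Cod ?C f))\<cdot>\<^bsub>?E\<^esub>FAr (NDom tu) (FAr (NCod sig) f) \<cdot>\<^bsub>?E\<^esub>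
   FAr (NDom tu) (NAt sig (Dom ?C f))"
  unfolding s using f assms p c by simp
 also have "... = (NAt tu (FOb (NCod sig) (Cod ?C f))\<cdot>\<^bsub>?E\<^esub>FAr (NDom tu) (FAr (NCod sig) f)) \<cdot>\<^bsub>?E\<^esub>
   FAr (NDom tu) (NAt sig (Dom ?C f))"
  using f assms p c by simp
 also have "... = FAr (NCod tu) (FAr (NCod sig) f)\<cdot>\<^bsub>?E\<^esub>NAt ?x (Dom ?C f)"
  using t[of "FAr (NCod sig) f"] f assms p c by simp
 finally show "NAt ?x (Cod (FDom (NDom ?x)) f)\<cdot>\<^bsub>FCod (NDom ?x)\<^esub>FAr (NDom ?x) f =
  FAr (NCod ?x) f\<cdot>\<^bsub>FCod (NDom ?x)\<^esub>NAt ?x (Dom (FDom (NDom ?x)) f)"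
  using f assms p c by simp
qed (use assms nat_trans_parallel[OF assms(1)] nat_trans_parallel[OF assms(2)] in auto)

text \<open>The pointwise inverses of a natural family are automatically natural, which reduces
  invertibility of a transformation to its components.\<close>

lemma nat_iso_iff:
 "nat_iso sig \<longleftrightarrow> nat_trans sig \<and> (\<forall>a\<in>Ob (FDom (NDom sig)). cat_iso (FCod (NDom sig)) (NAt sig a))"
  (is "?L \<longleftrightarrow> ?R")
proof
 let ?C = "FDom (NDom sig)" let ?D = "FCod (NDom sig)"
 assume L: ?L
 then obtain tu where s: "nat_trans sig" and t: "nat_trans tu" "NDom tu = NCod sig" "NCod tu = NDom sig"
   "tu \<bullet>\<^sub>N sig = nid (NDom sig)" "sig \<bullet>\<^sub>N tu = nid (NCod sig)" unfolding nat_iso_def by blast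
 note p = nat_trans_parallel[OF s]
 have "NAt tu a\<cdot>\<^bsub>?D\<^esub>NAt sig a = Id ?D (FOb (NDom sig) a)" "NAt sig a\<cdot>\<^bsub>?D\<^esub>NAt tu a = Id ?D (FOb (NCod sig) a)"
  if "a\<in>Ob ?C" for a
  using arg_cong[OF t(4), of "\<lambda>x. NAt x a"] arg_cong[OF t(5), of "\<lambda>x. NAt x a"] that p
  by (simp_all add: t(2,3))
 moreover have "NAt tu a\<in>Ar ?D \<and> Dom ?D (NAt tu a) = FOb (NCod sig) a \<and> Cod ?D (NAt tu a) = FOb (NDom sig) a"
  if "a\<in>Ob ?C" for a
  using nat_trans_at[OF t(1), of ?D a] that unfolding t(2,3) p by simp
 ultimately show ?R using s by (auto intro!: cat_isoI[of _ _ "NAt tu _"])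
next
 let ?C = "FDom (NDom sig)" let ?D = "FCod (NDom sig)"
 assume R: ?R
 then have s: "nat_trans sig" and i: "!!a. a\<in>Ob ?C ==> cat_iso ?D (NAt sig a)" by auto
 note p = nat_trans_parallel[OF s]
 have c: "category ?C" "category ?D" using s by simp_all
 define tu where "tu = \<lparr>NDom = NCod sig, NCod = NDom sig, NAt = (\<lambda>a\<in>Ob ?C. cat_inv ?D (NAt sig a))\<rparr>"
 have t: "nat_trans tu"
 proof (rule nat_transI)
  fix f assume f: "f\<in>Ar (FDom (NDom tu))"
  then have f: "f\<in>Ar ?C" by (simp add: tu_def p)
  \<comment> \<open>Inserting \<open>sig\<close> and its inverse at the domain of \<open>f\<close>
    exposes a naturality square of \<open>sig\<close>.\<close>
  have "cat_inv ?D (NAt sig (Cod ?C f))\<cdot>\<^bsub>?D\<^esub>FAr (NCod sig) f =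
    cat_inv ?D (NAt sig (Cod ?C f))\<cdot>\<^bsub>?D\<^esub>(FAr (NCod sig) f\<cdot>\<^bsub>?D\<^esub>NAt sig (Dom ?C f))\<cdot>\<^bsub>?D\<^esub>cat_inv ?D (NAt sig (Dom ?C f))"
   using s f c p i cat_inv[OF i, of "Dom ?C f"] cat_inv[OF i, of "Cod ?C f"] by simp
  also have "... = FAr (NDom sig) f\<cdot>\<^bsub>?D\<^esub>cat_inv ?D (NAt sig (Dom ?C f))"
   unfolding nat_trans_natural[OF s f, symmetric]
   using s f c p i cat_inv[OF i, of "Dom ?C f"] cat_inv[OF i, of "Cod ?C f"] by simp
  finally show "NAt tu (Cod (FDom (NDom tu)) f)\<cdot>\<^bsub>FCod (NDom tu)\<^esub>FAr (NDom tu) f =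
   FAr (NCod tu) f\<cdot>\<^bsub>FCod (NDom tu)\<^esub>NAt tu (Dom (FDom (NDom tu)) f)"
   using f p c by (simp add: tu_def)
 qed (use s p cat_inv[OF i] in "auto simp: tu_def")
 have "tu \<bullet>\<^sub>N sig = nid (NDom sig)" "sig \<bullet>\<^sub>N tu = nid (NCod sig)"
  using s t p cat_inv[OF i] by (auto intro!: nat_trans_eqI simp: tu_def)
 then show ?L using s t by (auto simp: nat_iso_def tu_def intro!: exI[of _ tu])
qed

text \<open>The quasi-inverse sends \<open>d\<close> to a chosen object \<open>c d\<close> with an
  isomorphism \<open>e d\<close> from \<open>F (c d)\<close> to \<open>d\<close>, and an arrow to
  the unique lift of its conjugate by these isomorphisms. Uniqueness of lifts yields functoriality
  and the naturality of the unit.\<close>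

lemma cat_equivalenceI:
 fixes F :: "('o, 'm, 'p, 'n) fctr"
 assumes F: "is_functor F"
  and bij: "!!a b. a\<in>Ob (FDom F) ==> b\<in>Ob (FDom F) ==>
   bij_betw (FAr F) (Hom (FDom F) a b) (Hom (FCod F) (FOb F a) (FOb F b))"
  and surj: "!!d. d\<in>Ob (FCod F) ==> \<exists>c\<in>Ob (FDom F). isomorphic_in (FCod F) (FOb F c) d"
 shows "cat_equivalence F"
proof -
 let ?C = "FDom F" let ?D = "FCod F"
 have c: "category ?C" "category ?D" using F by simp_all
 obtain c e where ce: "!!d. d\<in>Ob ?D ==> c d\<in>Ob ?C \<and> cat_iso ?D (e d) \<and> Dom ?D (e d) = FOb F (c d) \<and> Cod ?D (e d) = d"
  using surj unfolding isomorphic_in_def by metis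
 let ?i = "\<lambda>d. cat_inv ?D (e d)"
 have ii: "?i d\<in>Ar ?D" "Dom ?D (?i d) = d" "Cod ?D (?i d) = FOb F (c d)"
  "?i d\<cdot>\<^bsub>?D\<^esub>e d = Id ?D (FOb F (c d))" "e d\<cdot>\<^bsub>?D\<^esub>?i d = Id ?D d" if "d\<in>Ob ?D" for d
  using cat_inv[of ?D "e d"] ce[OF that] by simp_all
 define lift where "lift a b h = inv_into (Hom ?C a b) (FAr F) h" for a b h
 have lift: "lift a b h\<in>Ar ?C \<and> Dom ?C (lift a b h) = a \<and> Cod ?C (lift a b h) = b \<and> FAr F (lift a b h) = h"
  if "a\<in>Ob ?C" "b\<in>Ob ?C" "h\<in>Ar ?D" "Dom ?D h = FOb F a" "Cod ?D h = FOb F b" for a b h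
 proof -
  have h: "h\<in>FAr F ` Hom ?C a b" using bij[OF that(1,2)] that unfolding bij_betw_def by simp
  show ?thesis using inv_into_into[OF h] f_inv_into_f[OF h] unfolding lift_def by simp
 qed
 \<comment> \<open>By faithfulness, equations in the domain of \<open>F\<close> may from here on be
   checked after applying \<open>F\<close>.\<close>
 have inj: "f = g" if "f\<in>Ar ?C" "g\<in>Ar ?C" "Dom ?C f = Dom ?C g" "Cod ?C f = Cod ?C g" "FAr F f = FAr F g" for f g
  using bij[of "Dom ?C g" "Cod ?C g"] that c unfolding bij_betw_def inj_on_def by auto
 define G where "G = \<lparr>FDom = ?D, FCod = ?C, FOb = restrict c (Ob ?D),
  FAr = (\<lambda>h\<in>Ar ?D. lift (c (Dom ?D h)) (c (Cod ?D h)) (?i (Cod ?D h)\<cdot>\<^bsub>?D\<^esub>h\<cdot>\<^bsub>?D\<^esub>e (Dom ?D h)))\<rparr>"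
 have G_simps [simp]: "FDom G = ?D" "FCod G = ?C" "!!d. d\<in>Ob ?D ==> FOb G d = c d"
  by (simp_all add: G_def)
 have G_ar: "FAr G h\<in>Ar ?C \<and> Dom ?C (FAr G h) = c (Dom ?D h) \<and> Cod ?C (FAr G h) = c (Cod ?D h) \<and>
   FAr F (FAr G h) = ?i (Cod ?D h)\<cdot>\<^bsub>?D\<^esub>h\<cdot>\<^bsub>?D\<^esub>e (Dom ?D h)" if "h\<in>Ar ?D" for h
  using lift[of "c (Dom ?D h)" "c (Cod ?D h)" "?i (Cod ?D h)\<cdot>\<^bsub>?D\<^esub>h\<cdot>\<^bsub>?D\<^esub>e (Dom ?D h)"]
   that ce[of "Dom ?D h"] ce[of "Cod ?D h"] ii[of "Cod ?D h"] c by (simp add: G_def)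
 have G: "is_functor G"
 proof (rule functorI)
  fix a assume a: "a\<in>Ob (FDom G)"
  then show "FAr G (Id (FDom G) a) = Id (FCod G) (FOb G a)"
   using G_ar[of "Id ?D a"] ce[of a] ii[of a] c F by (intro inj) auto
 next
  fix f g assume fg: "f\<in>Ar (FDom G)" "g\<in>Ar (FDom G)" "Cod (FDom G) f = Dom (FDom G) g"
  then show "FAr G (g\<cdot>\<^bsub>FDom G\<^esub>f) = FAr G g\<cdot>\<^bsub>FCod G\<^esub>FAr G f"
   using G_ar[of f] G_ar[of g] G_ar[of "g\<cdot>\<^bsub>?D\<^esub>f"] ce[of "Dom ?D f"] ce[of "Cod ?D f"] ce[of "Cod ?D g"]
    ii[of "Dom ?D f"] ii[of "Cod ?D f"] ii[of "Cod ?D g"] c F cat_inv_comp(2)[of ?D "e (Dom ?D g)" "f\<cdot>\<^bsub>?D\<^esub>e (Dom ?D f)"]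
   by (intro inj) auto
 next
  show "FAr G\<in>extensional (Ar (FDom G))" by (simp add: G_def)
 qed (use c G_ar ce in "auto simp: G_def")
 define \<epsilon> where "\<epsilon> = \<lparr>NDom = F \<circ>\<^sub>F G, NCod = fid ?D, NAt = restrict e (Ob ?D)\<rparr>"
 \<comment> \<open>The unit at \<open>a\<close> lifts the inverse of \<open>e (F a)\<close>; its own
   inverse, found below, lifts \<open>e (F a)\<close>.\<close>
 define et where "et = \<lparr>NDom = fid ?C, NCod = G \<circ>\<^sub>F F,
  NAt = (\<lambda>a\<in>Ob ?C. lift a (c (FOb F a)) (?i (FOb F a)))\<rparr>"
 have eps: "nat_trans \<epsilon>"
 proof (rule nat_transI)
  fix f assume "f\<in>Ar (FDom (NDom \<epsilon>))"
  then show "NAt \<epsilon> (Cod (FDom (NDom \<epsilon>)) f)\<cdot>\<^bsub>FCod (NDom \<epsilon>)\<^esub>FAr (NDom \<epsilon>) f =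
   FAr (NCod \<epsilon>) f\<cdot>\<^bsub>FCod (NDom \<epsilon>)\<^esub>NAt \<epsilon> (Dom (FDom (NDom \<epsilon>)) f)"
   using c ce[of "Cod ?D f"] ce[of "Dom ?D f"] G_ar[of f] by (simp add: \<epsilon>_def)
 qed (use c F G ce in "auto simp: \<epsilon>_def")
 then have eps': "nat_iso \<epsilon>" using ce by (simp add: nat_iso_iff) (simp add: \<epsilon>_def)
 have eta_at: "lift a (c (FOb F a)) (?i (FOb F a))\<in>Ar ?C \<and> Dom ?C (lift a (c (FOb F a)) (?i (FOb F a))) = a \<and>
   Cod ?C (lift a (c (FOb F a)) (?i (FOb F a))) = c (FOb F a) \<and> FAr F (lift a (c (FOb F a)) (?i (FOb F a))) = ?i (FOb F a)"
  if "a\<in>Ob ?C" for a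
  using that F ce[of "FOb F a"] ii[of "FOb F a"] by (intro lift) auto
 have eta: "nat_trans et"
 proof (rule nat_transI)
  fix f assume "f\<in>Ar (FDom (NDom et))"
  then have f: "f\<in>Ar ?C" by (simp add: et_def)
  let ?a = "Dom ?C f" let ?b = "Cod ?C f"
  have "lift ?b (c (FOb F ?b)) (?i (FOb F ?b))\<cdot>\<^bsub>?C\<^esub>f = FAr G (FAr F f)\<cdot>\<^bsub>?C\<^esub>lift ?a (c (FOb F ?a)) (?i (FOb F ?a))"
   using f F c eta_at[of ?a] eta_at[of ?b] G_ar[of "FAr F f"] ii[of "FOb F ?a"] ce[of "FOb F ?a"] ce[of "FOb F ?b"] ii[of "FOb F ?b"]
   by (intro inj) auto
  then show "NAt et (Cod (FDom (NDom et)) f)\<cdot>\<^bsub>FCod (NDom et)\<^esub>FAr (NDom et) f =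
   FAr (NCod et) f\<cdot>\<^bsub>FCod (NDom et)\<^esub>NAt et (Dom (FDom (NDom et)) f)"
   using f F c by (simp add: et_def)
 qed (use c F G eta_at in "auto simp: et_def")
 have "cat_iso ?C (lift a (c (FOb F a)) (?i (FOb F a)))" if a: "a\<in>Ob ?C" for a
 proof -
  have k: "lift (c (FOb F a)) a (e (FOb F a))\<in>Ar ?C \<and> Dom ?C (lift (c (FOb F a)) a (e (FOb F a))) = c (FOb F a) \<and>
   Cod ?C (lift (c (FOb F a)) a (e (FOb F a))) = a \<and> FAr F (lift (c (FOb F a)) a (e (FOb F a))) = e (FOb F a)"
   using a F ce[of "FOb F a"] by (intro lift) auto
  show ?thesis
   using a F c k eta_at[OF a] ii[of "FOb F a"] ce[of "FOb F a"]
   by (intro cat_isoI[of _ _ "lift (c (FOb F a)) a (e (FOb F a))"] inj) auto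
 qed
 then have eta': "nat_iso et" using eta by (simp add: nat_iso_iff) (simp add: et_def)
 show ?thesis unfolding cat_equivalence_def
  using F G eps' eta' by (intro conjI exI[of _ G] exI[of _ et] exI[of _ \<epsilon>]) (simp_all add: \<epsilon>_def et_def)
qed

text \<open>The unit makes \<open>F\<close> faithful and the counit makes \<open>G\<close> faithful.
  Fullness of \<open>F\<close> follows, since \<open>G\<close> cannot distinguish \<open>h\<close>
  from the image of the conjugate of \<open>G h\<close> by the unit.\<close>

lemma cat_equivalence_bij:
 assumes "cat_equivalence F" "FDom F = C" "FCod F = D" "a\<in>Ob C" "b\<in>Ob C"
 shows "bij_betw (FAr F) (Hom C a b) (Hom D (FOb F a) (FOb F b))"
proof -
 obtain G et \<epsilon> where F: "is_functor F" and G: "is_functor G" "FDom G = D" "FCod G = C"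
  and eta: "nat_iso et" "NDom et = fid C" "NCod et = G \<circ>\<^sub>F F"
  and eps: "nat_iso \<epsilon>" "NDom \<epsilon> = F \<circ>\<^sub>F G" "NCod \<epsilon> = fid D"
  using assms(1-3) unfolding cat_equivalence_def by auto
 have c: "category C" "category D" using functor_cat(1)[OF G(1,2)] functor_cat(2)[OF G(1,3)] by simp_all
 have eta_iso: "cat_iso C (NAt et x)" if "x\<in>Ob C" for x
  using eta(1) that unfolding nat_iso_iff eta(2) by simp
 have eps_iso: "cat_iso D (NAt \<epsilon> x)" if "x\<in>Ob D" for x
  using eps(1) that assms(3) unfolding nat_iso_iff eps(2) using G by simp
 have eta': "nat_trans et" and eps': "nat_trans \<epsilon>" using eta eps by (auto simp: nat_iso_def)
 have ed: "NAt et x\<in>Ar C" "Dom C (NAt et x) = x" "Cod C (NAt et x) = FOb G (FOb F x)" if "x\<in>Ob C" for x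
  using nat_trans_at[OF eta', of C x] eta that assms by simp_all
 have pd: "NAt \<epsilon> x\<in>Ar D" "Dom D (NAt \<epsilon> x) = FOb F (FOb G x)" "Cod D (NAt \<epsilon> x) = x" if "x\<in>Ob D" for x
  using nat_trans_at[OF eps', of D x] eps that assms G by simp_all
 have en: "NAt et (Cod C f)\<cdot>\<^bsub>C\<^esub>f = FAr G (FAr F f)\<cdot>\<^bsub>C\<^esub>NAt et (Dom C f)" if "f\<in>Ar C" for f
  using nat_trans_natural[OF eta', of f] eta that assms by simp
 have pn: "NAt \<epsilon> (Cod D f)\<cdot>\<^bsub>D\<^esub>FAr F (FAr G f) = f\<cdot>\<^bsub>D\<^esub>NAt \<epsilon> (Dom D f)" if "f\<in>Ar D" for f
  using nat_trans_natural[OF eps', of f] eps that assms G by simp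
 \<comment> \<open>Naturality of the invertible unit expresses \<open>f\<close> through
   \<open>G (F f)\<close>.\<close>
 have injF: "f = g" if "f\<in>Ar C" "g\<in>Ar C" "Dom C f = Dom C g" "Cod C f = Cod C g" "FAr F f = FAr F g" for f g
 proof -
  have "NAt et (Cod C f)\<cdot>\<^bsub>C\<^esub>f = NAt et (Cod C f)\<cdot>\<^bsub>C\<^esub>g" using en[of f] en[of g] that by simp
  then have "cat_inv C (NAt et (Cod C f))\<cdot>\<^bsub>C\<^esub>(NAt et (Cod C f)\<cdot>\<^bsub>C\<^esub>f) = cat_inv C (NAt et (Cod C f))\<cdot>\<^bsub>C\<^esub>(NAt et (Cod C f)\<cdot>\<^bsub>C\<^esub>g)" by simp
  then show ?thesis using that c eta_iso ed by simp
 qed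
 have injG: "f = g" if "f\<in>Ar D" "g\<in>Ar D" "Dom D f = Dom D g" "Cod D f = Cod D g" "FAr G f = FAr G g" for f g
 proof -
  have "f\<cdot>\<^bsub>D\<^esub>NAt \<epsilon> (Dom D f) = g\<cdot>\<^bsub>D\<^esub>NAt \<epsilon> (Dom D f)" using pn[of f] pn[of g] that by simp
  then have "(f\<cdot>\<^bsub>D\<^esub>NAt \<epsilon> (Dom D f))\<cdot>\<^bsub>D\<^esub>cat_inv D (NAt \<epsilon> (Dom D f)) = (g\<cdot>\<^bsub>D\<^esub>NAt \<epsilon> (Dom D f))\<cdot>\<^bsub>D\<^esub>cat_inv D (NAt \<epsilon> (Dom D f))" by simp
  then show ?thesis using that c pd[of "Dom D f"] cat_inv[OF eps_iso[of "Dom D f"]] pd[of "Dom D g"] cat_inv[OF eps_iso[of "Dom D g"]] by simp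
 qed
 show ?thesis
 proof (rule bij_betw_imageI)
  show "inj_on (FAr F) (Hom C a b)" by (auto intro!: inj_onI injF)
  show "FAr F ` Hom C a b = Hom D (FOb F a) (FOb F b)"
  proof
   show "FAr F ` Hom C a b \<subseteq> Hom D (FOb F a) (FOb F b)" using F assms by auto
   show "Hom D (FOb F a) (FOb F b) \<subseteq> FAr F ` Hom C a b"
   proof
    fix h assume h: "h\<in>Hom D (FOb F a) (FOb F b)"
    \<comment> \<open>\<open>F f\<close> and \<open>h\<close> are parallel and will be shown to have
      the same image under the faithful \<open>G\<close>.\<close>
    define f where "f = cat_inv C (NAt et b)\<cdot>\<^bsub>C\<^esub>FAr G h\<cdot>\<^bsub>C\<^esub>NAt et a"
    note iv = cat_inv[OF eta_iso[OF assms(5)]]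
    have f: "f\<in>Ar C" "Dom C f = a" "Cod C f = b"
     using h assms G F c ed iv by (auto simp: f_def)
    have gh: "FAr G h\<in>Ar C" "Dom C (FAr G h) = FOb G (FOb F a)" "Cod C (FAr G h) = FOb G (FOb F b)"
     using h G by auto
    have "NAt et b\<cdot>\<^bsub>C\<^esub>f = FAr G h\<cdot>\<^bsub>C\<^esub>NAt et a"
     unfolding f_def using c(1) gh ed[OF assms(4)] ed[OF assms(5)] eta_iso[OF assms(5)] by simp
    then have "FAr G (FAr F f)\<cdot>\<^bsub>C\<^esub>NAt et a = FAr G h\<cdot>\<^bsub>C\<^esub>NAt et a"
     using en[OF f(1)] unfolding f(2,3) by simp
    then have "(FAr G (FAr F f)\<cdot>\<^bsub>C\<^esub>NAt et a)\<cdot>\<^bsub>C\<^esub>cat_inv C (NAt et a) = (FAr G h\<cdot>\<^bsub>C\<^esub>NAt et a)\<cdot>\<^bsub>C\<^esub>cat_inv C (NAt et a)"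
     by simp
    then have "FAr G (FAr F f) = FAr G h"
     using f gh assms(2,3) G F c(1) ed[OF assms(4)] cat_inv[OF eta_iso[OF assms(4)]] by simp
    then have "FAr F f = h" using h f assms F by (intro injG) auto
    then show "h\<in>FAr F ` Hom C a b" using f by (auto intro!: image_eqI[of _ _ f])
   qed
  qed
 qed
qed

lemma cat_equivalence_surj:
 assumes "cat_equivalence F" "FDom F = C" "FCod F = D" "d\<in>Ob D"
 shows "\<exists>c\<in>Ob C. isomorphic_in D (FOb F c) d"
proof -
 obtain G \<epsilon> where G: "is_functor G" "FDom G = D" "FCod G = C"
  and eps: "nat_iso \<epsilon>" "NDom \<epsilon> = F \<circ>\<^sub>F G" "NCod \<epsilon> = fid D"
  using assms(1-3) unfolding cat_equivalence_def by auto
 have "cat_iso D (NAt \<epsilon> d)" "Dom D (NAt \<epsilon> d) = FOb F (FOb G d)" "Cod D (NAt \<epsilon> d) = d"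
  using eps assms G by (auto simp: nat_iso_iff)
 then show ?thesis using G assms by (auto simp: isomorphic_in_def intro!: bexI[of _ "FOb G d"])
qed

section \<open>Calculus of 2-cells\<close>

lemma Hom1_iff [simp]: "f\<in>Hom1 H X Y \<longleftrightarrow> f\<in>Arr H \<and> Src H f = X \<and> Tgt H f = Y"
 by (simp add: Hom1_def)

lemma Hom2_iff [simp]: "al\<in>Hom2 H f g \<longleftrightarrow> al\<in>Cel H \<and> Dm H al = f \<and> Cd H al = g"
 by (simp add: Hom2_def)

lemma HomC_simps [simp]:
 "Ob (HomC H X Y) = Hom1 H X Y" "Ar (HomC H X Y) = {al\<in>Cel H. Dm H al\<in>Hom1 H X Y}"
 "Dom (HomC H X Y) = Dm H" "Cod (HomC H X Y) = Cd H" "Id (HomC H X Y) = Idc H" "Comp (HomC H X Y) = VC H"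
 by (simp_all add: HomC_def)

context
 fixes H :: "('o, 'a, 'c) twocat" (structure)
 assumes H: "two_category H"
begin

lemma tc_ob: "f\<in>Arr H ==> Src H f\<in>Obj H" "f\<in>Arr H ==> Tgt H f\<in>Obj H"
 using two_category.src_in[OF H] two_category.tgt_in[OF H] by blast+

lemma tc_cel:
 assumes "al\<in>Cel H"
 shows "Dm H al\<in>Arr H" "Cd H al\<in>Arr H" "Src H (Cd H al) = Src H (Dm H al)" "Tgt H (Cd H al) = Tgt H (Dm H al)"
 using two_category.cell_dom[OF H assms]
  two_category.cell_parallel[OF H assms, of "Src H (Dm H al)" "Tgt H (Dm H al)"] by auto

lemma tc_one: "X\<in>Obj H ==> One H X\<in>Arr H" "X\<in>Obj H ==> Src H (One H X) = X"
 "X\<in>Obj H ==> Tgt H (One H X) = X"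
 using two_category.one_in[OF H] by auto

text \<open>The axioms of \<open>two_category\<close> carry the end points as free variables. In
  terms of \<open>Src\<close> and \<open>Tgt\<close> the side conditions become equations that the
  simplifier can discharge.\<close>

lemma tc_cmp:
 assumes "f\<in>Arr H" "g\<in>Arr H" "Tgt H f = Src H g"
 shows "g\<odot>f\<in>Arr H" "Src H (g\<odot>f) = Src H f" "Tgt H (g\<odot>f) = Tgt H g"
 using two_category.cmp_in[OF H, of f "Src H f" "Tgt H f" g "Tgt H g"] assms by auto

lemma tc_cmp_one:
 assumes "f\<in>Arr H"
 shows "Src H f = X ==> f\<odot>One H X = f" "Tgt H f = Y ==> One H Y\<odot>f = f"
 using two_category.cmp_one[OF H, of f "Src H f" "Tgt H f"] two_category.one_cmp[OF H, of f "Src H f" "Tgt H f"]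
  assms by auto

lemma tc_cmp_assoc:
 "f\<in>Arr H ==> g\<in>Arr H ==> h\<in>Arr H ==> Tgt H f = Src H g ==> Tgt H g = Src H h ==>
  (h\<odot>g)\<odot>f = h\<odot>(g\<odot>f)"
 using two_category.cmp_assoc[OF H, of f "Src H f" "Tgt H f" g "Tgt H g" h "Tgt H h"] by simp

lemma tc_hom: "X\<in>Obj H ==> Y\<in>Obj H ==> category (HomC H X Y)"
 using two_category.hom_category[OF H] .

text \<open>Vertical composition is governed by the hom-category containing the cells, so the
  vertical laws below are instances of the laws of a category.\<close>

lemma tc_hom': "f\<in>Arr H ==> category (HomC H (Src H f) (Tgt H f))"
 by (simp add: tc_hom tc_ob)

lemma tc_idc:
 assumes "f\<in>Arr H"
 shows "Idc H f\<in>Cel H" "Dm H (Idc H f) = f" "Cd H (Idc H f) = f"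
 using cat_id[OF tc_hom'[OF assms], of f] assms by auto

lemma tc_vc:
 assumes "al\<in>Cel H" "be\<in>Cel H" "Cd H al = Dm H be"
 shows "be\<bullet>al\<in>Cel H" "Dm H (be\<bullet>al) = Dm H al" "Cd H (be\<bullet>al) = Cd H be"
 using cat_comp[OF tc_hom'[of "Dm H al"], of al be] tc_cel[OF assms(1)] tc_cel[OF assms(2)] assms by auto

lemma tc_vc_idc:
 assumes "al\<in>Cel H"
 shows "Dm H al = f ==> al\<bullet>Idc H f = al" "Cd H al = g ==> Idc H g\<bullet>al = al"
 using cat_unit[OF tc_hom'[of "Dm H al"], of al] tc_cel[OF assms(1)] assms by auto

lemma tc_vc_assoc:
 assumes "al\<in>Cel H" "be\<in>Cel H" "gm\<in>Cel H" "Cd H al = Dm H be" "Cd H be = Dm H gm"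
 shows "(gm\<bullet>be)\<bullet>al = gm\<bullet>(be\<bullet>al)"
 using cat_assoc[OF tc_hom'[of "Dm H al"], of al be gm] tc_cel[OF assms(1)] tc_cel[OF assms(2)] tc_cel[OF assms(3)] assms
 by auto

lemma tc_hc:
 assumes "al\<in>Cel H" "be\<in>Cel H" "Tgt H (Dm H al) = Src H (Dm H be)"
 shows "be\<star>al\<in>Cel H" "Dm H (be\<star>al) = Dm H be\<odot>Dm H al" "Cd H (be\<star>al) = Cd H be\<odot>Cd H al"
 using two_category.hc_in[OF H, of al "Dm H al" "Cd H al" be "Dm H be" "Cd H be"] assms by auto

lemma tc_hc_one:
 assumes "al\<in>Cel H"
 shows "Src H (Dm H al) = X ==> al\<star>Idc H (One H X) = al" "Tgt H (Dm H al) = Y ==> Idc H (One H Y)\<star>al = al"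
 using two_category.hc_one[OF H, of al "Dm H al" "Cd H al"] two_category.one_hc[OF H, of al "Dm H al" "Cd H al"] assms
 by auto

lemma tc_hc_assoc:
 assumes "al\<in>Cel H" "be\<in>Cel H" "gm\<in>Cel H"
  and "Tgt H (Dm H al) = Src H (Dm H be)" "Tgt H (Dm H be) = Src H (Dm H gm)"
 shows "(gm\<star>be)\<star>al = gm\<star>(be\<star>al)"
 using two_category.hc_assoc[OF H, of al "Dm H al" "Cd H al" be "Dm H be" "Cd H be" gm "Dm H gm" "Cd H gm"] assms by auto

lemma tc_hc_idc: "f\<in>Arr H ==> g\<in>Arr H ==> Tgt H f = Src H g ==> Idc H g\<star>Idc H f = Idc H (g\<odot>f)"
 using two_category.hc_idc[OF H, of f "Src H f" "Tgt H f" g "Tgt H g"] by auto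

text \<open>Horizontal composites are nested to the right, so adjacent identities on the left have
  to be merged in front of a remaining cell.\<close>

lemma tc_hc_idc': "al\<in>Cel H ==> f\<in>Arr H ==> g\<in>Arr H ==> Tgt H f = Src H g ==> Tgt H (Dm H al) = Src H f ==>
 Idc H g\<star>(Idc H f\<star>al) = Idc H (g\<odot>f)\<star>al"
 by (simp add: tc_idc flip: tc_hc_assoc tc_hc_idc)

lemma tc_interchange:
 assumes "al\<in>Cel H" "al'\<in>Cel H" "be\<in>Cel H" "be'\<in>Cel H"
  and "Cd H al = Dm H al'" "Cd H be = Dm H be'" "Tgt H (Dm H al) = Src H (Dm H be)"
 shows "(be'\<bullet>be)\<star>(al'\<bullet>al) = (be'\<star>al')\<bullet>(be\<star>al)"
 using two_category.interchange[OF H, of al "Dm H al" "Cd H al" al' "Cd H al'" be "Dm H be" "Cd H be" be' "Cd H be'"] assms by auto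

text \<open>Interchange against an identity cell.\<close>

lemma tc_whisker:
 assumes "al\<in>Cel H" "be\<in>Cel H" "f\<in>Arr H" "Cd H al = Dm H be"
 shows "Tgt H (Dm H al) = Src H f ==> Idc H f\<star>(be\<bullet>al) = (Idc H f\<star>be)\<bullet>(Idc H f\<star>al)"
  "Tgt H f = Src H (Dm H al) ==> (be\<bullet>al)\<star>Idc H f = (be\<star>Idc H f)\<bullet>(al\<star>Idc H f)"
 using tc_interchange[of al be "Idc H f" "Idc H f"] tc_interchange[of "Idc H f" "Idc H f" al be] assms
 by (simp_all add: tc_idc tc_vc_idc)

text \<open>Both bracketings come from interchange with identities. Equating the two left-hand sides
  lets cells that act on disjoint 1-cells slide past one another; this is how interchange enters the
  pasting arguments below.\<close>

lemma tc_hc_whisker: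
 assumes "al\<in>Cel H" "be\<in>Cel H" "Tgt H (Dm H al) = Src H (Dm H be)"
 shows "(be\<star>Idc H (Cd H al))\<bullet>(Idc H (Dm H be)\<star>al) = be\<star>al"
  "(Idc H (Cd H be)\<star>al)\<bullet>(be\<star>Idc H (Dm H al)) = be\<star>al"
 using tc_interchange[of al "Idc H (Cd H al)" "Idc H (Dm H be)" be] tc_interchange[of "Idc H (Dm H al)" al be "Idc H (Cd H be)"] assms
 by (simp_all add: tc_idc tc_vc_idc tc_cel)

lemma inv_cellI:
 assumes "al\<in>Cel H" "be\<in>Cel H" "Dm H be = Cd H al" "Cd H be = Dm H al"
  and "be\<bullet>al = Idc H (Dm H al)" "al\<bullet>be = Idc H (Cd H al)"
 shows "inv_cell H al"
 unfolding inv_cell_def using assms by (intro conjI bexI[of _ be]) simp_all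

end

definition cinv :: "('o, 'a, 'c) twocat => 'c => 'c" where
 "cinv H al = (SOME be. be\<in>Hom2 H (Cd H al) (Dm H al) \<and>
   be\<bullet>\<^bsub>H\<^esub>al = Idc H (Dm H al) \<and> al\<bullet>\<^bsub>H\<^esub>be = Idc H (Cd H al))"

lemma cinv:
 assumes "inv_cell H al"
 shows "al\<in>Cel H" "cinv H al\<in>Cel H" "Dm H (cinv H al) = Cd H al" "Cd H (cinv H al) = Dm H al"
  "cinv H al\<bullet>\<^bsub>H\<^esub>al = Idc H (Dm H al)" "al\<bullet>\<^bsub>H\<^esub>cinv H al = Idc H (Cd H al)"
proof -
 have "\<exists>be. be\<in>Hom2 H (Cd H al) (Dm H al) \<and>
   be\<bullet>\<^bsub>H\<^esub>al = Idc H (Dm H al) \<and> al\<bullet>\<^bsub>H\<^esub>be = Idc H (Cd H al)"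
  using assms unfolding inv_cell_def Bex_def by (elim conjE)
 from someI_ex[OF this] show "cinv H al\<in>Cel H" "Dm H (cinv H al) = Cd H al" "Cd H (cinv H al) = Dm H al"
  "cinv H al\<bullet>\<^bsub>H\<^esub>al = Idc H (Dm H al)" "al\<bullet>\<^bsub>H\<^esub>cinv H al = Idc H (Cd H al)"
  unfolding cinv_def[symmetric] by simp_all
 show "al\<in>Cel H" using assms unfolding inv_cell_def by (elim conjE)
qed

text \<open>These rules bring a pasting into normal form: a right-nested vertical composite of
  whiskered cells in which adjacent identities are merged. Most coherence proofs then only choose
  intermediate bracketings; where a whiskered composite has to stay together, the distributing rules
  are switched off.\<close>

lemmas tc_simps [simp] = tc_ob tc_cel tc_one tc_cmp tc_cmp_one tc_cmp_assoc tc_hom tc_idc tc_vc tc_vc_idc tc_vc_assoc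
 tc_hc tc_hc_one tc_hc_assoc tc_hc_idc tc_hc_idc' tc_whisker cinv

context
 fixes H :: "('o, 'a, 'c) twocat" (structure)
 assumes H [simp]: "two_category H"
begin

lemma cinv_vc:
 assumes "inv_cell H al" "be\<in>Cel H"
 shows "Cd H be = Dm H al ==> cinv H al\<bullet>(al\<bullet>be) = be" "Cd H be = Cd H al ==> al\<bullet>(cinv H al\<bullet>be) = be"
 using assms by (simp_all flip: tc_vc_assoc)

lemma inv_cell_cinv: "inv_cell H al ==> inv_cell H (cinv H al)"
 by (rule inv_cellI[OF H, of _ al]) simp_all

lemma inv_cell_idc: "f\<in>Arr H ==> inv_cell H (Idc H f)"
 by (rule inv_cellI[OF H, of _ "Idc H f"]) simp_all

lemma inv_cell_vc:
 assumes "inv_cell H al" "inv_cell H be" "Cd H al = Dm H be"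
 shows "inv_cell H (be\<bullet>al)"
 by (rule inv_cellI[OF H, of _ "cinv H al\<bullet>cinv H be"]) (use assms in "simp_all add: cinv_vc")

lemma inv_cell_hc:
 assumes "inv_cell H al" "inv_cell H be" "Tgt H (Dm H al) = Src H (Dm H be)"
 shows "inv_cell H (be\<star>al)"
 by (rule inv_cellI[OF H, of _ "cinv H be\<star>cinv H al"])
  (use tc_interchange[OF H, of al "cinv H al" be "cinv H be"]
    tc_interchange[OF H, of "cinv H al" al "cinv H be" be] assms in simp_all)

text \<open>Constraints of a pseudofunctor are invertible, so an equation may be proved with such a
  cell pasted on. This rule and its mirror image remove the cell at the end.\<close>

lemma vc_cancel_left:
 assumes "inv_cell H al" "be\<in>Cel H" "gm\<in>Cel H" "Cd H be = Dm H al" "Cd H gm = Dm H al" "al\<bullet>be = al\<bullet>gm"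
 shows "be = gm"
 using cinv_vc(1)[OF assms(1,2,4)] cinv_vc(1)[OF assms(1,3,5)] unfolding assms(6) by metis

lemma vc_cancel_right:
 assumes "inv_cell H al" "be\<in>Cel H" "gm\<in>Cel H" "Dm H be = Cd H al" "Dm H gm = Cd H al" "be\<bullet>al = gm\<bullet>al"
 shows "be = gm"
proof -
 have "be = (be\<bullet>al)\<bullet>cinv H al" using assms(1-5) by simp
 also have "... = (gm\<bullet>al)\<bullet>cinv H al" unfolding assms(6) ..
 also have "... = gm" using assms(1-5) by simp
 finally show ?thesis .
qed

text \<open>CAT-valued constructions deliver isomorphisms of hom-categories, whereas cones are
  stated with invertible cells of \<open>H\<close>; this is the bridge.\<close>

lemma inv_cell_iff_iso:
 assumes "f\<in>Hom1 H X Y" "al\<in>Cel H" "Dm H al = f"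
 shows "cat_iso (HomC H X Y) al \<longleftrightarrow> inv_cell H al"
proof
 assume a: "cat_iso (HomC H X Y) al"
 show "inv_cell H al"
  using cat_inv[OF a] assms by (intro inv_cellI[OF H, of _ "cat_inv (HomC H X Y) al"]) auto
next
 assume a: "inv_cell H al"
 show "cat_iso (HomC H X Y) al"
  by (rule cat_isoI[of _ _ "cinv H al"]) (use a assms in auto)
qed

end

lemmas inv_simps [simp] = cinv_vc inv_cell_cinv inv_cell_idc inv_cell_vc inv_cell_hc

text \<open>The vertical laws are stated for all cells at once; every hom-category inherits
  them.\<close>

lemma two_categoryI:
 assumes "!!f. f\<in>Arr H ==> Src H f\<in>Obj H \<and> Tgt H f\<in>Obj H"
  and "!!al. al\<in>Cel H ==> Dm H al\<in>Arr H \<and> Cd H al\<in>Arr H \<and> Src H (Cd H al) = Src H (Dm H al) \<and> Tgt H (Cd H al) = Tgt H (Dm H al)"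
  and "!!f. f\<in>Arr H ==> Idc H f\<in>Cel H \<and> Dm H (Idc H f) = f \<and> Cd H (Idc H f) = f"
  and "!!al be. al\<in>Cel H ==> be\<in>Cel H ==> Cd H al = Dm H be ==>
   be\<bullet>\<^bsub>H\<^esub>al\<in>Cel H \<and> Dm H (be\<bullet>\<^bsub>H\<^esub>al) = Dm H al \<and> Cd H (be\<bullet>\<^bsub>H\<^esub>al) = Cd H be"
  and "!!al. al\<in>Cel H ==> al\<bullet>\<^bsub>H\<^esub>Idc H (Dm H al) = al \<and> Idc H (Cd H al)\<bullet>\<^bsub>H\<^esub>al = al"
  and "!!al be gm. al\<in>Cel H ==> be\<in>Cel H ==> gm\<in>Cel H ==> Cd H al = Dm H be ==> Cd H be = Dm H gm ==>
   (gm\<bullet>\<^bsub>H\<^esub>be)\<bullet>\<^bsub>H\<^esub>al = gm\<bullet>\<^bsub>H\<^esub>(be\<bullet>\<^bsub>H\<^esub>al)"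
  and "!!X. X\<in>Obj H ==> One H X\<in>Arr H \<and> Src H (One H X) = X \<and> Tgt H (One H X) = X"
  and "!!f g. f\<in>Arr H ==> g\<in>Arr H ==> Tgt H f = Src H g ==>
   g\<odot>\<^bsub>H\<^esub>f\<in>Arr H \<and> Src H (g\<odot>\<^bsub>H\<^esub>f) = Src H f \<and> Tgt H (g\<odot>\<^bsub>H\<^esub>f) = Tgt H g"
  and "!!f. f\<in>Arr H ==> f\<odot>\<^bsub>H\<^esub>One H (Src H f) = f \<and> One H (Tgt H f)\<odot>\<^bsub>H\<^esub>f = f"
  and "!!f g h. f\<in>Arr H ==> g\<in>Arr H ==> h\<in>Arr H ==> Tgt H f = Src H g ==> Tgt H g = Src H h ==>
   (h\<odot>\<^bsub>H\<^esub>g)\<odot>\<^bsub>H\<^esub>f = h\<odot>\<^bsub>H\<^esub>(g\<odot>\<^bsub>H\<^esub>f)"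
  and "!!al be. al\<in>Cel H ==> be\<in>Cel H ==> Tgt H (Dm H al) = Src H (Dm H be) ==>
   be\<star>\<^bsub>H\<^esub>al\<in>Cel H \<and> Dm H (be\<star>\<^bsub>H\<^esub>al) = Dm H be\<odot>\<^bsub>H\<^esub>Dm H al \<and> Cd H (be\<star>\<^bsub>H\<^esub>al) = Cd H be\<odot>\<^bsub>H\<^esub>Cd H al"
  and "!!al. al\<in>Cel H ==> al\<star>\<^bsub>H\<^esub>Idc H (One H (Src H (Dm H al))) = al \<and> Idc H (One H (Tgt H (Dm H al)))\<star>\<^bsub>H\<^esub>al = al"
  and "!!al be gm. al\<in>Cel H ==> be\<in>Cel H ==> gm\<in>Cel H ==> Tgt H (Dm H al) = Src H (Dm H be) ==>
   Tgt H (Dm H be) = Src H (Dm H gm) ==> (gm\<star>\<^bsub>H\<^esub>be)\<star>\<^bsub>H\<^esub>al = gm\<star>\<^bsub>H\<^esub>(be\<star>\<^bsub>H\<^esub>al)"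
  and "!!f g. f\<in>Arr H ==> g\<in>Arr H ==> Tgt H f = Src H g ==> Idc H g\<star>\<^bsub>H\<^esub>Idc H f = Idc H (g\<odot>\<^bsub>H\<^esub>f)"
  and "!!al al' be be'. al\<in>Cel H ==> al'\<in>Cel H ==> be\<in>Cel H ==> be'\<in>Cel H ==> Cd H al = Dm H al' ==>
   Cd H be = Dm H be' ==> Tgt H (Dm H al) = Src H (Dm H be) ==>
   (be'\<bullet>\<^bsub>H\<^esub>be)\<star>\<^bsub>H\<^esub>(al'\<bullet>\<^bsub>H\<^esub>al) = (be'\<star>\<^bsub>H\<^esub>al')\<bullet>\<^bsub>H\<^esub>(be\<star>\<^bsub>H\<^esub>al)"
 shows "two_category H"
proof (rule two_category.intro)
 show "category (HomC H X Y)" for X Y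
  by (rule categoryI) (use assms(2-6) in auto)
qed (use assms in auto)

section \<open>Opposites, locally discrete 2-categories and CAT\<close>

lemma OpT_simps [simp]:
 "Obj (OpT H) = Obj H" "Arr (OpT H) = Arr H" "Cel (OpT H) = Cel H" "Src (OpT H) = Tgt H" "Tgt (OpT H) = Src H"
 "Dm (OpT H) = Dm H" "Cd (OpT H) = Cd H" "One (OpT H) = One H" "Idc (OpT H) = Idc H" "VC (OpT H) = VC H"
 "g\<odot>\<^bsub>OpT H\<^esub>f = f\<odot>\<^bsub>H\<^esub>g" "be\<star>\<^bsub>OpT H\<^esub>al = al\<star>\<^bsub>H\<^esub>be"
 by (simp_all add: OpT_def)

text \<open>Only the 1-cells are reversed, so the hom-category keeps its direction and merely swaps
  its indices. This is why \<open>yo (OpT H) L\<close> is the contravariant representable.\<close>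

lemma OpT_HomC [simp]: "HomC (OpT H) X Y = HomC H Y X"
 by (auto simp: HomC_def Hom1_def)

lemma two_category_OpT [simp]:
 assumes "two_category H"
 shows "two_category (OpT H)"
 by (rule two_categoryI) (use assms in "auto simp: tc_interchange[OF assms]")

lemma LD_simps [simp]:
 "Obj (LD C) = Ob C" "Arr (LD C) = Ar C" "Cel (LD C) = Ar C" "Src (LD C) = Dom C" "Tgt (LD C) = Cod C"
 "Dm (LD C) f = f" "Cd (LD C) f = f" "One (LD C) = Id C" "Cmp (LD C) = Comp C" "Idc (LD C) f = f"
 "VC (LD C) g f = f" "HC (LD C) = Comp C"
 by (simp_all add: LD_def)

lemma two_category_LD [simp]: "category C ==> two_category (LD C)"
 by (rule two_categoryI) auto

lemma CAT_simps [simp]: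
 "Obj CAT = {C. category C}" "Arr CAT = {F. is_functor F}" "Cel CAT = {sig. nat_trans sig}"
 "Src CAT = FDom" "Tgt CAT = FCod" "Dm CAT = NDom" "Cd CAT = NCod" "One CAT = fid" "Cmp CAT = fcomp" "Idc CAT = nid"
 "VC CAT = nvcomp" "HC CAT = nhcomp"
 by (simp_all add: CAT_def)

lemma nvcomp_nid [simp]:
 assumes "nat_trans sig"
 shows "NDom sig = F ==> sig \<bullet>\<^sub>N nid F = sig" "NCod sig = F ==> nid F \<bullet>\<^sub>N sig = sig"
 by (rule nat_trans_eqI; use assms nat_trans_parallel[OF assms] in auto)+

lemma nhcomp_nid [simp]:
 assumes "is_functor F" "is_functor G" "FCod F = FDom G"
 shows "nid G \<star>\<^sub>N nid F = nid (G \<circ>\<^sub>F F)"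
 by (rule nat_trans_eqI; use assms in auto)

lemma nhcomp_assoc [simp]:
 assumes "nat_trans sig" "nat_trans tu" "nat_trans up" "FCod (NDom sig) = FDom (NDom tu)" "FCod (NDom tu) = FDom (NDom up)"
 shows "(up \<star>\<^sub>N tu) \<star>\<^sub>N sig = up \<star>\<^sub>N (tu \<star>\<^sub>N sig)"
 by (rule nat_trans_eqI; use assms nat_trans_parallel[OF assms(1)] nat_trans_parallel[OF assms(2)] nat_trans_parallel[OF assms(3)] in auto)

lemma nvcomp_assoc [simp]:
 assumes "nat_trans sig" "nat_trans tu" "nat_trans up" "NCod sig = NDom tu" "NCod tu = NDom up"
 shows "(up \<bullet>\<^sub>N tu) \<bullet>\<^sub>N sig = up \<bullet>\<^sub>N (tu \<bullet>\<^sub>N sig)"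
 by (rule nat_trans_eqI; use assms nat_trans_parallel[OF assms(1)] nat_trans_parallel[OF assms(2)] nat_trans_parallel[OF assms(3)] in auto)

text \<open>Componentwise the two sides differ by one naturality square of \<open>tu\<close>, taken
  at the component of \<open>sig'\<close>.\<close>

lemma nhcomp_nvcomp:
 assumes "nat_trans sig" "nat_trans sig'" "nat_trans tu" "nat_trans tu'" "NCod sig = NDom sig'" "NCod tu = NDom tu'"
  and "FCod (NDom sig) = FDom (NDom tu)"
 shows "(tu' \<bullet>\<^sub>N tu) \<star>\<^sub>N (sig' \<bullet>\<^sub>N sig) = (tu' \<star>\<^sub>N sig') \<bullet>\<^sub>N (tu \<star>\<^sub>N sig)"
proof (rule nat_trans_eqI)
 let ?x = "(tu' \<bullet>\<^sub>N tu) \<star>\<^sub>N (sig' \<bullet>\<^sub>N sig)"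
 note p = nat_trans_parallel[OF assms(1)] nat_trans_parallel[OF assms(2)] nat_trans_parallel[OF assms(3)] nat_trans_parallel[OF assms(4)]
 fix a assume "a\<in>Ob (FDom (NDom ?x))"
 then have a: "a\<in>Ob (FDom (NDom sig))" by simp
 let ?D = "FCod (NDom tu)"
 have c: "category ?D" "category (FCod (NDom sig))" using assms by simp_all
 have "NAt tu (FOb (NCod sig') a)\<cdot>\<^bsub>?D\<^esub>FAr (NDom tu) (NAt sig' a) = FAr (NCod tu) (NAt sig' a)\<cdot>\<^bsub>?D\<^esub>NAt tu (FOb (NDom sig') a)"
  using nat_trans_natural[OF assms(3), of "NAt sig' a"] a assms p by simp
 then have "(NAt tu (FOb (NCod sig') a)\<cdot>\<^bsub>?D\<^esub>FAr (NDom tu) (NAt sig' a))\<cdot>\<^bsub>?D\<^esub>FAr (NDom tu) (NAt sig a) =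
   (FAr (NCod tu) (NAt sig' a)\<cdot>\<^bsub>?D\<^esub>NAt tu (FOb (NDom sig') a))\<cdot>\<^bsub>?D\<^esub>FAr (NDom tu) (NAt sig a)" by simp
 then show "NAt ?x a = NAt ((tu' \<star>\<^sub>N sig') \<bullet>\<^sub>N (tu \<star>\<^sub>N sig)) a"
  using a assms p c by simp
qed (use assms nat_trans_parallel[OF assms(1)] nat_trans_parallel[OF assms(2)] nat_trans_parallel[OF assms(3)] nat_trans_parallel[OF assms(4)] in auto)

lemma nhcomp_fid [simp]:
 assumes "nat_trans sig"
 shows "FDom (NDom sig) = C ==> sig \<star>\<^sub>N nid (fid C) = sig" "FCod (NDom sig) = D ==> nid (fid D) \<star>\<^sub>N sig = sig"
 by (rule nat_trans_eqI; use assms nat_trans_parallel[OF assms] in auto)+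

lemma two_category_CAT [simp]: "two_category (CAT :: (('x, 'y) cat, ('x, 'y, 'x, 'y) fctr, ('x, 'y, 'x, 'y) ntrans) twocat)"
 by (rule two_categoryI) (auto simp: nat_trans_parallel nhcomp_nvcomp)

lemma inv_cell_CAT [simp]: "inv_cell CAT sig = nat_iso sig"
 unfolding inv_cell_def nat_iso_def by auto

text \<open>In right-nested form the left side of an equation \<open>a\<bullet>b = r\<close> occurs
  with a tail \<open>x\<close> attached; this variant rewrites it there.\<close>

lemma vc_reassoc:
 assumes "a\<bullet>\<^bsub>H\<^esub>b = r" "two_category H" "a\<in>Cel H" "b\<in>Cel H" "x\<in>Cel H" "Cd H b = Dm H a" "Cd H x = Dm H b"
 shows "a\<bullet>\<^bsub>H\<^esub>(b\<bullet>\<^bsub>H\<^esub>x) = r\<bullet>\<^bsub>H\<^esub>x"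
 unfolding assms(1)[symmetric] using assms(2-) by simp

section \<open>Pseudofunctors\<close>

context pseudofunctor
begin

lemma arr: "f\<in>Arr A ==> PA F f\<in>Arr B" "f\<in>Arr A ==> Src B (PA F f) = PO F (Src A f)"
 "f\<in>Arr A ==> Tgt B (PA F f) = PO F (Tgt A f)"
 using pa_in[of f "Src A f" "Tgt A f"] by simp_all

lemma cel: "th\<in>Cel A ==> PC F th\<in>Cel B" "th\<in>Cel A ==> Dm B (PC F th) = PA F (Dm A th)"
 "th\<in>Cel A ==> Cd B (PC F th) = PA F (Cd A th)"
 using pc_in[of th "Dm A th" "Cd A th"] by simp_all

lemma vc: "th\<in>Cel A ==> xi\<in>Cel A ==> Cd A th = Dm A xi ==> PC F (xi\<bullet>\<^bsub>A\<^esub>th) = PC F xi\<bullet>\<^bsub>B\<^esub>PC F th"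
 using pc_vc[of th "Dm A th" "Cd A th"] by simp

lemma pu: "X\<in>Obj A ==> PU F X\<in>Cel B" "X\<in>Obj A ==> Dm B (PU F X) = One B (PO F X)"
 "X\<in>Obj A ==> Cd B (PU F X) = PA F (One A X)"
 using pu_in[of X] by simp_all

lemma pm:
 assumes "f\<in>Arr A" "g\<in>Arr A" "Tgt A f = Src A g"
 shows "PM F g f\<in>Cel B" "Dm B (PM F g f) = PA F g\<odot>\<^bsub>B\<^esub>PA F f" "Cd B (PM F g f) = PA F (g\<odot>\<^bsub>A\<^esub>f)"
  "inv_cell B (PM F g f)"
 using pm_in[of f "Src A f" "Tgt A f" g "Tgt A g"] pm_inv[of f "Src A f" "Tgt A f" g "Tgt A g"] assms by simp_all

lemma nat:
 assumes "th\<in>Cel A" "xi\<in>Cel A" "Tgt A (Dm A th) = Src A (Dm A xi)"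
 shows "PC F (xi\<star>\<^bsub>A\<^esub>th)\<bullet>\<^bsub>B\<^esub>PM F (Dm A xi) (Dm A th) = PM F (Cd A xi) (Cd A th)\<bullet>\<^bsub>B\<^esub>(PC F xi\<star>\<^bsub>B\<^esub>PC F th)"
 using pm_natural[of th "Dm A th" "Cd A th" xi "Dm A xi" "Cd A xi"] assms by simp

lemma assoc:
 assumes "f\<in>Arr A" "g\<in>Arr A" "h\<in>Arr A" "Tgt A f = Src A g" "Tgt A g = Src A h"
 shows "PM F h (g\<odot>\<^bsub>A\<^esub>f)\<bullet>\<^bsub>B\<^esub>(Idc B (PA F h)\<star>\<^bsub>B\<^esub>PM F g f) =
   PM F (h\<odot>\<^bsub>A\<^esub>g) f\<bullet>\<^bsub>B\<^esub>(PM F h g\<star>\<^bsub>B\<^esub>Idc B (PA F f))"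
 using pm_assoc[of f "Src A f" "Tgt A f" g "Tgt A g" h "Tgt A h"] assms by simp

lemma unit_right: "f\<in>Arr A ==> PM F f (One A (Src A f))\<bullet>\<^bsub>B\<^esub>(Idc B (PA F f)\<star>\<^bsub>B\<^esub>PU F (Src A f)) = Idc B (PA F f)"
 using pm_unit_right[of f "Src A f" "Tgt A f"] by simp

lemma unit_left: "f\<in>Arr A ==> PM F (One A (Tgt A f)) f\<bullet>\<^bsub>B\<^esub>(PU F (Tgt A f)\<star>\<^bsub>B\<^esub>Idc B (PA F f)) = Idc B (PA F f)"
 using pm_unit_left[of f "Src A f" "Tgt A f"] by simp

lemmas simps [simp] = po_in arr cel vc pu pu_inv pm pc_idc

end

lemma pseudofunctorI:
 assumes "PO F\<in>extensional (Obj A)" "PA F\<in>extensional (Arr A)" "PC F\<in>extensional (Cel A)"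
  "PU F\<in>extensional (Obj A)" "PM F = restrict2 A (PM F)"
  and "!!X. X\<in>Obj A ==> PO F X\<in>Obj B"
  and "!!f. f\<in>Arr A ==> PA F f\<in>Hom1 B (PO F (Src A f)) (PO F (Tgt A f))"
  and "!!th. th\<in>Cel A ==> PC F th\<in>Hom2 B (PA F (Dm A th)) (PA F (Cd A th))"
  and "!!f. f\<in>Arr A ==> PC F (Idc A f) = Idc B (PA F f)"
  and "!!th xi. th\<in>Cel A ==> xi\<in>Cel A ==> Cd A th = Dm A xi ==> PC F (xi\<bullet>\<^bsub>A\<^esub>th) = PC F xi\<bullet>\<^bsub>B\<^esub>PC F th"
  and "!!X. X\<in>Obj A ==> PU F X\<in>Hom2 B (One B (PO F X)) (PA F (One A X)) \<and> inv_cell B (PU F X)"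
  and "!!f g. f\<in>Arr A ==> g\<in>Arr A ==> Tgt A f = Src A g ==>
   PM F g f\<in>Hom2 B (PA F g\<odot>\<^bsub>B\<^esub>PA F f) (PA F (g\<odot>\<^bsub>A\<^esub>f)) \<and> inv_cell B (PM F g f)"
  and "!!th xi. th\<in>Cel A ==> xi\<in>Cel A ==> Tgt A (Dm A th) = Src A (Dm A xi) ==>
   PC F (xi\<star>\<^bsub>A\<^esub>th)\<bullet>\<^bsub>B\<^esub>PM F (Dm A xi) (Dm A th) = PM F (Cd A xi) (Cd A th)\<bullet>\<^bsub>B\<^esub>(PC F xi\<star>\<^bsub>B\<^esub>PC F th)"
  and "!!f g h. f\<in>Arr A ==> g\<in>Arr A ==> h\<in>Arr A ==> Tgt A f = Src A g ==> Tgt A g = Src A h ==>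
   PM F h (g\<odot>\<^bsub>A\<^esub>f)\<bullet>\<^bsub>B\<^esub>(Idc B (PA F h)\<star>\<^bsub>B\<^esub>PM F g f) =
   PM F (h\<odot>\<^bsub>A\<^esub>g) f\<bullet>\<^bsub>B\<^esub>(PM F h g\<star>\<^bsub>B\<^esub>Idc B (PA F f))"
  and "!!f. f\<in>Arr A ==> PM F f (One A (Src A f))\<bullet>\<^bsub>B\<^esub>(Idc B (PA F f)\<star>\<^bsub>B\<^esub>PU F (Src A f)) = Idc B (PA F f)"
  and "!!f. f\<in>Arr A ==> PM F (One A (Tgt A f)) f\<bullet>\<^bsub>B\<^esub>(PU F (Tgt A f)\<star>\<^bsub>B\<^esub>Idc B (PA F f)) = Idc B (PA F f)"
 shows "pseudofunctor A B F"
proof -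
 have n: "PC F (xi\<star>\<^bsub>A\<^esub>th)\<bullet>\<^bsub>B\<^esub>PM F g f = PM F g' f'\<bullet>\<^bsub>B\<^esub>(PC F xi\<star>\<^bsub>B\<^esub>PC F th)"
  if "th\<in>Hom2 A f f'" "xi\<in>Hom2 A g g'" "Tgt A f = Src A g" for f f' g g' th xi
  using assms(13)[of th xi] that by auto
 show ?thesis
  by (rule pseudofunctor.intro) (use assms(1-12,14-) n in auto)
qed

lemma restrict2_simps [simp]:
 "g\<in>Arr A ==> f\<in>Arr A ==> Tgt A f = Src A g ==> restrict2 A m g f = m g f"
 "restrict2 A (restrict2 A m) = restrict2 A m"
 by (auto simp: restrict2_def fun_eq_iff)

lemma restrict2_eqI:
 assumes "m = restrict2 A m" "n = restrict2 A n"
  and "!!g f. g\<in>Arr A ==> f\<in>Arr A ==> Tgt A f = Src A g ==> m g f = n g f"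
 shows "m = n"
proof (intro ext)
 fix g f
 have "m g f = restrict2 A m g f" using assms(1) by simp
 also have "... = restrict2 A n g f" using assms(3) by (auto simp: restrict2_def)
 finally show "m g f = n g f" using assms(2) by simp
qed

lemma psf_eqI:
 fixes F G :: "('o, 'a, 'c, 'p, 'b, 'd) psf"
 assumes "pseudofunctor A B F" "pseudofunctor A B G"
  and "!!X. X\<in>Obj A ==> PO F X = PO G X" "!!f. f\<in>Arr A ==> PA F f = PA G f"
  and "!!th. th\<in>Cel A ==> PC F th = PC G th" "!!X. X\<in>Obj A ==> PU F X = PU G X"
  and "!!g f. g\<in>Arr A ==> f\<in>Arr A ==> Tgt A f = Src A g ==> PM F g f = PM G g f"
 shows "F = G"
proof -
 interpret F: pseudofunctor A B F by fact
 interpret G: pseudofunctor A B G by fact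
 have "PO F = PO G" "PA F = PA G" "PC F = PC G" "PU F = PU G"
  using assms(3-6) F.po_ext F.pa_ext F.pc_ext F.pu_ext G.po_ext G.pa_ext G.pc_ext G.pu_ext
  by (auto intro!: extensionalityI)
 moreover have "PM F = PM G" by (rule restrict2_eqI[OF F.pm_ext G.pm_ext]) (use assms in auto)
 ultimately show ?thesis by simp
qed

lemma strict_psf_simps [simp]:
 "X\<in>Obj A ==> PO (strict_psf A B po pa pc) X = po X" "f\<in>Arr A ==> PA (strict_psf A B po pa pc) f = pa f"
 "th\<in>Cel A ==> PC (strict_psf A B po pa pc) th = pc th"
 "X\<in>Obj A ==> PU (strict_psf A B po pa pc) X = Idc B (pa (One A X))"
 "g\<in>Arr A ==> f\<in>Arr A ==> Tgt A f = Src A g ==> PM (strict_psf A B po pa pc) g f = Idc B (pa (g\<odot>\<^bsub>A\<^esub>f))"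
 by (simp_all add: strict_psf_def)

text \<open>With identity constraints each coherence axiom degenerates to strict preservation of the
  corresponding operation.\<close>

lemma pseudofunctor_strict:
 assumes "two_category A" "two_category B"
  and "!!X. X\<in>Obj A ==> po X\<in>Obj B"
  and "!!f. f\<in>Arr A ==> pa f\<in>Hom1 B (po (Src A f)) (po (Tgt A f))"
  and "!!th. th\<in>Cel A ==> pc th\<in>Hom2 B (pa (Dm A th)) (pa (Cd A th))"
  and "!!f. f\<in>Arr A ==> pc (Idc A f) = Idc B (pa f)"
  and "!!th xi. th\<in>Cel A ==> xi\<in>Cel A ==> Cd A th = Dm A xi ==> pc (xi\<bullet>\<^bsub>A\<^esub>th) = pc xi\<bullet>\<^bsub>B\<^esub>pc th"
  and "!!X. X\<in>Obj A ==> pa (One A X) = One B (po X)"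
  and "!!f g. f\<in>Arr A ==> g\<in>Arr A ==> Tgt A f = Src A g ==> pa (g\<odot>\<^bsub>A\<^esub>f) = pa g\<odot>\<^bsub>B\<^esub>pa f"
  and "!!th xi. th\<in>Cel A ==> xi\<in>Cel A ==> Tgt A (Dm A th) = Src A (Dm A xi) ==>
   pc (xi\<star>\<^bsub>A\<^esub>th) = pc xi\<star>\<^bsub>B\<^esub>pc th"
 shows "pseudofunctor A B (strict_psf A B po pa pc)"
proof -
 have a: "pa f\<in>Arr B" "Src B (pa f) = po (Src A f)" "Tgt B (pa f) = po (Tgt A f)" if "f\<in>Arr A" for f
  using assms(4)[OF that] by simp_all
 have c: "pc th\<in>Cel B" "Dm B (pc th) = pa (Dm A th)" "Cd B (pc th) = pa (Cd A th)" if "th\<in>Cel A" for th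
  using assms(5)[OF that] by simp_all
 note [simp] = assms(1-3,6-) a c
 show ?thesis
  by (rule pseudofunctorI) (simp_all, simp_all add: strict_psf_def)
qed

lemma psf_comp_simps [simp]:
 "X\<in>Obj A ==> PO (psf_comp A C G F) X = PO G (PO F X)" "f\<in>Arr A ==> PA (psf_comp A C G F) f = PA G (PA F f)"
 "th\<in>Cel A ==> PC (psf_comp A C G F) th = PC G (PC F th)"
 "X\<in>Obj A ==> PU (psf_comp A C G F) X = PC G (PU F X)\<bullet>\<^bsub>C\<^esub>PU G (PO F X)"
 "g\<in>Arr A ==> f\<in>Arr A ==> Tgt A f = Src A g ==>
  PM (psf_comp A C G F) g f = PC G (PM F g f)\<bullet>\<^bsub>C\<^esub>PM G (PA F g) (PA F f)"
 by (simp_all add: psf_comp_def compose_def)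

lemma (in pseudofunctor) inv_cell_pc [simp]:
 assumes "two_category A" "two_category B" "inv_cell A th"
 shows "inv_cell B (PC F th)"
proof (rule inv_cellI[OF assms(2), of _ "PC F (cinv A th)"])
 show "PC F (cinv A th)\<bullet>\<^bsub>B\<^esub>PC F th = Idc B (Dm B (PC F th))" "PC F th\<bullet>\<^bsub>B\<^esub>PC F (cinv A th) = Idc B (Cd B (PC F th))"
  using assms vc[of th "cinv A th"] vc[of "cinv A th" th] by simp_all
qed (use assms in simp_all)

text \<open>A constraint of the composite is a constraint of \<open>G\<close> followed by the image
  of one of \<open>F\<close>. Naturality of \<open>PM G\<close> brings the images of the constraints
  of \<open>F\<close> together, where the axiom of \<open>F\<close> applies under
  \<open>PC G\<close>; what remains is the axiom of \<open>G\<close>.\<close>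

lemma pseudofunctor_comp [simp]:
 assumes A [simp]: "two_category A" and B [simp]: "two_category B" and C [simp]: "two_category C"
  and F: "pseudofunctor A B F" and G: "pseudofunctor B C G"
 shows "pseudofunctor A C (psf_comp A C G F)"
proof -
 interpret F: pseudofunctor A B F by fact
 interpret G: pseudofunctor B C G by fact
 have unit: "PC G (PM F f (One A (Src A f)))\<bullet>\<^bsub>C\<^esub>PM G (PA F f) (PA F (One A (Src A f))) \<bullet>\<^bsub>C\<^esub>
   (Idc C (PA G (PA F f))\<star>\<^bsub>C\<^esub>PC G (PU F (Src A f)))\<bullet>\<^bsub>C\<^esub>(Idc C (PA G (PA F f))\<star>\<^bsub>C\<^esub>PU G (PO F (Src A f))) = Idc C (PA G (PA F f))"
  (is "?a\<bullet>\<^bsub>C\<^esub>?b\<bullet>\<^bsub>C\<^esub>?c\<bullet>\<^bsub>C\<^esub>?d = _")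
  "PC G (PM F (One A (Tgt A f)) f)\<bullet>\<^bsub>C\<^esub>PM G (PA F (One A (Tgt A f))) (PA F f) \<bullet>\<^bsub>C\<^esub>
   (PC G (PU F (Tgt A f))\<star>\<^bsub>C\<^esub>Idc C (PA G (PA F f)))\<bullet>\<^bsub>C\<^esub>(PU G (PO F (Tgt A f))\<star>\<^bsub>C\<^esub>Idc C (PA G (PA F f))) = Idc C (PA G (PA F f))"
  (is "?a'\<bullet>\<^bsub>C\<^esub>?b'\<bullet>\<^bsub>C\<^esub>?c'\<bullet>\<^bsub>C\<^esub>?d' = _")
  if f: "f\<in>Arr A" for f
 proof -
  have "?a\<bullet>\<^bsub>C\<^esub>?b\<bullet>\<^bsub>C\<^esub>?c\<bullet>\<^bsub>C\<^esub>?d = ?a\<bullet>\<^bsub>C\<^esub>(?b\<bullet>\<^bsub>C\<^esub>?c)\<bullet>\<^bsub>C\<^esub>?d" using f by simp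
  \<comment> \<open>Naturality of \<open>PM G\<close> at the unit constraint of \<open>F\<close>,
    with an identity cell in the other argument.\<close>
  also have "?b\<bullet>\<^bsub>C\<^esub>?c = PC G (Idc B (PA F f)\<star>\<^bsub>B\<^esub>PU F (Src A f))\<bullet>\<^bsub>C\<^esub>PM G (PA F f) (One B (PO F (Src A f)))"
   using G.nat[of "PU F (Src A f)" "Idc B (PA F f)"] f by simp
  also have "?a\<bullet>\<^bsub>C\<^esub>(...)\<bullet>\<^bsub>C\<^esub>?d = PC G (PM F f (One A (Src A f))\<bullet>\<^bsub>B\<^esub>(Idc B (PA F f)\<star>\<^bsub>B\<^esub>PU F (Src A f)))\<bullet>\<^bsub>C\<^esub>(PM G (PA F f) (One B (PO F (Src A f)))\<bullet>\<^bsub>C\<^esub>?d)"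
   using f by simp
  also have "... = Idc C (PA G (PA F f))" using f F.unit_right[OF f] G.unit_right[of "PA F f"] by (simp del: G.vc)
  finally show "?a\<bullet>\<^bsub>C\<^esub>?b\<bullet>\<^bsub>C\<^esub>?c\<bullet>\<^bsub>C\<^esub>?d = Idc C (PA G (PA F f))" .
  have "?a'\<bullet>\<^bsub>C\<^esub>?b'\<bullet>\<^bsub>C\<^esub>?c'\<bullet>\<^bsub>C\<^esub>?d' = ?a'\<bullet>\<^bsub>C\<^esub>(?b'\<bullet>\<^bsub>C\<^esub>?c')\<bullet>\<^bsub>C\<^esub>?d'" using f by simp
  also have "?b'\<bullet>\<^bsub>C\<^esub>?c' = PC G (PU F (Tgt A f)\<star>\<^bsub>B\<^esub>Idc B (PA F f))\<bullet>\<^bsub>C\<^esub>PM G (One B (PO F (Tgt A f))) (PA F f)"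
   using G.nat[of "Idc B (PA F f)" "PU F (Tgt A f)"] f by simp
  also have "?a'\<bullet>\<^bsub>C\<^esub>(...)\<bullet>\<^bsub>C\<^esub>?d' = PC G (PM F (One A (Tgt A f)) f\<bullet>\<^bsub>B\<^esub>(PU F (Tgt A f)\<star>\<^bsub>B\<^esub>Idc B (PA F f)))\<bullet>\<^bsub>C\<^esub>(PM G (One B (PO F (Tgt A f))) (PA F f)\<bullet>\<^bsub>C\<^esub>?d')"
   using f by simp
  also have "... = Idc C (PA G (PA F f))" using f F.unit_left[OF f] G.unit_left[of "PA F f"] by (simp del: G.vc)
  finally show "?a'\<bullet>\<^bsub>C\<^esub>?b'\<bullet>\<^bsub>C\<^esub>?c'\<bullet>\<^bsub>C\<^esub>?d' = Idc C (PA G (PA F f))" .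
 qed
 have assoc: "(PC G (PM F h (g\<odot>\<^bsub>A\<^esub>f))\<bullet>\<^bsub>C\<^esub>PM G (PA F h) (PA F (g\<odot>\<^bsub>A\<^esub>f))) \<bullet>\<^bsub>C\<^esub>
   (Idc C (PA G (PA F h))\<star>\<^bsub>C\<^esub>(PC G (PM F g f)\<bullet>\<^bsub>C\<^esub>PM G (PA F g) (PA F f))) =
  (PC G (PM F (h\<odot>\<^bsub>A\<^esub>g) f)\<bullet>\<^bsub>C\<^esub>PM G (PA F (h\<odot>\<^bsub>A\<^esub>g)) (PA F f)) \<bullet>\<^bsub>C\<^esub>
   ((PC G (PM F h g)\<bullet>\<^bsub>C\<^esub>PM G (PA F h) (PA F g))\<star>\<^bsub>C\<^esub>Idc C (PA G (PA F f)))" (is "?L = ?R")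
  if t: "f\<in>Arr A" "g\<in>Arr A" "h\<in>Arr A" "Tgt A f = Src A g" "Tgt A g = Src A h" for f g h
 proof -
  let ?f = "PA F f" let ?g = "PA F g" let ?h = "PA F h" let ?i = "\<lambda>f. Idc C (PA G f)"
  \<comment> \<open>\<open>n1\<close> and \<open>n2\<close> are naturality of \<open>PM G\<close> at
    the constraints of \<open>F\<close>, \<open>n3\<close> is associativity for \<open>G\<close>,
    and \<open>n4\<close> is associativity for \<open>F\<close> under \<open>G\<close>.\<close>
  have n1: "PM G ?h (PA F (g\<odot>\<^bsub>A\<^esub>f))\<bullet>\<^bsub>C\<^esub>(?i ?h\<star>\<^bsub>C\<^esub>PC G (PM F g f)) =
    PC G (Idc B ?h\<star>\<^bsub>B\<^esub>PM F g f)\<bullet>\<^bsub>C\<^esub>PM G ?h (?g\<odot>\<^bsub>B\<^esub>?f)"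
   using G.nat[of "PM F g f" "Idc B ?h"] t by simp
  have n2: "PM G (PA F (h\<odot>\<^bsub>A\<^esub>g)) ?f\<bullet>\<^bsub>C\<^esub>(PC G (PM F h g)\<star>\<^bsub>C\<^esub>?i ?f) =
    PC G (PM F h g\<star>\<^bsub>B\<^esub>Idc B ?f)\<bullet>\<^bsub>C\<^esub>PM G (?h\<odot>\<^bsub>B\<^esub>?g) ?f"
   using G.nat[of "Idc B ?f" "PM F h g"] t by simp
  have n3: "PM G ?h (?g\<odot>\<^bsub>B\<^esub>?f)\<bullet>\<^bsub>C\<^esub>(?i ?h\<star>\<^bsub>C\<^esub>PM G ?g ?f) = PM G (?h\<odot>\<^bsub>B\<^esub>?g) ?f\<bullet>\<^bsub>C\<^esub>(PM G ?h ?g\<star>\<^bsub>C\<^esub>?i ?f)"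
   using G.assoc[of ?f ?g ?h] t by simp
  have n4: "PC G (PM F h (g\<odot>\<^bsub>A\<^esub>f))\<bullet>\<^bsub>C\<^esub>PC G (Idc B ?h\<star>\<^bsub>B\<^esub>PM F g f) =
    PC G (PM F (h\<odot>\<^bsub>A\<^esub>g) f)\<bullet>\<^bsub>C\<^esub>PC G (PM F h g\<star>\<^bsub>B\<^esub>Idc B ?f)"
   using arg_cong[OF F.assoc[OF t], of "PC G"] t by simp
  have "?L = PC G (PM F h (g\<odot>\<^bsub>A\<^esub>f))\<bullet>\<^bsub>C\<^esub>(PM G ?h (PA F (g\<odot>\<^bsub>A\<^esub>f))\<bullet>\<^bsub>C\<^esub>(?i ?h\<star>\<^bsub>C\<^esub>PC G (PM F g f)))\<bullet>\<^bsub>C\<^esub>(?i ?h\<star>\<^bsub>C\<^esub>PM G ?g ?f)"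
   using t by simp
  also have "... = (PC G (PM F h (g\<odot>\<^bsub>A\<^esub>f))\<bullet>\<^bsub>C\<^esub>PC G (Idc B ?h\<star>\<^bsub>B\<^esub>PM F g f))\<bullet>\<^bsub>C\<^esub>(PM G ?h (?g\<odot>\<^bsub>B\<^esub>?f)\<bullet>\<^bsub>C\<^esub>(?i ?h\<star>\<^bsub>C\<^esub>PM G ?g ?f))"
   unfolding n1 using t by simp
  also have "... = PC G (PM F (h\<odot>\<^bsub>A\<^esub>g) f)\<bullet>\<^bsub>C\<^esub>(PC G (PM F h g\<star>\<^bsub>B\<^esub>Idc B ?f)\<bullet>\<^bsub>C\<^esub>PM G (?h\<odot>\<^bsub>B\<^esub>?g) ?f)\<bullet>\<^bsub>C\<^esub>(PM G ?h ?g\<star>\<^bsub>C\<^esub>?i ?f)"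
   unfolding n3 n4 using t by simp
  also have "... = ?R" unfolding n2[symmetric] using t by simp
  finally show ?thesis .
 qed
 show ?thesis
 proof (rule pseudofunctorI)
  fix th xi assume t: "th\<in>Cel A" "xi\<in>Cel A" "Tgt A (Dm A th) = Src A (Dm A xi)"
  have "PC G (PC F (xi\<star>\<^bsub>A\<^esub>th))\<bullet>\<^bsub>C\<^esub>PC G (PM F (Dm A xi) (Dm A th)) = PC G (PM F (Cd A xi) (Cd A th))\<bullet>\<^bsub>C\<^esub>PC G (PC F xi\<star>\<^bsub>B\<^esub>PC F th)"
   using arg_cong[OF F.nat[OF t], of "PC G"] t by simp
  note n1 = vc_reassoc[OF this C]
  have "PC G (PC F xi\<star>\<^bsub>B\<^esub>PC F th)\<bullet>\<^bsub>C\<^esub>PM G (PA F (Dm A xi)) (PA F (Dm A th)) =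
    PM G (PA F (Cd A xi)) (PA F (Cd A th))\<bullet>\<^bsub>C\<^esub>(PC G (PC F xi)\<star>\<^bsub>C\<^esub>PC G (PC F th))"
   using G.nat[of "PC F th" "PC F xi"] t by simp
  then show "PC (psf_comp A C G F) (xi\<star>\<^bsub>A\<^esub>th)\<bullet>\<^bsub>C\<^esub>PM (psf_comp A C G F) (Dm A xi) (Dm A th) =
    PM (psf_comp A C G F) (Cd A xi) (Cd A th)\<bullet>\<^bsub>C\<^esub>(PC (psf_comp A C G F) xi\<star>\<^bsub>C\<^esub>PC (psf_comp A C G F) th)"
   using t n1 by simp
 next
  fix f g h assume t: "f\<in>Arr A" "g\<in>Arr A" "h\<in>Arr A" "Tgt A f = Src A g" "Tgt A g = Src A h"
  then show "PM (psf_comp A C G F) h (g\<odot>\<^bsub>A\<^esub>f)\<bullet>\<^bsub>C\<^esub>(Idc C (PA (psf_comp A C G F) h)\<star>\<^bsub>C\<^esub>PM (psf_comp A C G F) g f) =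
    PM (psf_comp A C G F) (h\<odot>\<^bsub>A\<^esub>g) f\<bullet>\<^bsub>C\<^esub>(PM (psf_comp A C G F) h g\<star>\<^bsub>C\<^esub>Idc C (PA (psf_comp A C G F) f))"
   using assoc[OF t] by (simp del: tc_vc_assoc tc_whisker)
 next
  fix f assume f: "f\<in>Arr A"
  show "PM (psf_comp A C G F) f (One A (Src A f))\<bullet>\<^bsub>C\<^esub>(Idc C (PA (psf_comp A C G F) f)\<star>\<^bsub>C\<^esub>PU (psf_comp A C G F) (Src A f)) =
    Idc C (PA (psf_comp A C G F) f)"
   using unit(1)[OF f] f by simp
  show "PM (psf_comp A C G F) (One A (Tgt A f)) f\<bullet>\<^bsub>C\<^esub>(PU (psf_comp A C G F) (Tgt A f)\<star>\<^bsub>C\<^esub>Idc C (PA (psf_comp A C G F) f)) =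
    Idc C (PA (psf_comp A C G F) f)"
   using unit(2)[OF f] f by simp
 qed (simp_all, simp_all add: psf_comp_def compose_def)
qed

section \<open>Representable pseudofunctors\<close>

text \<open>The maps that \<open>yo\<close> binds locally get names, so that their properties can be
  stated once and used for both variances.\<close>

definition yo_arr :: "('o, 'a, 'c) twocat => 'o => 'a => ('a, 'c, 'a, 'c) fctr" where
 "yo_arr K X g = \<lparr>FDom = HomC K X (Src K g), FCod = HomC K X (Tgt K g),
   FOb = (\<lambda>f\<in>Ob (HomC K X (Src K g)). g\<odot>\<^bsub>K\<^esub>f),
   FAr = (\<lambda>al\<in>Ar (HomC K X (Src K g)). Idc K g\<star>\<^bsub>K\<^esub>al)\<rparr>"

definition yo_cel :: "('o, 'a, 'c) twocat => 'o => 'c => ('a, 'c, 'a, 'c) ntrans" where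
 "yo_cel K X th = \<lparr>NDom = yo_arr K X (Dm K th), NCod = yo_arr K X (Cd K th),
   NAt = (\<lambda>f\<in>Ob (HomC K X (Src K (Dm K th))). th\<star>\<^bsub>K\<^esub>Idc K f)\<rparr>"

lemma yo_eq: "yo K X = strict_psf K CAT (HomC K X) (yo_arr K X) (yo_cel K X)"
 by (simp add: yo_def yo_arr_def[abs_def] yo_cel_def[abs_def] Let_def)

lemma yo_arr_simps [simp]:
 "FDom (yo_arr K X g) = HomC K X (Src K g)" "FCod (yo_arr K X g) = HomC K X (Tgt K g)"
 "f\<in>Arr K ==> Src K f = X ==> Tgt K f = Src K g ==> FOb (yo_arr K X g) f = g\<odot>\<^bsub>K\<^esub>f"
 "al\<in>Cel K ==> Dm K al\<in>Arr K ==> Src K (Dm K al) = X ==> Tgt K (Dm K al) = Src K g ==> FAr (yo_arr K X g) al = Idc K g\<star>\<^bsub>K\<^esub>al"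
 by (simp_all add: yo_arr_def)

lemma yo_cel_simps [simp]:
 "NDom (yo_cel K X th) = yo_arr K X (Dm K th)" "NCod (yo_cel K X th) = yo_arr K X (Cd K th)"
 "f\<in>Arr K ==> Src K f = X ==> Tgt K f = Src K (Dm K th) ==> NAt (yo_cel K X th) f = th\<star>\<^bsub>K\<^esub>Idc K f"
 by (simp_all add: yo_cel_def)

lemma yo_arr_functor [simp]:
 assumes "two_category K" "X\<in>Obj K" "g\<in>Arr K"
 shows "is_functor (yo_arr K X g)"
proof (rule functorI)
 show "FOb (yo_arr K X g)\<in>extensional (Ob (FDom (yo_arr K X g)))"
  "FAr (yo_arr K X g)\<in>extensional (Ar (FDom (yo_arr K X g)))" by (simp_all add: yo_arr_def del: HomC_simps)
qed (use assms in auto)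

lemma yo_cel_trans [simp]:
 assumes "two_category K" "X\<in>Obj K" "th\<in>Cel K"
 shows "nat_trans (yo_cel K X th)"
proof (rule nat_transI)
 show "NAt (yo_cel K X th)\<in>extensional (Ob (FDom (NDom (yo_cel K X th))))" by (simp add: yo_cel_def yo_arr_def del: HomC_simps)
qed (use assms in "auto simp: tc_hc_whisker")

lemma pseudofunctor_yo [simp]:
 assumes "two_category K" "X\<in>Obj K"
 shows "pseudofunctor K CAT (yo K X)"
 unfolding yo_eq
proof (rule pseudofunctor_strict)
 show "yo_arr K X (One K Y) = One CAT (HomC K X Y)" if "Y\<in>Obj K" for Y
  using that assms by (auto intro!: functor_eqI)
 show "yo_arr K X (g\<odot>\<^bsub>K\<^esub>f) = yo_arr K X g\<odot>\<^bsub>CAT\<^esub>yo_arr K X f" if "f\<in>Arr K" "g\<in>Arr K" "Tgt K f = Src K g" for f g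
  using that assms by (auto intro!: functor_eqI)
 show "yo_cel K X (Idc K f) = Idc CAT (yo_arr K X f)" if "f\<in>Arr K" for f
  using that assms by (auto intro!: nat_trans_eqI)
 show "yo_cel K X (xi\<bullet>\<^bsub>K\<^esub>th) = yo_cel K X xi\<bullet>\<^bsub>CAT\<^esub>yo_cel K X th" if "th\<in>Cel K" "xi\<in>Cel K" "Cd K th = Dm K xi" for th xi
  using that assms tc_cel[OF assms(1) that(1)] tc_cel[OF assms(1) that(2)] by (auto intro!: nat_trans_eqI)
 show "yo_cel K X (xi\<star>\<^bsub>K\<^esub>th) = yo_cel K X xi\<star>\<^bsub>CAT\<^esub>yo_cel K X th"
  if t: "th\<in>Cel K" "xi\<in>Cel K" "Tgt K (Dm K th) = Src K (Dm K xi)" for th xi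
 proof -
  have "yo_arr K X (g\<odot>\<^bsub>K\<^esub>f) = yo_arr K X g \<circ>\<^sub>F yo_arr K X f" if "f\<in>Arr K" "g\<in>Arr K" "Tgt K f = Src K g" for f g
   using that assms by (auto intro!: functor_eqI)
  note h = this
  show ?thesis
  proof (rule nat_trans_eqI)
   show "NDom (yo_cel K X (xi\<star>\<^bsub>K\<^esub>th)) = NDom (yo_cel K X xi\<star>\<^bsub>CAT\<^esub>yo_cel K X th)"
    "NCod (yo_cel K X (xi\<star>\<^bsub>K\<^esub>th)) = NCod (yo_cel K X xi\<star>\<^bsub>CAT\<^esub>yo_cel K X th)"
    using h[of "Dm K th" "Dm K xi"] h[of "Cd K th" "Cd K xi"] t assms by simp_all
   fix f assume "f\<in>Ob (FDom (NDom (yo_cel K X (xi\<star>\<^bsub>K\<^esub>th))))"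
   then have f: "f\<in>Arr K" "Src K f = X" "Tgt K f = Src K (Dm K th)" using t assms by auto
   \<comment> \<open>The component of a horizontal composite of natural transformations is one of
     the two bracketings of a horizontal composite of cells.\<close>
   show "NAt (yo_cel K X (xi\<star>\<^bsub>K\<^esub>th)) f = NAt (yo_cel K X xi\<star>\<^bsub>CAT\<^esub>yo_cel K X th) f"
    using tc_hc_whisker(1)[OF assms(1), of "th\<star>\<^bsub>K\<^esub>Idc K f" xi] f t assms by simp
  qed (use t assms in simp_all)
 qed
qed (use assms in auto)

section \<open>The 2-category of pseudofunctors\<close>

lemma psnatI:
 assumes "pseudofunctor A B (TDom t)" "pseudofunctor A B (TCod t)"
  and "TO t\<in>extensional (Obj A)" "TA t\<in>extensional (Arr A)"
  and "!!X. X\<in>Obj A ==> TO t X\<in>Hom1 B (PO (TDom t) X) (PO (TCod t) X)"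
  and "!!f. f\<in>Arr A ==> TA t f\<in>Hom2 B (PA (TCod t) f\<odot>\<^bsub>B\<^esub>TO t (Src A f)) (TO t (Tgt A f)\<odot>\<^bsub>B\<^esub>PA (TDom t) f) \<and>
   inv_cell B (TA t f)"
  and "!!th. th\<in>Cel A ==> (Idc B (TO t (Tgt A (Dm A th)))\<star>\<^bsub>B\<^esub>PC (TDom t) th)\<bullet>\<^bsub>B\<^esub>TA t (Dm A th) =
    TA t (Cd A th)\<bullet>\<^bsub>B\<^esub>(PC (TCod t) th\<star>\<^bsub>B\<^esub>Idc B (TO t (Src A (Dm A th))))"
  and "!!f g. f\<in>Arr A ==> g\<in>Arr A ==> Tgt A f = Src A g ==>
    TA t (g\<odot>\<^bsub>A\<^esub>f)\<bullet>\<^bsub>B\<^esub>(PM (TCod t) g f\<star>\<^bsub>B\<^esub>Idc B (TO t (Src A f))) =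
    (Idc B (TO t (Tgt A g))\<star>\<^bsub>B\<^esub>PM (TDom t) g f)\<bullet>\<^bsub>B\<^esub>(TA t g\<star>\<^bsub>B\<^esub>Idc B (PA (TDom t) f)) \<bullet>\<^bsub>B\<^esub>
     (Idc B (PA (TCod t) g)\<star>\<^bsub>B\<^esub>TA t f)"
  and "!!X. X\<in>Obj A ==> TA t (One A X)\<bullet>\<^bsub>B\<^esub>(PU (TCod t) X\<star>\<^bsub>B\<^esub>Idc B (TO t X)) =
    Idc B (TO t X)\<star>\<^bsub>B\<^esub>PU (TDom t) X"
 shows "psnat A B t"
 unfolding psnat_def Let_def PiE_iff using assms by auto

locale psn_transf = A: two_category A + B: two_category B
 for A :: "('o, 'a, 'c) twocat" and B :: "('p, 'b, 'd) twocat" +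
 fixes t :: "('o, 'a, 'c, 'p, 'b, 'd) psnt"
 assumes psnat: "psnat A B t"
begin

sublocale F: pseudofunctor A B "TDom t" + G: pseudofunctor A B "TCod t"
 using psnat by (simp_all add: psnat_def Let_def)

lemma ext: "TO t\<in>extensional (Obj A)" "TA t\<in>extensional (Arr A)"
 using psnat by (simp_all add: psnat_def Let_def PiE_iff)

lemma to [simp]: "X\<in>Obj A ==> TO t X\<in>Arr B" "X\<in>Obj A ==> Src B (TO t X) = PO (TDom t) X"
 "X\<in>Obj A ==> Tgt B (TO t X) = PO (TCod t) X"
 using psnat by (simp_all add: psnat_def Let_def PiE_iff)

lemma ta [simp]: "f\<in>Arr A ==> TA t f\<in>Cel B" "f\<in>Arr A ==> Dm B (TA t f) = PA (TCod t) f\<odot>\<^bsub>B\<^esub>TO t (Src A f)"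
 "f\<in>Arr A ==> Cd B (TA t f) = TO t (Tgt A f)\<odot>\<^bsub>B\<^esub>PA (TDom t) f" "f\<in>Arr A ==> inv_cell B (TA t f)"
 using psnat by (simp_all add: psnat_def Let_def PiE_iff)

lemma natural: "th\<in>Cel A ==> (Idc B (TO t (Tgt A (Dm A th)))\<star>\<^bsub>B\<^esub>PC (TDom t) th)\<bullet>\<^bsub>B\<^esub>TA t (Dm A th) =
    TA t (Cd A th)\<bullet>\<^bsub>B\<^esub>(PC (TCod t) th\<star>\<^bsub>B\<^esub>Idc B (TO t (Src A (Dm A th))))"
 using psnat A.two_category_axioms unfolding psnat_def Let_def by simp

lemma comp: "f\<in>Arr A ==> g\<in>Arr A ==> Tgt A f = Src A g ==>
    TA t (g\<odot>\<^bsub>A\<^esub>f)\<bullet>\<^bsub>B\<^esub>(PM (TCod t) g f\<star>\<^bsub>B\<^esub>Idc B (TO t (Src A f))) =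
    (Idc B (TO t (Tgt A g))\<star>\<^bsub>B\<^esub>PM (TDom t) g f)\<bullet>\<^bsub>B\<^esub>(TA t g\<star>\<^bsub>B\<^esub>Idc B (PA (TDom t) f)) \<bullet>\<^bsub>B\<^esub>
     (Idc B (PA (TCod t) g)\<star>\<^bsub>B\<^esub>TA t f)"
proof -
 assume h: "f\<in>Arr A" "g\<in>Arr A" "Tgt A f = Src A g"
 have "\<forall>X\<in>Obj A. \<forall>Y\<in>Obj A. \<forall>Z\<in>Obj A. \<forall>f\<in>Hom1 A X Y. \<forall>g\<in>Hom1 A Y Z.
    TA t (g\<odot>\<^bsub>A\<^esub>f)\<bullet>\<^bsub>B\<^esub>(PM (TCod t) g f\<star>\<^bsub>B\<^esub>Idc B (TO t X)) =
    (Idc B (TO t Z)\<star>\<^bsub>B\<^esub>PM (TDom t) g f)\<bullet>\<^bsub>B\<^esub>(TA t g\<star>\<^bsub>B\<^esub>Idc B (PA (TDom t) f)) \<bullet>\<^bsub>B\<^esub>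
     (Idc B (PA (TCod t) g)\<star>\<^bsub>B\<^esub>TA t f)"
  using psnat unfolding psnat_def Let_def by (elim conjE)
 from this[rule_format, of "Src A f" "Tgt A f" "Tgt A g" f g] show ?thesis
  using h A.two_category_axioms by simp
qed

lemma unit: "X\<in>Obj A ==> TA t (One A X)\<bullet>\<^bsub>B\<^esub>(PU (TCod t) X\<star>\<^bsub>B\<^esub>Idc B (TO t X)) =
    Idc B (TO t X)\<star>\<^bsub>B\<^esub>PU (TDom t) X"
 using psnat unfolding psnat_def Let_def by simp

end

lemma psnI: "two_category A ==> two_category B ==> psnat A B t ==> psn_transf A B t"
 by (simp add: psn_transf_def psn_transf_axioms_def)

lemma psnat_eqI:
 fixes s t :: "('o, 'a, 'c, 'p, 'b, 'd) psnt"
 assumes "psnat A B s" "psnat A B t" "TDom s = TDom t" "TCod s = TCod t"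
  and "!!X. X\<in>Obj A ==> TO s X = TO t X" "!!f. f\<in>Arr A ==> TA s f = TA t f"
 shows "s = t"
proof -
 have "TO s\<in>extensional (Obj A)" "TA s\<in>extensional (Arr A)" "TO t\<in>extensional (Obj A)" "TA t\<in>extensional (Arr A)"
  using assms(1,2) by (simp_all add: psnat_def Let_def PiE_iff)
 then have "TO s = TO t" "TA s = TA t" using assms(5,6) by (auto intro!: extensionalityI)
 then show ?thesis using assms by simp
qed

lemma modificationI:
 assumes "two_category A" "psnat A B (MDom Gm)" "psnat A B (MCod Gm)" "TDom (MCod Gm) = TDom (MDom Gm)" "TCod (MCod Gm) = TCod (MDom Gm)"
  and "MO Gm\<in>extensional (Obj A)" "!!X. X\<in>Obj A ==> MO Gm X\<in>Hom2 B (TO (MDom Gm) X) (TO (MCod Gm) X)"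
  and "!!f. f\<in>Arr A ==> (MO Gm (Tgt A f)\<star>\<^bsub>B\<^esub>Idc B (PA (TDom (MDom Gm)) f))\<bullet>\<^bsub>B\<^esub>TA (MDom Gm) f =
    TA (MCod Gm) f\<bullet>\<^bsub>B\<^esub>(Idc B (PA (TCod (MDom Gm)) f)\<star>\<^bsub>B\<^esub>MO Gm (Src A f))"
 shows "modification A B Gm"
 unfolding modification_def Let_def PiE_iff using assms by auto

context
 fixes A :: "('o, 'a, 'c) twocat" and B :: "('p, 'b, 'd) twocat"
  and Gm :: "(('o, 'a, 'c, 'p, 'b, 'd) psnt, 'o, 'd) mdf"
 assumes A: "two_category A" and m: "modification A B Gm"
begin

lemma mdf_psnat: "psnat A B (MDom Gm)" "psnat A B (MCod Gm)"
 using m by (simp_all add: modification_def Let_def)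

lemma mdf_parallel: "TDom (MCod Gm) = TDom (MDom Gm)" "TCod (MCod Gm) = TCod (MDom Gm)"
 using m by (simp_all add: modification_def Let_def)

lemma mdf_ext: "MO Gm\<in>extensional (Obj A)"
 using m by (simp_all add: modification_def Let_def PiE_iff)

lemma mdf_mo: "X\<in>Obj A ==> MO Gm X\<in>Cel B" "X\<in>Obj A ==> Dm B (MO Gm X) = TO (MDom Gm) X"
 "X\<in>Obj A ==> Cd B (MO Gm X) = TO (MCod Gm) X"
 using m by (simp_all add: modification_def Let_def PiE_iff)

lemma mdf_natural: "f\<in>Arr A ==> (MO Gm (Tgt A f)\<star>\<^bsub>B\<^esub>Idc B (PA (TDom (MDom Gm)) f))\<bullet>\<^bsub>B\<^esub>TA (MDom Gm) f =
    TA (MCod Gm) f\<bullet>\<^bsub>B\<^esub>(Idc B (PA (TCod (MDom Gm)) f)\<star>\<^bsub>B\<^esub>MO Gm (Src A f))"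
 using m A unfolding modification_def Let_def by simp

end

lemma mdf_eqI:
 fixes Gm Dl :: "(('o, 'a, 'c, 'p, 'b, 'd) psnt, 'o, 'd) mdf"
 assumes "two_category A" "modification A B Gm" "modification A B Dl" "MDom Gm = MDom Dl" "MCod Gm = MCod Dl"
  and "!!X. X\<in>Obj A ==> MO Gm X = MO Dl X"
 shows "Gm = Dl"
proof -
 have "MO Gm = MO Dl" using assms mdf_ext[OF assms(1,2)] mdf_ext[OF assms(1,3)] by (auto intro!: extensionalityI)
 then show ?thesis using assms by simp
qed

lemma PsFun_simps [simp]:
 "Obj (PsFun A B) = {F. pseudofunctor A B F}" "Arr (PsFun A B) = {t. psnat A B t}" "Cel (PsFun A B) = {Gm. modification A B Gm}"
 "Src (PsFun A B) = TDom" "Tgt (PsFun A B) = TCod" "Dm (PsFun A B) = MDom" "Cd (PsFun A B) = MCod"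
 "Cmp (PsFun A B) = psn_comp A B"
 by (simp_all add: PsFun_def)

lemma PsFun_One [simp]:
 "TDom (One (PsFun A B) F) = F" "TCod (One (PsFun A B) F) = F"
 "X\<in>Obj A ==> TO (One (PsFun A B) F) X = One B (PO F X)" "f\<in>Arr A ==> TA (One (PsFun A B) F) f = Idc B (PA F f)"
 by (simp_all add: PsFun_def)

lemma PsFun_Idc [simp]: "MDom (Idc (PsFun A B) t) = t" "MCod (Idc (PsFun A B) t) = t"
 "X\<in>Obj A ==> MO (Idc (PsFun A B) t) X = Idc B (TO t X)"
 by (simp_all add: PsFun_def)

lemma PsFun_VC [simp]: "MDom (Dl\<bullet>\<^bsub>PsFun A B\<^esub>Gm) = MDom Gm" "MCod (Dl\<bullet>\<^bsub>PsFun A B\<^esub>Gm) = MCod Dl"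
 "X\<in>Obj A ==> MO (Dl\<bullet>\<^bsub>PsFun A B\<^esub>Gm) X = MO Dl X\<bullet>\<^bsub>B\<^esub>MO Gm X"
 by (simp_all add: PsFun_def)

lemma PsFun_HC [simp]: "MDom (Dl\<star>\<^bsub>PsFun A B\<^esub>Gm) = psn_comp A B (MDom Dl) (MDom Gm)"
 "MCod (Dl\<star>\<^bsub>PsFun A B\<^esub>Gm) = psn_comp A B (MCod Dl) (MCod Gm)"
 "X\<in>Obj A ==> MO (Dl\<star>\<^bsub>PsFun A B\<^esub>Gm) X = MO Dl X\<star>\<^bsub>B\<^esub>MO Gm X"
 by (simp_all add: PsFun_def)

lemma psn_comp_simps [simp]: "TDom (psn_comp A B s t) = TDom t" "TCod (psn_comp A B s t) = TCod s"
 "X\<in>Obj A ==> TO (psn_comp A B s t) X = TO s X\<odot>\<^bsub>B\<^esub>TO t X"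
 "f\<in>Arr A ==> TA (psn_comp A B s t) f =
   (Idc B (TO s (Tgt A f))\<star>\<^bsub>B\<^esub>TA t f)\<bullet>\<^bsub>B\<^esub>(TA s f\<star>\<^bsub>B\<^esub>Idc B (TO t (Src A f)))"
 by (simp_all add: psn_comp_def)

context
 fixes A :: "('o, 'a, 'c) twocat" and B :: "('p, 'b, 'd) twocat" (structure)
 assumes A [simp]: "two_category A" and B [simp]: "two_category B"
begin

lemma psnat_one: "pseudofunctor A B F ==> psnat A B (One (PsFun A B) F)"
proof (rule psnatI)
 assume "pseudofunctor A B F"
 then interpret F: pseudofunctor A B F .
 show "TO (One (PsFun A B) F)\<in>extensional (Obj A)" "TA (One (PsFun A B) F)\<in>extensional (Arr A)"
  by (simp_all add: PsFun_def)
qed (simp_all add: pseudofunctor.simps)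

text \<open>The square of the composite over an arrow is the square of \<open>s\<close> pasted with
  that of \<open>t\<close>, so each axiom is proved by one use of the axiom of \<open>s\<close> and
  one of the axiom of \<open>t\<close>.\<close>

lemma psnat_comp:
 assumes s: "psnat A B s" and t: "psnat A B t" and st: "TCod t = TDom s"
 shows "psnat A B (psn_comp A B s t)"
proof -
 interpret s: psn_transf A B s using s by (simp add: psnI)
 interpret t: psn_transf A B t using t by (simp add: psnI)
 let ?i = "Idc B" let ?F = "TDom t" let ?G = "TDom s" let ?K = "TCod s"
 show ?thesis
 proof (rule psnatI)
  fix th assume h: "th\<in>Cel A"
  let ?X = "Src A (Dm A th)" let ?Y = "Tgt A (Dm A th)" let ?f = "Dm A th" let ?g = "Cd A th"
  have tn: "(?i (TO t ?Y)\<star>PC ?F th)\<bullet>TA t ?f = TA t ?g\<bullet>(PC ?G th\<star>?i (TO t ?X))"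
   using t.natural[OF h] st by simp
  have sn: "(?i (TO s ?Y)\<star>PC ?G th)\<bullet>TA s ?f = TA s ?g\<bullet>(PC ?K th\<star>?i (TO s ?X))"
   using s.natural[OF h] by simp
  have "(?i (TO s ?Y\<odot>TO t ?Y)\<star>PC ?F th)\<bullet>(?i (TO s ?Y)\<star>TA t ?f)\<bullet>(TA s ?f\<star>?i (TO t ?X)) =
    (?i (TO s ?Y)\<star>((?i (TO t ?Y)\<star>PC ?F th)\<bullet>TA t ?f))\<bullet>(TA s ?f\<star>?i (TO t ?X))"
   using h st by simp
  also have "... = (?i (TO s ?Y)\<star>TA t ?g)\<bullet>(((?i (TO s ?Y)\<star>PC ?G th)\<bullet>TA s ?f)\<star>?i (TO t ?X))"
   unfolding tn using h st by simp
  also have "... = (?i (TO s ?Y)\<star>TA t ?g)\<bullet>(TA s ?g\<star>?i (TO t ?X))\<bullet>(PC ?K th\<star>?i (TO s ?X\<odot>TO t ?X))"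
   unfolding sn using h st by simp
  finally show "(?i (TO (psn_comp A B s t) ?Y)\<star>PC (TDom (psn_comp A B s t)) th)\<bullet>TA (psn_comp A B s t) ?f =
    TA (psn_comp A B s t) ?g\<bullet>(PC (TCod (psn_comp A B s t)) th\<star>?i (TO (psn_comp A B s t) ?X))"
   using h st by simp
 next
  fix f g assume h: "f\<in>Arr A" "g\<in>Arr A" "Tgt A f = Src A g"
  let ?X = "Src A f" let ?Y = "Src A g" let ?Z = "Tgt A g"
  have sc: "TA s (g\<odot>\<^bsub>A\<^esub>f)\<bullet>(PM ?K g f\<star>?i (TO s ?X)) = (?i (TO s ?Z)\<star>PM ?G g f)\<bullet>(TA s g\<star>?i (PA ?G f))\<bullet>(?i (PA ?K g)\<star>TA s f)"
   using s.comp[OF h] .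
  have tc: "TA t (g\<odot>\<^bsub>A\<^esub>f)\<bullet>(PM ?G g f\<star>?i (TO t ?X)) = (?i (TO t ?Z)\<star>PM ?F g f)\<bullet>(TA t g\<star>?i (PA ?F f))\<bullet>(?i (PA ?G g)\<star>TA t f)"
   using t.comp[OF h] st by simp
  \<comment> \<open>The square of \<open>t\<close> over \<open>f\<close> and the square of
    \<open>s\<close> over \<open>g\<close> act on disjoint 1-cells and can be interchanged.\<close>
  have x: "(?i (TO s ?Z\<odot>PA ?G g)\<star>TA t f)\<bullet>(TA s g\<star>?i (PA ?G f\<odot>TO t ?X)) =
   (TA s g\<star>?i (TO t ?Y\<odot>PA ?F f))\<bullet>(?i (PA ?K g\<odot>TO s ?Y)\<star>TA t f)"
   using tc_hc_whisker[OF B, of "TA t f" "TA s g"] h st by simp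
  have "((?i (TO s ?Z)\<star>TA t (g\<odot>\<^bsub>A\<^esub>f))\<bullet>(TA s (g\<odot>\<^bsub>A\<^esub>f)\<star>?i (TO t ?X)))\<bullet>(PM ?K g f\<star>?i (TO s ?X\<odot>TO t ?X)) =
    (?i (TO s ?Z)\<star>TA t (g\<odot>\<^bsub>A\<^esub>f))\<bullet>((TA s (g\<odot>\<^bsub>A\<^esub>f)\<bullet>(PM ?K g f\<star>?i (TO s ?X)))\<star>?i (TO t ?X))"
   using h st by simp
  also have "... = (?i (TO s ?Z)\<star>(TA t (g\<odot>\<^bsub>A\<^esub>f)\<bullet>(PM ?G g f\<star>?i (TO t ?X))))\<bullet>(TA s g\<star>?i (PA ?G f\<odot>TO t ?X))\<bullet>(?i (PA ?K g)\<star>TA s f\<star>?i (TO t ?X))"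
   unfolding sc using h st by simp
  also have "... = (?i (TO s ?Z\<odot>TO t ?Z)\<star>PM ?F g f)\<bullet>(?i (TO s ?Z)\<star>TA t g\<star>?i (PA ?F f)) \<bullet>
    ((?i (TO s ?Z\<odot>PA ?G g)\<star>TA t f)\<bullet>(TA s g\<star>?i (PA ?G f\<odot>TO t ?X)))\<bullet>(?i (PA ?K g)\<star>TA s f\<star>?i (TO t ?X))"
   unfolding tc using h st by simp
  also have "... = (?i (TO s ?Z\<odot>TO t ?Z)\<star>PM ?F g f)\<bullet>(((?i (TO s ?Z)\<star>TA t g)\<bullet>(TA s g\<star>?i (TO t ?Y)))\<star>?i (PA ?F f)) \<bullet>
   (?i (PA ?K g)\<star>((?i (TO s ?Y)\<star>TA t f)\<bullet>(TA s f\<star>?i (TO t ?X))))"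
   unfolding x using h st by simp
  finally show "TA (psn_comp A B s t) (g\<odot>\<^bsub>A\<^esub>f)\<bullet>(PM (TCod (psn_comp A B s t)) g f\<star>?i (TO (psn_comp A B s t) ?X)) =
    (?i (TO (psn_comp A B s t) ?Z)\<star>PM (TDom (psn_comp A B s t)) g f)\<bullet>(TA (psn_comp A B s t) g\<star>?i (PA (TDom (psn_comp A B s t)) f)) \<bullet>
     (?i (PA (TCod (psn_comp A B s t)) g)\<star>TA (psn_comp A B s t) f)"
   using h st by simp
 next
  fix X assume X: "X\<in>Obj A"
  have "((?i (TO s X)\<star>TA t (One A X))\<bullet>(TA s (One A X)\<star>?i (TO t X)))\<bullet>(PU ?K X\<star>?i (TO s X\<odot>TO t X)) =
   (?i (TO s X)\<star>TA t (One A X))\<bullet>((TA s (One A X)\<bullet>(PU ?K X\<star>?i (TO s X)))\<star>?i (TO t X))"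
   using X st by simp
  also have "... = ?i (TO s X)\<star>(TA t (One A X)\<bullet>(PU ?G X\<star>?i (TO t X)))"
   unfolding s.unit[OF X] using X st by simp
  also have "... = ?i (TO s X)\<star>?i (TO t X)\<star>PU ?F X" using t.unit[OF X] st by simp
  finally show "TA (psn_comp A B s t) (One A X)\<bullet>(PU (TCod (psn_comp A B s t)) X\<star>?i (TO (psn_comp A B s t) X)) =
    ?i (TO (psn_comp A B s t) X)\<star>PU (TDom (psn_comp A B s t)) X" using X st by simp
 next
  show "TO (psn_comp A B s t)\<in>extensional (Obj A)" "TA (psn_comp A B s t)\<in>extensional (Arr A)"
   by (simp_all add: psn_comp_def)
 qed (use st t.F.pseudofunctor_axioms s.G.pseudofunctor_axioms in simp_all)
qed

lemma mdf_id: "psnat A B t ==> modification A B (Idc (PsFun A B) t)"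
proof (rule modificationI)
 assume "psnat A B t"
 then interpret t: psn_transf A B t by (simp add: psnI)
 show "MO (Idc (PsFun A B) t) X\<in>Hom2 B (TO (MDom (Idc (PsFun A B) t)) X) (TO (MCod (Idc (PsFun A B) t)) X)"
  if "X\<in>Obj A" for X using that by simp
 show "(MO (Idc (PsFun A B) t) (Tgt A f)\<star>Idc B (PA (TDom (MDom (Idc (PsFun A B) t))) f))\<bullet>TA (MDom (Idc (PsFun A B) t)) f =
     TA (MCod (Idc (PsFun A B) t)) f\<bullet>(Idc B (PA (TCod (MDom (Idc (PsFun A B) t))) f)\<star>MO (Idc (PsFun A B) t) (Src A f))"
  if "f\<in>Arr A" for f using that by simp
qed (simp_all, simp add: PsFun_def)

lemma mdf_vc:
 assumes G: "modification A B Gm" and D: "modification A B Dl" and GD: "MCod Gm = MDom Dl"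
 shows "modification A B (Dl\<bullet>\<^bsub>PsFun A B\<^esub>Gm)"
proof (rule modificationI)
 interpret s: psn_transf A B "MDom Gm" using mdf_psnat[OF A G] by (simp add: psnI)
 interpret t: psn_transf A B "MDom Dl" using mdf_psnat[OF A D] by (simp add: psnI)
 interpret u: psn_transf A B "MCod Dl" using mdf_psnat[OF A D] by (simp add: psnI)
 note [simp] = mdf_mo[OF A G] mdf_mo[OF A D] GD
 have [simp]: "TDom (MDom Dl) = TDom (MDom Gm)" "TCod (MDom Dl) = TCod (MDom Gm)"
  using mdf_parallel[OF A G] GD by simp_all
 note [simp] = mdf_parallel[OF A D]
 show "psnat A B (MDom (Dl\<bullet>\<^bsub>PsFun A B\<^esub>Gm))" "psnat A B (MCod (Dl\<bullet>\<^bsub>PsFun A B\<^esub>Gm))"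
  using s.psnat u.psnat by simp_all
 show "MO (Dl\<bullet>\<^bsub>PsFun A B\<^esub>Gm)\<in>extensional (Obj A)" by (simp add: PsFun_def)
 show "MO (Dl\<bullet>\<^bsub>PsFun A B\<^esub>Gm) X\<in>Hom2 B (TO (MDom (Dl\<bullet>\<^bsub>PsFun A B\<^esub>Gm)) X) (TO (MCod (Dl\<bullet>\<^bsub>PsFun A B\<^esub>Gm)) X)"
  if "X\<in>Obj A" for X using that by simp
 fix f assume f: "f\<in>Arr A"
 let ?i = "Idc B" let ?Y = "Tgt A f" let ?X = "Src A f" let ?F = "TDom (MDom Gm)" let ?G = "TCod (MDom Gm)"
 have g: "(MO Gm ?Y\<star>?i (PA ?F f))\<bullet>TA (MDom Gm) f = TA (MDom Dl) f\<bullet>(?i (PA ?G f)\<star>MO Gm ?X)"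
  using mdf_natural[OF A G f] by simp
 have d: "(MO Dl ?Y\<star>?i (PA ?F f))\<bullet>TA (MDom Dl) f = TA (MCod Dl) f\<bullet>(?i (PA ?G f)\<star>MO Dl ?X)"
  using mdf_natural[OF A D f] by simp
 have "((MO Dl ?Y\<bullet>MO Gm ?Y)\<star>?i (PA ?F f))\<bullet>TA (MDom Gm) f =
   (MO Dl ?Y\<star>?i (PA ?F f))\<bullet>((MO Gm ?Y\<star>?i (PA ?F f))\<bullet>TA (MDom Gm) f)"
  using f by simp
 also have "... = ((MO Dl ?Y\<star>?i (PA ?F f))\<bullet>TA (MDom Dl) f)\<bullet>(?i (PA ?G f)\<star>MO Gm ?X)"
  unfolding g using f by simp
 also have "... = TA (MCod Dl) f\<bullet>(?i (PA ?G f)\<star>(MO Dl ?X\<bullet>MO Gm ?X))" unfolding d using f by simp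
 finally show "(MO (Dl\<bullet>\<^bsub>PsFun A B\<^esub>Gm) ?Y\<star>?i (PA (TDom (MDom (Dl\<bullet>\<^bsub>PsFun A B\<^esub>Gm))) f))\<bullet>TA (MDom (Dl\<bullet>\<^bsub>PsFun A B\<^esub>Gm)) f =
    TA (MCod (Dl\<bullet>\<^bsub>PsFun A B\<^esub>Gm)) f\<bullet>(?i (PA (TCod (MDom (Dl\<bullet>\<^bsub>PsFun A B\<^esub>Gm))) f)\<star>MO (Dl\<bullet>\<^bsub>PsFun A B\<^esub>Gm) ?X)"
  using f by simp
qed (use mdf_parallel[OF A G] mdf_parallel[OF A D] GD in simp_all)

text \<open>Each horizontal composite of components is split into two whiskered cells. The
  modification axioms of \<open>Gm\<close> and \<open>Dl\<close> can then be applied separately,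
  with the interchanges \<open>w\<close> and \<open>z\<close> in between.\<close>

lemma mdf_hc:
 assumes G: "modification A B Gm" and D: "modification A B Dl" and GD: "TCod (MDom Gm) = TDom (MDom Dl)"
 shows "modification A B (Dl\<star>\<^bsub>PsFun A B\<^esub>Gm)"
proof (rule modificationI)
 interpret t: psn_transf A B "MDom Gm" using mdf_psnat[OF A G] by (simp add: psnI)
 interpret t': psn_transf A B "MCod Gm" using mdf_psnat[OF A G] by (simp add: psnI)
 interpret s: psn_transf A B "MDom Dl" using mdf_psnat[OF A D] by (simp add: psnI)
 interpret s': psn_transf A B "MCod Dl" using mdf_psnat[OF A D] by (simp add: psnI)
 note [simp] = mdf_mo[OF A G] mdf_mo[OF A D] mdf_parallel[OF A G] mdf_parallel[OF A D] GD
 show "psnat A B (MDom (Dl\<star>\<^bsub>PsFun A B\<^esub>Gm))" "psnat A B (MCod (Dl\<star>\<^bsub>PsFun A B\<^esub>Gm))"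
  using s.psnat t.psnat s'.psnat t'.psnat by (auto intro!: psnat_comp)
 show "MO (Dl\<star>\<^bsub>PsFun A B\<^esub>Gm)\<in>extensional (Obj A)" by (simp add: PsFun_def)
 show "MO (Dl\<star>\<^bsub>PsFun A B\<^esub>Gm) X\<in>Hom2 B (TO (MDom (Dl\<star>\<^bsub>PsFun A B\<^esub>Gm)) X) (TO (MCod (Dl\<star>\<^bsub>PsFun A B\<^esub>Gm)) X)"
  if "X\<in>Obj A" for X using that by simp
 fix f assume f: "f\<in>Arr A"
 let ?i = "Idc B" let ?Y = "Tgt A f" let ?X = "Src A f" let ?F = "TDom (MDom Gm)" let ?G = "TDom (MDom Dl)" let ?K = "TCod (MDom Dl)"
 let ?t = "MDom Gm" let ?t' = "MCod Gm" let ?s = "MDom Dl" let ?s' = "MCod Dl"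
 have g: "(MO Gm ?Y\<star>?i (PA ?F f))\<bullet>TA ?t f = TA ?t' f\<bullet>(?i (PA ?G f)\<star>MO Gm ?X)"
  using mdf_natural[OF A G f] by simp
 have d: "(MO Dl ?Y\<star>?i (PA ?G f))\<bullet>TA ?s f = TA ?s' f\<bullet>(?i (PA ?K f)\<star>MO Dl ?X)"
  using mdf_natural[OF A D f] by simp
 have y: "MO Dl ?Y\<star>MO Gm ?Y = (MO Dl ?Y\<star>?i (TO ?t' ?Y))\<bullet>(?i (TO ?s ?Y)\<star>MO Gm ?Y)"
  using tc_hc_whisker(1)[OF B, of "MO Gm ?Y" "MO Dl ?Y"] f by simp
 have x: "MO Dl ?X\<star>MO Gm ?X = (MO Dl ?X\<star>?i (TO ?t' ?X))\<bullet>(?i (TO ?s ?X)\<star>MO Gm ?X)"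
  using tc_hc_whisker(1)[OF B, of "MO Gm ?X" "MO Dl ?X"] f by simp
 have w: "(MO Dl ?Y\<star>?i (TO ?t' ?Y\<odot>PA ?F f))\<bullet>(?i (TO ?s ?Y)\<star>TA ?t' f) = (?i (TO ?s' ?Y)\<star>TA ?t' f)\<bullet>(MO Dl ?Y\<star>?i (PA ?G f\<odot>TO ?t' ?X))"
  using tc_hc_whisker[OF B, of "TA ?t' f" "MO Dl ?Y"] f by simp
 have z: "(?i (TO ?s ?Y\<odot>PA ?G f)\<star>MO Gm ?X)\<bullet>(TA ?s f\<star>?i (TO ?t ?X)) = (TA ?s f\<star>?i (TO ?t' ?X))\<bullet>(?i (PA ?K f\<odot>TO ?s ?X)\<star>MO Gm ?X)"
  using tc_hc_whisker[OF B, of "MO Gm ?X" "TA ?s f"] f by simp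
 have "((MO Dl ?Y\<star>MO Gm ?Y)\<star>?i (PA ?F f))\<bullet>(?i (TO ?s ?Y)\<star>TA ?t f)\<bullet>(TA ?s f\<star>?i (TO ?t ?X)) =
  (MO Dl ?Y\<star>?i (TO ?t' ?Y\<odot>PA ?F f))\<bullet>(?i (TO ?s ?Y)\<star>((MO Gm ?Y\<star>?i (PA ?F f))\<bullet>TA ?t f))\<bullet>(TA ?s f\<star>?i (TO ?t ?X))"
  unfolding y using f by simp
 also have "... = ((MO Dl ?Y\<star>?i (TO ?t' ?Y\<odot>PA ?F f))\<bullet>(?i (TO ?s ?Y)\<star>TA ?t' f)) \<bullet>
  ((?i (TO ?s ?Y\<odot>PA ?G f)\<star>MO Gm ?X)\<bullet>(TA ?s f\<star>?i (TO ?t ?X)))"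
  unfolding g using f by simp
 also have "... = (?i (TO ?s' ?Y)\<star>TA ?t' f)\<bullet>(((MO Dl ?Y\<star>?i (PA ?G f))\<bullet>TA ?s f)\<star>?i (TO ?t' ?X))\<bullet>(?i (PA ?K f\<odot>TO ?s ?X)\<star>MO Gm ?X)"
  unfolding w z using f by simp
 also have "... = ((?i (TO ?s' ?Y)\<star>TA ?t' f)\<bullet>(TA ?s' f\<star>?i (TO ?t' ?X)))\<bullet>(?i (PA ?K f)\<star>(MO Dl ?X\<star>MO Gm ?X))"
  unfolding d x using f by simp
 finally show "(MO (Dl\<star>\<^bsub>PsFun A B\<^esub>Gm) ?Y\<star>?i (PA (TDom (MDom (Dl\<star>\<^bsub>PsFun A B\<^esub>Gm))) f))\<bullet>TA (MDom (Dl\<star>\<^bsub>PsFun A B\<^esub>Gm)) f =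
    TA (MCod (Dl\<star>\<^bsub>PsFun A B\<^esub>Gm)) f\<bullet>(?i (PA (TCod (MDom (Dl\<star>\<^bsub>PsFun A B\<^esub>Gm))) f)\<star>MO (Dl\<star>\<^bsub>PsFun A B\<^esub>Gm) ?X)"
  using f by (simp del: tc_hc_assoc)
qed (use mdf_parallel[OF A G] mdf_parallel[OF A D] GD in simp_all)

lemma psn_comp_assoc:
 assumes "psnat A B r" "psnat A B s" "psnat A B t" "TCod r = TDom s" "TCod s = TDom t"
 shows "psn_comp A B (psn_comp A B t s) r = psn_comp A B t (psn_comp A B s r)"
proof (rule psnat_eqI)
 interpret r: psn_transf A B r using assms by (simp add: psnI)
 interpret s: psn_transf A B s using assms by (simp add: psnI)
 interpret t: psn_transf A B t using assms by (simp add: psnI)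
 show "TO (psn_comp A B (psn_comp A B t s) r) X = TO (psn_comp A B t (psn_comp A B s r)) X" if "X\<in>Obj A" for X
  using that assms by simp
 show "TA (psn_comp A B (psn_comp A B t s) r) f = TA (psn_comp A B t (psn_comp A B s r)) f" if "f\<in>Arr A" for f
  using that assms by simp
qed (use assms in "auto intro!: psnat_comp")

lemma psn_comp_one:
 assumes "psnat A B t"
 shows "psn_comp A B t (One (PsFun A B) (TDom t)) = t" "psn_comp A B (One (PsFun A B) (TCod t)) t = t"
proof -
 interpret t: psn_transf A B t using assms by (simp add: psnI)
 show "psn_comp A B t (One (PsFun A B) (TDom t)) = t" "psn_comp A B (One (PsFun A B) (TCod t)) t = t"
  by - (rule psnat_eqI[of A B]; use assms t.F.pseudofunctor_axioms t.G.pseudofunctor_axioms in "auto intro!: psnat_comp psnat_one")+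
qed

lemma two_category_PsFun [simp]: "two_category (PsFun A B)"
proof (rule two_categoryI)
 fix t assume "t\<in>Arr (PsFun A B)"
 then have t: "psnat A B t" by simp
 interpret t: psn_transf A B t using t by (simp add: psnI)
 show "Src (PsFun A B) t\<in>Obj (PsFun A B) \<and> Tgt (PsFun A B) t\<in>Obj (PsFun A B)"
  using t.F.pseudofunctor_axioms t.G.pseudofunctor_axioms by simp
 show "Idc (PsFun A B) t\<in>Cel (PsFun A B) \<and> Dm (PsFun A B) (Idc (PsFun A B) t) = t \<and> Cd (PsFun A B) (Idc (PsFun A B) t) = t"
  using t by (simp add: mdf_id)
 show "t\<odot>\<^bsub>PsFun A B\<^esub>One (PsFun A B) (Src (PsFun A B) t) = t \<and> One (PsFun A B) (Tgt (PsFun A B) t)\<odot>\<^bsub>PsFun A B\<^esub>t = t"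
  using t by (simp add: psn_comp_one)
next
 fix Gm assume "Gm\<in>Cel (PsFun A B)"
 then have G: "modification A B Gm" by simp
 note P = mdf_psnat[OF A G] mdf_parallel[OF A G]
 interpret s: psn_transf A B "MDom Gm" using P by (simp add: psnI)
 interpret t: psn_transf A B "MCod Gm" using P by (simp add: psnI)
 show "Dm (PsFun A B) Gm\<in>Arr (PsFun A B) \<and> Cd (PsFun A B) Gm\<in>Arr (PsFun A B) \<and>
  Src (PsFun A B) (Cd (PsFun A B) Gm) = Src (PsFun A B) (Dm (PsFun A B) Gm) \<and> Tgt (PsFun A B) (Cd (PsFun A B) Gm) = Tgt (PsFun A B) (Dm (PsFun A B) Gm)"
  using P by simp
 show "Gm\<bullet>\<^bsub>PsFun A B\<^esub>Idc (PsFun A B) (Dm (PsFun A B) Gm) = Gm \<and> Idc (PsFun A B) (Cd (PsFun A B) Gm)\<bullet>\<^bsub>PsFun A B\<^esub>Gm = Gm"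
  using P G mdf_mo[OF A G] by (auto intro!: mdf_eqI mdf_vc mdf_id)
 show "Gm\<star>\<^bsub>PsFun A B\<^esub>Idc (PsFun A B) (One (PsFun A B) (Src (PsFun A B) (Dm (PsFun A B) Gm))) = Gm \<and>
  Idc (PsFun A B) (One (PsFun A B) (Tgt (PsFun A B) (Dm (PsFun A B) Gm)))\<star>\<^bsub>PsFun A B\<^esub>Gm = Gm"
  using P G mdf_mo[OF A G] psn_comp_one[OF P(1)] psn_comp_one[OF P(2)] s.F.pseudofunctor_axioms s.G.pseudofunctor_axioms
  by (auto intro!: mdf_eqI mdf_hc mdf_id psnat_one)
next
 fix al be gm assume "al\<in>Cel (PsFun A B)" "be\<in>Cel (PsFun A B)" "gm\<in>Cel (PsFun A B)"
  "Cd (PsFun A B) al = Dm (PsFun A B) be" "Cd (PsFun A B) be = Dm (PsFun A B) gm"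
 then show "(gm\<bullet>\<^bsub>PsFun A B\<^esub>be)\<bullet>\<^bsub>PsFun A B\<^esub>al = gm\<bullet>\<^bsub>PsFun A B\<^esub>(be\<bullet>\<^bsub>PsFun A B\<^esub>al)"
  using mdf_mo[OF A, of B al] mdf_mo[OF A, of B be] mdf_mo[OF A, of B gm] by (auto intro!: mdf_eqI mdf_vc)
next
 fix al be gm assume h: "al\<in>Cel (PsFun A B)" "be\<in>Cel (PsFun A B)" "gm\<in>Cel (PsFun A B)"
  "Tgt (PsFun A B) (Dm (PsFun A B) al) = Src (PsFun A B) (Dm (PsFun A B) be)"
  "Tgt (PsFun A B) (Dm (PsFun A B) be) = Src (PsFun A B) (Dm (PsFun A B) gm)"
 note P = mdf_psnat[OF A, of B al] mdf_psnat[OF A, of B be] mdf_psnat[OF A, of B gm]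
  mdf_parallel[OF A, of B al] mdf_parallel[OF A, of B be] mdf_parallel[OF A, of B gm]
 interpret a: psn_transf A B "MDom al" using h P by (simp add: psnI)
 interpret b: psn_transf A B "MDom be" using h P by (simp add: psnI)
 interpret c: psn_transf A B "MDom gm" using h P by (simp add: psnI)
 show "(gm\<star>\<^bsub>PsFun A B\<^esub>be)\<star>\<^bsub>PsFun A B\<^esub>al = gm\<star>\<^bsub>PsFun A B\<^esub>(be\<star>\<^bsub>PsFun A B\<^esub>al)"
  using h P mdf_mo[OF A, of B al] mdf_mo[OF A, of B be] mdf_mo[OF A, of B gm]
  by (auto intro!: mdf_eqI mdf_hc psn_comp_assoc)
next
 fix s t assume h: "s\<in>Arr (PsFun A B)" "t\<in>Arr (PsFun A B)" "Tgt (PsFun A B) s = Src (PsFun A B) t"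
 interpret s: psn_transf A B s using h by (simp add: psnI)
 interpret t: psn_transf A B t using h by (simp add: psnI)
 show "Idc (PsFun A B) t\<star>\<^bsub>PsFun A B\<^esub>Idc (PsFun A B) s = Idc (PsFun A B) (t\<odot>\<^bsub>PsFun A B\<^esub>s)"
  using h by (auto intro!: mdf_eqI mdf_hc mdf_id psnat_comp)
next
 fix al al' be be' assume h: "al\<in>Cel (PsFun A B)" "al'\<in>Cel (PsFun A B)" "be\<in>Cel (PsFun A B)" "be'\<in>Cel (PsFun A B)"
  "Cd (PsFun A B) al = Dm (PsFun A B) al'" "Cd (PsFun A B) be = Dm (PsFun A B) be'"
  "Tgt (PsFun A B) (Dm (PsFun A B) al) = Src (PsFun A B) (Dm (PsFun A B) be)"
 note P = mdf_psnat[OF A, of B al] mdf_psnat[OF A, of B be] mdf_psnat[OF A, of B al'] mdf_psnat[OF A, of B be']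
  mdf_parallel[OF A, of B al] mdf_parallel[OF A, of B be] mdf_parallel[OF A, of B al'] mdf_parallel[OF A, of B be']
 interpret a: psn_transf A B "MDom al" using h P by (simp add: psnI)
 interpret b: psn_transf A B "MDom be" using h P by (simp add: psnI)
 have e: "TCod (MDom al') = TDom (MDom be')" 
  using h P(9)[of] mdf_parallel[OF A, of B al] mdf_parallel[OF A, of B be] by (metis PsFun_simps(3-7) mem_Collect_eq)
 show "(be'\<bullet>\<^bsub>PsFun A B\<^esub>be)\<star>\<^bsub>PsFun A B\<^esub>(al'\<bullet>\<^bsub>PsFun A B\<^esub>al) = (be'\<star>\<^bsub>PsFun A B\<^esub>al')\<bullet>\<^bsub>PsFun A B\<^esub>(be\<star>\<^bsub>PsFun A B\<^esub>al)"
 proof (rule mdf_eqI[OF A])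
  fix X assume X: "X\<in>Obj A"
  show "MO ((be'\<bullet>\<^bsub>PsFun A B\<^esub>be)\<star>\<^bsub>PsFun A B\<^esub>(al'\<bullet>\<^bsub>PsFun A B\<^esub>al)) X = MO ((be'\<star>\<^bsub>PsFun A B\<^esub>al')\<bullet>\<^bsub>PsFun A B\<^esub>(be\<star>\<^bsub>PsFun A B\<^esub>al)) X"
   using tc_interchange[OF B, of "MO al X" "MO al' X" "MO be X" "MO be' X"] h X
    mdf_mo[OF A, of B al] mdf_mo[OF A, of B be] mdf_mo[OF A, of B al'] mdf_mo[OF A, of B be']
   by simp
 qed (use h e in "auto intro!: mdf_vc mdf_hc")
qed (auto intro!: mdf_vc mdf_hc psnat_comp psnat_one psn_comp_assoc)

end

section \<open>Precomposition\<close>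

lemma psn_pre_simps [simp]: "TDom (psn_pre A B J t) = psf_comp A B (TDom t) J" "TCod (psn_pre A B J t) = psf_comp A B (TCod t) J"
 "X\<in>Obj A ==> TO (psn_pre A B J t) X = TO t (PO J X)" "f\<in>Arr A ==> TA (psn_pre A B J t) f = TA t (PA J f)"
 by (simp_all add: psn_pre_def compose_def)

lemma mdf_pre_simps [simp]: "MDom (mdf_pre A B J Gm) = psn_pre A B J (MDom Gm)" "MCod (mdf_pre A B J Gm) = psn_pre A B J (MCod Gm)"
 "X\<in>Obj A ==> MO (mdf_pre A B J Gm) X = MO Gm (PO J X)"
 by (simp_all add: mdf_pre_def compose_def)

context
 fixes A :: "('o, 'a, 'c) twocat" and A' :: "('q, 'e, 'k) twocat" and B :: "('p, 'b, 'd) twocat" (structure)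
  and J :: "('o, 'a, 'c, 'q, 'e, 'k) psf"
 assumes A [simp]: "two_category A" and A' [simp]: "two_category A'" and B [simp]: "two_category B"
  and J: "pseudofunctor A A' J"
begin

interpretation J: pseudofunctor A A' J by (rule J)

text \<open>The constraints of the composites with \<open>J\<close> contain images of the
  constraints of \<open>J\<close>. Naturality of \<open>t\<close> in 2-cells carries these images
  across, and the corresponding axiom of \<open>t\<close> finishes.\<close>

lemma psnat_pre:
 assumes t: "psnat A' B t"
 shows "psnat A B (psn_pre A B J t)"
proof (rule psnatI)
 interpret t: psn_transf A' B t using t by (simp add: psnI)
 show "pseudofunctor A B (TDom (psn_pre A B J t))" "pseudofunctor A B (TCod (psn_pre A B J t))"
  using pseudofunctor_comp[OF A A' B J] t.F.pseudofunctor_axioms t.G.pseudofunctor_axioms by simp_all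
 show "TO (psn_pre A B J t)\<in>extensional (Obj A)" "TA (psn_pre A B J t)\<in>extensional (Arr A)"
  by (simp_all add: psn_pre_def compose_def)
 show "TO (psn_pre A B J t) X\<in>Hom1 B (PO (TDom (psn_pre A B J t)) X) (PO (TCod (psn_pre A B J t)) X)"
  if "X\<in>Obj A" for X using that by simp
 show "TA (psn_pre A B J t) f\<in>Hom2 B (PA (TCod (psn_pre A B J t)) f\<odot>TO (psn_pre A B J t) (Src A f))
   (TO (psn_pre A B J t) (Tgt A f)\<odot>PA (TDom (psn_pre A B J t)) f) \<and> inv_cell B (TA (psn_pre A B J t) f)"
  if "f\<in>Arr A" for f using that by simp
 show "(Idc B (TO (psn_pre A B J t) (Tgt A (Dm A th)))\<star>PC (TDom (psn_pre A B J t)) th)\<bullet>TA (psn_pre A B J t) (Dm A th) =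
    TA (psn_pre A B J t) (Cd A th)\<bullet>(PC (TCod (psn_pre A B J t)) th\<star>Idc B (TO (psn_pre A B J t) (Src A (Dm A th))))"
  if "th\<in>Cel A" for th using that t.natural[of "PC J th"] by simp
 show "TA (psn_pre A B J t) (One A X)\<bullet>(PU (TCod (psn_pre A B J t)) X\<star>Idc B (TO (psn_pre A B J t) X)) =
    Idc B (TO (psn_pre A B J t) X)\<star>PU (TDom (psn_pre A B J t)) X" if X: "X\<in>Obj A" for X
 proof -
  have "TA t (PA J (One A X))\<bullet>((PC (TCod t) (PU J X)\<bullet>PU (TCod t) (PO J X))\<star>Idc B (TO t (PO J X))) =
   (TA t (PA J (One A X))\<bullet>(PC (TCod t) (PU J X)\<star>Idc B (TO t (PO J X))))\<bullet>(PU (TCod t) (PO J X)\<star>Idc B (TO t (PO J X)))"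
   using X by simp
  also have "... = (Idc B (TO t (PO J X))\<star>PC (TDom t) (PU J X))\<bullet>(TA t (One A' (PO J X))\<bullet>(PU (TCod t) (PO J X)\<star>Idc B (TO t (PO J X))))"
   using t.natural[of "PU J X"] X by (simp flip: tc_vc_assoc)
  also have "... = Idc B (TO t (PO J X))\<star>(PC (TDom t) (PU J X)\<bullet>PU (TDom t) (PO J X))"
   using t.unit[of "PO J X"] X by simp
  finally show ?thesis using X by simp
 qed
 fix f g assume h: "f\<in>Arr A" "g\<in>Arr A" "Tgt A f = Src A g"
 let ?F = "TDom t" let ?G = "TCod t" let ?X = "PO J (Src A f)" let ?Z = "PO J (Tgt A g)" let ?i = "Idc B"
 have n: "TA t (PA J (g\<odot>\<^bsub>A\<^esub>f))\<bullet>(PC ?G (PM J g f)\<star>?i (TO t ?X)) = (?i (TO t ?Z)\<star>PC ?F (PM J g f))\<bullet>TA t (PA J g\<odot>\<^bsub>A'\<^esub>PA J f)"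
  using t.natural[of "PM J g f"] h by simp
 have c: "TA t (PA J g\<odot>\<^bsub>A'\<^esub>PA J f)\<bullet>(PM ?G (PA J g) (PA J f)\<star>?i (TO t ?X)) =
  (?i (TO t ?Z)\<star>PM ?F (PA J g) (PA J f))\<bullet>(TA t (PA J g)\<star>?i (PA ?F (PA J f)))\<bullet>(?i (PA ?G (PA J g))\<star>TA t (PA J f))"
  using t.comp[of "PA J f" "PA J g"] h by simp
 have "TA t (PA J (g\<odot>\<^bsub>A\<^esub>f))\<bullet>((PC ?G (PM J g f)\<bullet>PM ?G (PA J g) (PA J f))\<star>?i (TO t ?X)) =
  (TA t (PA J (g\<odot>\<^bsub>A\<^esub>f))\<bullet>(PC ?G (PM J g f)\<star>?i (TO t ?X)))\<bullet>(PM ?G (PA J g) (PA J f)\<star>?i (TO t ?X))"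
  using h by simp
 also have "... = (?i (TO t ?Z)\<star>PC ?F (PM J g f))\<bullet>(TA t (PA J g\<odot>\<^bsub>A'\<^esub>PA J f)\<bullet>(PM ?G (PA J g) (PA J f)\<star>?i (TO t ?X)))"
  unfolding n using h by simp
 also have "... = (?i (TO t ?Z)\<star>(PC ?F (PM J g f)\<bullet>PM ?F (PA J g) (PA J f)))\<bullet>(TA t (PA J g)\<star>?i (PA ?F (PA J f)))\<bullet>(?i (PA ?G (PA J g))\<star>TA t (PA J f))"
  unfolding c using h by simp
 finally show "TA (psn_pre A B J t) (g\<odot>\<^bsub>A\<^esub>f)\<bullet>(PM (TCod (psn_pre A B J t)) g f\<star>?i (TO (psn_pre A B J t) (Src A f))) =
    (?i (TO (psn_pre A B J t) (Tgt A g))\<star>PM (TDom (psn_pre A B J t)) g f)\<bullet>(TA (psn_pre A B J t) g\<star>?i (PA (TDom (psn_pre A B J t)) f)) \<bullet>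
     (?i (PA (TCod (psn_pre A B J t)) g)\<star>TA (psn_pre A B J t) f)"
  using h by simp
qed

lemma modification_pre:
 assumes G: "modification A' B Gm"
 shows "modification A B (mdf_pre A B J Gm)"
proof (rule modificationI)
 show "psnat A B (MDom (mdf_pre A B J Gm))" "psnat A B (MCod (mdf_pre A B J Gm))"
  using mdf_psnat[OF A' G] psnat_pre by simp_all
 interpret s: psn_transf A' B "MDom Gm" using mdf_psnat[OF A' G] by (simp add: psnI)
 interpret t: psn_transf A' B "MCod Gm" using mdf_psnat[OF A' G] by (simp add: psnI)
 note [simp] = mdf_mo[OF A' G] mdf_parallel[OF A' G]
 show "MO (mdf_pre A B J Gm)\<in>extensional (Obj A)" by (simp add: mdf_pre_def compose_def)
 show "MO (mdf_pre A B J Gm) X\<in>Hom2 B (TO (MDom (mdf_pre A B J Gm)) X) (TO (MCod (mdf_pre A B J Gm)) X)"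
  if "X\<in>Obj A" for X using that by simp
 show "(MO (mdf_pre A B J Gm) (Tgt A f)\<star>Idc B (PA (TDom (MDom (mdf_pre A B J Gm))) f))\<bullet>TA (MDom (mdf_pre A B J Gm)) f =
     TA (MCod (mdf_pre A B J Gm)) f\<bullet>(Idc B (PA (TCod (MDom (mdf_pre A B J Gm))) f)\<star>MO (mdf_pre A B J Gm) (Src A f))"
  if "f\<in>Arr A" for f using that mdf_natural[OF A' G, of "PA J f"] by simp
qed (use mdf_parallel[OF A' G] in simp_all)

text \<open>Transformations and modifications compose componentwise, so reindexing their components
  along \<open>J\<close> preserves composition strictly.\<close>

lemma pseudofunctor_pre:
 "pseudofunctor (OpT (PsFun A' B)) (OpT (PsFun A B))
  (strict_psf (OpT (PsFun A' B)) (OpT (PsFun A B)) (\<lambda>S. psf_comp A B S J) (psn_pre A B J) (mdf_pre A B J))"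
proof -
 let ?x = "OpT (PsFun A' B)"
 have [simp]: "pseudofunctor A B (psf_comp A B F J)" if "pseudofunctor A' B F" for F
  using pseudofunctor_comp[OF A A' B J that] .
 have pf: "pseudofunctor A' B (TDom t)" "pseudofunctor A' B (TCod t)" if "psnat A' B t" for t
  using that by (simp_all add: psnat_def Let_def)
 have one: "psn_pre A B J (One (PsFun A' B) F) = One (PsFun A B) (psf_comp A B F J)" if "pseudofunctor A' B F" for F
  by (rule psnat_eqI[of A B]) (use that in "auto intro!: psnat_pre psnat_one")
 have comp: "psn_pre A B J (psn_comp A' B g f) = psn_comp A B (psn_pre A B J g) (psn_pre A B J f)"
  if "psnat A' B f" "psnat A' B g" "TCod f = TDom g" for f g
  by (rule psnat_eqI[of A B]) (use that in "auto intro!: psnat_pre psnat_comp")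
 note m = mdf_psnat[OF A'] mdf_parallel[OF A']
 show ?thesis
 proof (rule pseudofunctor_strict)
  fix f g assume "f\<in>Arr ?x" "g\<in>Arr ?x" "Tgt ?x f = Src ?x g"
  then show "psn_pre A B J (g\<odot>\<^bsub>OpT (PsFun A' B)\<^esub>f) = psn_pre A B J g\<odot>\<^bsub>OpT (PsFun A B)\<^esub>psn_pre A B J f"
   by (simp add: comp)
 next
  fix th xi assume "th\<in>Cel ?x" "xi\<in>Cel ?x" "Cd ?x th = Dm ?x xi"
  then show "mdf_pre A B J (xi\<bullet>\<^bsub>OpT (PsFun A' B)\<^esub>th) = mdf_pre A B J xi\<bullet>\<^bsub>OpT (PsFun A B)\<^esub>mdf_pre A B J th"
   by (auto intro!: mdf_eqI[of A B] modification_pre mdf_vc)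
 next
  fix th xi assume h: "th\<in>Cel ?x" "xi\<in>Cel ?x"
   "Tgt ?x (Dm ?x th) = Src ?x (Dm ?x xi)"
  then show "mdf_pre A B J (xi\<star>\<^bsub>OpT (PsFun A' B)\<^esub>th) = mdf_pre A B J xi\<star>\<^bsub>OpT (PsFun A B)\<^esub>mdf_pre A B J th"
   using m[of B th] m[of B xi] by (auto intro!: mdf_eqI[of A B] modification_pre mdf_hc simp: comp)
 next
  fix th assume "th\<in>Cel ?x"
  then show "mdf_pre A B J th\<in>Hom2 (OpT (PsFun A B)) (psn_pre A B J (Dm ?x th)) (psn_pre A B J (Cd ?x th))"
   by (simp add: modification_pre)
 next
  fix f assume "f\<in>Arr ?x"
  then show "mdf_pre A B J (Idc ?x f) = Idc (OpT (PsFun A B)) (psn_pre A B J f)"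
   by (auto intro!: mdf_eqI[of A B] modification_pre mdf_id psnat_pre)
 qed (use one psnat_pre in auto)
qed

end

section \<open>The bicategorical Yoneda lemma\<close>

text \<open>A birepresentation given by one object \<open>c\<close> of \<open>G L\<close>:
  evaluation of \<open>G\<close> at \<open>c\<close> is essentially surjective and fully faithful
  over every \<open>X\<close>. Here \<open>G\<close> is contravariant, that is, defined on
  \<open>OpT K\<close>.\<close>

definition universal_elt :: "('p, 'b, 'd) twocat => ('p, 'b, 'd, 'x, 'y) catpsf => 'p => 'x => bool" where
 "universal_elt K G L c \<longleftrightarrow> L\<in>Obj K \<and> c\<in>Ob (PO G L) \<and>
   (\<forall>X\<in>Obj K. (\<forall>z\<in>Ob (PO G X). \<exists>f\<in>Hom1 K X L. isomorphic_in (PO G X) (FOb (PA G f) c) z) \<and>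
    (\<forall>f\<in>Hom1 K X L. \<forall>g\<in>Hom1 K X L.
     bij_betw (\<lambda>al. NAt (PC G al) c) (Hom2 K f g) (Hom (PO G X) (FOb (PA G f) c) (FOb (PA G g) c))))"

text \<open>\<open>c\<close> is the image of the identity of \<open>L\<close>. The cell of
  \<open>e\<close> over \<open>f\<close>, read at that identity, is an isomorphism from
  \<open>G f c\<close> to \<open>e f\<close>; through it evaluation at \<open>c\<close> inherits
  both properties from the components of \<open>e\<close>.\<close>

lemma universal_elt_of_equivalence:
 fixes e :: "('p, 'b, 'd, 'b, 'd, 'x, 'y) catpsnt" and K :: "('p, 'b, 'd) twocat"
 assumes K [simp]: "two_category K" and L [simp]: "L\<in>Obj K"
  and e: "cat_psnat_equivalence (OpT K) e" "TDom e = yo (OpT K) L" "TCod e = G"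
 shows "\<exists>c. universal_elt K G L c"
proof -
 have ep: "cat_psnat (OpT K) e" using e by (simp add: cat_psnat_equivalence_def)
 have "pseudofunctor (OpT K) CAT G" using ep e unfolding cat_psnat_def Let_def by simp
 then interpret G: pseudofunctor "OpT K" CAT G .
 have eo: "is_functor (TO e X)" "FDom (TO e X) = HomC K X L" "FCod (TO e X) = PO G X" "cat_equivalence (TO e X)"
  if "X\<in>Obj K" for X
  using ep e that unfolding cat_psnat_def cat_psnat_equivalence_def Let_def PiE_iff by (auto simp: yo_eq)
 define c where "c = FOb (TO e L) (One K L)"
 have c: "c\<in>Ob (PO G L)" unfolding c_def using eo[OF L] by simp
 define ph where "ph f = NAt (TA e f) (One K L)" for f
 have ta: "nat_iso (TA e f)" "NDom (TA e f) = PA G f \<circ>\<^sub>F TO e L" "NCod (TA e f) = TO e X \<circ>\<^sub>F yo_arr (OpT K) L f"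
  if "f\<in>Hom1 K X L" for f X
  using ep e that unfolding cat_psnat_def Let_def PiE_iff by (auto simp: yo_eq)
 have GF: "FDom (PA G f) = PO G L" "FCod (PA G f) = PO G X" "is_functor (PA G f)" "category (PO G X)" "X\<in>Obj K" if "f\<in>Hom1 K X L" for f X
  using that G.arr[of f] G.po_in[of X] by auto
 have phi: "cat_iso (PO G X) (ph f)" "Dom (PO G X) (ph f) = FOb (PA G f) c" "Cod (PO G X) (ph f) = FOb (TO e X) f"
  if f: "f\<in>Hom1 K X L" for f X
 proof -
  note t = ta[OF f] note g = GF[OF f] note l = eo[OF L]
  have o: "One K L\<in>Ob (FDom (NDom (TA e f)))" by (simp add: t l)
  have nt: "nat_trans (TA e f)" using t(1) by (simp add: nat_iso_iff)
  have fc: "FCod (NDom (TA e f)) = PO G X" by (simp add: t g)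
  show "cat_iso (PO G X) (ph f)" using t(1) o fc unfolding nat_iso_iff ph_def by auto
  show "Dom (PO G X) (ph f) = FOb (PA G f) c" "Cod (PO G X) (ph f) = FOb (TO e X) f"
   using nat_trans_at[OF nt fc o] f unfolding ph_def t c_def by (simp_all add: l)
 qed
 \<comment> \<open>Naturality of \<open>e\<close> in the 2-cell \<open>al\<close>, read off at the
   identity 1-cell of \<open>L\<close>.\<close>
 have nat: "FAr (TO e X) al\<cdot>\<^bsub>PO G X\<^esub>ph f = ph g\<cdot>\<^bsub>PO G X\<^esub>NAt (PC G al) c"
  if f: "f\<in>Hom1 K X L" and g: "g\<in>Hom1 K X L" and a: "al\<in>Hom2 K f g" for f g X al
 proof -
  have X: "X\<in>Obj K" using f by auto
  have "\<forall>X\<in>Obj (OpT K). \<forall>Y\<in>Obj (OpT K). \<forall>f\<in>Hom1 (OpT K) X Y. \<forall>g\<in>Hom1 (OpT K) X Y. \<forall>th\<in>Hom2 (OpT K) f g.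
    (nid (TO e Y) \<star>\<^sub>N PC (yo (OpT K) L) th) \<bullet>\<^sub>N TA e f = TA e g \<bullet>\<^sub>N (PC G th \<star>\<^sub>N nid (TO e X))"
   using ep e unfolding cat_psnat_def Let_def by (elim conjE) simp
  from this[rule_format, of L X f g al] have "(nid (TO e X) \<star>\<^sub>N PC (yo (OpT K) L) al) \<bullet>\<^sub>N TA e f = TA e g \<bullet>\<^sub>N (PC G al \<star>\<^sub>N nid (TO e L))"
   using f g a X by auto
  then have "(nid (TO e X) \<star>\<^sub>N yo_cel (OpT K) L al) \<bullet>\<^sub>N TA e f = TA e g \<bullet>\<^sub>N (PC G al \<star>\<^sub>N nid (TO e L))"
   using f g a by (auto simp: yo_eq)
  then have "NAt ((nid (TO e X) \<star>\<^sub>N yo_cel (OpT K) L al) \<bullet>\<^sub>N TA e f) (One K L) = NAt (TA e g \<bullet>\<^sub>N (PC G al \<star>\<^sub>N nid (TO e L))) (One K L)"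
   by simp
  moreover have "NAt (PC G al) c\<in>Ar (PO G X)" "Dom (PO G X) (NAt (PC G al) c) = FOb (PA G f) c" "NDom (PC G al) = PA G f"
   using G.cel[of al] a f GF[OF f] c by (auto)
  ultimately show ?thesis
   using f g a eo[OF X] eo[OF L] GF[OF f] GF[OF g] phi[OF f] phi[OF g] ta[OF f] ta[OF g] c G.cel[of al]
   by (simp add: ph_def[symmetric] c_def[symmetric])
 qed
 have "universal_elt K G L c"
  unfolding universal_elt_def
 proof (intro conjI ballI)
  fix X z assume X: "X\<in>Obj K" and z: "z\<in>Ob (PO G X)"
  obtain f where f: "f\<in>Hom1 K X L" "isomorphic_in (PO G X) (FOb (TO e X) f) z"
   using cat_equivalence_surj[OF eo(4)[OF X] eo(2)[OF X] eo(3)[OF X] z] by auto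
  then show "\<exists>f\<in>Hom1 K X L. isomorphic_in (PO G X) (FOb (PA G f) c) z"
   using phi[OF f(1)] GF[OF f(1)] by (intro bexI[of _ f] isomorphic_trans[OF _ _ f(2)]) (auto simp: isomorphic_in_def)
 next
  fix X f g assume X: "X\<in>Obj K" and f: "f\<in>Hom1 K X L" and g: "g\<in>Hom1 K X L"
  let ?D = "PO G X"
  have D: "category ?D" using GF[OF f] by simp
  have b: "bij_betw (FAr (TO e X)) (Hom2 K f g) (Hom ?D (FOb (TO e X) f) (FOb (TO e X) g))"
  proof -
   have "Hom (HomC K X L) f g = Hom2 K f g" using f by auto
   then show ?thesis using cat_equivalence_bij[OF eo(4)[OF X] eo(2)[OF X] eo(3)[OF X], of f g] f g by simp
  qed
  have ga: "NAt (PC G al) c\<in>Hom ?D (FOb (PA G f) c) (FOb (PA G g) c)" if "al\<in>Hom2 K f g" for al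
   using G.cel[of al] that f GF[OF f] c by auto
  note iv = cat_inv[OF phi(1)[OF g]]
  have eq: "NAt (PC G al) c = cat_inv ?D (ph g)\<cdot>\<^bsub>?D\<^esub>FAr (TO e X) al\<cdot>\<^bsub>?D\<^esub>ph f" if "al\<in>Hom2 K f g" for al
   using nat[OF f g that] ga[OF that] D phi[OF g] iv by simp
  \<comment> \<open>Conjugation by the isomorphisms \<open>ph\<close> turns the bijection given by
    \<open>e\<close> into the one for evaluation at \<open>c\<close>.\<close>
  have b2: "bij_betw (\<lambda>h. cat_inv ?D (ph g)\<cdot>\<^bsub>?D\<^esub>h\<cdot>\<^bsub>?D\<^esub>ph f) (Hom ?D (FOb (TO e X) f) (FOb (TO e X) g)) (Hom ?D (FOb (PA G f) c) (FOb (PA G g) c))"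
   using D phi[OF f] phi[OF g] cat_inv[OF phi(1)[OF f]] iv
   by (intro bij_betw_byWitness[where f'="\<lambda>h. ph g\<cdot>\<^bsub>?D\<^esub>h\<cdot>\<^bsub>?D\<^esub>cat_inv ?D (ph f)"]) auto
  show "bij_betw (\<lambda>al. NAt (PC G al) c) (Hom2 K f g) (Hom ?D (FOb (PA G f) c) (FOb (PA G g) c))"
   using bij_betw_trans[OF b b2] eq by (subst bij_betw_cong) (auto simp: comp_def)
 qed (use c in auto)
 then show ?thesis ..
qed

section \<open>Evaluation at an element as a transformation\<close>

definition yoneda_fun :: "('p, 'b, 'd) twocat => ('p, 'b, 'd, 'x, 'y) catpsf => 'p => 'x => 'p => ('b, 'd, 'x, 'y) fctr" where
 "yoneda_fun K G L c X = \<lparr>FDom = HomC K X L, FCod = PO G X,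
   FOb = (\<lambda>f\<in>Ob (HomC K X L). FOb (PA G f) c), FAr = (\<lambda>al\<in>Ar (HomC K X L). NAt (PC G al) c)\<rparr>"

text \<open>The cells over 1-cells are identities; this gives a transformation when \<open>G\<close>
  preserves composition of 1-cells strictly.\<close>

definition yoneda_tr :: "('p, 'b, 'd) twocat => ('p, 'b, 'd, 'x, 'y) catpsf => 'p => 'x => ('p, 'b, 'd, 'b, 'd, 'x, 'y) catpsnt" where
 "yoneda_tr K G L c = \<lparr>TDom = yo (OpT K) L, TCod = G, TO = restrict (yoneda_fun K G L c) (Obj K),
   TA = (\<lambda>u\<in>Arr K. nid (PA G u \<circ>\<^sub>F yoneda_fun K G L c (Tgt K u)))\<rparr>"

context
 fixes K :: "('p, 'b, 'd) twocat" (structure) and G :: "('p, 'b, 'd, 'x, 'y) catpsf"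
 assumes K [simp]: "two_category K" and G: "pseudofunctor (OpT K) CAT G"
begin

interpretation G: pseudofunctor "OpT K" CAT G by (rule G)

lemma contra_arr: "f\<in>Arr K ==> is_functor (PA G f)" "f\<in>Arr K ==> FDom (PA G f) = PO G (Tgt K f)"
 "f\<in>Arr K ==> FCod (PA G f) = PO G (Src K f)" "X\<in>Obj K ==> category (PO G X)"
 using G.arr[of f] G.po_in[of X] by simp_all

lemma contra_cel: "al\<in>Cel K ==> nat_trans (PC G al)" "al\<in>Cel K ==> NDom (PC G al) = PA G (Dm K al)"
 "al\<in>Cel K ==> NCod (PC G al) = PA G (Cd K al)"
 using G.cel[of al] by simp_all

lemma contra_cel_at:
 assumes "al\<in>Cel K" "c\<in>Ob (PO G (Tgt K (Dm K al)))" "Src K (Dm K al) = X"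
 shows "NAt (PC G al) c\<in>Ar (PO G X)" "Dom (PO G X) (NAt (PC G al) c) = FOb (PA G (Dm K al)) c"
  "Cod (PO G X) (NAt (PC G al) c) = FOb (PA G (Cd K al)) c"
 using nat_trans_at[OF contra_cel(1)[OF assms(1)], of "PO G X" c] assms by (simp_all add: contra_cel contra_arr)

lemma contra_vc_at:
 assumes "al\<in>Cel K" "be\<in>Cel K" "Cd K al = Dm K be" "c\<in>Ob (PO G (Tgt K (Dm K al)))" "Src K (Dm K al) = X"
 shows "NAt (PC G (be\<bullet>al)) c = NAt (PC G be) c\<cdot>\<^bsub>PO G X\<^esub>NAt (PC G al) c"
 using G.vc[of al be] assms by (simp add: contra_cel contra_arr)

lemma contra_idc_at:
 assumes "f\<in>Arr K" "c\<in>Ob (PO G (Tgt K f))" "Src K f = X"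
 shows "NAt (PC G (Idc K f)) c = Id (PO G X) (FOb (PA G f) c)"
 using G.pc_idc[of f] assms by (simp add: contra_arr)

text \<open>Evaluation at \<open>c\<close> is fully faithful, and fully faithful functors reflect
  isomorphism.\<close>

lemma universal_elt_reflect:
 assumes u: "universal_elt K G L c" and f: "f\<in>Hom1 K X L" "g\<in>Hom1 K X L"
  and i: "isomorphic_in (PO G X) (FOb (PA G f) c) (FOb (PA G g) c)"
 shows "\<exists>al\<in>Hom2 K f g. inv_cell K al"
proof -
 have X: "X\<in>Obj K" using f by auto
 have c: "c\<in>Ob (PO G L)" "L\<in>Obj K" using u by (simp_all add: universal_elt_def)
 have b: "bij_betw (\<lambda>al. NAt (PC G al) c) (Hom2 K f g) (Hom (PO G X) (FOb (PA G f) c) (FOb (PA G g) c))"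
  if "f\<in>Hom1 K X L" "g\<in>Hom1 K X L" for f g using u X that unfolding universal_elt_def by blast
 obtain h where h: "cat_iso (PO G X) h" "Dom (PO G X) h = FOb (PA G f) c" "Cod (PO G X) h = FOb (PA G g) c"
  using i unfolding isomorphic_in_def by blast
 note iv = cat_inv[OF h(1)]
 have "h\<in>(\<lambda>al. NAt (PC G al) c) ` Hom2 K f g"
  unfolding bij_betw_imp_surj_on[OF b[OF f]] using h by simp
 then obtain al where a: "al\<in>Hom2 K f g" "NAt (PC G al) c = h" by blast
 have "cat_inv (PO G X) h\<in>Hom (PO G X) (FOb (PA G g) c) (FOb (PA G f) c)" using h(2,3) iv(1-3) by simp
 then have "cat_inv (PO G X) h\<in>(\<lambda>al. NAt (PC G al) c) ` Hom2 K g f"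
  unfolding bij_betw_imp_surj_on[OF b[OF f(2,1)]] .
 then obtain be where b'': "cat_inv (PO G X) h = NAt (PC G be) c" "be\<in>Hom2 K g f" by (rule imageE)
 note b' = b''(2) b''(1)[symmetric]
 have inj: "al = be" if "al\<in>Hom2 K f f" "be\<in>Hom2 K f f" "NAt (PC G al) c = NAt (PC G be) c" "f\<in>Hom1 K X L" for al be f
  using b[OF that(4,4)] that(1-3) unfolding bij_betw_def inj_on_def by blast
 have "be\<bullet>al = Idc K f"
  by (rule inj[of _ f]) (use a b' f c(1) h(2) iv(4) contra_vc_at[of al be c X] contra_idc_at[of f c X] in auto)
 moreover have "al\<bullet>be = Idc K g"
  by (rule inj[of _ g]) (use a b' f c(1) h(3) iv(5) contra_vc_at[of be al c X] contra_idc_at[of g c X] in auto)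
 ultimately have "inv_cell K al" using a b' by (intro inv_cellI[OF K, of _ be]) auto
 then show ?thesis using a by blast
qed

lemma functor_isomorphic:
 assumes "is_functor F" "FDom F = C" "FCod F = D" "isomorphic_in C a b"
 shows "isomorphic_in D (FOb F a) (FOb F b)"
proof -
 obtain h where "cat_iso C h" "Dom C h = a" "Cod C h = b" using assms(4) unfolding isomorphic_in_def by blast
 then show ?thesis unfolding isomorphic_in_def using assms functor_iso[OF assms(1-3), of h]
  by (intro exI[of _ "FAr F h"]) auto
qed

text \<open>Each of the two elements is reached from the other by a 1-cell. The composites of these
  1-cells fix the elements up to isomorphism and are therefore isomorphic to identities.\<close>

lemma universal_elt_unique:
 assumes u: "universal_elt K G L c" and u': "universal_elt K G L' c'"
 shows "equivalent_in K L L'"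
proof -
 \<comment> \<open>Up to isomorphism \<open>f\<odot>g\<close> sends \<open>c\<close> to
   \<open>G g (G f c)\<close> by the composition constraint, then to \<open>G g c'\<close>, then to
   \<open>c\<close>; the unit constraint says the same of the identity. Reflection turns this into a
   2-cell. The statement is used twice, with the roles exchanged.\<close>
 have half: "\<exists>al\<in>Hom2 K (f\<odot>g) (One K L). inv_cell K al"
  if u: "universal_elt K G L c" and c': "c'\<in>Ob (PO G L')" and f: "f\<in>Hom1 K L' L" "isomorphic_in (PO G L') (FOb (PA G f) c) c'"
   and g: "g\<in>Hom1 K L L'" "isomorphic_in (PO G L) (FOb (PA G g) c') c" for L L' f g c c'
 proof (rule universal_elt_reflect[OF u])
  have c: "c\<in>Ob (PO G L)" and L: "L\<in>Obj K" using u by (simp_all add: universal_elt_def)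
  have D: "category (PO G L)" using L by (simp add: contra_arr)
  show "f\<odot>g\<in>Hom1 K L L" "One K L\<in>Hom1 K L L" using f g L by auto
  have pm: "nat_iso (PM G g f)" "NDom (PM G g f) = PA G g \<circ>\<^sub>F PA G f" "NCod (PM G g f) = PA G (f\<odot>g)"
   using G.pm[of f g] f g by simp_all
  have "c\<in>Ob (FDom (NDom (PM G g f)))" using pm f c by (simp add: contra_arr)
  then have "cat_iso (PO G L) (NAt (PM G g f) c)" "Dom (PO G L) (NAt (PM G g f) c) = FOb (PA G g) (FOb (PA G f) c)"
   "Cod (PO G L) (NAt (PM G g f) c) = FOb (PA G (f\<odot>g)) c"
   using pm f g c nat_trans_at[of "PM G g f" "PO G L" c] by (auto simp: nat_iso_iff contra_arr)
  then have 1: "isomorphic_in (PO G L) (FOb (PA G g) (FOb (PA G f) c)) (FOb (PA G (f\<odot>g)) c)"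
   unfolding isomorphic_in_def by blast
  have 2: "isomorphic_in (PO G L) (FOb (PA G g) (FOb (PA G f) c)) (FOb (PA G g) c')"
   by (rule functor_isomorphic[OF _ _ _ f(2)]) (use g in "simp_all add: contra_arr")
  have pu: "nat_iso (PU G L)" "NDom (PU G L) = fid (PO G L)" "NCod (PU G L) = PA G (One K L)"
   using G.pu[of L] G.pu_inv[of L] L by simp_all
  then have "cat_iso (PO G L) (NAt (PU G L) c)" "Dom (PO G L) (NAt (PU G L) c) = c" "Cod (PO G L) (NAt (PU G L) c) = FOb (PA G (One K L)) c"
   using c nat_trans_at[of "PU G L" "PO G L" c] by (auto simp: nat_iso_iff)
  then have 3: "isomorphic_in (PO G L) c (FOb (PA G (One K L)) c)"
   unfolding isomorphic_in_def by blast
  show "isomorphic_in (PO G L) (FOb (PA G (f\<odot>g)) c) (FOb (PA G (One K L)) c)"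
   using isomorphic_trans[OF D isomorphic_trans[OF D isomorphic_trans[OF D isomorphic_sym[OF 1] 2] g(2)] 3] .
 qed
 have L: "L\<in>Obj K" "L'\<in>Obj K" and c: "c\<in>Ob (PO G L)" "c'\<in>Ob (PO G L')" using u u' by (simp_all add: universal_elt_def)
 obtain f where f: "f\<in>Hom1 K L' L" "isomorphic_in (PO G L') (FOb (PA G f) c) c'"
  using u L c unfolding universal_elt_def by blast
 obtain g where g: "g\<in>Hom1 K L L'" "isomorphic_in (PO G L) (FOb (PA G g) c') c"
  using u' L c unfolding universal_elt_def by blast
 obtain al where a: "al\<in>Hom2 K (f\<odot>g) (One K L)" "inv_cell K al" using half[OF u c(2) f g] by blast
 obtain be where b: "be\<in>Hom2 K (g\<odot>f) (One K L')" "inv_cell K be" using half[OF u' c(1) g f] by blast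
 \<comment> \<open>The first cell is inverted, because \<open>equivalent_in\<close> wants the unit
   to start at the identity.\<close>
 show ?thesis unfolding equivalent_in_def
  using L f(1) g(1) a b by (intro conjI bexI[of _ g] bexI[of _ f] bexI[of _ "cinv K al"] bexI[of _ be]) auto
qed

lemma yoneda_fun_simps [simp]: "FDom (yoneda_fun K G L c X) = HomC K X L" "FCod (yoneda_fun K G L c X) = PO G X"
 "f\<in>Hom1 K X L ==> FOb (yoneda_fun K G L c X) f = FOb (PA G f) c"
 "al\<in>Cel K ==> Dm K al\<in>Hom1 K X L ==> FAr (yoneda_fun K G L c X) al = NAt (PC G al) c"
 by (simp_all add: yoneda_fun_def)

lemma yoneda_functor:
 assumes "L\<in>Obj K" "c\<in>Ob (PO G L)" "X\<in>Obj K"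
 shows "is_functor (yoneda_fun K G L c X)"
proof (rule functorI)
 let ?x = "yoneda_fun K G L c X"
 show "FOb ?x\<in>extensional (Ob (FDom ?x))" "FAr ?x\<in>extensional (Ar (FDom ?x))"
  by (simp_all add: yoneda_fun_def del: HomC_simps)
qed (use assms in "auto simp: contra_arr contra_cel_at contra_vc_at contra_idc_at")

context
 fixes L c
 assumes u: "universal_elt K G L c"
  and sU: "!!X. X\<in>Obj K ==> PU G X = nid (PA G (One K X))"
  and sM: "!!f g. f\<in>Arr K ==> g\<in>Arr K ==> Src K f = Tgt K g ==> PM G g f = nid (PA G (f\<odot>g))"
begin

text \<open>An identity cell has equal source and target, so the typing of the constraints already
  yields strict functoriality.\<close>

lemma strict_one: "X\<in>Obj K ==> PA G (One K X) = fid (PO G X)"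
 using G.pu(2)[of X] sU[of X] by simp

lemma strict_cmp: "f\<in>Arr K ==> g\<in>Arr K ==> Src K f = Tgt K g ==> PA G (f\<odot>g) = PA G g \<circ>\<^sub>F PA G f"
 using G.pm(2)[of f g] sM[of f g] by simp

lemma strict_hc:
 assumes "al\<in>Cel K" "be\<in>Cel K" "Src K (Dm K al) = Tgt K (Dm K be)"
 shows "PC G (al\<star>be) = PC G be \<star>\<^sub>N PC G al"
proof -
 have "PC G (al\<star>be) \<bullet>\<^sub>N PM G (Dm K be) (Dm K al) = PM G (Cd K be) (Cd K al) \<bullet>\<^sub>N (PC G be \<star>\<^sub>N PC G al)"
  using G.nat[of al be] assms by simp
 then show ?thesis using assms by (simp add: sM contra_cel strict_cmp contra_arr)
qed

text \<open>Strictness makes the squares of \<open>yoneda_tr\<close> commute on the nose, so that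
  the axioms of a transformation reduce to equations of functors. The components are equivalences by
  universality of \<open>c\<close>.\<close>

lemma yoneda_tr_equivalence: "cat_psnat_equivalence (OpT K) (yoneda_tr K G L c)"
proof -
 let ?x = "yoneda_tr K G L c"
 let ?y = "yo (OpT K) L"
 have L [simp]: "L\<in>Obj K" and c: "c\<in>Ob (PO G L)" using u by (simp_all add: universal_elt_def)
 note yf [simp] = yoneda_functor[OF L c]
 note [simp] = contra_arr
 have yoK: "u\<in>Arr K ==> PA ?y u = yo_arr (OpT K) L u" "th\<in>Cel K ==> PC ?y th = yo_cel (OpT K) L th"
  for u th by (simp_all add: yo_eq)
 have yoM: "PM ?y g f = nid (yo_arr (OpT K) L (f\<odot>g))" if "f\<in>Arr K" "g\<in>Arr K" "Src K f = Tgt K g" for f g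
  using that by (simp add: yo_eq)
 have yoF: "is_functor (yo_arr (OpT K) L u)" if "u\<in>Arr K" for u using that by simp
 \<comment> \<open>On 2-cells this is \<open>strict_hc\<close> for whiskering with
   \<open>u\<close>.\<close>
 have E: "PA G u \<circ>\<^sub>F yoneda_fun K G L c (Tgt K u) = yoneda_fun K G L c (Src K u) \<circ>\<^sub>F yo_arr (OpT K) L u" if u: "u\<in>Arr K" for u
 proof (rule functor_eqI)
  show "FOb (PA G u \<circ>\<^sub>F yoneda_fun K G L c (Tgt K u)) f = FOb (yoneda_fun K G L c (Src K u) \<circ>\<^sub>F yo_arr (OpT K) L u) f"
   if "f\<in>Ob (FDom (PA G u \<circ>\<^sub>F yoneda_fun K G L c (Tgt K u)))" for f
   using that u c by (simp add: strict_cmp)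
  show "FAr (PA G u \<circ>\<^sub>F yoneda_fun K G L c (Tgt K u)) al = FAr (yoneda_fun K G L c (Src K u) \<circ>\<^sub>F yo_arr (OpT K) L u) al"
   if "al\<in>Ar (FDom (PA G u \<circ>\<^sub>F yoneda_fun K G L c (Tgt K u)))" for al
  proof -
   have a: "al\<in>Cel K" "Src K (Dm K al) = Tgt K u" "Tgt K (Dm K al) = L" using that by auto
   have "NAt (PC G (al\<star>Idc K u)) c = FAr (PA G u) (NAt (PC G al) c)"
    using a u c contra_cel_at[of al c "Tgt K u"] by (simp add: strict_hc contra_cel G.pc_idc[of u, simplified])
   then show ?thesis using a u by simp
  qed
 qed (use u c in auto)
 have yo_cmp: "yo_arr (OpT K) L (f\<odot>g) = yo_arr (OpT K) L g \<circ>\<^sub>F yo_arr (OpT K) L f" if "f\<in>Arr K" "g\<in>Arr K" "Src K f = Tgt K g" for f g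
  using that by (auto intro!: functor_eqI)
 have yo_one: "yo_arr (OpT K) L (One K X) = fid (HomC K X L)" if "X\<in>Obj K" for X
  using that by (auto intro!: functor_eqI)
 have T: "TO ?x X = yoneda_fun K G L c X" if "X\<in>Obj K" for X using that by (simp add: yoneda_tr_def)
 have TA: "TA ?x u = nid (PA G u \<circ>\<^sub>F yoneda_fun K G L c (Tgt K u))" if "u\<in>Arr K" for u using that by (simp add: yoneda_tr_def)
 have D: "TDom ?x = yo (OpT K) L" "TCod ?x = G" by (simp_all add: yoneda_tr_def)
 have ni: "nat_iso (nid F)" if "is_functor F" for F :: "('b, 'd, 'x, 'y) fctr"
  using that by (simp add: nat_iso_iff)
 have "cat_psnat (OpT K) ?x"
  unfolding cat_psnat_def Let_def D PiE_iff
 proof (intro conjI ballI)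
  show "TO ?x\<in>extensional (Obj (OpT K))" "TA ?x\<in>extensional (Arr (OpT K))"
   by (simp_all add: yoneda_tr_def)
  show "pseudofunctor (OpT K) CAT ?y" by simp
 next
  fix X Y f g th assume h: "X\<in>Obj (OpT K)" "Y\<in>Obj (OpT K)" "f\<in>Hom1 (OpT K) X Y" "g\<in>Hom1 (OpT K) X Y" "th\<in>Hom2 (OpT K) f g"
  have "nid (yoneda_fun K G L c Y) \<star>\<^sub>N yo_cel (OpT K) L th = PC G th \<star>\<^sub>N nid (yoneda_fun K G L c X)"
  proof (rule nat_trans_eqI)
   show "NAt (nid (yoneda_fun K G L c Y) \<star>\<^sub>N yo_cel (OpT K) L th) k = NAt (PC G th \<star>\<^sub>N nid (yoneda_fun K G L c X)) k"
    if "k\<in>Ob (FDom (NDom (nid (yoneda_fun K G L c Y) \<star>\<^sub>N yo_cel (OpT K) L th)))" for k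
   proof -
    have k: "k\<in>Arr K" "Src K k = X" "Tgt K k = L" using that h by auto
    have "NAt (PC G (Idc K k\<star>th)) c = NAt (PC G th) (FOb (PA G k) c)"
     using k h c contra_cel_at[of th "FOb (PA G k) c" Y] by (simp add: strict_hc contra_cel G.pc_idc[of k, simplified])
    moreover have "NAt (PC G (Idc K k\<star>th)) c\<in>Ar (PO G Y)" "Cod (PO G Y) (NAt (PC G (Idc K k\<star>th)) c) = FOb (PA G (k\<odot>g)) c"
     using contra_cel_at[of "Idc K k\<star>th" c Y] k h c by auto
    ultimately show ?thesis using k h c contra_cel_at[of th "FOb (PA G k) c" Y] by (simp add: contra_cel strict_cmp)
   qed
  qed (use h E[of f] E[of g] in "auto simp: contra_cel")
  then show "(nid (TO ?x Y) \<star>\<^sub>N PC ?y th) \<bullet>\<^sub>N TA ?x f =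
    TA ?x g \<bullet>\<^sub>N (PC G th \<star>\<^sub>N nid (TO ?x X))"
   using h E[of f] E[of g] by (simp add: T TA yoK contra_cel)
 next
  fix X Y Z f g assume h: "X\<in>Obj (OpT K)" "Y\<in>Obj (OpT K)" "Z\<in>Obj (OpT K)" "f\<in>Hom1 (OpT K) X Y" "g\<in>Hom1 (OpT K) Y Z"
  have e: "PA G g \<circ>\<^sub>F PA G f \<circ>\<^sub>F yoneda_fun K G L c X = PA G g \<circ>\<^sub>F yoneda_fun K G L c Y \<circ>\<^sub>F yo_arr (OpT K) L f"
   "(PA G g \<circ>\<^sub>F yoneda_fun K G L c Y) \<circ>\<^sub>F yo_arr (OpT K) L f = (yoneda_fun K G L c Z \<circ>\<^sub>F yo_arr (OpT K) L g) \<circ>\<^sub>F yo_arr (OpT K) L f"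
   using E[of f] E[of g] h by simp_all
  show "TA ?x (g\<odot>\<^bsub>OpT K\<^esub>f) \<bullet>\<^sub>N (PM G g f \<star>\<^sub>N nid (TO ?x X)) =
    (nid (TO ?x Z) \<star>\<^sub>N PM ?y g f) \<bullet>\<^sub>N (TA ?x g \<star>\<^sub>N nid (PA ?y f)) \<bullet>\<^sub>N (nid (PA G g) \<star>\<^sub>N TA ?x f)"
   using h e by (simp add: T TA yoK yoM sM strict_cmp yo_cmp)
 next
  fix X assume X: "X\<in>Obj (OpT K)"
  show "TA ?x (One (OpT K) X) \<bullet>\<^sub>N (PU G X \<star>\<^sub>N nid (TO ?x X)) = nid (TO ?x X) \<star>\<^sub>N PU ?y X"
   using X by (simp add: T TA yo_eq sU strict_one yo_one)
 next
  fix f assume f: "f\<in>Arr (OpT K)"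
  then show "nat_iso (TA ?x f)" "TA ?x f\<in>{sig. nat_trans sig \<and>
    NDom sig = PA G f \<circ>\<^sub>F TO ?x (Src (OpT K) f) \<and> NCod sig = TO ?x (Tgt (OpT K) f) \<circ>\<^sub>F PA ?y f}"
   using E[of f] by (auto simp: T TA yo_eq intro!: ni)
 qed (use G in "auto simp: T yo_eq")
 moreover have "cat_equivalence (TO ?x X)" if X: "X\<in>Obj K" for X
 proof (rule cat_equivalenceI)
  fix f g assume "f\<in>Ob (FDom (TO ?x X))" "g\<in>Ob (FDom (TO ?x X))"
  then have fg: "f\<in>Hom1 K X L" "g\<in>Hom1 K X L" using X by (simp_all add: T)
  have e: "Hom (HomC K X L) f g = Hom2 K f g" using fg by auto
  have "bij_betw (\<lambda>al. NAt (PC G al) c) (Hom2 K f g) (Hom (PO G X) (FOb (PA G f) c) (FOb (PA G g) c))"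
   using u X fg unfolding universal_elt_def by blast
  moreover have "FAr (yoneda_fun K G L c X) al = NAt (PC G al) c" if "al\<in>Hom2 K f g" for al using that fg by simp
  then have "bij_betw (FAr (yoneda_fun K G L c X)) (Hom2 K f g) S = bij_betw (\<lambda>al. NAt (PC G al) c) (Hom2 K f g) S" for S
   by (rule bij_betw_cong)
  ultimately have "bij_betw (FAr (yoneda_fun K G L c X)) (Hom (HomC K X L) f g) (Hom (PO G X) (FOb (PA G f) c) (FOb (PA G g) c))"
   unfolding e by blast
  then show "bij_betw (FAr (TO ?x X)) (Hom (FDom (TO ?x X)) f g)
    (Hom (FCod (TO ?x X)) (FOb (TO ?x X) f) (FOb (TO ?x X) g))"
   using fg X by (simp add: T)
 next
  fix d assume "d\<in>Ob (FCod (TO ?x X))"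
  then have "\<exists>f\<in>Hom1 K X L. isomorphic_in (PO G X) (FOb (PA G f) c) d"
   using u X unfolding universal_elt_def by (simp add: T)
  then show "\<exists>f\<in>Ob (FDom (TO ?x X)). isomorphic_in (FCod (TO ?x X)) (FOb (TO ?x X) f) d"
   using X by (auto simp: T)
 qed (use X in "simp add: T")
 ultimately show ?thesis by (simp add: cat_psnat_equivalence_def)
qed

end

end

section \<open>Weighted cones\<close>

text \<open>The indexing 2-category is locally discrete, so \<open>W\<close> and \<open>B\<close>
  send its 2-cells to identities and naturality in 2-cells holds automatically.\<close>

locale weighted = H: two_category H + C: category C + W: pseudofunctor "LD C" CAT W + B: pseudofunctor "LD C" H B
 for C :: "('o, 'm) cat" and H :: "('p, 'b, 'd) twocat" (structure)
  and W :: "('o, 'm, 'm, 'x, 'y) catpsf" and B :: "('o, 'm, 'm, 'p, 'b, 'd) psf"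
begin

abbreviation "V X \<equiv> hom_into (LD C) H B X"

abbreviation "wc X \<equiv> CatPsHom (LD C) W (V X)"

lemma HC [simp]: "two_category H" "category C" by unfold_locales

lemma ld [simp]: "f\<in>Ar C ==> PC B f = Idc H (PA B f)" "f\<in>Ar C ==> PC W f = nid (PA W f)"
 using B.pc_idc[of f] W.pc_idc[of f] by simp_all

lemma pw [simp]: "a\<in>Ob C ==> category (PO W a)" "f\<in>Ar C ==> is_functor (PA W f)" "f\<in>Ar C ==> FDom (PA W f) = PO W (Dom C f)"
 "f\<in>Ar C ==> FCod (PA W f) = PO W (Cod C f)"
 using W.po_in[of a] W.arr[of f] by simp_all

lemma pw_m: assumes "f\<in>Ar C" "g\<in>Ar C" "Cod C f = Dom C g"
 shows "nat_iso (PM W g f)" "NDom (PM W g f) = PA W g \<circ>\<^sub>F PA W f" "NCod (PM W g f) = PA W (g\<cdot>\<^bsub>C\<^esub>f)"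
  "w\<in>Ob (PO W (Dom C f)) ==> NAt (PM W g f) w\<in>Ar (PO W (Cod C g))"
  "w\<in>Ob (PO W (Dom C f)) ==> Dom (PO W (Cod C g)) (NAt (PM W g f) w) = FOb (PA W g) (FOb (PA W f) w)"
  "w\<in>Ob (PO W (Dom C f)) ==> Cod (PO W (Cod C g)) (NAt (PM W g f) w) = FOb (PA W (g\<cdot>\<^bsub>C\<^esub>f)) w"
proof -
 show n: "nat_iso (PM W g f)" "NDom (PM W g f) = PA W g \<circ>\<^sub>F PA W f" "NCod (PM W g f) = PA W (g\<cdot>\<^bsub>C\<^esub>f)"
  using W.pm[of f g] assms by simp_all
 assume w: "w\<in>Ob (PO W (Dom C f))"
 have "nat_trans (PM W g f)" using n by (simp add: nat_iso_iff)
 from nat_trans_at[OF this, of "PO W (Cod C g)" w]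
 show "NAt (PM W g f) w\<in>Ar (PO W (Cod C g))"
  "Dom (PO W (Cod C g)) (NAt (PM W g f) w) = FOb (PA W g) (FOb (PA W f) w)"
  "Cod (PO W (Cod C g)) (NAt (PM W g f) w) = FOb (PA W (g\<cdot>\<^bsub>C\<^esub>f)) w"
  using w n assms by simp_all
qed

lemma pw_u: assumes "a\<in>Ob C"
 shows "nat_iso (PU W a)" "NDom (PU W a) = fid (PO W a)" "NCod (PU W a) = PA W (Id C a)"
  "w\<in>Ob (PO W a) ==> NAt (PU W a) w\<in>Ar (PO W a)"
  "w\<in>Ob (PO W a) ==> Dom (PO W a) (NAt (PU W a) w) = w"
  "w\<in>Ob (PO W a) ==> Cod (PO W a) (NAt (PU W a) w) = FOb (PA W (Id C a)) w"
proof -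
 show n: "nat_iso (PU W a)" "NDom (PU W a) = fid (PO W a)" "NCod (PU W a) = PA W (Id C a)"
  using W.pu[of a] W.pu_inv[of a] assms by simp_all
 assume w: "w\<in>Ob (PO W a)"
 have "nat_trans (PU W a)" using n by (simp add: nat_iso_iff)
 from nat_trans_at[OF this, of "PO W a" w]
 show "NAt (PU W a) w\<in>Ar (PO W a)"
  "Dom (PO W a) (NAt (PU W a) w) = w" "Cod (PO W a) (NAt (PU W a) w) = FOb (PA W (Id C a)) w"
  using w n assms by simp_all
qed

lemma V_simps [simp]: assumes "X\<in>Obj H"
 shows "a\<in>Ob C ==> PO (V X) a = HomC H X (PO B a)" "f\<in>Ar C ==> PA (V X) f = yo_arr H X (PA B f)"
  "f\<in>Ar C ==> PC (V X) f = nid (yo_arr H X (PA B f))"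
  "a\<in>Ob C ==> NDom (PU (V X) a) = fid (HomC H X (PO B a))" "a\<in>Ob C ==> NCod (PU (V X) a) = yo_arr H X (PA B (Id C a))"
  "a\<in>Ob C ==> h\<in>Hom1 H X (PO B a) ==> NAt (PU (V X) a) h = PU B a\<star>Idc H h"
  "f\<in>Ar C ==> g\<in>Ar C ==> Cod C f = Dom C g ==> NDom (PM (V X) g f) = yo_arr H X (PA B g) \<circ>\<^sub>F yo_arr H X (PA B f)"
  "f\<in>Ar C ==> g\<in>Ar C ==> Cod C f = Dom C g ==> NCod (PM (V X) g f) = yo_arr H X (PA B (g\<cdot>\<^bsub>C\<^esub>f))"
  "f\<in>Ar C ==> g\<in>Ar C ==> Cod C f = Dom C g ==> h\<in>Hom1 H X (PO B (Dom C f)) ==> NAt (PM (V X) g f) h = PM B g f\<star>Idc H h"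
  "pseudofunctor (LD C) CAT (V X)"
proof -
 have yo: "pseudofunctor H CAT (yo H X)" using assms by simp
 show V: "pseudofunctor (LD C) CAT (V X)"
  unfolding hom_into_def by (rule pseudofunctor_comp[OF _ _ _ B.pseudofunctor_axioms yo]) simp_all
 interpret V: pseudofunctor "LD C" CAT "V X" by (rule V)
 show a: "a\<in>Ob C ==> PO (V X) a = HomC H X (PO B a)" "f\<in>Ar C ==> PA (V X) f = yo_arr H X (PA B f)" for f a
  by (simp_all add: hom_into_def yo_eq)
 show "f\<in>Ar C ==> PC (V X) f = nid (yo_arr H X (PA B f))" using V.pc_idc[of f] a(2)[of f] by simp
 show "a\<in>Ob C ==> NDom (PU (V X) a) = fid (HomC H X (PO B a))" "a\<in>Ob C ==> NCod (PU (V X) a) = yo_arr H X (PA B (Id C a))"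
  using V.pu[of a] a by simp_all
 show "f\<in>Ar C ==> g\<in>Ar C ==> Cod C f = Dom C g ==> NDom (PM (V X) g f) = yo_arr H X (PA B g) \<circ>\<^sub>F yo_arr H X (PA B f)"
  "f\<in>Ar C ==> g\<in>Ar C ==> Cod C f = Dom C g ==> NCod (PM (V X) g f) = yo_arr H X (PA B (g\<cdot>\<^bsub>C\<^esub>f))"
  using V.pm[of f g] a by simp_all
 show "a\<in>Ob C ==> h\<in>Hom1 H X (PO B a) ==> NAt (PU (V X) a) h = PU B a\<star>Idc H h"
  using assms by (simp add: hom_into_def yo_eq)
 show "f\<in>Ar C ==> g\<in>Ar C ==> Cod C f = Dom C g ==> h\<in>Hom1 H X (PO B (Dom C f)) ==> NAt (PM (V X) g f) h = PM B g f\<star>Idc H h"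
  using assms by (simp add: hom_into_def yo_eq)
qed

text \<open>A weighted cone in components: functors \<open>S a\<close> from \<open>W a\<close> to the hom-category from \<open>X\<close> to \<open>B a\<close>, and
 cells \<open>tu f w\<close>.\<close>

definition wcone :: "'p => ('o => ('x, 'y, 'b, 'd) fctr) => ('m => 'x => 'd) => bool" where
 "wcone X S tu \<longleftrightarrow> X\<in>Obj H \<and>
   (\<forall>a\<in>Ob C. is_functor (S a) \<and> FDom (S a) = PO W a \<and> FCod (S a) = HomC H X (PO B a)) \<and>
   (\<forall>f\<in>Ar C. \<forall>w\<in>Ob (PO W (Dom C f)). inv_cell H (tu f w) \<and> Dm H (tu f w) = PA B f\<odot>FOb (S (Dom C f)) w \<and>
    Cd H (tu f w) = FOb (S (Cod C f)) (FOb (PA W f) w)) \<and>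
   (\<forall>f\<in>Ar C. \<forall>m\<in>Ar (PO W (Dom C f)). tu f (Cod (PO W (Dom C f)) m)\<bullet>(Idc H (PA B f)\<star>FAr (S (Dom C f)) m) =
    FAr (S (Cod C f)) (FAr (PA W f) m)\<bullet>tu f (Dom (PO W (Dom C f)) m)) \<and>
   (\<forall>f\<in>Ar C. \<forall>g\<in>Ar C. \<forall>w\<in>Ob (PO W (Dom C f)). Cod C f = Dom C g \<longrightarrow>
    tu (g\<cdot>\<^bsub>C\<^esub>f) w\<bullet>(PM B g f\<star>Idc H (FOb (S (Dom C f)) w)) =
    FAr (S (Cod C g)) (NAt (PM W g f) w)\<bullet>tu g (FOb (PA W f) w)\<bullet>(Idc H (PA B g)\<star>tu f w)) \<and>
   (\<forall>a\<in>Ob C. \<forall>w\<in>Ob (PO W a). tu (Id C a) w\<bullet>(PU B a\<star>Idc H (FOb (S a) w)) = FAr (S a) (NAt (PU W a) w))"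

lemma wc_simps [simp]: "t\<in>Ob (wc X) \<longleftrightarrow> cat_psnat (LD C) t \<and> TDom t = W \<and> TCod t = V X"
 "Gm\<in>Ar (wc X) \<longleftrightarrow> cat_modification (LD C) Gm \<and> TDom (MDom Gm) = W \<and> TCod (MDom Gm) = V X"
 "Dom (wc X) = MDom" "Cod (wc X) = MCod"
 "MDom (Id (wc X) t) = t" "MCod (Id (wc X) t) = t" "a\<in>Ob C ==> MO (Id (wc X) t) a = nid (TO t a)"
 "MDom (Dl\<cdot>\<^bsub>wc X\<^esub>Gm) = MDom Gm" "MCod (Dl\<cdot>\<^bsub>wc X\<^esub>Gm) = MCod Dl" "a\<in>Ob C ==> MO (Dl\<cdot>\<^bsub>wc X\<^esub>Gm) a = MO Dl a \<bullet>\<^sub>N MO Gm a"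
 by (simp_all add: CatPsHom_def)

lemma wcone_functor: assumes "wcone X S tu"
 shows "X\<in>Obj H" "a\<in>Ob C ==> is_functor (S a)" "a\<in>Ob C ==> FDom (S a) = PO W a" "a\<in>Ob C ==> FCod (S a) = HomC H X (PO B a)"
 using assms unfolding wcone_def by simp_all

lemma wcone_ob: assumes "wcone X S tu" "a\<in>Ob C" "w\<in>Ob (PO W a)"
 shows "FOb (S a) w\<in>Arr H" "Src H (FOb (S a) w) = X" "Tgt H (FOb (S a) w) = PO B a"
 using functor_ob[OF wcone_functor(2,4)[OF assms(1,2)] , of w] wcone_functor[OF assms(1)] assms by simp_all

lemma wcone_ar: assumes "wcone X S tu" "a\<in>Ob C" "m\<in>Ar (PO W a)"
 shows "FAr (S a) m\<in>Cel H" "Dm H (FAr (S a) m) = FOb (S a) (Dom (PO W a) m)" "Cd H (FAr (S a) m) = FOb (S a) (Cod (PO W a) m)"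
 using functor_ar[OF wcone_functor(2,4)[OF assms(1,2)], of m] functor_dom_cod[OF wcone_functor(2,4)[OF assms(1,2)], of m]
  wcone_functor[OF assms(1)] assms by simp_all

lemma wcone_cel: assumes "wcone X S tu" "f\<in>Ar C" "w\<in>Ob (PO W (Dom C f))"
 shows "inv_cell H (tu f w)" "Dm H (tu f w) = PA B f\<odot>FOb (S (Dom C f)) w" "Cd H (tu f w) = FOb (S (Cod C f)) (FOb (PA W f) w)"
 using assms unfolding wcone_def by simp_all

lemma wcone_nat: assumes "wcone X S tu" "f\<in>Ar C" "m\<in>Ar (PO W (Dom C f))"
 shows "tu f (Cod (PO W (Dom C f)) m)\<bullet>(Idc H (PA B f)\<star>FAr (S (Dom C f)) m) =
    FAr (S (Cod C f)) (FAr (PA W f) m)\<bullet>tu f (Dom (PO W (Dom C f)) m)"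
 using assms unfolding wcone_def by simp

lemma wcone_comp: assumes "wcone X S tu" "f\<in>Ar C" "g\<in>Ar C" "Cod C f = Dom C g" "w\<in>Ob (PO W (Dom C f))"
 shows "tu (g\<cdot>\<^bsub>C\<^esub>f) w\<bullet>(PM B g f\<star>Idc H (FOb (S (Dom C f)) w)) =
    FAr (S (Cod C g)) (NAt (PM W g f) w)\<bullet>tu g (FOb (PA W f) w)\<bullet>(Idc H (PA B g)\<star>tu f w)"
 using assms unfolding wcone_def by blast

lemma wcone_unit: assumes "wcone X S tu" "a\<in>Ob C" "w\<in>Ob (PO W a)"
 shows "tu (Id C a) w\<bullet>(PU B a\<star>Idc H (FOb (S a) w)) = FAr (S a) (NAt (PU W a) w)"
 using assms unfolding wcone_def by blast

text \<open>Natural transformations into a hom-category are families of 2-cells of \<open>H\<close>;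
  reading the axioms of a transformation at the objects and arrows of the weight gives the clauses
  of \<open>wcone\<close>.\<close>

lemma cat_psnat_wcone:
 assumes "cat_psnat (LD C) t" "TDom t = W" "TCod t = V X" and X: "X\<in>Obj H"
 shows "wcone X (TO t) (\<lambda>f. NAt (TA t f))"
proof -
 have S: "is_functor (TO t a)" "FDom (TO t a) = PO W a" "FCod (TO t a) = HomC H X (PO B a)" if "a\<in>Ob C" for a
  using assms that unfolding cat_psnat_def Let_def PiE_iff by simp_all
 have T: "nat_iso (TA t f)" "NDom (TA t f) = yo_arr H X (PA B f) \<circ>\<^sub>F TO t (Dom C f)" "NCod (TA t f) = TO t (Cod C f) \<circ>\<^sub>F PA W f"
  if "f\<in>Ar C" for f
  using assms that unfolding cat_psnat_def Let_def PiE_iff by simp_all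
 have Tn: "nat_trans (TA t f)" if "f\<in>Ar C" for f using T(1)[OF that] by (simp add: nat_iso_iff)
 have so: "FOb (TO t a) w\<in>Arr H" "Src H (FOb (TO t a) w) = X" "Tgt H (FOb (TO t a) w) = PO B a" if "a\<in>Ob C" "w\<in>Ob (PO W a)" for a w
  using functor_ob[OF S(1,3)[OF that(1)], of w] S that by simp_all
 have ta: "cat_iso (HomC H X (PO B (Cod C f))) (NAt (TA t f) w)" "NAt (TA t f) w\<in>Cel H" "Dm H (NAt (TA t f) w) = PA B f\<odot>FOb (TO t (Dom C f)) w"
  "Cd H (NAt (TA t f) w) = FOb (TO t (Cod C f)) (FOb (PA W f) w)" if "f\<in>Ar C" "w\<in>Ob (PO W (Dom C f))" for f w
  using T[OF that(1)] that nat_trans_at[OF Tn[OF that(1)], of "HomC H X (PO B (Cod C f))" w] S[of "Dom C f"] so[of "Dom C f" w]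
  by (auto simp: nat_iso_iff)
 have inv: "inv_cell H (NAt (TA t f) w)" if "f\<in>Ar C" "w\<in>Ob (PO W (Dom C f))" for f w
  using ta[OF that] inv_cell_iff_iso[OF HC(1), of "PA B f\<odot>FOb (TO t (Dom C f)) w" X "PO B (Cod C f)" "NAt (TA t f) w"] so[of "Dom C f" w] that
  by simp
 have P: "pseudofunctor (LD C) CAT (V X)" using X by simp
 have comp: "TA t (g\<cdot>\<^bsub>C\<^esub>f) \<bullet>\<^sub>N (PM (V X) g f \<star>\<^sub>N nid (TO t (Dom C f))) =
    (nid (TO t (Cod C g)) \<star>\<^sub>N PM W g f) \<bullet>\<^sub>N (TA t g \<star>\<^sub>N nid (PA W f)) \<bullet>\<^sub>N (nid (yo_arr H X (PA B g)) \<star>\<^sub>N TA t f)"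
  if h: "f\<in>Ar C" "g\<in>Ar C" "Cod C f = Dom C g" for f g
 proof -
  have "\<forall>X\<in>Obj (LD C). \<forall>Y\<in>Obj (LD C). \<forall>Z\<in>Obj (LD C). \<forall>f\<in>Hom1 (LD C) X Y. \<forall>g\<in>Hom1 (LD C) Y Z.
    TA t (g\<odot>\<^bsub>LD C\<^esub>f) \<bullet>\<^sub>N (PM (TCod t) g f \<star>\<^sub>N nid (TO t X)) =
    (nid (TO t Z) \<star>\<^sub>N PM (TDom t) g f) \<bullet>\<^sub>N (TA t g \<star>\<^sub>N nid (PA (TDom t) f)) \<bullet>\<^sub>N (nid (PA (TCod t) g) \<star>\<^sub>N TA t f)"
   using assms(1) unfolding cat_psnat_def Let_def by (elim conjE)
  from this[rule_format, of "Dom C f" "Cod C f" "Cod C g" f g] show ?thesis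
   using h assms(2,3) X by simp
 qed
 have unit: "TA t (Id C a) \<bullet>\<^sub>N (PU (V X) a \<star>\<^sub>N nid (TO t a)) = nid (TO t a) \<star>\<^sub>N PU W a" if "a\<in>Ob C" for a
  using assms that unfolding cat_psnat_def Let_def by simp
 show ?thesis
  unfolding wcone_def
 proof (intro conjI ballI impI X S inv ta(3,4))
  fix f m assume h: "f\<in>Ar C" "m\<in>Ar (PO W (Dom C f))"
  show "NAt (TA t f) (Cod (PO W (Dom C f)) m)\<bullet>(Idc H (PA B f)\<star>FAr (TO t (Dom C f)) m) =
    FAr (TO t (Cod C f)) (FAr (PA W f) m)\<bullet>NAt (TA t f) (Dom (PO W (Dom C f)) m)"
   using nat_trans_natural[OF Tn[OF h(1)], of m] T[OF h(1)] h S[of "Dom C f"] functor_ar[OF S(1,3), of "Dom C f" m] by simp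
 next
  fix f g w assume h: "f\<in>Ar C" "g\<in>Ar C" "w\<in>Ob (PO W (Dom C f))" "Cod C f = Dom C g"
  have w': "FOb (PA W f) w\<in>Ob (PO W (Dom C g))" "Dom C f\<in>Ob C" "Cod C g\<in>Ob C" using h functor_ob[of "PA W f"] by auto
  show "NAt (TA t (g\<cdot>\<^bsub>C\<^esub>f)) w\<bullet>(PM B g f\<star>Idc H (FOb (TO t (Dom C f)) w)) =
    FAr (TO t (Cod C g)) (NAt (PM W g f) w)\<bullet>NAt (TA t g) (FOb (PA W f) w)\<bullet>(Idc H (PA B g)\<star>NAt (TA t f) w)"
   using arg_cong[OF comp[OF h(1,2,4)], of "\<lambda>sig. NAt sig w"] h w' T[OF h(1)] T[OF h(2)] S[of "Dom C f"] S[of "Dom C g"] S[of "Cod C g"]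
    so[of "Dom C f" w] so[of "Dom C g" "FOb (PA W f) w"] ta[OF h(1,3)] ta[OF h(2) w'(1)] pw_m[OF h(1,2,4)] X
    functor_ar[OF S(1,3), of "Cod C g" "NAt (PM W g f) w"]
    functor_dom_cod[OF S(1,3), of "Cod C g" "NAt (PM W g f) w"]
   by simp
 next
  fix a w assume h: "a\<in>Ob C" "w\<in>Ob (PO W a)"
  show "NAt (TA t (Id C a)) w\<bullet>(PU B a\<star>Idc H (FOb (TO t a) w)) = FAr (TO t a) (NAt (PU W a) w)"
   using arg_cong[OF unit[OF h(1)], of "\<lambda>sig. NAt sig w"] h T[of "Id C a"] S[OF h(1)] so[OF h] pw_u[OF h(1)] X
    functor_ar[OF S(1,3)[OF h(1)], of "NAt (PU W a) w"]
    functor_dom_cod[OF S(1,3)[OF h(1)], of "NAt (PU W a) w"]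
   by simp
 qed
qed

text \<open>Parallel natural transformations with the same components are equal, so the clauses of
  \<open>wcone\<close> imply the axioms; the other hypotheses fix the record fields that the
  components do not determine.\<close>

lemma wcone_cat_psnat:
 assumes w: "wcone X (TO t) (\<lambda>f. NAt (TA t f))" and D: "TDom t = W" "TCod t = V X"
  and e: "TO t\<in>extensional (Ob C)" "TA t\<in>extensional (Ar C)"
  and TA: "!!f. f\<in>Ar C ==> NDom (TA t f) = yo_arr H X (PA B f) \<circ>\<^sub>F TO t (Dom C f)"
  "!!f. f\<in>Ar C ==> NCod (TA t f) = TO t (Cod C f) \<circ>\<^sub>F PA W f"
  "!!f. f\<in>Ar C ==> NAt (TA t f)\<in>extensional (Ob (PO W (Dom C f)))"
 shows "cat_psnat (LD C) t"
proof -
 note S = wcone_functor[OF w] note X = S(1)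
 note so = wcone_ob[OF w] note ta = wcone_cel[OF w]
 have Tn: "nat_trans (TA t f)" if f: "f\<in>Ar C" for f
 proof (rule nat_transI)
  show "NAt (TA t f)\<in>extensional (Ob (FDom (NDom (TA t f))))" using TA[OF f] S f by simp
  fix m assume "m\<in>Ar (FDom (NDom (TA t f)))"
  then have m: "m\<in>Ar (PO W (Dom C f))" using TA[OF f] S f by simp
  show "NAt (TA t f) (Cod (FDom (NDom (TA t f))) m)\<cdot>\<^bsub>FCod (NDom (TA t f))\<^esub>FAr (NDom (TA t f)) m =
   FAr (NCod (TA t f)) m\<cdot>\<^bsub>FCod (NDom (TA t f))\<^esub>NAt (TA t f) (Dom (FDom (NDom (TA t f))) m)"
   using wcone_nat[OF w f m] TA[OF f] S f m wcone_ar[OF w _ m] wcone_ob[OF w, of "Dom C f"] by simp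
 qed (use TA[OF f] S f so[of "Dom C f"] ta[OF f] in auto)
 have Ti: "nat_iso (TA t f)" if f: "f\<in>Ar C" for f
  unfolding nat_iso_iff
 proof (intro conjI ballI Tn f)
  fix x assume "x\<in>Ob (FDom (NDom (TA t f)))"
  then have x: "x\<in>Ob (PO W (Dom C f))" using TA[OF f] S f by simp
  show "cat_iso (FCod (NDom (TA t f))) (NAt (TA t f) x)"
   using inv_cell_iff_iso[OF HC(1), of "PA B f\<odot>FOb (TO t (Dom C f)) x" X "PO B (Cod C f)" "NAt (TA t f) x"] so[of "Dom C f" x] ta[OF f x] x f TA[OF f]
   by simp
 qed
 have P: "pseudofunctor (LD C) CAT (V X)" using X by simp
 show ?thesis
  unfolding cat_psnat_def Let_def D PiE_iff
 proof (intro conjI ballI P W.pseudofunctor_axioms)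
  fix Y Z U f g assume "Y\<in>Obj (LD C)" "Z\<in>Obj (LD C)" "U\<in>Obj (LD C)" "f\<in>Hom1 (LD C) Y Z" "g\<in>Hom1 (LD C) Z U"
  then have h: "f\<in>Ar C" "g\<in>Ar C" "Cod C f = Dom C g" and [simp]: "Y = Dom C f" "Z = Dom C g" "U = Cod C g" by auto
  show "TA t (g\<odot>\<^bsub>LD C\<^esub>f) \<bullet>\<^sub>N (PM (V X) g f \<star>\<^sub>N nid (TO t Y)) =
    (nid (TO t U) \<star>\<^sub>N PM W g f) \<bullet>\<^sub>N (TA t g \<star>\<^sub>N nid (PA W f)) \<bullet>\<^sub>N (nid (PA (V X) g) \<star>\<^sub>N TA t f)"
  proof (rule nat_trans_eqI)
   interpret V: pseudofunctor "LD C" CAT "V X" by (rule P)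
   have pm: "nat_trans (PM (V X) g f)" "nat_trans (PM W g f)" using V.pm[of f g] W.pm[of f g] h by simp_all
   note T = TA(1,2)[OF h(1)] TA(1,2)[OF h(2)] TA(1,2)[of "g\<cdot>\<^bsub>C\<^esub>f"] Tn[OF h(1)] Tn[OF h(2)] Tn[of "g\<cdot>\<^bsub>C\<^esub>f"]
   show "nat_trans (TA t (g\<odot>\<^bsub>LD C\<^esub>f) \<bullet>\<^sub>N (PM (V X) g f \<star>\<^sub>N nid (TO t Y)))"
    "nat_trans ((nid (TO t U) \<star>\<^sub>N PM W g f) \<bullet>\<^sub>N (TA t g \<star>\<^sub>N nid (PA W f)) \<bullet>\<^sub>N (nid (PA (V X) g) \<star>\<^sub>N TA t f))"
    "NDom (TA t (g\<odot>\<^bsub>LD C\<^esub>f) \<bullet>\<^sub>N (PM (V X) g f \<star>\<^sub>N nid (TO t Y))) =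
     NDom ((nid (TO t U) \<star>\<^sub>N PM W g f) \<bullet>\<^sub>N (TA t g \<star>\<^sub>N nid (PA W f)) \<bullet>\<^sub>N (nid (PA (V X) g) \<star>\<^sub>N TA t f))"
    "NCod (TA t (g\<odot>\<^bsub>LD C\<^esub>f) \<bullet>\<^sub>N (PM (V X) g f \<star>\<^sub>N nid (TO t Y))) =
     NCod ((nid (TO t U) \<star>\<^sub>N PM W g f) \<bullet>\<^sub>N (TA t g \<star>\<^sub>N nid (PA W f)) \<bullet>\<^sub>N (nid (PA (V X) g) \<star>\<^sub>N TA t f))"
    using T h pm S X pw_m[OF h] by simp_all
   fix w0 assume "w0\<in>Ob (FDom (NDom (TA t (g\<odot>\<^bsub>LD C\<^esub>f) \<bullet>\<^sub>N (PM (V X) g f \<star>\<^sub>N nid (TO t Y)))))"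
   then have w0: "w0\<in>Ob (PO W (Dom C f))" using S h X by simp
   have w': "FOb (PA W f) w0\<in>Ob (PO W (Dom C g))" using h w0 functor_ob[of "PA W f"] by auto
   show "NAt (TA t (g\<odot>\<^bsub>LD C\<^esub>f) \<bullet>\<^sub>N (PM (V X) g f \<star>\<^sub>N nid (TO t Y))) w0 =
    NAt ((nid (TO t U) \<star>\<^sub>N PM W g f) \<bullet>\<^sub>N (TA t g \<star>\<^sub>N nid (PA W f)) \<bullet>\<^sub>N (nid (PA (V X) g) \<star>\<^sub>N TA t f)) w0"
    using wcone_comp[OF w h w0] T h w0 w' X S so[of "Dom C f" w0] so[of "Dom C g" "FOb (PA W f) w0"] ta[OF h(1) w0] ta[OF h(2) w']
     pw_m[OF h] wcone_ar[OF w, of "Cod C g" "NAt (PM W g f) w0"]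
    by simp
  qed
 next
  fix a assume "a\<in>Obj (LD C)"
  then have a: "a\<in>Ob C" by simp
  show "TA t (One (LD C) a) \<bullet>\<^sub>N (PU (V X) a \<star>\<^sub>N nid (TO t a)) = nid (TO t a) \<star>\<^sub>N PU W a"
  proof (rule nat_trans_eqI)
   interpret V: pseudofunctor "LD C" CAT "V X" by (rule P)
   have pu: "nat_trans (PU (V X) a)" "nat_trans (PU W a)" using V.pu[of a] W.pu[of a] a by simp_all
   note T = TA(1,2)[of "Id C a"] Tn[of "Id C a"]
   show "nat_trans (TA t (One (LD C) a) \<bullet>\<^sub>N (PU (V X) a \<star>\<^sub>N nid (TO t a)))" "nat_trans (nid (TO t a) \<star>\<^sub>N PU W a)"
    "NDom (TA t (One (LD C) a) \<bullet>\<^sub>N (PU (V X) a \<star>\<^sub>N nid (TO t a))) = NDom (nid (TO t a) \<star>\<^sub>N PU W a)"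
    "NCod (TA t (One (LD C) a) \<bullet>\<^sub>N (PU (V X) a \<star>\<^sub>N nid (TO t a))) = NCod (nid (TO t a) \<star>\<^sub>N PU W a)"
    using T a pu S X pw_u[OF a] by simp_all
   fix w0 assume "w0\<in>Ob (FDom (NDom (TA t (One (LD C) a) \<bullet>\<^sub>N (PU (V X) a \<star>\<^sub>N nid (TO t a)))))"
   then have w0: "w0\<in>Ob (PO W a)" using S a X by simp
   show "NAt (TA t (One (LD C) a) \<bullet>\<^sub>N (PU (V X) a \<star>\<^sub>N nid (TO t a))) w0 = NAt (nid (TO t a) \<star>\<^sub>N PU W a) w0"
    using wcone_unit[OF w a w0] T a w0 X S so[OF a w0] pw_u[OF a] wcone_ar[OF w a, of "NAt (PU W a) w0"] by simp
  qed
 next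
  fix Y Z f g th assume "Y\<in>Obj (LD C)" "Z\<in>Obj (LD C)" "f\<in>Hom1 (LD C) Y Z" "g\<in>Hom1 (LD C) Y Z" "th\<in>Hom2 (LD C) f g"
  then have h: "f\<in>Ar C" and [simp]: "g = f" "th = f" "Y = Dom C f" "Z = Cod C f" by auto
  show "(nid (TO t Z) \<star>\<^sub>N PC W th) \<bullet>\<^sub>N TA t f = TA t g \<bullet>\<^sub>N (PC (V X) th \<star>\<^sub>N nid (TO t Y))"
   using h S X Tn[OF h] TA[OF h] by simp
 qed (use e S Tn Ti TA X in auto)
qed

text \<open>The second clause is naturality in the weight and the third is the modification axiom,
  both read at components.\<close>

definition wmod :: "('o => ('x, 'y, 'b, 'd) fctr) => ('m => 'x => 'd) => ('o => ('x, 'y, 'b, 'd) fctr) => ('m => 'x => 'd) =>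
  ('o => 'x => 'd) => bool" where
 "wmod S tu S' tu' gm \<longleftrightarrow>
   (\<forall>a\<in>Ob C. \<forall>w\<in>Ob (PO W a). gm a w\<in>Hom2 H (FOb (S a) w) (FOb (S' a) w)) \<and>
   (\<forall>a\<in>Ob C. \<forall>m\<in>Ar (PO W a). gm a (Cod (PO W a) m)\<bullet>FAr (S a) m = FAr (S' a) m\<bullet>gm a (Dom (PO W a) m)) \<and>
   (\<forall>f\<in>Ar C. \<forall>w\<in>Ob (PO W (Dom C f)). gm (Cod C f) (FOb (PA W f) w)\<bullet>tu f w = tu' f w\<bullet>(Idc H (PA B f)\<star>gm (Dom C f) w))"

lemma wmodD: assumes "wmod S tu S' tu' gm"
 shows "a\<in>Ob C ==> w\<in>Ob (PO W a) ==> gm a w\<in>Cel H" "a\<in>Ob C ==> w\<in>Ob (PO W a) ==> Dm H (gm a w) = FOb (S a) w"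
  "a\<in>Ob C ==> w\<in>Ob (PO W a) ==> Cd H (gm a w) = FOb (S' a) w"
  "a\<in>Ob C ==> m\<in>Ar (PO W a) ==> gm a (Cod (PO W a) m)\<bullet>FAr (S a) m = FAr (S' a) m\<bullet>gm a (Dom (PO W a) m)"
  "f\<in>Ar C ==> w\<in>Ob (PO W (Dom C f)) ==> gm (Cod C f) (FOb (PA W f) w)\<bullet>tu f w = tu' f w\<bullet>(Idc H (PA B f)\<star>gm (Dom C f) w)"
 using assms unfolding wmod_def by simp_all

lemma wc_obD: assumes "t\<in>Ob (wc X)" "X\<in>Obj H"
 shows "wcone X (TO t) (\<lambda>f. NAt (TA t f))" "TDom t = W" "TCod t = V X" "TO t\<in>extensional (Ob C)" "TA t\<in>extensional (Ar C)"
  "f\<in>Ar C ==> nat_trans (TA t f)"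
  "f\<in>Ar C ==> NDom (TA t f) = yo_arr H X (PA B f) \<circ>\<^sub>F TO t (Dom C f)" "f\<in>Ar C ==> NCod (TA t f) = TO t (Cod C f) \<circ>\<^sub>F PA W f"
proof -
 have t: "cat_psnat (LD C) t" "TDom t = W" "TCod t = V X" using assms by simp_all
 show "wcone X (TO t) (\<lambda>f. NAt (TA t f))" "TDom t = W" "TCod t = V X" using cat_psnat_wcone[OF t assms(2)] t by simp_all
 show "TO t\<in>extensional (Ob C)"
  using t(1) unfolding cat_psnat_def Let_def PiE_iff LD_simps by (elim conjE)
 show "TA t\<in>extensional (Ar C)"
  using t(1) unfolding cat_psnat_def Let_def PiE_iff LD_simps by (elim conjE)
 have "\<forall>f\<in>Arr (LD C). TA t f\<in>{sig. nat_trans sig \<and>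
    NDom sig = PA (TCod t) f \<circ>\<^sub>F TO t (Src (LD C) f) \<and> NCod sig = TO t (Tgt (LD C) f) \<circ>\<^sub>F PA (TDom t) f}"
  using t(1) unfolding cat_psnat_def Let_def PiE_iff by (elim conjE)
 then show "f\<in>Ar C ==> nat_trans (TA t f)"
  "f\<in>Ar C ==> NDom (TA t f) = yo_arr H X (PA B f) \<circ>\<^sub>F TO t (Dom C f)" "f\<in>Ar C ==> NCod (TA t f) = TO t (Cod C f) \<circ>\<^sub>F PA W f"
  using t(2,3) assms(2) by simp_all
qed

lemma wc_arD: assumes "Gm\<in>Ar (wc X)" "X\<in>Obj H"
 shows "MDom Gm\<in>Ob (wc X)" "MCod Gm\<in>Ob (wc X)" "MO Gm\<in>extensional (Ob C)" "a\<in>Ob C ==> nat_trans (MO Gm a)"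
  "a\<in>Ob C ==> NDom (MO Gm a) = TO (MDom Gm) a" "a\<in>Ob C ==> NCod (MO Gm a) = TO (MCod Gm) a"
  "wmod (TO (MDom Gm)) (\<lambda>f. NAt (TA (MDom Gm) f)) (TO (MCod Gm)) (\<lambda>f. NAt (TA (MCod Gm) f)) (\<lambda>a. NAt (MO Gm a))"
proof -
 have m: "cat_modification (LD C) Gm" "TDom (MDom Gm) = W" "TCod (MDom Gm) = V X" using assms by simp_all
 show o: "MDom Gm\<in>Ob (wc X)" "MCod Gm\<in>Ob (wc X)" "MO Gm\<in>extensional (Ob C)" and n: "a\<in>Ob C ==> nat_trans (MO Gm a)"
  "a\<in>Ob C ==> NDom (MO Gm a) = TO (MDom Gm) a" "a\<in>Ob C ==> NCod (MO Gm a) = TO (MCod Gm) a" for a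
  using m unfolding cat_modification_def Let_def PiE_iff by simp_all
 note s = wc_obD[OF o(1) assms(2)] note t = wc_obD[OF o(2) assms(2)]
 note S = wcone_functor[OF s(1)] note T = wcone_functor[OF t(1)]
 have at: "NAt (MO Gm a) w\<in>Cel H" "Dm H (NAt (MO Gm a) w) = FOb (TO (MDom Gm) a) w" "Cd H (NAt (MO Gm a) w) = FOb (TO (MCod Gm) a) w"
  if "a\<in>Ob C" "w\<in>Ob (PO W a)" for a w
  using nat_trans_at[OF n(1)[OF that(1)], of "HomC H X (PO B a)" w] n[OF that(1)] S T that by simp_all
 have nat: "(MO Gm (Cod C f) \<star>\<^sub>N nid (PA W f)) \<bullet>\<^sub>N TA (MDom Gm) f = TA (MCod Gm) f \<bullet>\<^sub>N (nid (yo_arr H X (PA B f)) \<star>\<^sub>N MO Gm (Dom C f))"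
  if "f\<in>Ar C" for f
  using m that assms(2) unfolding cat_modification_def Let_def by simp
 show "wmod (TO (MDom Gm)) (\<lambda>f. NAt (TA (MDom Gm) f)) (TO (MCod Gm)) (\<lambda>f. NAt (TA (MCod Gm) f)) (\<lambda>a. NAt (MO Gm a))"
  unfolding wmod_def
 proof (intro conjI ballI)
  fix a m assume h: "a\<in>Ob C" "m\<in>Ar (PO W a)"
  show "NAt (MO Gm a) (Cod (PO W a) m)\<bullet>FAr (TO (MDom Gm) a) m = FAr (TO (MCod Gm) a) m\<bullet>NAt (MO Gm a) (Dom (PO W a) m)"
   using nat_trans_natural[OF n(1)[OF h(1)], of m] n[OF h(1)] S(2-4)[of a] h by simp
 next
  fix f w assume h: "f\<in>Ar C" "w\<in>Ob (PO W (Dom C f))"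
  have w': "FOb (PA W f) w\<in>Ob (PO W (Cod C f))" using h functor_ob[of "PA W f"] by auto
  show "NAt (MO Gm (Cod C f)) (FOb (PA W f) w)\<bullet>NAt (TA (MDom Gm) f) w =
    NAt (TA (MCod Gm) f) w\<bullet>(Idc H (PA B f)\<star>NAt (MO Gm (Dom C f)) w)"
   using arg_cong[OF nat[OF h(1)], of "\<lambda>sig. NAt sig w"] h w' n[of "Cod C f"] n[of "Dom C f"] s(7,8)[OF h(1)] S T at[of "Dom C f" w] at[of "Cod C f" "FOb (PA W f) w"]
    wcone_ob[OF s(1), of "Dom C f" w] wcone_ob[OF t(1), of "Dom C f" w]
   by simp
 qed (use at in auto)
qed

lemma wc_arI:
 assumes X: "X\<in>Obj H" and o: "MDom Gm\<in>Ob (wc X)" "MCod Gm\<in>Ob (wc X)" "MO Gm\<in>extensional (Ob C)"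
  and n: "!!a. a\<in>Ob C ==> NDom (MO Gm a) = TO (MDom Gm) a" "!!a. a\<in>Ob C ==> NCod (MO Gm a) = TO (MCod Gm) a"
   "!!a. a\<in>Ob C ==> NAt (MO Gm a)\<in>extensional (Ob (PO W a))"
  and m: "wmod (TO (MDom Gm)) (\<lambda>f. NAt (TA (MDom Gm) f)) (TO (MCod Gm)) (\<lambda>f. NAt (TA (MCod Gm) f)) (\<lambda>a. NAt (MO Gm a))"
 shows "Gm\<in>Ar (wc X)"
proof -
 note s = wc_obD[OF o(1) X] note t = wc_obD[OF o(2) X]
 note S = wcone_functor[OF s(1)] note T = wcone_functor[OF t(1)]
 have nt: "nat_trans (MO Gm a)" if a: "a\<in>Ob C" for a
  by (rule nat_transI)
   (use n[OF a] S(2-4)[of a] T(2-4)[of a] a wmodD(1-4)[OF m] wcone_ob[OF s(1) a] wcone_ob[OF t(1) a] in auto)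
 have "cat_modification (LD C) Gm"
  unfolding cat_modification_def Let_def PiE_iff
 proof (intro conjI ballI)
  fix Y Z f assume "Y\<in>Obj (LD C)" "Z\<in>Obj (LD C)" "f\<in>Hom1 (LD C) Y Z"
  then have f: "f\<in>Ar C" and [simp]: "Y = Dom C f" "Z = Cod C f" by auto
  have "(MO Gm (Cod C f) \<star>\<^sub>N nid (PA W f)) \<bullet>\<^sub>N TA (MDom Gm) f = TA (MCod Gm) f \<bullet>\<^sub>N (nid (yo_arr H X (PA B f)) \<star>\<^sub>N MO Gm (Dom C f))"
  proof (rule nat_trans_eqI)
   fix w assume "w\<in>Ob (FDom (NDom ((MO Gm (Cod C f) \<star>\<^sub>N nid (PA W f)) \<bullet>\<^sub>N TA (MDom Gm) f)))"
   then have w: "w\<in>Ob (PO W (Dom C f))" using s(7)[OF f] S f by simp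
   have w': "FOb (PA W f) w\<in>Ob (PO W (Cod C f))" using f w functor_ob[of "PA W f"] by auto
   show "NAt ((MO Gm (Cod C f) \<star>\<^sub>N nid (PA W f)) \<bullet>\<^sub>N TA (MDom Gm) f) w = NAt (TA (MCod Gm) f \<bullet>\<^sub>N (nid (yo_arr H X (PA B f)) \<star>\<^sub>N MO Gm (Dom C f))) w"
    using wmodD(5)[OF m f w] f w w' n[of "Cod C f"] n[of "Dom C f"] s(7,8)[OF f] S T wmodD(1-3)[OF m, of "Dom C f" w] wmodD(1-3)[OF m, of "Cod C f" "FOb (PA W f) w"]
    wcone_ob[OF s(1), of "Dom C f" w] wcone_ob[OF t(1), of "Dom C f" w] by simp
  qed (use nt[of "Dom C f"] nt[of "Cod C f"] f n[of "Dom C f"] n[of "Cod C f"] s(6-8)[OF f] t(6-8)[OF f] S T X in simp_all)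
  then show "(MO Gm Z \<star>\<^sub>N nid (PA (TDom (MDom Gm)) f)) \<bullet>\<^sub>N TA (MDom Gm) f = TA (MCod Gm) f \<bullet>\<^sub>N (nid (PA (TCod (MDom Gm)) f) \<star>\<^sub>N MO Gm Y)"
   using f s(2,3) X by simp
 qed (use o nt n in auto)
 then show ?thesis using o by simp
qed

lemma wc_ar_eqI:
 assumes X: "X\<in>Obj H" and "Gm\<in>Ar (wc X)" "Dl\<in>Ar (wc X)" "MDom Gm = MDom Dl" "MCod Gm = MCod Dl"
  and "!!a w. a\<in>Ob C ==> w\<in>Ob (PO W a) ==> NAt (MO Gm a) w = NAt (MO Dl a) w"
 shows "Gm = Dl"
proof -
 note g = wc_arD[OF assms(2) X] note d = wc_arD[OF assms(3) X]
 have "MO Gm a = MO Dl a" if "a\<in>Ob C" for a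
  by (rule nat_trans_eqI) (use that assms g d wcone_functor[OF wc_obD(1)[OF g(1) X]] in auto)
 then have "MO Gm = MO Dl" using g d by (auto intro!: extensionalityI)
 then show ?thesis using assms by simp
qed

lemma wc_ob_eqI:
 assumes X: "X\<in>Obj H" and "s\<in>Ob (wc X)" "t\<in>Ob (wc X)" "!!a. a\<in>Ob C ==> TO s a = TO t a"
  and "!!f w. f\<in>Ar C ==> w\<in>Ob (PO W (Dom C f)) ==> NAt (TA s f) w = NAt (TA t f) w"
 shows "s = t"
proof -
 note g = wc_obD[OF assms(2) X] note d = wc_obD[OF assms(3) X]
 have "TO s = TO t" using g d assms by (auto intro!: extensionalityI)
 moreover have "TA s f = TA t f" if "f\<in>Ar C" for f
  by (rule nat_trans_eqI) (use that assms g d wcone_functor[OF g(1)] in auto)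
 then have "TA s = TA t" using g d by (auto intro!: extensionalityI)
 ultimately show ?thesis using g d by simp
qed

end

context weighted
begin

section \<open>The category of weighted cones\<close>

lemma wc_category [simp]: assumes X: "X\<in>Obj H" shows "category (wc X)"
proof -
 have comp: "Dl\<cdot>\<^bsub>wc X\<^esub>Gm\<in>Ar (wc X)" if h: "Gm\<in>Ar (wc X)" "Dl\<in>Ar (wc X)" "MCod Gm = MDom Dl" for Gm Dl
 proof (rule wc_arI[OF X])
  note g = wc_arD[OF h(1) X] note d = wc_arD[OF h(2) X]
  note s = wc_obD[OF g(1) X] note t = wc_obD[OF g(2) X] note u = wc_obD[OF d(2) X]
  show "MDom (Dl\<cdot>\<^bsub>wc X\<^esub>Gm)\<in>Ob (wc X)" "MCod (Dl\<cdot>\<^bsub>wc X\<^esub>Gm)\<in>Ob (wc X)" using g(1) d(2) by simp_all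
  show "MO (Dl\<cdot>\<^bsub>wc X\<^esub>Gm)\<in>extensional (Ob C)" by (simp add: CatPsHom_def)
  show "NDom (MO (Dl\<cdot>\<^bsub>wc X\<^esub>Gm) a) = TO (MDom (Dl\<cdot>\<^bsub>wc X\<^esub>Gm)) a" "NCod (MO (Dl\<cdot>\<^bsub>wc X\<^esub>Gm) a) = TO (MCod (Dl\<cdot>\<^bsub>wc X\<^esub>Gm)) a"
   "NAt (MO (Dl\<cdot>\<^bsub>wc X\<^esub>Gm) a)\<in>extensional (Ob (PO W a))" if "a\<in>Ob C" for a
   using that g d h nvcomp_trans[of "MO Gm a" "MO Dl a"] nat_trans_ext[of "MO Dl a \<bullet>\<^sub>N MO Gm a"] wcone_functor[OF s(1)] by simp_all
  have at: "NAt (MO (Dl\<cdot>\<^bsub>wc X\<^esub>Gm) a) w = NAt (MO Dl a) w\<bullet>NAt (MO Gm a) w" if "a\<in>Ob C" "w\<in>Ob (PO W a)" for a w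
   using that g d wcone_functor[OF s(1)] by simp
  show "wmod (TO (MDom (Dl\<cdot>\<^bsub>wc X\<^esub>Gm))) (\<lambda>f. NAt (TA (MDom (Dl\<cdot>\<^bsub>wc X\<^esub>Gm)) f)) (TO (MCod (Dl\<cdot>\<^bsub>wc X\<^esub>Gm)))
   (\<lambda>f. NAt (TA (MCod (Dl\<cdot>\<^bsub>wc X\<^esub>Gm)) f)) (\<lambda>a. NAt (MO (Dl\<cdot>\<^bsub>wc X\<^esub>Gm) a))"
   unfolding wmod_def
  proof (intro conjI ballI)
   fix a m assume m: "a\<in>Ob C" "m\<in>Ar (PO W a)"
   let ?x = "Dom (PO W a) m" let ?y = "Cod (PO W a) m"
   have xy: "?x\<in>Ob (PO W a)" "?y\<in>Ob (PO W a)" using m by simp_all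
   have "(NAt (MO Dl a) ?y\<bullet>NAt (MO Gm a) ?y)\<bullet>FAr (TO (MDom Gm) a) m = NAt (MO Dl a) ?y\<bullet>(NAt (MO Gm a) ?y\<bullet>FAr (TO (MDom Gm) a) m)"
    using m xy wmodD[OF g(7)] wmodD[OF d(7)] wcone_ar[OF s(1) m] h by simp
   also have "... = (NAt (MO Dl a) ?y\<bullet>FAr (TO (MDom Dl) a) m)\<bullet>NAt (MO Gm a) ?x"
    unfolding wmodD(4)[OF g(7) m] using m xy wmodD(1-3)[OF g(7)] wmodD(1-3)[OF d(7)] wcone_ar[OF t(1) m] h by simp
   also have "... = FAr (TO (MCod Dl) a) m\<bullet>(NAt (MO Dl a) ?x\<bullet>NAt (MO Gm a) ?x)"
    unfolding wmodD(4)[OF d(7) m] using m xy wmodD(1-3)[OF g(7)] wmodD(1-3)[OF d(7)] wcone_ar[OF u(1) m] h by simp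
   finally show "NAt (MO (Dl\<cdot>\<^bsub>wc X\<^esub>Gm) a) (Cod (PO W a) m)\<bullet>FAr (TO (MDom (Dl\<cdot>\<^bsub>wc X\<^esub>Gm)) a) m =
     FAr (TO (MCod (Dl\<cdot>\<^bsub>wc X\<^esub>Gm)) a) m\<bullet>NAt (MO (Dl\<cdot>\<^bsub>wc X\<^esub>Gm) a) (Dom (PO W a) m)"
    using at m xy by simp
  next
   fix f w assume f: "f\<in>Ar C" "w\<in>Ob (PO W (Dom C f))"
   let ?x = "FOb (PA W f) w"
   have x: "?x\<in>Ob (PO W (Cod C f))" using f functor_ob[of "PA W f"] by auto
   have "(NAt (MO Dl (Cod C f)) ?x\<bullet>NAt (MO Gm (Cod C f)) ?x)\<bullet>NAt (TA (MDom Gm) f) w =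
    NAt (MO Dl (Cod C f)) ?x\<bullet>(NAt (MO Gm (Cod C f)) ?x\<bullet>NAt (TA (MDom Gm) f) w)"
    using f x wmodD(1-3)[OF g(7)] wmodD(1-3)[OF d(7)] wcone_cel[OF s(1) f] h by simp
   also have "... = (NAt (MO Dl (Cod C f)) ?x\<bullet>NAt (TA (MDom Dl) f) w)\<bullet>(Idc H (PA B f)\<star>NAt (MO Gm (Dom C f)) w)"
    unfolding wmodD(5)[OF g(7) f] using f x wmodD(1-3)[OF g(7)] wmodD(1-3)[OF d(7)] wcone_cel[OF t(1) f] wcone_ob[OF s(1), of "Dom C f" w] h by simp
   also have "... = NAt (TA (MCod Dl) f) w\<bullet>(Idc H (PA B f)\<star>(NAt (MO Dl (Dom C f)) w\<bullet>NAt (MO Gm (Dom C f)) w))"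
    unfolding wmodD(5)[OF d(7) f] using f x wmodD(1-3)[OF g(7)] wmodD(1-3)[OF d(7)] wcone_cel[OF u(1) f]
     wcone_ob[OF s(1), of "Dom C f" w] wcone_ob[OF t(1), of "Dom C f" w] h by simp
   finally show "NAt (MO (Dl\<cdot>\<^bsub>wc X\<^esub>Gm) (Cod C f)) ?x\<bullet>NAt (TA (MDom (Dl\<cdot>\<^bsub>wc X\<^esub>Gm)) f) w =
    NAt (TA (MCod (Dl\<cdot>\<^bsub>wc X\<^esub>Gm)) f) w\<bullet>(Idc H (PA B f)\<star>NAt (MO (Dl\<cdot>\<^bsub>wc X\<^esub>Gm) (Dom C f)) w)"
    using at f x by simp
  qed (use at wmodD(1-3)[OF g(7)] wmodD(1-3)[OF d(7)] h in auto)
 qed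
 have id: "Id (wc X) t\<in>Ar (wc X)" if t: "t\<in>Ob (wc X)" for t
 proof (rule wc_arI[OF X])
  note s = wc_obD[OF t X] note S = wcone_functor[OF s(1)]
  show "MDom (Id (wc X) t)\<in>Ob (wc X)" "MCod (Id (wc X) t)\<in>Ob (wc X)" using t by simp_all
  show "MO (Id (wc X) t)\<in>extensional (Ob C)" by (simp add: CatPsHom_def)
  show "NAt (MO (Id (wc X) t) a)\<in>extensional (Ob (PO W a))" if "a\<in>Ob C" for a
   using that S nat_trans_ext[of "nid (TO t a)"] by simp
  have sa: "FAr (TO t a) m\<in>Cel H" "Dm H (FAr (TO t a) m) = FOb (TO t a) (Dom (PO W a) m)" "Cd H (FAr (TO t a) m) = FOb (TO t a) (Cod (PO W a) m)"
   if "a\<in>Ob C" "m\<in>Ar (PO W a)" for a m using wcone_ar[OF s(1) that] .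
  show "wmod (TO (MDom (Id (wc X) t))) (\<lambda>f. NAt (TA (MDom (Id (wc X) t)) f)) (TO (MCod (Id (wc X) t)))
   (\<lambda>f. NAt (TA (MCod (Id (wc X) t)) f)) (\<lambda>a. NAt (MO (Id (wc X) t) a))"
   unfolding wmod_def using S sa wcone_ob[OF s(1)] wcone_cel[OF s(1)] functor_ob[of "PA W _"] by simp
 qed simp_all
 show ?thesis
 proof (rule categoryI)
  fix Gm Dl \<Xi> assume h: "Gm\<in>Ar (wc X)" "Dl\<in>Ar (wc X)" "\<Xi>\<in>Ar (wc X)" "Cod (wc X) Gm = Dom (wc X) Dl" "Cod (wc X) Dl = Dom (wc X) \<Xi>"
  note hh = h[unfolded wc_simps(3,4)]
  show "(\<Xi>\<cdot>\<^bsub>wc X\<^esub>Dl)\<cdot>\<^bsub>wc X\<^esub>Gm = \<Xi>\<cdot>\<^bsub>wc X\<^esub>(Dl\<cdot>\<^bsub>wc X\<^esub>Gm)"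
  proof (rule wc_ar_eqI[OF X])
   show "(\<Xi>\<cdot>\<^bsub>wc X\<^esub>Dl)\<cdot>\<^bsub>wc X\<^esub>Gm\<in>Ar (wc X)" "\<Xi>\<cdot>\<^bsub>wc X\<^esub>(Dl\<cdot>\<^bsub>wc X\<^esub>Gm)\<in>Ar (wc X)"
    using hh comp[OF hh(1,2)] comp[OF hh(2,3)] by (auto simp del: wc_simps(2) intro!: comp)
  qed (use hh wc_arD(4-6)[OF hh(1) X] wc_arD(4-6)[OF hh(2) X] wc_arD(4-6)[OF hh(3) X] in "simp_all del: wc_simps(2)")
 next
  fix Gm assume h: "Gm\<in>Ar (wc X)"
  note o = wc_arD[OF h X]
  show "Gm\<cdot>\<^bsub>wc X\<^esub>Id (wc X) (Dom (wc X) Gm) = Gm \<and> Id (wc X) (Cod (wc X) Gm)\<cdot>\<^bsub>wc X\<^esub>Gm = Gm"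
  proof
   show "Gm\<cdot>\<^bsub>wc X\<^esub>Id (wc X) (Dom (wc X) Gm) = Gm"
    by (rule wc_ar_eqI[OF X]) (use h o id[OF o(1)] comp[OF id[OF o(1)] h] in "simp_all del: wc_simps(1,2)")
   show "Id (wc X) (Cod (wc X) Gm)\<cdot>\<^bsub>wc X\<^esub>Gm = Gm"
    by (rule wc_ar_eqI[OF X]) (use h o id[OF o(2)] comp[OF h id[OF o(2)]] in "simp_all del: wc_simps(1,2)")
  qed
  show "Dom (wc X) Gm\<in>Ob (wc X) \<and> Cod (wc X) Gm\<in>Ob (wc X)" using o(1,2) by simp
 qed (use comp id in "simp_all del: wc_simps(1,2)")
qed

section \<open>Precomposition of weighted cones with 1-cells and 2-cells\<close>

definition act :: "'b => ('o, 'm, 'm, 'x, 'y, 'b, 'd) catpsnt => ('o, 'm, 'm, 'x, 'y, 'b, 'd) catpsnt" where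
 "act u t = cat_psn_comp (LD C) (hom_into_arr (LD C) H B u) t"

definition actc :: "'d => ('o, 'm, 'm, 'x, 'y, 'b, 'd) catmdf => ('o, 'm, 'm, 'x, 'y, 'b, 'd) catmdf" where
 "actc th Gm = cat_mdf_hcomp (LD C) (hom_into_cell (LD C) H B th) Gm"

lemma hom_into_arr_simps:
 assumes "u\<in>Arr H"
 shows "TDom (hom_into_arr (LD C) H B u) = V (Tgt H u)" "TCod (hom_into_arr (LD C) H B u) = V (Src H u)"
  "a\<in>Ob C ==> TO (hom_into_arr (LD C) H B u) a = yo_arr (OpT H) (PO B a) u"
  "f\<in>Ar C ==> TA (hom_into_arr (LD C) H B u) f = nid (yo_arr (OpT H) (PO B (Cod C f)) u \<circ>\<^sub>F yo_arr H (Tgt H u) (PA B f))"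
 using assms by (simp_all add: hom_into_arr_def yo_eq)

text \<open>Precomposition whiskers every component with \<open>u\<close>, so each clause of
  \<open>wcone\<close> for \<open>act u t\<close> is the same clause for \<open>t\<close>,
  whiskered.\<close>

lemma act:
 assumes u: "u\<in>Arr H" and t: "t\<in>Ob (wc (Tgt H u))"
 shows "act u t\<in>Ob (wc (Src H u))"
  "a\<in>Ob C ==> w\<in>Ob (PO W a) ==> FOb (TO (act u t) a) w = FOb (TO t a) w\<odot>u"
  "a\<in>Ob C ==> m\<in>Ar (PO W a) ==> FAr (TO (act u t) a) m = FAr (TO t a) m\<star>Idc H u"
  "f\<in>Ar C ==> w\<in>Ob (PO W (Dom C f)) ==> NAt (TA (act u t) f) w = NAt (TA t f) w\<star>Idc H u"
proof -
 let ?X = "Tgt H u" let ?Y = "Src H u"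
 have X: "?X\<in>Obj H" "?Y\<in>Obj H" using u by simp_all
 note s = wc_obD[OF t X(1)] note S = wcone_functor[OF s(1)]
 note so = wcone_ob[OF s(1)] note sa = wcone_ar[OF s(1)] note sc = wcone_cel[OF s(1)]
 have D: "TDom (act u t) = W" "TCod (act u t) = V ?Y" "TO (act u t)\<in>extensional (Ob C)" "TA (act u t)\<in>extensional (Ar C)"
  "a\<in>Ob C ==> TO (act u t) a = yo_arr (OpT H) (PO B a) u \<circ>\<^sub>F TO t a"
  "f\<in>Ar C ==> TA (act u t) f = (nid (yo_arr (OpT H) (PO B (Cod C f)) u) \<star>\<^sub>N TA t f) \<bullet>\<^sub>N
   (nid (yo_arr (OpT H) (PO B (Cod C f)) u \<circ>\<^sub>F yo_arr H ?X (PA B f)) \<star>\<^sub>N nid (TO t (Dom C f)))" for a f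
  using s(2,3) u by (simp_all add: act_def cat_psn_comp_def hom_into_arr_simps)
 show ob: "FOb (TO (act u t) a) w = FOb (TO t a) w\<odot>u" if "a\<in>Ob C" "w\<in>Ob (PO W a)" for a w
  using that D S so by simp
 show ar: "FAr (TO (act u t) a) m = FAr (TO t a) m\<star>Idc H u" if "a\<in>Ob C" "m\<in>Ar (PO W a)" for a m
  using that D S so sa[OF that] by simp
 have fu: "is_functor (yo_arr (OpT H) (PO B a) u)" if "a\<in>Ob C" for a using that u by simp
 show cel: "NAt (TA (act u t) f) w = NAt (TA t f) w\<star>Idc H u" if "f\<in>Ar C" "w\<in>Ob (PO W (Dom C f))" for f w
  using that D S so[of "Dom C f" w] sc[OF that] s(6-8)[OF that(1)] u X functor_ob[of "PA W f"] fu so[of "Cod C f" "FOb (PA W f) w"] by simp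
 have w: "wcone ?Y (TO (act u t)) (\<lambda>f. NAt (TA (act u t) f))"
  unfolding wcone_def
 proof (intro conjI ballI impI)
  show "is_functor (TO (act u t) a)" "FDom (TO (act u t) a) = PO W a" "FCod (TO (act u t) a) = HomC H ?Y (PO B a)" if "a\<in>Ob C" for a
   using that D S fu by simp_all
  show "?Y\<in>Obj H" by (rule X)
 next
  fix f w assume h: "f\<in>Ar C" "w\<in>Ob (PO W (Dom C f))"
  have x: "FOb (PA W f) w\<in>Ob (PO W (Cod C f))" using h functor_ob[of "PA W f"] by auto
  show "inv_cell H (NAt (TA (act u t) f) w)" "Dm H (NAt (TA (act u t) f) w) = PA B f\<odot>FOb (TO (act u t) (Dom C f)) w"
   "Cd H (NAt (TA (act u t) f) w) = FOb (TO (act u t) (Cod C f)) (FOb (PA W f) w)"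
   using cel[OF h] ob[of "Dom C f" w] ob[of "Cod C f" "FOb (PA W f) w"] h x sc[OF h] so[of "Dom C f" w] u by simp_all
 next
  fix f m assume h: "f\<in>Ar C" "m\<in>Ar (PO W (Dom C f))"
  have x: "FAr (PA W f) m\<in>Ar (PO W (Cod C f))" using h functor_ar[of "PA W f"] by auto
  have x': "Dom (PO W (Cod C f)) (FAr (PA W f) m) = FOb (PA W f) (Dom (PO W (Dom C f)) m)" using h functor_dom_cod[of "PA W f" "PO W (Cod C f)"] by auto
  have o: "Dom (PO W (Dom C f)) m\<in>Ob (PO W (Dom C f))" "Cod (PO W (Dom C f)) m\<in>Ob (PO W (Dom C f))" using h by simp_all
  note sm = sa[OF _ h(2)] note sm' = sa[OF _ x] note c1 = sc[OF h(1) o(1)] note c2 = sc[OF h(1) o(2)]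
  show "NAt (TA (act u t) f) (Cod (PO W (Dom C f)) m)\<bullet>(Idc H (PA B f)\<star>FAr (TO (act u t) (Dom C f)) m) =
    FAr (TO (act u t) (Cod C f)) (FAr (PA W f) m)\<bullet>NAt (TA (act u t) f) (Dom (PO W (Dom C f)) m)"
   using arg_cong[OF wcone_nat[OF s(1) h], of "\<lambda>x. x\<star>Idc H u"] h x x' o sm sm' c1 c2 cel ar u
    so[of "Dom C f" "Cod (PO W (Dom C f)) m"] so[of "Dom C f" "Dom (PO W (Dom C f)) m"] by simp
 next
  fix f g w assume h: "f\<in>Ar C" "g\<in>Ar C" "w\<in>Ob (PO W (Dom C f))" "Cod C f = Dom C g"
  have x: "FOb (PA W f) w\<in>Ob (PO W (Dom C g))" using h functor_ob[of "PA W f"] by auto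
  have gf: "g\<cdot>\<^bsub>C\<^esub>f\<in>Ar C" "w\<in>Ob (PO W (Dom C (g\<cdot>\<^bsub>C\<^esub>f)))" using h by simp_all
  note pm = pw_m[OF h(1,2,4)] note sm = sa[of "Cod C g" "NAt (PM W g f) w"]
  show "NAt (TA (act u t) (g\<cdot>\<^bsub>C\<^esub>f)) w\<bullet>(PM B g f\<star>Idc H (FOb (TO (act u t) (Dom C f)) w)) =
    FAr (TO (act u t) (Cod C g)) (NAt (PM W g f) w)\<bullet>NAt (TA (act u t) g) (FOb (PA W f) w)\<bullet>(Idc H (PA B g)\<star>NAt (TA (act u t) f) w)"
   using arg_cong[OF wcone_comp[OF s(1) h(1,2,4,3)], of "\<lambda>x. x\<star>Idc H u"] h x gf pm sm sc[OF h(1,3)] sc[OF h(2) x] sc[OF gf] cel ar ob u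
    so[of "Dom C f" w] so[of "Dom C g" "FOb (PA W f) w"] by simp
 next
  fix a w assume h: "a\<in>Ob C" "w\<in>Ob (PO W a)"
  note pu = pw_u[OF h(1)] note sm = sa[of a "NAt (PU W a) w"]
  have i: "Id C a\<in>Ar C" "w\<in>Ob (PO W (Dom C (Id C a)))" using h by simp_all
  show "NAt (TA (act u t) (Id C a)) w\<bullet>(PU B a\<star>Idc H (FOb (TO (act u t) a) w)) = FAr (TO (act u t) a) (NAt (PU W a) w)"
   using arg_cong[OF wcone_unit[OF s(1) h], of "\<lambda>x. x\<star>Idc H u"] h i pu sm sc[OF i] cel ar ob u so[OF h] by simp
 qed
 \<comment> \<open>Composing with \<open>B f\<close> on one side and with \<open>u\<close> on the
   other commute strictly, by associativity in \<open>H\<close>.\<close>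
 have comm: "yo_arr (OpT H) (PO B (Cod C f)) u \<circ>\<^sub>F yo_arr H ?X (PA B f) = yo_arr H ?Y (PA B f) \<circ>\<^sub>F yo_arr (OpT H) (PO B (Dom C f)) u"
  if "f\<in>Ar C" for f
  by (rule functor_eqI) (use that u X in auto)
 have "cat_psnat (LD C) (act u t)"
 proof (rule wcone_cat_psnat[OF w D(1-4)])
  fix f assume f: "f\<in>Ar C"
  show "NDom (TA (act u t) f) = yo_arr H ?Y (PA B f) \<circ>\<^sub>F TO (act u t) (Dom C f)"
   using f D S s(6-8)[OF f] u X fu comm[OF f] by (simp flip: fcomp_assoc)
  show "NCod (TA (act u t) f) = TO (act u t) (Cod C f) \<circ>\<^sub>F PA W f"
   using f D S s(6-8)[OF f] u X fu by simp
  show "NAt (TA (act u t) f)\<in>extensional (Ob (PO W (Dom C f)))"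
   using f D S s(6-8)[OF f] u X by (simp add: nvcomp_def)
 qed
 then show "act u t\<in>Ob (wc ?Y)" using D by simp
qed

text \<open>The component formula writes the horizontal composite as \<open>Gm\<close> followed by
  \<open>th\<close>. The clauses of \<open>wmod\<close> then need one interchange of
  \<open>th\<close> with a cell of the target cone.\<close>

lemma actc:
 assumes q: "th\<in>Cel H" and G: "Gm\<in>Ar (wc (Tgt H (Dm H th)))"
 shows "MDom (actc th Gm) = act (Dm H th) (MDom Gm)" "MCod (actc th Gm) = act (Cd H th) (MCod Gm)"
  "a\<in>Ob C ==> w\<in>Ob (PO W a) ==> NAt (MO (actc th Gm) a) w =
    (Idc H (FOb (TO (MCod Gm) a) w)\<star>th)\<bullet>(NAt (MO Gm a) w\<star>Idc H (Dm H th))"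
  "actc th Gm\<in>Ar (wc (Src H (Dm H th)))"
proof -
 let ?x1 = "actc th Gm"
 let ?u = "Dm H th" let ?v = "Cd H th" let ?X = "Tgt H ?u" let ?Y = "Src H ?u"
 have X: "?X\<in>Obj H" "?Y\<in>Obj H" using q by simp_all
 note g = wc_arD[OF G X(1)] note s = wc_obD[OF g(1) X(1)] note t = wc_obD[OF g(2) X(1)]
 note S = wcone_functor[OF s(1)] note T = wcone_functor[OF t(1)] note m = wmodD[OF g(7)]
 have uv: "?u\<in>Arr H" "?v\<in>Arr H" "Tgt H ?v = ?X" "Src H ?v = ?Y" using q by simp_all
 note as = act[OF uv(1) g(1)]
 have t': "MCod Gm\<in>Ob (wc (Tgt H ?v))" using g(2) uv by simp
 note at = act[OF uv(2) t', unfolded uv]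
 show D: "MDom ?x1 = act ?u (MDom Gm)" "MCod ?x1 = act ?v (MCod Gm)"
  by (simp_all add: actc_def act_def cat_mdf_hcomp_def hom_into_cell_def)
 have MO: "MO ?x1 a = yo_cel (OpT H) (PO B a) th \<star>\<^sub>N MO Gm a" if "a\<in>Ob C" for a
  using that q by (simp add: actc_def cat_mdf_hcomp_def hom_into_cell_def yo_eq)
 show cel: "NAt (MO ?x1 a) w = (Idc H (FOb (TO (MCod Gm) a) w)\<star>th)\<bullet>(NAt (MO Gm a) w\<star>Idc H ?u)" if "a\<in>Ob C" "w\<in>Ob (PO W a)" for a w
  using that MO g(4-6)[OF that(1)] S T q m(1-3)[OF that] wcone_ob[OF s(1) that] wcone_ob[OF t(1) that] by simp
 show "actc th Gm\<in>Ar (wc ?Y)"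
 proof (rule wc_arI[OF X(2)])
  show "MDom ?x1\<in>Ob (wc ?Y)" "MCod ?x1\<in>Ob (wc ?Y)" using D as(1) at(1) by simp_all
  show "MO ?x1\<in>extensional (Ob C)" by (simp add: actc_def cat_mdf_hcomp_def)
  fix a assume a: "a\<in>Ob C"
  have TOact: "TO (act u r) a = yo_arr (OpT H) (PO B a) u \<circ>\<^sub>F TO r a" if "u\<in>Arr H" for u r
   using a that by (simp add: act_def cat_psn_comp_def hom_into_arr_simps)
  show "NDom (MO ?x1 a) = TO (MDom ?x1) a" "NCod (MO ?x1 a) = TO (MCod ?x1) a"
   using a MO[OF a] g(5,6)[OF a] D TOact uv(1,2) by simp_all
  show "NAt (MO ?x1 a)\<in>extensional (Ob (PO W a))"
   using a MO[OF a] g(5,6)[OF a] S by (simp add: nhcomp_def)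
 next
  show "wmod (TO (MDom ?x1)) (\<lambda>f. NAt (TA (MDom ?x1) f)) (TO (MCod ?x1)) (\<lambda>f. NAt (TA (MCod ?x1) f)) (\<lambda>a. NAt (MO ?x1 a))"
   unfolding wmod_def D
  proof (intro conjI ballI)
   fix a w assume h: "a\<in>Ob C" "w\<in>Ob (PO W a)"
   show "NAt (MO ?x1 a) w\<in>Hom2 H (FOb (TO (act ?u (MDom Gm)) a) w) (FOb (TO (act ?v (MCod Gm)) a) w)"
    using cel[OF h] as(2)[OF h] at(2)[OF h] m(1-3)[OF h] wcone_ob[OF s(1) h] wcone_ob[OF t(1) h] q by simp
  next
   fix a n assume h: "a\<in>Ob C" "n\<in>Ar (PO W a)"
   let ?x = "Dom (PO W a) n" let ?y = "Cod (PO W a) n"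
   have xy: "?x\<in>Ob (PO W a)" "?y\<in>Ob (PO W a)" using h by simp_all
   let ?t = "TO (MCod Gm) a" let ?s = "TO (MDom Gm) a"
   note so = wcone_ob[OF s(1) h(1) xy(1)] wcone_ob[OF s(1) h(1) xy(2)] wcone_ob[OF t(1) h(1) xy(1)] wcone_ob[OF t(1) h(1) xy(2)]
   note sa = wcone_ar[OF s(1) h] wcone_ar[OF t(1) h] note mm = m(1-3)[OF h(1) xy(1)] m(1-3)[OF h(1) xy(2)]
   have i: "(Idc H (FOb ?t ?y)\<star>th)\<bullet>(FAr ?t n\<star>Idc H ?u) = (FAr ?t n\<star>Idc H ?v)\<bullet>(Idc H (FOb ?t ?x)\<star>th)"
    using tc_hc_whisker[OF HC(1), of th "FAr ?t n"] so sa q by simp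
   have "((Idc H (FOb ?t ?y)\<star>th)\<bullet>(NAt (MO Gm a) ?y\<star>Idc H ?u))\<bullet>(FAr ?s n\<star>Idc H ?u) =
    (Idc H (FOb ?t ?y)\<star>th)\<bullet>((NAt (MO Gm a) ?y\<bullet>FAr ?s n)\<star>Idc H ?u)" using so sa mm q by simp
   also have "... = ((Idc H (FOb ?t ?y)\<star>th)\<bullet>(FAr ?t n\<star>Idc H ?u))\<bullet>(NAt (MO Gm a) ?x\<star>Idc H ?u)"
    unfolding m(4)[OF h] using so sa mm q by simp
   also have "... = (FAr ?t n\<star>Idc H ?v)\<bullet>((Idc H (FOb ?t ?x)\<star>th)\<bullet>(NAt (MO Gm a) ?x\<star>Idc H ?u))"
    unfolding i using so sa mm q by simp
   finally show "NAt (MO ?x1 a) ?y\<bullet>FAr (TO (act ?u (MDom Gm)) a) n = FAr (TO (act ?v (MCod Gm)) a) n\<bullet>NAt (MO ?x1 a) ?x"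
    using cel h xy as(3)[OF h] at(3)[OF h] by simp
  next
   fix f w assume h: "f\<in>Ar C" "w\<in>Ob (PO W (Dom C f))"
   let ?x = "FOb (PA W f) w"
   have x: "?x\<in>Ob (PO W (Cod C f))" "Dom C f\<in>Ob C" "Cod C f\<in>Ob C" using h functor_ob[of "PA W f"] by auto
   let ?t = "\<lambda>a. FOb (TO (MCod Gm) a)" let ?s = "\<lambda>a. FOb (TO (MDom Gm) a)"
   let ?tf = "NAt (TA (MCod Gm) f) w" let ?sf = "NAt (TA (MDom Gm) f) w" let ?m = "\<lambda>a. NAt (MO Gm a)"
   note so = wcone_ob[OF s(1) x(2) h(2)] wcone_ob[OF s(1) x(3,1)] wcone_ob[OF t(1) x(2) h(2)] wcone_ob[OF t(1) x(3,1)]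
   note sc = wcone_cel[OF s(1) h] wcone_cel[OF t(1) h] note mm = m(1-3)[OF x(2) h(2)] m(1-3)[OF x(3,1)]
   have i: "(Idc H (?t (Cod C f) ?x)\<star>th)\<bullet>(?tf\<star>Idc H ?u) = (?tf\<star>Idc H ?v)\<bullet>(Idc H (PA B f\<odot>?t (Dom C f) w)\<star>th)"
    using tc_hc_whisker[OF HC(1), of th ?tf] so sc q h by simp
   have "((Idc H (?t (Cod C f) ?x)\<star>th)\<bullet>(?m (Cod C f) ?x\<star>Idc H ?u))\<bullet>(?sf\<star>Idc H ?u) =
    (Idc H (?t (Cod C f) ?x)\<star>th)\<bullet>((?m (Cod C f) ?x\<bullet>?sf)\<star>Idc H ?u)" using so sc mm q h by simp
   also have "... = ((Idc H (?t (Cod C f) ?x)\<star>th)\<bullet>(?tf\<star>Idc H ?u))\<bullet>(Idc H (PA B f)\<star>?m (Dom C f) w\<star>Idc H ?u)"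
    unfolding m(5)[OF h] using so sc mm q h by simp
   also have "... = (?tf\<star>Idc H ?v)\<bullet>(Idc H (PA B f)\<star>((Idc H (?t (Dom C f) w)\<star>th)\<bullet>(?m (Dom C f) w\<star>Idc H ?u)))"
    unfolding i using so sc mm q h by simp
   finally show "NAt (MO ?x1 (Cod C f)) ?x\<bullet>NAt (TA (act ?u (MDom Gm)) f) w =
    NAt (TA (act ?v (MCod Gm)) f) w\<bullet>(Idc H (PA B f)\<star>NAt (MO ?x1 (Dom C f)) w)"
    using cel x h as(4)[OF h] at(4)[OF h] by simp
  qed
 qed
qed

definition wpa :: "'b => _" where
 "wpa u = \<lparr>FDom = wc (Tgt H u), FCod = wc (Src H u), FOb = restrict (act u) (Ob (wc (Tgt H u))),
   FAr = restrict (actc (Idc H u)) (Ar (wc (Tgt H u)))\<rparr>"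

definition wpc :: "'d => _" where
 "wpc th = \<lparr>NDom = wpa (Dm H th), NCod = wpa (Cd H th),
   NAt = (\<lambda>t\<in>Ob (wc (Tgt H (Dm H th))). actc th (Id (wc (Tgt H (Dm H th))) t))\<rparr>"

text \<open>\<open>wpa\<close> and \<open>wpc\<close> give names to the maps bound locally in
  \<open>weighted_cones\<close>.\<close>

lemma weighted_cones_eq: "weighted_cones (LD C) H W B = strict_psf (OpT H) CAT wc wpa wpc"
proof -
 have "wpa = (\<lambda>u. \<lparr>FDom = wc (Tgt H u), FCod = wc (Src H u), FOb = \<lambda>t\<in>Ob (wc (Tgt H u)). cat_psn_comp (LD C) (hom_into_arr (LD C) H B u) t,
        FAr = \<lambda>Gm\<in>Ar (wc (Tgt H u)). cat_mdf_hcomp (LD C) (hom_into_cell (LD C) H B (Idc H u)) Gm\<rparr>)"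
  by (rule ext) (simp only: wpa_def act_def[abs_def] actc_def[abs_def])
 then show ?thesis unfolding weighted_cones_def Let_def wpc_def[abs_def] actc_def[abs_def] by (simp only:)
qed

lemma wpa_simps [simp]: "FDom (wpa u) = wc (Tgt H u)" "FCod (wpa u) = wc (Src H u)"
 "t\<in>Ob (wc (Tgt H u)) ==> FOb (wpa u) t = act u t" "Gm\<in>Ar (wc (Tgt H u)) ==> FAr (wpa u) Gm = actc (Idc H u) Gm"
 "NDom (wpc th) = wpa (Dm H th)" "NCod (wpc th) = wpa (Cd H th)"
 "t\<in>Ob (wc (Tgt H (Dm H th))) ==> NAt (wpc th) t = actc th (Id (wc (Tgt H (Dm H th))) t)"
 by (simp_all add: wpa_def wpc_def del: wc_simps(1,2))

lemma act_ob_eqI: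
 assumes "X\<in>Obj H" "s\<in>Ob (wc X)" "t\<in>Ob (wc X)"
  and "!!a w. a\<in>Ob C ==> w\<in>Ob (PO W a) ==> FOb (TO s a) w = FOb (TO t a) w"
  and "!!a m. a\<in>Ob C ==> m\<in>Ar (PO W a) ==> FAr (TO s a) m = FAr (TO t a) m"
  and "!!f w. f\<in>Ar C ==> w\<in>Ob (PO W (Dom C f)) ==> NAt (TA s f) w = NAt (TA t f) w"
 shows "s = t"
proof (rule wc_ob_eqI[OF assms(1-3)])
 note s = wcone_functor[OF wc_obD(1)[OF assms(2,1)]] note t = wcone_functor[OF wc_obD(1)[OF assms(3,1)]]
 fix a assume "a\<in>Ob C"
 then show "TO s a = TO t a" using s t assms(4,5) by (intro functor_eqI) auto
qed (rule assms(6))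

lemma id_at: "t\<in>Ob (wc X) ==> X\<in>Obj H ==> a\<in>Ob C ==> w\<in>Ob (PO W a) ==> NAt (MO (Id (wc X) t) a) w = Idc H (FOb (TO t a) w)"
 using wcone_functor[OF wc_obD(1)[of t X]] by (simp del: wc_simps(1))

lemma comp_at: "Gm\<in>Ar (wc X) ==> X\<in>Obj H ==> a\<in>Ob C ==> w\<in>Ob (PO W a) ==>
 NAt (MO (Dl\<cdot>\<^bsub>wc X\<^esub>Gm) a) w = NAt (MO Dl a) w\<bullet>NAt (MO Gm a) w"
 using wc_arD(1,4-6)[of Gm X] wcone_functor[OF wc_obD(1)[of "MDom Gm" X]] by (simp del: wc_simps(1,2))

lemma wc_ar_cel: assumes "Gm\<in>Ar (wc X)" "X\<in>Obj H" "a\<in>Ob C" "w\<in>Ob (PO W a)"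
 shows "NAt (MO Gm a) w\<in>Cel H" "Dm H (NAt (MO Gm a) w) = FOb (TO (MDom Gm) a) w" "Cd H (NAt (MO Gm a) w) = FOb (TO (MCod Gm) a) w"
 using wmodD(1-3)[OF wc_arD(7)[OF assms(1,2)] assms(3,4)] .

lemma wc_ob_arr: assumes "t\<in>Ob (wc X)" "X\<in>Obj H" "a\<in>Ob C" "w\<in>Ob (PO W a)"
 shows "FOb (TO t a) w\<in>Arr H" "Src H (FOb (TO t a) w) = X" "Tgt H (FOb (TO t a) w) = PO B a"
 using wcone_ob[OF wc_obD(1)[OF assms(1,2)] assms(3,4)] .

lemma wc_id: "t\<in>Ob (wc X) ==> X\<in>Obj H ==> Id (wc X) t\<in>Ar (wc X)"
 using cat_id(1)[OF wc_category] .

lemma wc_comp: "Gm\<in>Ar (wc X) ==> Dl\<in>Ar (wc X) ==> MCod Gm = MDom Dl ==> X\<in>Obj H ==> Dl\<cdot>\<^bsub>wc X\<^esub>Gm\<in>Ar (wc X)"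
 using cat_comp(1)[OF wc_category, of X Gm Dl] by (simp del: wc_simps(2))

lemma actc_id_at:
 assumes "th\<in>Cel H" "t\<in>Ob (wc (Tgt H (Dm H th)))" "a\<in>Ob C" "w\<in>Ob (PO W a)"
 shows "NAt (MO (actc th (Id (wc (Tgt H (Dm H th))) t)) a) w = Idc H (FOb (TO t a) w)\<star>th"
 using actc(3)[OF assms(1) wc_id[OF assms(2)] assms(3,4)] id_at[OF assms(2) _ assms(3,4)] wc_ob_arr[OF assms(2) _ assms(3,4)] assms(1)
 by (simp del: wc_simps(1,2))

lemma actc_idc_at:
 assumes "u\<in>Arr H" "Gm\<in>Ar (wc (Tgt H u))" "a\<in>Ob C" "w\<in>Ob (PO W a)"
 shows "NAt (MO (actc (Idc H u) Gm) a) w = NAt (MO Gm a) w\<star>Idc H u"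
proof -
 have X: "Tgt H u\<in>Obj H" using assms by simp
 note g = wc_arD(1,2)[OF assms(2) X]
 show ?thesis
  using actc(3)[of "Idc H u" Gm a w] wc_ar_cel[OF assms(2) X assms(3,4)] wc_ob_arr[OF g(2) X assms(3,4)] wc_ob_arr[OF g(1) X assms(3,4)] assms
  by (simp del: wc_simps(1,2))
qed

lemma actc_idc: assumes "u\<in>Arr H" "Gm\<in>Ar (wc (Tgt H u))"
 shows "actc (Idc H u) Gm\<in>Ar (wc (Src H u))" "MDom (actc (Idc H u) Gm) = act u (MDom Gm)" "MCod (actc (Idc H u) Gm) = act u (MCod Gm)"
 using actc[of "Idc H u" Gm] assms by (simp_all del: wc_simps)

lemma actc_id: assumes "th\<in>Cel H" "t\<in>Ob (wc (Tgt H (Dm H th)))"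
 shows "actc th (Id (wc (Tgt H (Dm H th))) t)\<in>Ar (wc (Src H (Dm H th)))"
  "MDom (actc th (Id (wc (Tgt H (Dm H th))) t)) = act (Dm H th) t" "MCod (actc th (Id (wc (Tgt H (Dm H th))) t)) = act (Cd H th) t"
 using actc[OF assms(1) wc_id[OF assms(2)]] assms by (simp_all del: wc_simps(1,2))

lemma wpa_functor: assumes u: "u\<in>Arr H" shows "is_functor (wpa u)"
proof (rule functorI)
 let ?x = "FDom (wpa u)"
 let ?y = "FCod (wpa u)"
 have X: "Tgt H u\<in>Obj H" "Src H u\<in>Obj H" using u by simp_all
 show "category ?x" "category ?y" using X by simp_all
 show "FOb (wpa u)\<in>extensional (Ob ?x)" "FAr (wpa u)\<in>extensional (Ar ?x)"
  by (simp_all add: wpa_def del: wc_simps)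
 show "FOb (wpa u) t\<in>Ob ?y" if "t\<in>Ob ?x" for t
  using act(1)[OF u] that by (simp del: wc_simps(1))
 show "FAr (wpa u) Gm\<in>Ar ?y \<and> Dom ?y (FAr (wpa u) Gm) = FOb (wpa u) (Dom ?x Gm) \<and>
   Cod ?y (FAr (wpa u) Gm) = FOb (wpa u) (Cod ?x Gm)" if "Gm\<in>Ar ?x" for Gm
  using actc_idc[OF u, of Gm] that wc_arD(1,2)[OF _ X(1), of Gm] by (simp del: wc_simps(1,2))
 show "FAr (wpa u) (Id ?x t) = Id ?y (FOb (wpa u) t)" if t: "t\<in>Ob ?x" for t
 proof -
  have t: "t\<in>Ob (wc (Tgt H u))" using t by simp
  note a = act[OF u t] note i = wc_id[OF t X(1)] wc_id[OF a(1) X(2)]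
  have "actc (Idc H u) (Id (wc (Tgt H u)) t) = Id (wc (Src H u)) (act u t)"
   by (rule wc_ar_eqI[OF X(2)]) (use actc_idc[OF u i(1)] i actc_idc_at[OF u i(1)] id_at[OF t X(1)] id_at[OF a(1) X(2)] a wc_ob_arr[OF t X(1)] u in "simp_all del: wc_simps(1,2)")
  then show ?thesis using t i by (simp del: wc_simps(1,2))
 qed
 show "FAr (wpa u) (Dl\<cdot>\<^bsub>FDom (wpa u)\<^esub>Gm) = FAr (wpa u) Dl\<cdot>\<^bsub>FCod (wpa u)\<^esub>FAr (wpa u) Gm"
  if "Gm\<in>Ar ?x" "Dl\<in>Ar ?x" "Cod ?x Gm = Dom ?x Dl" for Gm Dl
 proof -
  have h: "Gm\<in>Ar (wc (Tgt H u))" "Dl\<in>Ar (wc (Tgt H u))" "MCod Gm = MDom Dl" using that by (simp_all del: wc_simps(1,2))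
  note c = wc_comp[OF h X(1)] note g = actc_idc[OF u h(1)] note d = actc_idc[OF u h(2)]
  have gd: "actc (Idc H u) Dl\<cdot>\<^bsub>wc (Src H u)\<^esub>actc (Idc H u) Gm\<in>Ar (wc (Src H u))"
   by (rule wc_comp[OF g(1) d(1) _ X(2)]) (simp add: g d h)
  have "actc (Idc H u) (Dl\<cdot>\<^bsub>wc (Tgt H u)\<^esub>Gm) = actc (Idc H u) Dl\<cdot>\<^bsub>wc (Src H u)\<^esub>actc (Idc H u) Gm"
   by (rule wc_ar_eqI[OF X(2) actc_idc(1)[OF u c] gd])
    (use actc_idc[OF u c] c g d actc_idc_at[OF u c] actc_idc_at[OF u h(1)] actc_idc_at[OF u h(2)]
     comp_at[OF h(1) X(1)] comp_at[OF g(1) X(2)] wc_ar_cel[OF h(1) X(1)] wc_ar_cel[OF h(2) X(1)] h(3) u wc_ob_arr[OF wc_arD(1)[OF h(1) X(1)] X(1)]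
     in "simp_all del: wc_simps(1,2)")
  then show ?thesis using h c by (simp del: wc_simps(1,2))
 qed
qed

end

context weighted
begin

declare wc_simps(1,2) [simp del]

text \<open>At a component the naturality square is the interchange of \<open>th\<close> with the
  component of \<open>Gm\<close>.\<close>

lemma wpc_trans: assumes q: "th\<in>Cel H" shows "nat_trans (wpc th)"
proof (rule nat_transI)
 let ?x = "NDom (wpc th)"
 let ?u = "Dm H th" let ?v = "Cd H th" let ?X = "Tgt H ?u" let ?Y = "Src H ?u"
 have X: "?X\<in>Obj H" "?Y\<in>Obj H" and uv: "?u\<in>Arr H" "?v\<in>Arr H" "Tgt H ?v = ?X" "Src H ?v = ?Y" using q by simp_all
 show "is_functor ?x" "is_functor (NCod (wpc th))" using wpa_functor uv by simp_all
 show "NAt (wpc th)\<in>extensional (Ob (FDom ?x))" by (simp add: wpc_def)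
 show "NAt (wpc th) t\<in>Ar (FCod ?x) \<and> Dom (FCod ?x) (NAt (wpc th) t) = FOb ?x t \<and>
   Cod (FCod ?x) (NAt (wpc th) t) = FOb (NCod (wpc th)) t" if "t\<in>Ob (FDom ?x)" for t
  using actc_id[OF q, of t] that uv by simp
 fix Gm assume "Gm\<in>Ar (FDom ?x)"
 then have G: "Gm\<in>Ar (wc ?X)" by simp
 then have G': "Gm\<in>Ar (wc (Tgt H ?v))" using uv by simp
 note g = wc_arD(1,2)[OF G X(1)]
 note i = actc_id[OF q g(1)] actc_id[OF q g(2)] note a = actc_idc[OF uv(1) G] actc_idc[OF uv(2) G', unfolded uv]
 have 1: "actc th (Id (wc ?X) (MCod Gm))\<cdot>\<^bsub>wc ?Y\<^esub>actc (Idc H ?u) Gm\<in>Ar (wc ?Y)"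
  by (rule wc_comp[OF a(1) i(4) _ X(2)]) (simp add: a i)
 have 2: "actc (Idc H ?v) Gm\<cdot>\<^bsub>wc ?Y\<^esub>actc th (Id (wc ?X) (MDom Gm))\<in>Ar (wc ?Y)"
  by (rule wc_comp[OF i(1) a(4) _ X(2)]) (simp add: a i)
 have "actc th (Id (wc ?X) (MCod Gm))\<cdot>\<^bsub>wc ?Y\<^esub>actc (Idc H ?u) Gm = actc (Idc H ?v) Gm\<cdot>\<^bsub>wc ?Y\<^esub>actc th (Id (wc ?X) (MDom Gm))"
 proof (rule wc_ar_eqI[OF X(2) 1 2])
  fix b w assume h: "b\<in>Ob C" "w\<in>Ob (PO W b)"
  show "NAt (MO (actc th (Id (wc ?X) (MCod Gm))\<cdot>\<^bsub>wc ?Y\<^esub>actc (Idc H ?u) Gm) b) w = NAt (MO (actc (Idc H ?v) Gm\<cdot>\<^bsub>wc ?Y\<^esub>actc th (Id (wc ?X) (MDom Gm))) b) w"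
   using tc_hc_whisker[OF HC(1), of th "NAt (MO Gm b) w"] comp_at[OF a(1) X(2) h] comp_at[OF i(1) X(2) h]
    actc_id_at[OF q g(1) h] actc_id_at[OF q g(2) h] actc_idc_at[OF uv(1) G h] actc_idc_at[OF uv(2) G' h] wc_ar_cel[OF G X(1) h] wc_ob_arr[OF g(1) X(1) h] q
   by simp
 qed (use a i in simp_all)
 then show "NAt (wpc th) (Cod (FDom ?x) Gm)\<cdot>\<^bsub>FCod ?x\<^esub>FAr ?x Gm =
   FAr (NCod (wpc th)) Gm\<cdot>\<^bsub>FCod ?x\<^esub>NAt (wpc th) (Dom (FDom ?x) Gm)"
  using G G' g uv by simp
qed (use assms in simp_all)

lemma act_one: assumes "X\<in>Obj H" "t\<in>Ob (wc X)" shows "act (One H X) t = t"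
 using act[of "One H X" t] assms wc_ob_arr[OF assms(2,1)] wcone_ar[OF wc_obD(1)[OF assms(2,1)]] wcone_cel[OF wc_obD(1)[OF assms(2,1)]]
 by (intro act_ob_eqI[OF assms(1) _ assms(2)]) (simp_all add: wcone_ob[OF wc_obD(1)[OF assms(2,1)]])

lemma act_act: assumes "u\<in>Arr H" "v\<in>Arr H" "Src H u = Tgt H v" "t\<in>Ob (wc (Tgt H u))"
 shows "act v (act u t) = act (u\<odot>v) t"
proof (rule act_ob_eqI[of "Src H v"])
 have X: "Tgt H u\<in>Obj H" using assms by simp
 note a = act[OF assms(1,4)]
 have a1: "act u t\<in>Ob (wc (Tgt H v))" using a(1) assms by simp
 have t: "t\<in>Ob (wc (Tgt H (u\<odot>v)))" "u\<odot>v\<in>Arr H" using assms by simp_all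
 note b = act[OF assms(2) a1] note c = act[OF t(2,1)]
 show "act v (act u t)\<in>Ob (wc (Src H v))" "act (u\<odot>v) t\<in>Ob (wc (Src H v))" using b(1) c(1) assms by simp_all
 show "FOb (TO (act v (act u t)) x) w = FOb (TO (act (u\<odot>v) t) x) w" if "x\<in>Ob C" "w\<in>Ob (PO W x)" for x w
  using that a(2) b(2) c(2) assms wc_ob_arr[OF assms(4) X that] by simp
 show "FAr (TO (act v (act u t)) x) w = FAr (TO (act (u\<odot>v) t) x) w" if "x\<in>Ob C" "w\<in>Ar (PO W x)" for x w
  using that a(3) b(3) c(3) assms wcone_ar[OF wc_obD(1)[OF assms(4) X] that] wc_ob_arr[OF assms(4) X that(1)] by simp
 show "NAt (TA (act v (act u t)) f) w = NAt (TA (act (u\<odot>v) t) f) w" if "f\<in>Ar C" "w\<in>Ob (PO W (Dom C f))" for f w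
  using that a(4) b(4) c(4) assms wcone_cel[OF wc_obD(1)[OF assms(4) X] that] wc_ob_arr[OF assms(4) X, of "Dom C f" w] by simp
qed (use assms in simp)

lemma wpa_cmp: assumes that: "f\<in>Arr H" "g\<in>Arr H" "Src H f = Tgt H g"
 shows "wpa (f\<odot>g) = wpa g \<circ>\<^sub>F wpa f"
proof (rule functor_eqI)
 let ?x = "f\<odot>g"
 show "FOb (wpa ?x) t = FOb (wpa g \<circ>\<^sub>F wpa f) t" if "t\<in>Ob (FDom (wpa ?x))" for t
  using that act_act[OF assms] act(1)[OF assms(1)] assms by simp
 fix Gm assume "Gm\<in>Ar (FDom (wpa ?x))"
 then have G: "Gm\<in>Ar (wc (Tgt H f))" "Gm\<in>Ar (wc (Tgt H ?x))" and fg: "f\<odot>g\<in>Arr H" "Src H ?x = Src H g" using that by simp_all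
 have X: "Tgt H f\<in>Obj H" "Src H f\<in>Obj H" "Src H g\<in>Obj H" using that by simp_all
 note a = actc_idc[OF that(1) G(1)] note gd = wc_arD(1,2)[OF G(1) X(1)]
 have G2: "actc (Idc H f) Gm\<in>Ar (wc (Tgt H g))" using a that by simp
 note b = actc_idc[OF that(2) G2] note c = actc_idc[OF fg(1) G(2), unfolded fg]
 have "actc (Idc H ?x) Gm = actc (Idc H g) (actc (Idc H f) Gm)"
 proof (rule wc_ar_eqI[OF X(3) c(1) b(1)])
  fix x w assume xw: "x\<in>Ob C" "w\<in>Ob (PO W x)"
  show "NAt (MO (actc (Idc H ?x) Gm) x) w = NAt (MO (actc (Idc H g) (actc (Idc H f) Gm)) x) w"
   using actc_idc_at[OF that(1) G(1) xw] actc_idc_at[OF that(2) G2 xw] actc_idc_at[OF fg(1) G(2) xw] wc_ar_cel[OF G(1) X(1) xw] wc_ob_arr[OF gd(1) X(1) xw] that by simp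
 qed (use a b c act_act[OF that gd(1)] act_act[OF that gd(2)] in simp_all)
 then show "FAr (wpa ?x) Gm = FAr (wpa g \<circ>\<^sub>F wpa f) Gm" using G G2 by simp
qed (use that wpa_functor in simp_all)

text \<open>Composition of 1-cells of \<open>H\<close> is strictly associative and unital, so the
  action on cones is strictly functorial. The resulting identity constraints are what
  \<open>yoneda_tr_equivalence\<close> asks for.\<close>

lemma pseudofunctor_weighted_cones: "pseudofunctor (OpT H) CAT (weighted_cones (LD C) H W B)"
 unfolding weighted_cones_eq
proof (rule pseudofunctor_strict)
 show "wpa (v0 :: 'b)\<in>Hom1 CAT (wc (Src (OpT H) v0)) (wc (Tgt (OpT H) v0))" if "v0\<in>Arr (OpT H)" for v0
  using that wpa_functor by simp
 show "wpc th\<in>Hom2 CAT (wpa (Dm (OpT H) th)) (wpa (Cd (OpT H) th))" if "th\<in>Cel (OpT H)" for th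
  using that wpc_trans by simp
next
 fix u assume "u\<in>Arr (OpT H)"
 then have u: "u\<in>Arr H" and X: "Tgt H u\<in>Obj H" "Src H u\<in>Obj H" by simp_all
 show "wpc (Idc (OpT H) u) = Idc CAT (wpa u)"
 proof (rule nat_trans_eqI)
  fix t assume "t\<in>Ob (FDom (NDom (wpc (Idc (OpT H) u))))"
  then have t: "t\<in>Ob (wc (Tgt H u))" using u by simp
  have "FAr (wpa u) (Id (wc (Tgt H u)) t) = Id (wc (Src H u)) (FOb (wpa u) t)"
   using functor_id[OF wpa_functor[OF u], of "wc (Tgt H u)" t] t by simp
  then show "NAt (wpc (Idc (OpT H) u)) t = NAt (Idc CAT (wpa u)) t"
   using t u wc_id[OF t X(1)] by simp
 qed (use u wpc_trans wpa_functor in simp_all)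
next
 fix th xi assume h: "th\<in>Cel (OpT H)" "xi\<in>Cel (OpT H)" "Cd (OpT H) th = Dm (OpT H) xi"
 then have q: "th\<in>Cel H" "xi\<in>Cel H" "Cd H th = Dm H xi" by simp_all
 let ?X = "Tgt H (Dm H th)" let ?Y = "Src H (Dm H th)"
 have e: "Tgt H (Dm H xi) = ?X" "Src H (Dm H xi) = ?Y" using tc_cel(3,4)[OF HC(1) q(1)] q(3) by simp_all
 have X: "?X\<in>Obj H" "?Y\<in>Obj H" using q by simp_all
 show "wpc (xi\<bullet>\<^bsub>OpT H\<^esub>th) = wpc xi\<bullet>\<^bsub>CAT\<^esub>wpc th"
 proof (rule nat_trans_eqI)
  fix t assume "t\<in>Ob (FDom (NDom (wpc (xi\<bullet>\<^bsub>OpT H\<^esub>th))))"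
  then have t: "t\<in>Ob (wc ?X)" "t\<in>Ob (wc (Tgt H (Dm H xi)))" "t\<in>Ob (wc (Tgt H (Dm H (xi\<bullet>th))))" using q e by simp_all
  have c: "xi\<bullet>th\<in>Cel H" "Tgt H (Dm H (xi\<bullet>th)) = ?X" "Src H (Dm H (xi\<bullet>th)) = ?Y" using q by simp_all
  note i = actc_id[OF q(1) t(1)] actc_id[OF q(2) t(2), unfolded e] actc_id[OF c(1) t(3), unfolded c]
  have "actc (xi\<bullet>th) (Id (wc ?X) t) = actc xi (Id (wc ?X) t)\<cdot>\<^bsub>wc ?Y\<^esub>actc th (Id (wc ?X) t)"
  proof (rule wc_ar_eqI[OF X(2) i(7)])
   show "actc xi (Id (wc ?X) t)\<cdot>\<^bsub>wc ?Y\<^esub>actc th (Id (wc ?X) t)\<in>Ar (wc ?Y)"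
    by (rule wc_comp[OF i(1) i(4) _ X(2)]) (simp add: i q)
   fix a w assume aw: "a\<in>Ob C" "w\<in>Ob (PO W a)"
   show "NAt (MO (actc (xi\<bullet>th) (Id (wc ?X) t)) a) w = NAt (MO (actc xi (Id (wc ?X) t)\<cdot>\<^bsub>wc ?Y\<^esub>actc th (Id (wc ?X) t)) a) w"
    using comp_at[OF i(1) X(2) aw] actc_id_at[OF q(1) t(1) aw] actc_id_at[OF q(2) t(2) aw, unfolded e] actc_id_at[OF c(1) t(3) aw, unfolded c]
     wc_ob_arr[OF t(1) X(1) aw] q by simp
  qed (use i q in simp_all)
  then show "NAt (wpc (xi\<bullet>\<^bsub>OpT H\<^esub>th)) t = NAt (wpc xi\<bullet>\<^bsub>CAT\<^esub>wpc th) t" using t c e by simp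
 qed (use q e wpc_trans in simp_all)
next
 fix X assume "X\<in>Obj (OpT H)"
 then have X: "X\<in>Obj H" by simp
 show "wpa (One (OpT H) X) = One CAT (wc X)"
 proof (rule functor_eqI)
  show "FOb (wpa (One (OpT H) X)) t = FOb (One CAT (wc X)) t" if "t\<in>Ob (FDom (wpa (One (OpT H) X)))" for t
   using that act_one[OF X] X by simp
  fix Gm assume "Gm\<in>Ar (FDom (wpa (One (OpT H) X)))"
  then have G: "Gm\<in>Ar (wc X)" "Gm\<in>Ar (wc (Tgt H (One H X)))" and o: "One H X\<in>Arr H" using X by simp_all
  have "actc (Idc H (One H X)) Gm = Gm"
   by (rule wc_ar_eqI[OF X _ G(1)]) (use actc_idc[OF o G(2)] actc_idc_at[OF o G(2)] wc_arD(1,2)[OF G(1) X] act_one[OF X] X wc_ar_cel[OF G(1) X] wc_ob_arr[OF wc_arD(1)[OF G(1) X] X] in simp_all)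
  then show "FAr (wpa (One (OpT H) X)) Gm = FAr (One CAT (wc X)) Gm" using G by simp
 qed (use X wpa_functor in simp_all)
next
 fix f g assume "f\<in>Arr (OpT H)" "g\<in>Arr (OpT H)" "Tgt (OpT H) f = Src (OpT H) g"
 then show "wpa (g\<odot>\<^bsub>OpT H\<^esub>f) = wpa g\<odot>\<^bsub>CAT\<^esub>wpa f" by (simp add: wpa_cmp)
next
 fix th xi assume "th\<in>Cel (OpT H)" "xi\<in>Cel (OpT H)" "Tgt (OpT H) (Dm (OpT H) th) = Src (OpT H) (Dm (OpT H) xi)"
 then have q: "th\<in>Cel H" "xi\<in>Cel H" "Src H (Dm H th) = Tgt H (Dm H xi)" by simp_all
 let ?X = "Tgt H (Dm H th)" let ?Y = "Tgt H (Dm H xi)" let ?Z = "Src H (Dm H xi)"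
 have X: "?X\<in>Obj H" "?Y\<in>Obj H" "?Z\<in>Obj H" using q by simp_all
 have hq: "th\<star>xi\<in>Cel H" "Tgt H (Dm H (th\<star>xi)) = ?X" "Src H (Dm H (th\<star>xi)) = ?Z" using q by simp_all
 show "wpc (xi\<star>\<^bsub>OpT H\<^esub>th) = wpc xi\<star>\<^bsub>CAT\<^esub>wpc th"
 proof (rule nat_trans_eqI)
  show "NDom (wpc (xi\<star>\<^bsub>OpT H\<^esub>th)) = NDom (wpc xi\<star>\<^bsub>CAT\<^esub>wpc th)" "NCod (wpc (xi\<star>\<^bsub>OpT H\<^esub>th)) = NCod (wpc xi\<star>\<^bsub>CAT\<^esub>wpc th)"
   using q by (simp_all add: wpa_cmp)
  fix t assume "t\<in>Ob (FDom (NDom (wpc (xi\<star>\<^bsub>OpT H\<^esub>th))))"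
  then have t: "t\<in>Ob (wc ?X)" "t\<in>Ob (wc (Tgt H (Dm H (th\<star>xi))))" using q by simp_all
  have v: "Cd H th\<in>Arr H" "t\<in>Ob (wc (Tgt H (Cd H th)))" "Dm H xi\<in>Arr H" using q t by simp_all
  have t2: "act (Cd H th) t\<in>Ob (wc ?Y)" using act(1)[OF v(1,2)] q by simp
  note i = actc_id[OF q(1) t(1), unfolded q(3)] actc_id[OF q(2) t2] actc_id[OF hq(1) t(2), unfolded hq]
  note b = actc_idc[OF v(3) i(1)]
  have "actc (th\<star>xi) (Id (wc ?X) t) = actc xi (Id (wc ?Y) (act (Cd H th) t))\<cdot>\<^bsub>wc ?Z\<^esub>actc (Idc H (Dm H xi)) (actc th (Id (wc ?X) t))"
  proof (rule wc_ar_eqI[OF X(3) i(7)])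
   show "actc xi (Id (wc ?Y) (act (Cd H th) t))\<cdot>\<^bsub>wc ?Z\<^esub>actc (Idc H (Dm H xi)) (actc th (Id (wc ?X) t))\<in>Ar (wc ?Z)"
    by (rule wc_comp[OF b(1) i(4) _ X(3)]) (simp add: b i)
   fix a w assume aw: "a\<in>Ob C" "w\<in>Ob (PO W a)"
   let ?c = "FOb (TO t a) w"
   have c: "?c\<in>Arr H" "Src H ?c = ?X" "Tgt H ?c = PO B a" using wc_ob_arr[OF t(1) X(1) aw] .
   show "NAt (MO (actc (th\<star>xi) (Id (wc ?X) t)) a) w =
    NAt (MO (actc xi (Id (wc ?Y) (act (Cd H th) t))\<cdot>\<^bsub>wc ?Z\<^esub>actc (Idc H (Dm H xi)) (actc th (Id (wc ?X) t))) a) w"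
    using comp_at[OF b(1) X(3) aw] actc_id_at[OF q(1) t(1) aw] actc_id_at[OF q(2) t2 aw] actc_id_at[OF hq(1) t(2) aw, unfolded hq]
     actc_idc_at[OF v(3) i(1) aw] act(2)[OF v(1,2) aw] tc_hc_whisker(2)[OF HC(1), of xi "Idc H ?c\<star>th"] c q by simp
  qed (use i b q act_act[OF v(1) _ _ v(2), of "Cd H xi"] act_act[of "Dm H th" "Dm H xi" t] t in simp_all)
  then show "NAt (wpc (xi\<star>\<^bsub>OpT H\<^esub>th)) t = NAt (wpc xi\<star>\<^bsub>CAT\<^esub>wpc th) t" using t hq i t2 v q by simp
 qed (use q wpc_trans in simp_all)
qed simp_all

lemma weighted_cones_simps [simp]:
 "X\<in>Obj H ==> PO (weighted_cones (LD C) H W B) X = wc X" "u\<in>Arr H ==> PA (weighted_cones (LD C) H W B) u = wpa u"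
 "th\<in>Cel H ==> PC (weighted_cones (LD C) H W B) th = wpc th"
 "X\<in>Obj H ==> PU (weighted_cones (LD C) H W B) X = nid (wpa (One H X))"
 "f\<in>Arr H ==> g\<in>Arr H ==> Src H f = Tgt H g ==> PM (weighted_cones (LD C) H W B) g f = nid (wpa (f\<odot>g))"
 by (simp_all add: weighted_cones_eq)

end

section \<open>Conical cones\<close>

text \<open>A pseudocone on \<open>B\<close> with vertex \<open>X\<close>, \<open>P f\<close> being the cell \<open>B f\<odot>p a => p b\<close> for \<open>f : a \<rightarrow> b\<close>.\<close>

definition pcone :: "('o, 'm) cat => ('p, 'b, 'd) twocat => ('o, 'm, 'm, 'p, 'b, 'd) psf => 'p => ('o => 'b) => ('m => 'd) => bool" where
 "pcone C H B X p P \<longleftrightarrow> X\<in>Obj H \<and> (\<forall>a\<in>Ob C. p a\<in>Hom1 H X (PO B a)) \<and>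
   (\<forall>f\<in>Ar C. P f\<in>Hom2 H (PA B f\<odot>\<^bsub>H\<^esub>p (Dom C f)) (p (Cod C f)) \<and> inv_cell H (P f)) \<and>
   (\<forall>f\<in>Ar C. \<forall>g\<in>Ar C. Cod C f = Dom C g \<longrightarrow>
    P (g\<cdot>\<^bsub>C\<^esub>f)\<bullet>\<^bsub>H\<^esub>(PM B g f\<star>\<^bsub>H\<^esub>Idc H (p (Dom C f))) = P g\<bullet>\<^bsub>H\<^esub>(Idc H (PA B g)\<star>\<^bsub>H\<^esub>P f)) \<and>
   (\<forall>a\<in>Ob C. P (Id C a)\<bullet>\<^bsub>H\<^esub>(PU B a\<star>\<^bsub>H\<^esub>Idc H (p a)) = Idc H (p a))"

definition cone_mor :: "('o, 'm) cat => ('p, 'b, 'd) twocat => ('o, 'm, 'm, 'p, 'b, 'd) psf =>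
  ('o => 'b) => ('m => 'd) => ('o => 'b) => ('m => 'd) => ('o => 'd) => bool" where
 "cone_mor C H B p P q Q gm \<longleftrightarrow> (\<forall>a\<in>Ob C. gm a\<in>Hom2 H (p a) (q a)) \<and>
   (\<forall>f\<in>Ar C. gm (Cod C f)\<bullet>\<^bsub>H\<^esub>P f = Q f\<bullet>\<^bsub>H\<^esub>(Idc H (PA B f)\<star>\<^bsub>H\<^esub>gm (Dom C f)))"

text \<open>The counterpart of \<open>universal_elt\<close> for conical cones, stated with cells of
  \<open>H\<close> only. Free of any weight, it can be compared across different diagrams.\<close>

definition universal_cone :: "('o, 'm) cat => ('p, 'b, 'd) twocat => ('o, 'm, 'm, 'p, 'b, 'd) psf => 'p => ('o => 'b) => ('m => 'd) => bool" where
 "universal_cone C H B L p P \<longleftrightarrow> pcone C H B L p P \<and>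
   (\<forall>X q Q. pcone C H B X q Q \<longrightarrow> (\<exists>f\<in>Hom1 H X L. \<exists>sig. (\<forall>a\<in>Ob C. inv_cell H (sig a)) \<and>
    cone_mor C H B (\<lambda>a. p a\<odot>\<^bsub>H\<^esub>f) (\<lambda>h. P h\<star>\<^bsub>H\<^esub>Idc H f) q Q sig)) \<and>
   (\<forall>X\<in>Obj H. \<forall>f\<in>Hom1 H X L. \<forall>g\<in>Hom1 H X L. \<forall>gm.
    cone_mor C H B (\<lambda>a. p a\<odot>\<^bsub>H\<^esub>f) (\<lambda>h. P h\<star>\<^bsub>H\<^esub>Idc H f) (\<lambda>a. p a\<odot>\<^bsub>H\<^esub>g) (\<lambda>h. P h\<star>\<^bsub>H\<^esub>Idc H g) gm \<longrightarrow>
    (\<exists>!al. al\<in>Hom2 H f g \<and> (\<forall>a\<in>Ob C. Idc H (p a)\<star>\<^bsub>H\<^esub>al = gm a)))"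

lemma pconeD: assumes "pcone C H B X p P"
 shows "X\<in>Obj H" "a\<in>Ob C ==> p a\<in>Arr H" "a\<in>Ob C ==> Src H (p a) = X" "a\<in>Ob C ==> Tgt H (p a) = PO B a"
  "f\<in>Ar C ==> P f\<in>Cel H" "f\<in>Ar C ==> Dm H (P f) = PA B f\<odot>\<^bsub>H\<^esub>p (Dom C f)" "f\<in>Ar C ==> Cd H (P f) = p (Cod C f)"
  "f\<in>Ar C ==> inv_cell H (P f)"
 using assms unfolding pcone_def by simp_all

lemma pcone_comp: "pcone C H B X p P ==> f\<in>Ar C ==> g\<in>Ar C ==> Cod C f = Dom C g ==>
  P (g\<cdot>\<^bsub>C\<^esub>f)\<bullet>\<^bsub>H\<^esub>(PM B g f\<star>\<^bsub>H\<^esub>Idc H (p (Dom C f))) = P g\<bullet>\<^bsub>H\<^esub>(Idc H (PA B g)\<star>\<^bsub>H\<^esub>P f)"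
 unfolding pcone_def by blast

lemma pcone_unit: "pcone C H B X p P ==> a\<in>Ob C ==> P (Id C a)\<bullet>\<^bsub>H\<^esub>(PU B a\<star>\<^bsub>H\<^esub>Idc H (p a)) = Idc H (p a)"
 unfolding pcone_def by blast

lemma cone_morD: assumes "cone_mor C H B p P q Q gm"
 shows "a\<in>Ob C ==> gm a\<in>Cel H" "a\<in>Ob C ==> Dm H (gm a) = p a" "a\<in>Ob C ==> Cd H (gm a) = q a"
  "f\<in>Ar C ==> gm (Cod C f)\<bullet>\<^bsub>H\<^esub>P f = Q f\<bullet>\<^bsub>H\<^esub>(Idc H (PA B f)\<star>\<^bsub>H\<^esub>gm (Dom C f))"
 using assms unfolding cone_mor_def by simp_all

lemma cone_morI:
 assumes "!!a. a\<in>Ob C ==> gm a\<in>Cel H \<and> Dm H (gm a) = p a \<and> Cd H (gm a) = q a"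
  and "!!f. f\<in>Ar C ==> gm (Cod C f)\<bullet>\<^bsub>H\<^esub>P f = Q f\<bullet>\<^bsub>H\<^esub>(Idc H (PA B f)\<star>\<^bsub>H\<^esub>gm (Dom C f))"
 shows "cone_mor C H B p P q Q gm"
 using assms unfolding cone_mor_def by simp

locale diagram = H: two_category H + C: category C + B: pseudofunctor "LD C" H B
 for C :: "('o, 'm) cat" and H :: "('p, 'b, 'd) twocat" (structure) and B :: "('o, 'm, 'm, 'p, 'b, 'd) psf"
begin

lemma HC2 [simp]: "two_category H" "category C" by unfold_locales

lemma pcone_whisker:
 assumes p: "pcone C H B L p P" and u: "u\<in>Arr H" "Tgt H u = L"
 shows "pcone C H B (Src H u) (\<lambda>a. p a\<odot>u) (\<lambda>f. P f\<star>Idc H u)"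
 unfolding pcone_def
proof (intro conjI ballI impI)
 note [simp] = pconeD[OF p] u
 fix f g assume h: "f\<in>Ar C" "g\<in>Ar C" "Cod C f = Dom C g"
 then show "(P (g\<cdot>\<^bsub>C\<^esub>f)\<star>Idc H u)\<bullet>(PM B g f\<star>Idc H (p (Dom C f)\<odot>u)) = (P g\<star>Idc H u)\<bullet>(Idc H (PA B g)\<star>P f\<star>Idc H u)"
  using arg_cong[OF pcone_comp[OF p h], of "\<lambda>x. x\<star>Idc H u"] by simp
next
 note [simp] = pconeD[OF p] u
 fix a assume h: "a\<in>Ob C"
 then show "(P (Id C a)\<star>Idc H u)\<bullet>(PU B a\<star>Idc H (p a\<odot>u)) = Idc H (p a\<odot>u)"
  using arg_cong[OF pcone_unit[OF p h], of "\<lambda>x. x\<star>Idc H u"] by simp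
qed (use u pconeD[OF p] in simp_all)

lemma cone_mor_comp:
 assumes g: "cone_mor C H B p P q Q gm" and d: "cone_mor C H B q Q r R de"
  and p: "pcone C H B X p P" and q: "pcone C H B X q Q" and r: "pcone C H B X r R"
 shows "cone_mor C H B p P r R (\<lambda>a. de a\<bullet>gm a)"
proof (rule cone_morI)
 note [simp] = pconeD[OF p] pconeD[OF q] pconeD[OF r] cone_morD(1-3)[OF g] cone_morD(1-3)[OF d]
 fix f assume f: "f\<in>Ar C"
 have "(de (Cod C f)\<bullet>gm (Cod C f))\<bullet>P f = de (Cod C f)\<bullet>(gm (Cod C f)\<bullet>P f)" using f by simp
 also have "... = (de (Cod C f)\<bullet>Q f)\<bullet>(Idc H (PA B f)\<star>gm (Dom C f))" unfolding cone_morD(4)[OF g f] using f by simp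
 also have "... = R f\<bullet>(Idc H (PA B f)\<star>(de (Dom C f)\<bullet>gm (Dom C f)))" unfolding cone_morD(4)[OF d f] using f by simp
 finally show "(de (Cod C f)\<bullet>gm (Cod C f))\<bullet>P f = R f\<bullet>(Idc H (PA B f)\<star>(de (Dom C f)\<bullet>gm (Dom C f)))" .
qed (use cone_morD(1-3)[OF g] cone_morD(1-3)[OF d] in simp)

lemma cone_mor_inv:
 assumes g: "cone_mor C H B p P q Q gm" and i: "!!a. a\<in>Ob C ==> inv_cell H (gm a)"
  and p: "pcone C H B X p P" and q: "pcone C H B X q Q"
 shows "cone_mor C H B q Q p P (\<lambda>a. cinv H (gm a))"
proof (rule cone_morI)
 note [simp] = pconeD[OF p] pconeD[OF q] cone_morD(1-3)[OF g] i
 fix f assume f: "f\<in>Ar C"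
 let ?a = "gm (Dom C f)" let ?b = "gm (Cod C f)"
 \<comment> \<open>Inserting \<open>?a\<close> and its inverse under \<open>B f\<close> makes the
   square of \<open>gm\<close> over \<open>f\<close> appear.\<close>
 have "cinv H ?b\<bullet>Q f = cinv H ?b\<bullet>(Q f\<bullet>(Idc H (PA B f)\<star>?a))\<bullet>(Idc H (PA B f)\<star>cinv H ?a)"
  using f by (simp flip: tc_whisker(1))
 also have "... = P f\<bullet>(Idc H (PA B f)\<star>cinv H ?a)" unfolding cone_morD(4)[OF g f, symmetric] using f by simp
 finally show "cinv H ?b\<bullet>Q f = P f\<bullet>(Idc H (PA B f)\<star>cinv H ?a)" .
qed (use cone_morD(1-3)[OF g] i in simp)

text \<open>The square over \<open>f\<close> is the interchange of \<open>al\<close> with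
  \<open>P f\<close>.\<close>

lemma cone_mor_whisker:
 assumes p: "pcone C H B L p P" and a: "al\<in>Cel H" "Tgt H (Dm H al) = L"
 shows "cone_mor C H B (\<lambda>a. p a\<odot>Dm H al) (\<lambda>h. P h\<star>Idc H (Dm H al)) (\<lambda>a. p a\<odot>Cd H al) (\<lambda>h. P h\<star>Idc H (Cd H al)) (\<lambda>a. Idc H (p a)\<star>al)"
proof (rule cone_morI)
 note [simp] = pconeD[OF p]
 fix f assume "f\<in>Ar C"
 then show "(Idc H (p (Cod C f))\<star>al)\<bullet>(P f\<star>Idc H (Dm H al)) = (P f\<star>Idc H (Cd H al))\<bullet>(Idc H (PA B f)\<star>Idc H (p (Dom C f))\<star>al)"
  using tc_hc_whisker[OF HC2(1), of al "P f"] a by simp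
qed (use a pconeD[OF p] in simp)

end

section \<open>Weights with indiscrete values\<close>

text \<open>If all values of the weight are nonempty and indiscrete, a weighted cone is determined up to unique
 isomorphism by its components at one object \<open>base a\<close> of each \<open>W a\<close>.\<close>

locale indiscrete_weighted = weighted C H W B
 for C :: "('o, 'm) cat" and H :: "('p, 'b, 'd) twocat" (structure)
  and W :: "('o, 'm, 'm, 'x, 'y) catpsf" and B :: "('o, 'm, 'm, 'p, 'b, 'd) psf" +
 assumes nonempty: "a\<in>Ob C ==> Ob (PO W a) \<noteq> {}"
  and indiscrete: "a\<in>Ob C ==> x\<in>Ob (PO W a) ==> y\<in>Ob (PO W a) ==> \<exists>!m. m\<in>Hom (PO W a) x y"
begin

declare wc_simps(1,2) [simp del]

sublocale diagram C H B by unfold_locales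

definition "base a = (SOME w. w\<in>Ob (PO W a))"

definition "mv a x y = (THE m. m\<in>Hom (PO W a) x y)"

lemma base [simp]: "a\<in>Ob C ==> base a\<in>Ob (PO W a)"
 using nonempty[of a] unfolding base_def by (simp add: some_in_eq)

lemma mv: assumes "a\<in>Ob C" "x\<in>Ob (PO W a)" "y\<in>Ob (PO W a)"
 shows "mv a x y\<in>Ar (PO W a)" "Dom (PO W a) (mv a x y) = x" "Cod (PO W a) (mv a x y) = y"
 using theI'[OF indiscrete[OF assms]] unfolding mv_def[symmetric] by simp_all

lemma mv_eq: assumes "a\<in>Ob C" "m\<in>Ar (PO W a)" "Dom (PO W a) m = x" "Cod (PO W a) m = y" shows "m = mv a x y"
proof -
 have "x\<in>Ob (PO W a)" "y\<in>Ob (PO W a)" using assms by auto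
 from indiscrete[OF assms(1) this] mv[OF assms(1) this] show ?thesis using assms by (auto simp: Ex1_def)
qed

lemma wob [simp]: "f\<in>Ar C ==> w\<in>Ob (PO W (Dom C f)) ==> FOb (PA W f) w\<in>Ob (PO W (Cod C f))"
 using functor_ob[of "PA W f"] by simp

text \<open>The transport between the values of a cone at two objects of \<open>W a\<close>. In an
  indiscrete category there is only one arrow to transport along, so these cells compose and cancel
  freely.\<close>

definition "tm t a x y = FAr (TO t a) (mv a x y)"

definition "cone0 t a = FOb (TO t a) (base a)"

text \<open>\<open>W f\<close> does not in general send the base object of \<open>Dom C f\<close> to
  that of \<open>Cod C f\<close>, so the cell of the weighted cone is followed by a
  transport.\<close>

definition "cone1 t f = tm t (Cod C f) (FOb (PA W f) (base (Dom C f))) (base (Cod C f))\<bullet>NAt (TA t f) (base (Dom C f))"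

context
 fixes X t assumes X: "X\<in>Obj H" and t: "t\<in>Ob (wc X)"
begin

lemmas wt = wc_obD(1)[OF t X]

lemma tm: assumes "a\<in>Ob C" "x\<in>Ob (PO W a)" "y\<in>Ob (PO W a)"
 shows "tm t a x y\<in>Cel H" "Dm H (tm t a x y) = FOb (TO t a) x" "Cd H (tm t a x y) = FOb (TO t a) y" "inv_cell H (tm t a x y)"
proof -
 note m = mv[OF assms] mv[OF assms(1,3,2)]
 show h: "tm t a x y\<in>Cel H" "Dm H (tm t a x y) = FOb (TO t a) x" "Cd H (tm t a x y) = FOb (TO t a) y"
  using wcone_ar[OF wt assms(1) m(1)] m unfolding tm_def by simp_all
 have "mv a y x\<cdot>\<^bsub>PO W a\<^esub>mv a x y = Id (PO W a) x" "mv a x y\<cdot>\<^bsub>PO W a\<^esub>mv a y x = Id (PO W a) y"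
  using mv_eq[OF assms(1), of "mv a y x\<cdot>\<^bsub>PO W a\<^esub>mv a x y" x x] mv_eq[OF assms(1), of "Id (PO W a) x" x x]
   mv_eq[OF assms(1), of "mv a x y\<cdot>\<^bsub>PO W a\<^esub>mv a y x" y y] mv_eq[OF assms(1), of "Id (PO W a) y" y y] m assms by simp_all
 then have "cat_iso (PO W a) (mv a x y)" using m by (intro cat_isoI[of _ _ "mv a y x"]) simp_all
 then have "cat_iso (HomC H X (PO B a)) (tm t a x y)"
  using functor_iso[of "TO t a" "PO W a" "HomC H X (PO B a)"] wcone_functor[OF wt] assms(1) unfolding tm_def by simp
 then show "inv_cell H (tm t a x y)"
  using inv_cell_iff_iso[OF HC(1), of "FOb (TO t a) x" X "PO B a" "tm t a x y"] h wcone_ob[OF wt assms(1,2)] by simp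
qed

lemma tm_comp: assumes "a\<in>Ob C" "x\<in>Ob (PO W a)" "y\<in>Ob (PO W a)" "z\<in>Ob (PO W a)"
 shows "tm t a y z\<bullet>tm t a x y = tm t a x z"
proof -
 note m = mv[OF assms(1,2,3)] mv[OF assms(1,3,4)]
 have "mv a y z\<cdot>\<^bsub>PO W a\<^esub>mv a x y = mv a x z" using m assms by (intro mv_eq) simp_all
 then show ?thesis using functor_comp[of "TO t a" "PO W a" "mv a x y" "mv a y z"] m wcone_functor[OF wt] assms(1) unfolding tm_def by simp
qed

lemma tm_id: "a\<in>Ob C ==> x\<in>Ob (PO W a) ==> tm t a x x = Idc H (FOb (TO t a) x)"
 using mv_eq[of a "Id (PO W a) x" x x] functor_id[of "TO t a" "PO W a" x] wcone_functor[OF wt] unfolding tm_def by simp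

lemma tm_nat: assumes "f\<in>Ar C" "x\<in>Ob (PO W (Dom C f))" "y\<in>Ob (PO W (Dom C f))"
 shows "NAt (TA t f) y\<bullet>(Idc H (PA B f)\<star>tm t (Dom C f) x y) = tm t (Cod C f) (FOb (PA W f) x) (FOb (PA W f) y)\<bullet>NAt (TA t f) x"
proof -
 have a: "Dom C f\<in>Ob C" "Cod C f\<in>Ob C" using assms by simp_all
 note m = mv[OF a(1) assms(2,3)]
 have "FAr (PA W f) (mv (Dom C f) x y) = mv (Cod C f) (FOb (PA W f) x) (FOb (PA W f) y)"
  using m assms a functor_ar[of "PA W f" "PO W (Cod C f)"] functor_dom_cod[of "PA W f" "PO W (Cod C f)"] by (intro mv_eq) simp_all
 then show ?thesis using wcone_nat[OF wt assms(1) m(1)] m unfolding tm_def by simp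
qed

text \<open>The constraint of the weight is an arrow of an indiscrete category, so its image is a
  transport like any other.\<close>

lemma tm_pm: assumes "f\<in>Ar C" "g\<in>Ar C" "Cod C f = Dom C g" "w\<in>Ob (PO W (Dom C f))"
 shows "FAr (TO t (Cod C g)) (NAt (PM W g f) w) = tm t (Cod C g) (FOb (PA W g) (FOb (PA W f) w)) (FOb (PA W (g\<cdot>\<^bsub>C\<^esub>f)) w)"
 using mv_eq[OF _ pw_m(4-6)[OF assms(1-3) assms(4)]] assms unfolding tm_def by simp

lemma tm_pu: assumes "a\<in>Ob C" "w\<in>Ob (PO W a)"
 shows "FAr (TO t a) (NAt (PU W a) w) = tm t a w (FOb (PA W (Id C a)) w)"
 using mv_eq[OF _ pw_u(4-6)[OF assms(1) assms(2)]] assms unfolding tm_def by simp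

text \<open>Transports compose and are natural, so the axioms of the weighted cone at base objects
  survive the correction in \<open>cone1\<close>.\<close>

lemma cone_pcone: "pcone C H B X (cone0 t) (cone1 t)"
proof -
 note S = wcone_functor[OF wt] note so = wcone_ob[OF wt] note sc = wcone_cel[OF wt]
 have o: "cone0 t a\<in>Arr H" "Src H (cone0 t a) = X" "Tgt H (cone0 t a) = PO B a" if "a\<in>Ob C" for a
  using so[OF that, of "base a"] that by (simp_all add: cone0_def)
 have w: "FOb (PA W f) (base (Dom C f))\<in>Ob (PO W (Cod C f))" if "f\<in>Ar C" for f using that by simp
 have b: "base (Dom C f)\<in>Ob (PO W (Dom C f))" "base (Cod C f)\<in>Ob (PO W (Cod C f))" if "f\<in>Ar C" for f using that by simp_all
 have c: "cone1 t f\<in>Cel H" "Dm H (cone1 t f) = PA B f\<odot>cone0 t (Dom C f)" "Cd H (cone1 t f) = cone0 t (Cod C f)" "inv_cell H (cone1 t f)" if f: "f\<in>Ar C" for f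
  using sc[OF f b(1)[OF f]] tm[of "Cod C f", OF _ w[OF f] b(2)[OF f]] f by (simp_all add: cone1_def cone0_def)
 show ?thesis
  unfolding pcone_def
 proof (intro conjI ballI impI X)
  fix f g assume h: "f\<in>Ar C" "g\<in>Ar C" "Cod C f = Dom C g"
  let ?a = "base (Dom C f)" let ?b = "base (Dom C g)" let ?c = "base (Cod C g)" let ?i = "Idc H"
  let ?f = "FOb (PA W f)" let ?g = "FOb (PA W g)" let ?gf = "FOb (PA W (g\<cdot>\<^bsub>C\<^esub>f))" let ?T = "\<lambda>f. NAt (TA t f)"
  have ab: "?a\<in>Ob (PO W (Dom C f))" "?b\<in>Ob (PO W (Dom C g))" "?c\<in>Ob (PO W (Cod C g))" "?f ?a\<in>Ob (PO W (Dom C g))" "Dom C g\<in>Ob C" "Cod C g\<in>Ob C"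
   "Dom C f\<in>Ob C" using h b w[OF h(1)] by simp_all
  have gab: "?g (?f ?a)\<in>Ob (PO W (Cod C g))" "?g ?b\<in>Ob (PO W (Cod C g))" "?gf ?a\<in>Ob (PO W (Cod C g))" using h ab wob[of "g\<cdot>\<^bsub>C\<^esub>f"] by simp_all
  have gf: "g\<cdot>\<^bsub>C\<^esub>f\<in>Ar C" "?a\<in>Ob (PO W (Dom C (g\<cdot>\<^bsub>C\<^esub>f)))" using h ab by simp_all
  note sf = sc[OF h(1) ab(1)] note sg = sc[OF h(2) ab(4)] sc[OF h(2) ab(2)] note sgf = sc[OF gf]
  note tt = tm[OF ab(6)] tm[OF ab(5)] note s0 = so[OF ab(7) ab(1)] so[OF ab(5) ab(4)] so[OF ab(5) ab(2)]
  have "(tm t (Cod C g) (?gf ?a) ?c\<bullet>?T (g\<cdot>\<^bsub>C\<^esub>f) ?a)\<bullet>(PM B g f\<star>?i (FOb (TO t (Dom C f)) ?a)) =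
   tm t (Cod C g) (?gf ?a) ?c\<bullet>(?T (g\<cdot>\<^bsub>C\<^esub>f) ?a\<bullet>(PM B g f\<star>?i (FOb (TO t (Dom C f)) ?a)))"
   using h ab gab sgf tt s0 by simp
  also have "... = (tm t (Cod C g) (?gf ?a) ?c\<bullet>tm t (Cod C g) (?g (?f ?a)) (?gf ?a))\<bullet>?T g (?f ?a)\<bullet>(?i (PA B g)\<star>?T f ?a)"
   unfolding wcone_comp[OF wt h ab(1)] tm_pm[OF h ab(1)] using h ab gab sg sf tt s0 by simp
  \<comment> \<open>The transport to \<open>?c\<close> is rerouted through the image of the base
    object \<open>?b\<close>, so that \<open>tm_nat\<close> can move its first half across the
    square over \<open>g\<close>.\<close>
  also have "... = tm t (Cod C g) (?g ?b) ?c\<bullet>(tm t (Cod C g) (?g (?f ?a)) (?g ?b)\<bullet>?T g (?f ?a))\<bullet>(?i (PA B g)\<star>?T f ?a)"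
   unfolding tm_comp[OF ab(6) gab(1,3) ab(3)] tm_comp[OF ab(6) gab(1,2) ab(3), symmetric] using h ab gab sg sf tt s0 by simp
  also have "... = (tm t (Cod C g) (?g ?b) ?c\<bullet>?T g ?b)\<bullet>(?i (PA B g)\<star>(tm t (Dom C g) (?f ?a) ?b\<bullet>?T f ?a))"
   unfolding tm_nat[OF h(2) ab(4,2), symmetric] using h ab gab sg sf tt s0 by simp
  finally show "cone1 t (g\<cdot>\<^bsub>C\<^esub>f)\<bullet>(PM B g f\<star>?i (cone0 t (Dom C f))) = cone1 t g\<bullet>(?i (PA B g)\<star>cone1 t f)"
   using h by (simp add: cone1_def cone0_def del: tc_whisker tc_vc_assoc)
 next
  fix a assume a: "a\<in>Ob C"
  let ?w = "base a" let ?w' = "FOb (PA W (Id C a)) ?w"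
  have w': "?w'\<in>Ob (PO W a)" using wob[of "Id C a" ?w] a by simp
  have "cone1 t (Id C a)\<bullet>(PU B a\<star>Idc H (cone0 t a)) = tm t a ?w' ?w\<bullet>(NAt (TA t (Id C a)) ?w\<bullet>(PU B a\<star>Idc H (FOb (TO t a) ?w)))"
   using a w' sc[of "Id C a" ?w] tm[OF a w' base[OF a]] so[OF a base[OF a]] by (simp add: cone1_def cone0_def)
  also have "... = Idc H (cone0 t a)"
   unfolding wcone_unit[OF wt a base[OF a]] tm_pu[OF a base[OF a]] tm_comp[OF a base[OF a] w' base[OF a]] using tm_id[OF a base[OF a]] by (simp add: cone0_def)
  finally show "cone1 t (Id C a)\<bullet>(PU B a\<star>Idc H (cone0 t a)) = Idc H (cone0 t a)" .
 qed (use o c in simp_all)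
qed

end

lemma cone0_act: assumes "u\<in>Arr H" "t\<in>Ob (wc (Tgt H u))" "a\<in>Ob C"
 shows "cone0 (act u t) a = cone0 t a\<odot>u"
 using act(2)[OF assms(1,2,3), of "base a"] assms unfolding cone0_def by simp

lemma cone1_act: assumes "u\<in>Arr H" "t\<in>Ob (wc (Tgt H u))" "f\<in>Ar C"
 shows "cone1 (act u t) f = cone1 t f\<star>Idc H u"
proof -
 have X: "Tgt H u\<in>Obj H" using assms by simp
 let ?a = "base (Dom C f)" let ?b = "base (Cod C f)"
 have ab: "?a\<in>Ob (PO W (Dom C f))" "?b\<in>Ob (PO W (Cod C f))" "FOb (PA W f) ?a\<in>Ob (PO W (Cod C f))" "Cod C f\<in>Ob C" "Dom C f\<in>Ob C" using assms by simp_all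
 show ?thesis
  using act(3)[OF assms(1,2) ab(4) mv(1)[OF ab(4,3,2)]] act(4)[OF assms(1,2,3) ab(1)] tm[OF X assms(2) ab(4,3,2)] wcone_cel[OF wt[OF X assms(2)] assms(3) ab(1)]
   wc_ob_arr[OF assms(2) X ab(5,1)] assms
  by (simp add: cone1_def tm_def)
qed

section \<open>Modifications of weighted cones and maps of conical cones\<close>

lemma cone_mor_of_mod: assumes X: "X\<in>Obj H" and G: "Gm\<in>Ar (wc X)"
 shows "cone_mor C H B (cone0 (MDom Gm)) (cone1 (MDom Gm)) (cone0 (MCod Gm)) (cone1 (MCod Gm)) (\<lambda>a. NAt (MO Gm a) (base a))"
proof (rule cone_morI)
 note g = wc_arD(1,2,7)[OF G X] note w = wt[OF X g(1)] wt[OF X g(2)] note m = wmodD[OF g(3)]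
 show "NAt (MO Gm a) (base a)\<in>Cel H \<and> Dm H (NAt (MO Gm a) (base a)) = cone0 (MDom Gm) a \<and> Cd H (NAt (MO Gm a) (base a)) = cone0 (MCod Gm) a"
  if "a\<in>Ob C" for a using m(1-3)[OF that base[OF that]] that unfolding cone0_def by simp
 fix f assume f: "f\<in>Ar C"
 let ?a = "base (Dom C f)" let ?b = "base (Cod C f)" let ?x = "FOb (PA W f) ?a" let ?m = "\<lambda>a. NAt (MO Gm a)"
 let ?s = "MDom Gm" let ?t = "MCod Gm"
 have ab: "?a\<in>Ob (PO W (Dom C f))" "?b\<in>Ob (PO W (Cod C f))" "?x\<in>Ob (PO W (Cod C f))" "Cod C f\<in>Ob C" "Dom C f\<in>Ob C" using f by simp_all
 note mm = m(1-3)[OF ab(5,1)] m(1-3)[OF ab(4,2)] m(1-3)[OF ab(4,3)]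
 note ts = tm[OF X g(1) ab(4,3,2)] tm[OF X g(2) ab(4,3,2)] note sc = wcone_cel[OF w(1) f ab(1)] wcone_cel[OF w(2) f ab(1)]
 note so = wcone_ob[OF w(1) ab(5,1)] wcone_ob[OF w(2) ab(5,1)]
 have n: "?m (Cod C f) ?b\<bullet>tm ?s (Cod C f) ?x ?b = tm ?t (Cod C f) ?x ?b\<bullet>?m (Cod C f) ?x"
  using m(4)[OF ab(4) mv(1)[OF ab(4,3,2)]] mv(2,3)[OF ab(4,3,2)] unfolding tm_def by simp
 have "?m (Cod C f) ?b\<bullet>(tm ?s (Cod C f) ?x ?b\<bullet>NAt (TA ?s f) ?a) = (?m (Cod C f) ?b\<bullet>tm ?s (Cod C f) ?x ?b)\<bullet>NAt (TA ?s f) ?a"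
  using mm ts sc so f by simp
 also have "... = tm ?t (Cod C f) ?x ?b\<bullet>(?m (Cod C f) ?x\<bullet>NAt (TA ?s f) ?a)" unfolding n using mm ts sc so f by simp
 also have "... = (tm ?t (Cod C f) ?x ?b\<bullet>NAt (TA ?t f) ?a)\<bullet>(Idc H (PA B f)\<star>?m (Dom C f) ?a)"
  unfolding m(5)[OF f ab(1)] using mm ts sc so f by simp
 finally show "?m (Cod C f) ?b\<bullet>cone1 ?s f = cone1 ?t f\<bullet>(Idc H (PA B f)\<star>?m (Dom C f) ?a)" unfolding cone1_def .
qed

text \<open>Naturality of the component along the unique arrow from \<open>w\<close> to the base
  object, whose images under both cones are invertible.\<close>

lemma mod_determined: assumes X: "X\<in>Obj H" and G: "Gm\<in>Ar (wc X)" and a: "a\<in>Ob C" "w\<in>Ob (PO W a)"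
 shows "NAt (MO Gm a) w = tm (MCod Gm) a (base a) w\<bullet>NAt (MO Gm a) (base a)\<bullet>tm (MDom Gm) a w (base a)"
proof -
 note g = wc_arD(1,2,7)[OF G X] note m = wmodD[OF g(3)] note b = base[OF a(1)]
 note mm = m(1-3)[OF a] m(1-3)[OF a(1) b] note ts = tm[OF X g(1) a b] tm[OF X g(2) a b] tm[OF X g(2) a(1) b a(2)]
 have n: "NAt (MO Gm a) (base a)\<bullet>tm (MDom Gm) a w (base a) = tm (MCod Gm) a w (base a)\<bullet>NAt (MO Gm a) w"
  using m(4)[OF a(1) mv(1)[OF a b]] mv(2,3)[OF a b] unfolding tm_def by simp
 have "tm (MCod Gm) a (base a) w\<bullet>(tm (MCod Gm) a w (base a)\<bullet>NAt (MO Gm a) w) = NAt (MO Gm a) w"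
  using mm ts tm_comp[OF X g(2) a b a(2)] tm_id[OF X g(2) a] by (simp flip: tc_vc_assoc)
 then show ?thesis by (simp only: n)
qed

lemma mod_eqI: assumes X: "X\<in>Obj H" and "Gm\<in>Ar (wc X)" "Dl\<in>Ar (wc X)" "MDom Gm = MDom Dl" "MCod Gm = MCod Dl"
 and "!!a. a\<in>Ob C ==> NAt (MO Gm a) (base a) = NAt (MO Dl a) (base a)"
 shows "Gm = Dl"
proof (rule wc_ar_eqI[OF assms(1-5)])
 fix a w assume aw: "a\<in>Ob C" "w\<in>Ob (PO W a)"
 have "NAt (MO Gm a) w = tm (MCod Gm) a (base a) w\<bullet>NAt (MO Gm a) (base a)\<bullet>tm (MDom Gm) a w (base a)"
  by (rule mod_determined[OF X assms(2) aw])
 also have "... = tm (MCod Dl) a (base a) w\<bullet>NAt (MO Dl a) (base a)\<bullet>tm (MDom Dl) a w (base a)"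
  unfolding assms(4,5) assms(6)[OF aw(1)] ..
 also have "... = NAt (MO Dl a) w"
  by (rule mod_determined[OF X assms(3) aw, symmetric])
 finally show "NAt (MO Gm a) w = NAt (MO Dl a) w" .
qed

lemma mod_lift: assumes X: "X\<in>Obj H" and s: "s\<in>Ob (wc X)" and t: "t\<in>Ob (wc X)"
 and c: "cone_mor C H B (cone0 s) (cone1 s) (cone0 t) (cone1 t) gm"
 shows "\<exists>Gm\<in>Ar (wc X). MDom Gm = s \<and> MCod Gm = t \<and> (\<forall>a\<in>Ob C. NAt (MO Gm a) (base a) = gm a)"
proof -
 \<comment> \<open>By \<open>mod_determined\<close> these are the only possible components.\<close>
 define Gm where "Gm = \<lparr>MDom = s, MCod = t, MO = (\<lambda>a\<in>Ob C. \<lparr>NDom = TO s a, NCod = TO t a,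
   NAt = (\<lambda>w\<in>Ob (PO W a). tm t a (base a) w\<bullet>gm a\<bullet>tm s a w (base a))\<rparr>)\<rparr>"
 have D: "MDom Gm = s" "MCod Gm = t" by (simp_all add: Gm_def)
 have at: "NAt (MO Gm a) w = tm t a (base a) w\<bullet>gm a\<bullet>tm s a w (base a)" if "a\<in>Ob C" "w\<in>Ob (PO W a)" for a w
  using that by (simp add: Gm_def)
 note ws = wt[OF X s] note w_t = wt[OF X t]
 note gm = cone_morD[OF c]
 note S = tm[OF X s] note T = tm[OF X t]
 have g0: "gm a\<in>Cel H" "Dm H (gm a) = FOb (TO s a) (base a)" "Cd H (gm a) = FOb (TO t a) (base a)" if "a\<in>Ob C" for a
  using gm(1-3)[OF that] unfolding cone0_def by simp_all
 have "Gm\<in>Ar (wc X)"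
 proof (rule wc_arI[OF X])
  show "MDom Gm\<in>Ob (wc X)" "MCod Gm\<in>Ob (wc X)" using s t D by simp_all
  show "MO Gm\<in>extensional (Ob C)" "!!a. a\<in>Ob C ==> NDom (MO Gm a) = TO (MDom Gm) a" "!!a. a\<in>Ob C ==> NCod (MO Gm a) = TO (MCod Gm) a"
   "!!a. a\<in>Ob C ==> NAt (MO Gm a)\<in>extensional (Ob (PO W a))"
   by (simp_all add: Gm_def)
  show "wmod (TO (MDom Gm)) (\<lambda>f. NAt (TA (MDom Gm) f)) (TO (MCod Gm)) (\<lambda>f. NAt (TA (MCod Gm) f)) (\<lambda>a. NAt (MO Gm a))"
   unfolding wmod_def D
  proof (intro conjI ballI)
   fix a w assume h: "a\<in>Ob C" "w\<in>Ob (PO W a)"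
   show "NAt (MO Gm a) w\<in>Hom2 H (FOb (TO s a) w) (FOb (TO t a) w)"
    using at[OF h] g0[OF h(1)] S[OF h base[OF h(1)]] T[OF h(1) base[OF h(1)] h(2)] by simp
  next
   fix a m assume h: "a\<in>Ob C" "m\<in>Ar (PO W a)"
   let ?x = "Dom (PO W a) m" let ?y = "Cod (PO W a) m"
   have xy: "?x\<in>Ob (PO W a)" "?y\<in>Ob (PO W a)" and b: "base a\<in>Ob (PO W a)" using h by simp_all
   have m: "FAr (TO s a) m = tm s a ?x ?y" "FAr (TO t a) m = tm t a ?x ?y" using mv_eq[OF h] unfolding tm_def by simp_all
   have "(tm t a (base a) ?y\<bullet>gm a\<bullet>tm s a ?y (base a))\<bullet>tm s a ?x ?y = tm t a (base a) ?y\<bullet>gm a\<bullet>(tm s a ?y (base a)\<bullet>tm s a ?x ?y)"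
    using h xy b g0[OF h(1)] S[OF h(1)] T[OF h(1)] by simp
   also have "... = (tm t a ?x ?y\<bullet>tm t a (base a) ?x)\<bullet>gm a\<bullet>tm s a ?x (base a)"
    unfolding tm_comp[OF X s h(1) xy b] tm_comp[OF X t h(1) b xy] ..
   also have "... = tm t a ?x ?y\<bullet>(tm t a (base a) ?x\<bullet>gm a\<bullet>tm s a ?x (base a))"
    using h xy b g0[OF h(1)] S[OF h(1)] T[OF h(1)] by simp
   finally show "NAt (MO Gm a) ?y\<bullet>FAr (TO s a) m = FAr (TO t a) m\<bullet>NAt (MO Gm a) ?x" using at h xy m by simp
  next
   fix f w assume h: "f\<in>Ar C" "w\<in>Ob (PO W (Dom C f))"
   let ?a = "base (Dom C f)" let ?b = "base (Cod C f)" let ?fa = "FOb (PA W f) ?a" let ?fw = "FOb (PA W f) w" let ?c = "Cod C f" let ?d = "Dom C f"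
   have o: "?a\<in>Ob (PO W ?d)" "?b\<in>Ob (PO W ?c)" "?fa\<in>Ob (PO W ?c)" "?fw\<in>Ob (PO W ?c)" "?c\<in>Ob C" "?d\<in>Ob C" using h by simp_all
   note sc = wcone_cel[OF ws h] wcone_cel[OF ws h(1) o(1)] wcone_cel[OF w_t h] wcone_cel[OF w_t h(1) o(1)]
   note so = wcone_ob[OF ws o(6) h(2)] wcone_ob[OF ws o(6) o(1)] wcone_ob[OF w_t o(6) h(2)] wcone_ob[OF w_t o(6) o(1)]
   note tt = S[OF o(5)] T[OF o(5)] S[OF o(6)] T[OF o(6)] note gg = g0[OF o(5)] g0[OF o(6)]
   let ?A = "Idc H (PA B f)" let ?sf = "NAt (TA s f)" let ?tf = "NAt (TA t f)"
   have k: "gm ?c\<bullet>tm s ?c ?fa ?b\<bullet>?sf ?a = tm t ?c ?fa ?b\<bullet>?tf ?a\<bullet>(?A\<star>gm ?d)"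
    using gm(4)[OF h(1)] h o tt gg sc so unfolding cone1_def by simp
   have "(tm t ?c ?b ?fw\<bullet>gm ?c\<bullet>tm s ?c ?fw ?b)\<bullet>?sf w = tm t ?c ?b ?fw\<bullet>gm ?c\<bullet>(tm s ?c ?fa ?b\<bullet>tm s ?c ?fw ?fa)\<bullet>?sf w"
    unfolding tm_comp[OF X s o(5,4,3,2)] using h o tt gg sc so by simp
   also have "... = tm t ?c ?b ?fw\<bullet>gm ?c\<bullet>tm s ?c ?fa ?b\<bullet>(tm s ?c ?fw ?fa\<bullet>?sf w)" using h o tt gg sc so by simp
   also have "... = tm t ?c ?b ?fw\<bullet>(gm ?c\<bullet>tm s ?c ?fa ?b\<bullet>?sf ?a)\<bullet>(?A\<star>tm s ?d w ?a)"
    unfolding tm_nat[OF X s h(1) h(2) o(1), symmetric] using h o tt gg sc so by simp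
   also have "... = ((tm t ?c ?b ?fw\<bullet>tm t ?c ?fa ?b)\<bullet>?tf ?a)\<bullet>(?A\<star>(gm ?d\<bullet>tm s ?d w ?a))" unfolding k using h o tt gg sc so by simp
   also have "... = ?tf w\<bullet>(?A\<star>(tm t ?d ?a w\<bullet>gm ?d\<bullet>tm s ?d w ?a))"
    unfolding tm_comp[OF X t o(5,3,2,4)] tm_nat[OF X t h(1) o(1) h(2), symmetric] using h o tt gg sc so by simp
   finally show "NAt (MO Gm ?c) ?fw\<bullet>?sf w = ?tf w\<bullet>(?A\<star>NAt (MO Gm ?d) w)"
    using at[OF o(5,4)] at[OF o(6) h(2)] by simp
  qed
 qed
 moreover have "NAt (MO Gm a) (base a) = gm a" if a: "a\<in>Ob C" for a
  using at[OF a base[OF a]] tm_id[OF X s a base[OF a]] tm_id[OF X t a base[OF a]] g0[OF a] by simp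
 ultimately show ?thesis using D by blast
qed

text \<open>Functors constant at the 1-cells \<open>p a\<close> realise the cone on the nose, since
  every transport is then an identity.\<close>

lemma cone_surj: assumes p: "pcone C H B X p P"
 shows "\<exists>t\<in>Ob (wc X). (\<forall>a\<in>Ob C. cone0 t a = p a) \<and> (\<forall>f\<in>Ar C. cone1 t f = P f)"
proof -
 note pd = pconeD[OF p] note X = pd(1)
 define S :: "'o => ('x, 'y, 'b, 'd) fctr" where "S a = \<lparr>FDom = PO W a, FCod = HomC H X (PO B a), FOb = (\<lambda>w\<in>Ob (PO W a). p a), FAr = (\<lambda>m\<in>Ar (PO W a). Idc H (p a))\<rparr>" for a
 define t :: "('o, 'm, 'm, 'x, 'y, 'b, 'd) catpsnt" where "t = \<lparr>TDom = W, TCod = V X, TO = restrict S (Ob C), TA = (\<lambda>f\<in>Ar C. \<lparr>NDom = yo_arr H X (PA B f) \<circ>\<^sub>F S (Dom C f), NCod = S (Cod C f) \<circ>\<^sub>F PA W f,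
  NAt = (\<lambda>w\<in>Ob (PO W (Dom C f)). P f)\<rparr>)\<rparr>"
 have Ss: "FDom (S a) = PO W a" "FCod (S a) = HomC H X (PO B a)" "w\<in>Ob (PO W a) ==> FOb (S a) w = p a" "m\<in>Ar (PO W a) ==> FAr (S a) m = Idc H (p a)" for a w m
  by (simp_all add: S_def)
 have Sf: "is_functor (S a)" if a: "a\<in>Ob C" for a
 proof (rule functorI)
  show "FOb (S a)\<in>extensional (Ob (FDom (S a)))" "FAr (S a)\<in>extensional (Ar (FDom (S a)))" by (simp_all add: S_def)
 qed (use a X pd in "simp_all add: Ss")
 have tS: "TO t a = S a" if "a\<in>Ob C" for a using that by (simp add: t_def)
 have tP: "NAt (TA t f) w = P f" if "f\<in>Ar C" "w\<in>Ob (PO W (Dom C f))" for f w using that by (simp add: t_def)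
 have w: "wcone X (TO t) (\<lambda>f. NAt (TA t f))"
  unfolding wcone_def
 proof (intro conjI ballI impI X)
  show "is_functor (TO t a)" "FDom (TO t a) = PO W a" "FCod (TO t a) = HomC H X (PO B a)" if "a\<in>Ob C" for a
   using that tS Sf Ss by simp_all
  fix f assume f: "f\<in>Ar C"
  show "inv_cell H (NAt (TA t f) w)" "Dm H (NAt (TA t f) w) = PA B f\<odot>FOb (TO t (Dom C f)) w" "Cd H (NAt (TA t f) w) = FOb (TO t (Cod C f)) (FOb (PA W f) w)"
   if "w\<in>Ob (PO W (Dom C f))" for w using that f pd tS tP Ss by simp_all
  show "NAt (TA t f) (Cod (PO W (Dom C f)) m)\<bullet>(Idc H (PA B f)\<star>FAr (TO t (Dom C f)) m) = FAr (TO t (Cod C f)) (FAr (PA W f) m)\<bullet>NAt (TA t f) (Dom (PO W (Dom C f)) m)"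
   if "m\<in>Ar (PO W (Dom C f))" for m using that f pd tS tP Ss functor_ar[of "PA W f" "PO W (Cod C f)" m] by simp
  show "NAt (TA t (g\<cdot>\<^bsub>C\<^esub>f)) w\<bullet>(PM B g f\<star>Idc H (FOb (TO t (Dom C f)) w)) =
    FAr (TO t (Cod C g)) (NAt (PM W g f) w)\<bullet>NAt (TA t g) (FOb (PA W f) w)\<bullet>(Idc H (PA B g)\<star>NAt (TA t f) w)"
   if h: "g\<in>Ar C" "w\<in>Ob (PO W (Dom C f))" "Cod C f = Dom C g" for g w
   using h f pd tS tP Ss pcone_comp[OF p f h(1,3)] pw_m(4)[OF f h(1,3,2)] wob[OF f h(2)] by simp
 next
  fix a w assume h: "a\<in>Ob C" "w\<in>Ob (PO W a)"
  show "NAt (TA t (Id C a)) w\<bullet>(PU B a\<star>Idc H (FOb (TO t a) w)) = FAr (TO t a) (NAt (PU W a) w)"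
   using h tS tP[of "Id C a" w] Ss pcone_unit[OF p h(1)] pw_u(4)[OF h] by simp
 qed
 have "cat_psnat (LD C) t"
  by (rule wcone_cat_psnat[OF w]) (simp_all add: t_def)
 then have t: "t\<in>Ob (wc X)" by (simp add: wc_simps(1) t_def)
 have 0: "cone0 t a = p a" if a: "a\<in>Ob C" for a using tS[OF a] Ss(3)[OF base[OF a]] by (simp add: cone0_def)
 have 1: "cone1 t f = P f" if f: "f\<in>Ar C" for f
 proof -
  have m: "mv (Cod C f) (FOb (PA W f) (base (Dom C f))) (base (Cod C f))\<in>Ar (PO W (Cod C f))" by (rule mv) (use f in simp_all)
  have "cone1 t f = Idc H (p (Cod C f))\<bullet>P f" using f m tS tP Ss by (simp add: cone1_def tm_def)
  then show ?thesis using f pd by simp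
 qed
 show ?thesis using t 0 1 by blast
qed

lemma cone_mor_cong:
 assumes "!!a. a\<in>Ob C ==> p a = p' a" "!!f. f\<in>Ar C ==> P f = P' f" "!!a. a\<in>Ob C ==> q a = q' a" "!!f. f\<in>Ar C ==> Q f = Q' f"
  "!!a. a\<in>Ob C ==> gm a = gm' a"
 shows "cone_mor C H B p P q Q gm = cone_mor C H B p' P' q' Q' gm'"
 using assms by (simp add: cone_mor_def)

text \<open>Every conical cone comes from a weighted one by \<open>cone_surj\<close>, and maps
  between them correspond bijectively by \<open>mod_lift\<close> and \<open>mod_eqI\<close>, so
  universality carries over clause by clause.\<close>

lemma universal_cone_of_elt:
 assumes u: "universal_elt H (weighted_cones (LD C) H W B) L c"
 shows "universal_cone C H B L (cone0 c) (cone1 c)"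
proof -
 let ?x = "Id (wc L) c"
 let ?G = "weighted_cones (LD C) H W B"
 have L: "L\<in>Obj H" and c: "c\<in>Ob (wc L)" using u by (auto simp: universal_elt_def)
 have ac: "act f c\<in>Ob (wc X)" "!!a. a\<in>Ob C ==> cone0 (act f c) a = cone0 c a\<odot>f" "!!h. h\<in>Ar C ==> cone1 (act f c) h = cone1 c h\<star>Idc H f"
  if "f\<in>Hom1 H X L" for f X
  using act(1)[of f c] cone0_act[of f c] cone1_act[of f c] that c by auto
 show ?thesis
  unfolding universal_cone_def
 proof (intro conjI allI impI ballI cone_pcone[OF L c])
  fix X q Q assume q: "pcone C H B X q Q"
  have X: "X\<in>Obj H" using pconeD(1)[OF q] .
  obtain z where z: "z\<in>Ob (wc X)" "!!a. a\<in>Ob C ==> cone0 z a = q a" "!!f. f\<in>Ar C ==> cone1 z f = Q f" using cone_surj[OF q] by blast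
  have "\<forall>z\<in>Ob (PO ?G X). \<exists>f\<in>Hom1 H X L. isomorphic_in (PO ?G X) (FOb (PA ?G f) c) z"
   using u X unfolding universal_elt_def by blast
  then obtain f where f: "f\<in>Hom1 H X L" and "isomorphic_in (PO ?G X) (FOb (PA ?G f) c) z"
   using z(1) X by auto
  then have "isomorphic_in (wc X) (act f c) z" using c X by simp
  then obtain h where h: "cat_iso (wc X) h" "MDom h = act f c" "MCod h = z" unfolding isomorphic_in_def by auto
  note hi = cat_inv[OF h(1)]
  have ha: "h\<in>Ar (wc X)" using h(1) by simp
  have cm: "cone_mor C H B (\<lambda>a. cone0 c a\<odot>f) (\<lambda>h. cone1 c h\<star>Idc H f) q Q (\<lambda>a. NAt (MO h a) (base a))"
   using cone_mor_of_mod[OF X ha] ac[OF f] z h cone_mor_cong[of "cone0 (act f c)" "\<lambda>a. cone0 c a\<odot>f" "cone1 (act f c)" "\<lambda>h. cone1 c h\<star>Idc H f" "cone0 z" q "cone1 z" Q] by simp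
  have "inv_cell H (NAt (MO h a) (base a))" if a: "a\<in>Ob C" for a
  proof (rule inv_cellI[OF HC(1), of _ "NAt (MO (cat_inv (wc X) h) a) (base a)"])
   note b = base[OF a]
   have hi2: "cat_inv (wc X) h\<in>Ar (wc X)" "MDom (cat_inv (wc X) h) = z" "MCod (cat_inv (wc X) h) = act f c" using hi h by simp_all
   show "NAt (MO (cat_inv (wc X) h) a) (base a)\<bullet>NAt (MO h a) (base a) = Idc H (Dm H (NAt (MO h a) (base a)))"
    using comp_at[OF ha X a b, of "cat_inv (wc X) h"] hi(4) h id_at[OF ac(1)[OF f] X a b] wc_ar_cel[OF ha X a b] by simp
   show "NAt (MO h a) (base a)\<bullet>NAt (MO (cat_inv (wc X) h) a) (base a) = Idc H (Cd H (NAt (MO h a) (base a)))"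
    using comp_at[OF hi2(1) X a b, of h] hi(5) h id_at[OF z(1) X a b] wc_ar_cel[OF ha X a b] by simp
  qed (use wc_ar_cel[OF ha X a base[OF a]] wc_ar_cel[OF hi(1) X a base[OF a]] hi(2,3) h in simp_all)
  then show "\<exists>f\<in>Hom1 H X L. \<exists>sig. (\<forall>a\<in>Ob C. inv_cell H (sig a)) \<and> cone_mor C H B (\<lambda>a. cone0 c a\<odot>f) (\<lambda>h. cone1 c h\<star>Idc H f) q Q sig"
   using f cm by (intro bexI[of _ f] exI[of _ "\<lambda>a. NAt (MO h a) (base a)"] conjI ballI) simp_all
 next
  fix X f g gm assume X: "X\<in>Obj H" and f: "f\<in>Hom1 H X L" and g: "g\<in>Hom1 H X L"
   and m: "cone_mor C H B (\<lambda>a. cone0 c a\<odot>f) (\<lambda>h. cone1 c h\<star>Idc H f) (\<lambda>a. cone0 c a\<odot>g) (\<lambda>h. cone1 c h\<star>Idc H g) gm"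
  have "cone_mor C H B (cone0 (act f c)) (cone1 (act f c)) (cone0 (act g c)) (cone1 (act g c)) gm"
   using m ac[OF f] ac[OF g] by (simp cong: cone_mor_cong)
  from mod_lift[OF X ac(1)[OF f] ac(1)[OF g] this] obtain Gm where G: "Gm\<in>Ar (wc X)" "MDom Gm = act f c" "MCod Gm = act g c"
   "!!a. a\<in>Ob C ==> NAt (MO Gm a) (base a) = gm a" by blast
  have b: "bij_betw (\<lambda>al. NAt (PC ?G al) c) (Hom2 H f g) (Hom (wc X) (act f c) (act g c))"
  proof -
   have "bij_betw (\<lambda>al. NAt (PC ?G al) c) (Hom2 H f g) (Hom (PO ?G X) (FOb (PA ?G f) c) (FOb (PA ?G g) c))"
    using u X f g unfolding universal_elt_def by blast
   then show ?thesis using X f g c by simp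
  qed
  have e: "NAt (PC ?G al) c = actc al ?x" "!!a. a\<in>Ob C ==> NAt (MO (actc al ?x) a) (base a) = Idc H (cone0 c a)\<star>al"
   "actc al ?x\<in>Ar (wc X)" "MDom (actc al ?x) = act f c" "MCod (actc al ?x) = act g c"
   if a: "al\<in>Hom2 H f g" for al
  proof -
   have a': "al\<in>Cel H" "Tgt H (Dm H al) = L" "Src H (Dm H al) = X" "c\<in>Ob (wc (Tgt H (Dm H al)))" using a f c by auto
   show "NAt (PC ?G al) c = actc al ?x" "actc al ?x\<in>Ar (wc X)" "MDom (actc al ?x) = act f c" "MCod (actc al ?x) = act g c"
    using actc_id[OF a'(1,4)] a' a by simp_all
   show "!!a. a\<in>Ob C ==> NAt (MO (actc al ?x) a) (base a) = Idc H (cone0 c a)\<star>al"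
    using actc_id_at[OF a'(1,4)] a' by (simp add: cone0_def)
  qed
  have "Gm\<in>Hom (wc X) (act f c) (act g c)" using G by simp
  then obtain al where a': "Gm = NAt (PC ?G al) c" "al\<in>Hom2 H f g" unfolding bij_betw_imp_surj_on[OF b, symmetric] by (rule imageE)
  note a = a'(2,1)
  show "\<exists>!al. al\<in>Hom2 H f g \<and> (\<forall>a\<in>Ob C. Idc H (cone0 c a)\<star>al = gm a)"
  proof (rule ex1I[of _ al])
   show "al\<in>Hom2 H f g \<and> (\<forall>a\<in>Ob C. Idc H (cone0 c a)\<star>al = gm a)" using a e(1,2)[OF a(1)] G by simp
   fix be assume b2: "be\<in>Hom2 H f g \<and> (\<forall>a\<in>Ob C. Idc H (cone0 c a)\<star>be = gm a)"
   then have bb: "be\<in>Hom2 H f g" by blast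
   have "actc be ?x = actc al ?x"
    by (rule mod_eqI[OF X e(3)[OF bb] e(3)[OF a(1)]]) (use e(4,5)[OF bb] e(4,5)[OF a(1)] e(2)[OF bb] e(2)[OF a(1)] b2 a G e(1)[OF a(1)] in simp_all)
   then have "NAt (PC ?G be) c = NAt (PC ?G al) c" unfolding e(1)[OF bb] e(1)[OF a(1)] .
   then show "be = al" by (rule inj_onD[OF bij_betw_imp_inj_on[OF b]]) (rule bb, rule a(1))
  qed
 qed
qed

text \<open>The weighted cone is chosen by \<open>cone_surj\<close> with components exactly
  \<open>p\<close> and \<open>P\<close>, so that its precomposites are the whiskered cones without
  any comparison cell.\<close>

lemma universal_elt_of_cone:
 assumes u: "universal_cone C H B L p P"
 shows "\<exists>c. universal_elt H (weighted_cones (LD C) H W B) L c"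
proof -
 let ?G = "weighted_cones (LD C) H W B"
 have p: "pcone C H B L p P" using u by (simp add: universal_cone_def)
 have L: "L\<in>Obj H" using pconeD(1)[OF p] .
 obtain c where c: "c\<in>Ob (wc L)" and c0: "!!a. a\<in>Ob C ==> cone0 c a = p a" and c1: "!!f. f\<in>Ar C ==> cone1 c f = P f"
  using cone_surj[OF p] by blast
 have ac: "act f c\<in>Ob (wc X)" "!!a. a\<in>Ob C ==> cone0 (act f c) a = p a\<odot>f" "!!h. h\<in>Ar C ==> cone1 (act f c) h = P h\<star>Idc H f"
  if "f\<in>Hom1 H X L" for f X
  using act(1)[of f c] cone0_act[of f c] cone1_act[of f c] that c c0 c1 by auto
 have "universal_elt H ?G L c"
  unfolding universal_elt_def
 proof (intro conjI ballI)
  fix X z assume X: "X\<in>Obj H" and "z\<in>Ob (PO ?G X)"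
  then have z: "z\<in>Ob (wc X)" by simp
  note zp = cone_pcone[OF X z]
  obtain f sig where f: "f\<in>Hom1 H X L" and si: "!!a. a\<in>Ob C ==> inv_cell H (sig a)"
   and s: "cone_mor C H B (\<lambda>a. p a\<odot>f) (\<lambda>h. P h\<star>Idc H f) (cone0 z) (cone1 z) sig"
   using u zp unfolding universal_cone_def by blast
  have fp: "pcone C H B X (\<lambda>a. p a\<odot>f) (\<lambda>h. P h\<star>Idc H f)" using pcone_whisker[OF p, of f] f by simp
  have s1: "cone_mor C H B (cone0 (act f c)) (cone1 (act f c)) (cone0 z) (cone1 z) sig"
   using s ac[OF f] by (simp cong: cone_mor_cong)
  \<comment> \<open>The inverse cone map is lifted as well. Both composites of the lifts have
    identity components at the base objects and so are identities.\<close>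
  have s2: "cone_mor C H B (cone0 z) (cone1 z) (cone0 (act f c)) (cone1 (act f c)) (\<lambda>a. cinv H (sig a))"
   using cone_mor_inv[OF s si fp zp] ac[OF f] by (simp cong: cone_mor_cong)
  obtain h where h: "h\<in>Ar (wc X)" "MDom h = act f c" "MCod h = z" "!!a. a\<in>Ob C ==> NAt (MO h a) (base a) = sig a"
   using mod_lift[OF X ac(1)[OF f] z s1] by blast
  obtain k where k: "k\<in>Ar (wc X)" "MDom k = z" "MCod k = act f c" "!!a. a\<in>Ob C ==> NAt (MO k a) (base a) = cinv H (sig a)"
   using mod_lift[OF X z ac(1)[OF f] s2] by blast
  have "k\<cdot>\<^bsub>wc X\<^esub>h = Id (wc X) (act f c)"
  proof (rule mod_eqI[OF X])
   show "k\<cdot>\<^bsub>wc X\<^esub>h\<in>Ar (wc X)" "Id (wc X) (act f c)\<in>Ar (wc X)" using wc_comp[OF h(1) k(1) _ X] wc_id[OF ac(1)[OF f] X] h k by simp_all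
   show "NAt (MO (k\<cdot>\<^bsub>wc X\<^esub>h) a) (base a) = NAt (MO (Id (wc X) (act f c)) a) (base a)" if a: "a\<in>Ob C" for a
    using comp_at[OF h(1) X a base[OF a]] h(4)[OF a] k(4)[OF a] id_at[OF ac(1)[OF f] X a base[OF a]] si[OF a] cone_morD(2)[OF s1 a] by (simp add: cone0_def)
  qed (use h k in simp_all)
  moreover have "h\<cdot>\<^bsub>wc X\<^esub>k = Id (wc X) z"
  proof (rule mod_eqI[OF X])
   show "h\<cdot>\<^bsub>wc X\<^esub>k\<in>Ar (wc X)" "Id (wc X) z\<in>Ar (wc X)" using wc_comp[OF k(1) h(1) _ X] wc_id[OF z X] h k by simp_all
   show "NAt (MO (h\<cdot>\<^bsub>wc X\<^esub>k) a) (base a) = NAt (MO (Id (wc X) z) a) (base a)" if a: "a\<in>Ob C" for a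
    using comp_at[OF k(1) X a base[OF a]] h(4)[OF a] k(4)[OF a] id_at[OF z X a base[OF a]] si[OF a] cone_morD(3)[OF s1 a] by (simp add: cone0_def)
  qed (use h k in simp_all)
  ultimately have "cat_iso (wc X) h" using h k by (intro cat_isoI[of _ _ k]) simp_all
  then have "isomorphic_in (wc X) (act f c) z" unfolding isomorphic_in_def using h by auto
  then show "\<exists>f\<in>Hom1 H X L. isomorphic_in (PO ?G X) (FOb (PA ?G f) c) z" using f X c by (intro bexI[of _ f]) auto
 next
  fix X f g assume X: "X\<in>Obj H" and f: "f\<in>Hom1 H X L" and g: "g\<in>Hom1 H X L"
  have e: "NAt (PC ?G al) c = actc al (Id (wc L) c)" "!!a. a\<in>Ob C ==> NAt (MO (actc al (Id (wc L) c)) a) (base a) = Idc H (p a)\<star>al"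
   "actc al (Id (wc L) c)\<in>Ar (wc X)" "MDom (actc al (Id (wc L) c)) = act f c" "MCod (actc al (Id (wc L) c)) = act g c"
   if a: "al\<in>Hom2 H f g" for al
  proof -
   have a': "al\<in>Cel H" "Tgt H (Dm H al) = L" "Src H (Dm H al) = X" "c\<in>Ob (wc (Tgt H (Dm H al)))" using a f c by auto
   show "NAt (PC ?G al) c = actc al (Id (wc L) c)" "actc al (Id (wc L) c)\<in>Ar (wc X)" "MDom (actc al (Id (wc L) c)) = act f c" "MCod (actc al (Id (wc L) c)) = act g c"
    using actc_id[OF a'(1,4)] a' a by simp_all
   show "!!a. a\<in>Ob C ==> NAt (MO (actc al (Id (wc L) c)) a) (base a) = Idc H (p a)\<star>al"
    using actc_id_at[OF a'(1,4)] a' c0 by (simp add: cone0_def)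
  qed
  have uniq: "\<exists>!al. al\<in>Hom2 H f g \<and> (\<forall>a\<in>Ob C. Idc H (p a)\<star>al = NAt (MO Gm a) (base a))"
   if G: "Gm\<in>Ar (wc X)" "MDom Gm = act f c" "MCod Gm = act g c" for Gm
  proof -
   have "cone_mor C H B (\<lambda>a. p a\<odot>f) (\<lambda>h. P h\<star>Idc H f) (\<lambda>a. p a\<odot>g) (\<lambda>h. P h\<star>Idc H g) (\<lambda>a. NAt (MO Gm a) (base a))"
    using cone_mor_of_mod[OF X G(1)] ac[OF f] ac[OF g] G by (simp cong: cone_mor_cong)
   then show ?thesis using u X f g unfolding universal_cone_def by blast
  qed
  have "bij_betw (\<lambda>al. actc al (Id (wc L) c)) (Hom2 H f g) (Hom (wc X) (act f c) (act g c))"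
  proof (rule bij_betw_imageI)
   show "inj_on (\<lambda>al. actc al (Id (wc L) c)) (Hom2 H f g)"
   proof (rule inj_onI)
    fix al be assume h: "al\<in>Hom2 H f g" "be\<in>Hom2 H f g" "actc al (Id (wc L) c) = actc be (Id (wc L) c)"
    note u1 = uniq[OF e(3)[OF h(1)] e(4)[OF h(1)] e(5)[OF h(1)]]
    have A: "al\<in>Hom2 H f g \<and> (\<forall>a\<in>Ob C. Idc H (p a)\<star>al = NAt (MO (actc al (Id (wc L) c)) a) (base a))"
     using h(1) e(2)[OF h(1)] by simp
    have B: "be\<in>Hom2 H f g \<and> (\<forall>a\<in>Ob C. Idc H (p a)\<star>be = NAt (MO (actc al (Id (wc L) c)) a) (base a))"
     unfolding h(3) using h(2) e(2)[OF h(2)] by simp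
    show "al = be" by (rule HOL.trans[OF HOL.sym[OF the1_equality[OF u1 A]] the1_equality[OF u1 B]])
   qed
   show "(\<lambda>al. actc al (Id (wc L) c)) ` Hom2 H f g = Hom (wc X) (act f c) (act g c)"
   proof
    show "(\<lambda>al. actc al (Id (wc L) c)) ` Hom2 H f g \<subseteq> Hom (wc X) (act f c) (act g c)"
     using e(3-5) by (intro image_subsetI) simp
    show "Hom (wc X) (act f c) (act g c) \<subseteq> (\<lambda>al. actc al (Id (wc L) c)) ` Hom2 H f g"
    proof
     fix Gm assume "Gm\<in>Hom (wc X) (act f c) (act g c)"
     then have G: "Gm\<in>Ar (wc X)" "MDom Gm = act f c" "MCod Gm = act g c" by simp_all
     obtain al where a0: "al\<in>Hom2 H f g \<and> (\<forall>a\<in>Ob C. Idc H (p a)\<star>al = NAt (MO Gm a) (base a))"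
      using ex1_implies_ex[OF uniq[OF G]] by (rule exE)
     then have a: "al\<in>Hom2 H f g" "!!a. a\<in>Ob C ==> Idc H (p a)\<star>al = NAt (MO Gm a) (base a)"
      by (rule conjunct1) (rule bspec[OF conjunct2[OF a0]])
     have "Gm = actc al (Id (wc L) c)"
      by (rule mod_eqI[OF X G(1) e(3)[OF a(1)]]) (use G e(2,4,5)[OF a(1)] a(2) in simp_all)
     then show "Gm\<in>(\<lambda>al. actc al (Id (wc L) c)) ` Hom2 H f g" by (rule image_eqI) (rule a(1))
    qed
   qed
  qed
  moreover have "bij_betw (\<lambda>al. NAt (PC ?G al) c) (Hom2 H f g) S = bij_betw (\<lambda>al. actc al (Id (wc L) c)) (Hom2 H f g) S" for S
   by (rule bij_betw_cong) (rule e(1))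
  ultimately show "bij_betw (\<lambda>al. NAt (PC ?G al) c) (Hom2 H f g) (Hom (PO ?G X) (FOb (PA ?G f) c) (FOb (PA ?G g) c))"
   using X f g c by simp
 qed (use L c in simp_all)
 then show ?thesis ..
qed

text \<open>The Yoneda transformation of the corresponding universal element is the required
  equivalence, the pseudofunctor of weighted cones having identity constraints.\<close>

lemma is_bilim_of_universal_cone:
 assumes u: "universal_cone C H B L p P"
 shows "is_bilim (LD C) H W B L"
proof -
 obtain c where c: "universal_elt H (weighted_cones (LD C) H W B) L c" using universal_elt_of_cone[OF u] by blast
 have e: "cat_psnat_equivalence (OpT H) (yoneda_tr H (weighted_cones (LD C) H W B) L c)"
  by (rule yoneda_tr_equivalence[OF HC(1) pseudofunctor_weighted_cones c]) simp_all
 have L: "L\<in>Obj H" using u pconeD(1) by (auto simp: universal_cone_def)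
 show ?thesis unfolding is_bilim_def
  using L e by (intro conjI exI[of _ "yoneda_tr H (weighted_cones (LD C) H W B) L c"]) (simp_all add: yoneda_tr_def)
qed

lemma universal_cone_of_is_bilim:
 assumes "is_bilim (LD C) H W B L"
 shows "\<exists>p P. universal_cone C H B L p P"
proof -
 obtain c where "universal_elt H (weighted_cones (LD C) H W B) L c"
  using universal_elt_of_equivalence[OF HC(1)] assms unfolding is_bilim_def by blast
 from universal_cone_of_elt[OF this] show ?thesis by blast
qed

end

section \<open>The simplex categories\<close>

declare One_nat_def [simp del]

abbreviation (input) "DA \<equiv> Simplex_aug"

lemma Simplex_aug_simps [simp]:
 "Ob DA = UNIV" "(m, n, ph)\<in>Ar DA \<longleftrightarrow> ph\<in>{..<m} \<rightarrow>\<^sub>E {..<n} \<and> mono_on {..<m} ph"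
 "Dom DA = fst" "Cod DA = fst \<circ> snd" "Id DA n = (n, n, \<lambda>i\<in>{..<n}. i)"
 "(m', n, ps)\<cdot>\<^bsub>DA\<^esub>(l, m, ph) = (l, n, compose {..<l} ps ph)"
 by (simp_all add: Simplex_aug_def)

lemma category_Simplex_aug [simp]: "category DA"
proof (rule categoryI)
 fix f g assume h: "f\<in>Ar DA" "g\<in>Ar DA" "Cod DA f = Dom DA g"
 obtain l m ph where f: "f = (l, m, ph)" by (cases f) auto
 obtain m' n ps where g: "g = (m', n, ps)" by (cases g) auto
 show "g\<cdot>\<^bsub>DA\<^esub>f\<in>Ar DA \<and> Dom DA (g\<cdot>\<^bsub>DA\<^esub>f) = Dom DA f \<and>
   Cod DA (g\<cdot>\<^bsub>DA\<^esub>f) = Cod DA g"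
  using h unfolding f g by (auto simp: compose_def mono_on_def PiE_iff Pi_iff)
next
 fix f g h assume a: "f\<in>Ar DA" "g\<in>Ar DA" "h\<in>Ar DA" "Cod DA f = Dom DA g" "Cod DA g = Dom DA h"
 obtain l m ph where f: "f = (l, m, ph)" by (cases f) auto
 obtain m' n ps where g: "g = (m', n, ps)" by (cases g) auto
 obtain n' k ch where h: "h = (n', k, ch)" by (cases h) auto
 show "(h\<cdot>\<^bsub>DA\<^esub>g)\<cdot>\<^bsub>DA\<^esub>f = h\<cdot>\<^bsub>DA\<^esub>(g\<cdot>\<^bsub>DA\<^esub>f)"
  using a unfolding f g h by (auto simp: compose_def PiE_iff Pi_iff fun_eq_iff)
next
 fix f assume a: "f\<in>Ar DA"
 obtain l m ph where f: "f = (l, m, ph)" by (cases f) auto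
 show "f\<cdot>\<^bsub>DA\<^esub>Id DA (Dom DA f) = f \<and> Id DA (Cod DA f)\<cdot>\<^bsub>DA\<^esub>f = f"
  using a unfolding f by (auto simp: compose_def PiE_iff Pi_iff fun_eq_iff extensional_def)
qed (auto simp: mono_on_def)

lemma full_subcat_simps [simp]:
 "Ob (full_subcat C S) = Ob C \<inter> S" "Ar (full_subcat C S) = {f\<in>Ar C. Dom C f\<in>S \<and> Cod C f\<in>S}"
 "Dom (full_subcat C S) = Dom C" "Cod (full_subcat C S) = Cod C" "Id (full_subcat C S) = Id C" "Comp (full_subcat C S) = Comp C"
 by (simp_all add: full_subcat_def)

lemma category_full_subcat [simp]: "category C ==> category (full_subcat C S)"
 by (rule categoryI) auto

lemma Simplex_simps:
 "Ob Simplex = {1..}" "Ar Simplex = {f\<in>Ar DA. 1 \<le> fst f \<and> 1 \<le> fst (snd f)}" "Dom Simplex = fst" "Cod Simplex = fst \<circ> snd"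
 "Id Simplex = Id DA" "Comp Simplex = Comp DA"
 by (auto simp: Simplex_def)

lemma category_Simplex [simp]: "category Simplex"
 by (simp add: Simplex_def)

text \<open>A map out of a nonempty ordinal has a nonempty target, so the bound on the codomain
  follows from that on the domain.\<close>

lemma Simplex_arI:
 assumes "!!i. i < m ==> ph i < n" "!!i j. i \<le> j ==> j < m ==> ph i \<le> ph j" "!!i. \<not> i < m ==> ph i = undefined" "1 \<le> m"
 shows "(m, n, ph)\<in>Ar Simplex"
proof -
 have "ph 0 < n" using assms(1)[of 0] assms(4) by simp
 then have "1 \<le> n" by simp
 then show ?thesis using assms by (auto simp: Simplex_simps PiE_iff extensional_def mono_on_def)
qed

section \<open>Categories given by generators and relations\<close>

lemma is_path_V: "is_path V E s t a p b ==> a\<in>V \<and> b\<in>V"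
 by (induction p arbitrary: a) auto

lemma is_path_append: "is_path V E s t a (p @ q) c \<longleftrightarrow> (\<exists>b. is_path V E s t a p b \<and> is_path V E s t b q c)"
 by (induction p arbitrary: a) (auto dest: is_path_V)

context
 fixes V :: "'v set" and E :: "'e set" and s t :: "'e => 'v" and R :: "('e list \<times> 'e list) set"
begin

abbreviation "ppath \<equiv> is_path V E s t"
abbreviation "pcong \<equiv> path_cong V E s t R"
abbreviation "Pres \<equiv> presented V E s t R"

lemma path_cong_path: "pcong a b p q ==> ppath a p b \<and> ppath a q b"
 by (induction rule: path_cong.induct) (auto simp: is_path_append)

definition "cls a b p = {q. pcong a b p q}"

lemma cls_eq: "pcong a b p q ==> cls a b p = cls a b q"
 unfolding cls_def by (auto intro: path_cong.trans path_cong.sym)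

lemma cls_self: "ppath a p b ==> p\<in>cls a b p"
 unfolding cls_def by (simp add: path_cong.refl)

lemma presented_simps: "Ob Pres = V" "Ar Pres = {(a, b, cls a b p) |a b p. ppath a p b}" "Dom Pres = fst" "Cod Pres = fst \<circ> snd"
 "Id Pres a = (a, a, cls a a [])"
 by (simp_all add: presented_def cls_def)

text \<open>The congruence is closed under concatenation, so composition may be computed on
  representatives.\<close>

lemma presented_comp:
 assumes "ppath a p b" "ppath b q c"
 shows "(b, c, cls b c q)\<cdot>\<^bsub>Pres\<^esub>(a, b, cls a b p) = (a, c, cls a c (p @ q))"
proof -
 have "{r. \<exists>p'\<in>cls a b p. \<exists>q'\<in>cls b c q. pcong a c (p' @ q') r} = cls a c (p @ q)"
 proof (intro equalityI subsetI)
  fix r assume "r\<in>{r. \<exists>p'\<in>cls a b p. \<exists>q'\<in>cls b c q. pcong a c (p' @ q') r}"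
  then obtain p' q' where "pcong a b p p'" "pcong b c q q'" "pcong a c (p' @ q') r" by (auto simp: cls_def)
  then show "r\<in>cls a c (p @ q)" unfolding cls_def using path_cong.trans[OF path_cong.append] by simp
 next
  fix r assume "r\<in>cls a c (p @ q)"
  then show "r\<in>{r. \<exists>p'\<in>cls a b p. \<exists>q'\<in>cls b c q. pcong a c (p' @ q') r}"
   using cls_self[OF assms(1)] cls_self[OF assms(2)] by (auto simp: cls_def)
 qed
 then show ?thesis by (simp add: presented_def)
qed

lemma category_presented: "category Pres"
proof (rule categoryI)
 fix f assume "f\<in>Ar Pres"
 then obtain a b p where f: "f = (a, b, cls a b p)" "ppath a p b" by (auto simp: presented_simps)
 show "Dom Pres f\<in>Ob Pres \<and> Cod Pres f\<in>Ob Pres" using is_path_V[OF f(2)] f by (simp add: presented_simps)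
 have i: "ppath a [] a" "ppath b [] b" using is_path_V[OF f(2)] by simp_all
 show "f\<cdot>\<^bsub>Pres\<^esub>Id Pres (Dom Pres f) = f \<and> Id Pres (Cod Pres f)\<cdot>\<^bsub>Pres\<^esub>f = f"
  using presented_comp[OF i(1) f(2)] presented_comp[OF f(2) i(2)] f by (simp add: presented_simps)
next
 fix a assume "a\<in>Ob Pres"
 then have "ppath a [] a" by (simp add: presented_simps)
 then show "Id Pres a\<in>Ar Pres \<and> Dom Pres (Id Pres a) = a \<and> Cod Pres (Id Pres a) = a" by (auto simp: presented_simps)
next
 fix f g assume h: "f\<in>Ar Pres" "g\<in>Ar Pres" "Cod Pres f = Dom Pres g"
 obtain a b p where f: "f = (a, b, cls a b p)" "ppath a p b" using h by (auto simp: presented_simps)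
 obtain c q where g: "g = (b, c, cls b c q)" "ppath b q c" using h f by (auto simp: presented_simps)
 have "ppath a (p @ q) c" using f g by (auto simp: is_path_append)
 then show "g\<cdot>\<^bsub>Pres\<^esub>f\<in>Ar Pres \<and> Dom Pres (g\<cdot>\<^bsub>Pres\<^esub>f) = Dom Pres f \<and> Cod Pres (g\<cdot>\<^bsub>Pres\<^esub>f) = Cod Pres g"
  using presented_comp[OF f(2) g(2)] f g by (auto simp: presented_simps)
next
 fix f g k assume h: "f\<in>Ar Pres" "g\<in>Ar Pres" "k\<in>Ar Pres" "Cod Pres f = Dom Pres g" "Cod Pres g = Dom Pres k"
 obtain a b p where f: "f = (a, b, cls a b p)" "ppath a p b" using h by (auto simp: presented_simps)
 obtain c q where g: "g = (b, c, cls b c q)" "ppath b q c" using h f by (auto simp: presented_simps)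
 obtain d r where k: "k = (c, d, cls c d r)" "ppath c r d" using h g by (auto simp: presented_simps)
 have "ppath a (p @ q) c" "ppath b (q @ r) d" using f g k by (auto simp: is_path_append)
 then show "(k\<cdot>\<^bsub>Pres\<^esub>g)\<cdot>\<^bsub>Pres\<^esub>f = k\<cdot>\<^bsub>Pres\<^esub>(g\<cdot>\<^bsub>Pres\<^esub>f)"
  using presented_comp f g k by simp
qed

end

section \<open>The category \<open>Simplex3\<close>\<close>

abbreviation "gens3 \<equiv> {Face1 0, Face1 1, Degen1, Face2 0, Face2 1, Face2 2}"

abbreviation "rels3 \<equiv> {([Face1 i, Face2 k], [Face1 (k - 1), Face2 i]) |i k. i < k \<and> k \<le> 2} \<union> {([Face1 0, Degen1], []), ([Face1 1, Degen1], [])}"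

abbreviation "path3 \<equiv> is_path {1, 2, 3} gens3 gen3_src gen3_tgt"

abbreviation "cls3 \<equiv> cls {1, 2, 3} gens3 gen3_src gen3_tgt rels3"

text \<open>Evaluation starts from an arbitrary arrow \<open>ph\<close> and not from an identity, so
  that a concatenated path is evaluated by continuing from the value of its first part.\<close>

definition ev3 :: "gen3 list => omap => omap" where
 "ev3 p ph = fold (\<lambda>e ph. gen3_map e\<cdot>\<^bsub>Simplex\<^esub>ph) p ph"

definition gen_arr :: "gen3 => nat \<times> nat \<times> gen3 list set" where
 "gen_arr e = (gen3_src e, gen3_tgt e, cls3 (gen3_src e) (gen3_tgt e) [e])"

lemma category_Simplex3 [simp]: "category Simplex3"
 unfolding Simplex3_def by (rule category_presented)

lemma Simplex3_simps: "Ob Simplex3 = {1, 2, 3}" "Ar Simplex3 = {(a, b, cls3 a b p) |a b p. path3 a p b}"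
 "Dom Simplex3 = fst" "Cod Simplex3 = fst \<circ> snd" "Id Simplex3 a = (a, a, cls3 a a [])"
 unfolding Simplex3_def by (rule presented_simps)+

lemma Simplex3_arE:
 assumes "f\<in>Ar Simplex3" obtains a b p where "f = (a, b, cls3 a b p)" "path3 a p b"
 using assms[unfolded Simplex3_simps(2)] by (elim CollectE exE conjE) (rule that)

lemma coface_ar: "1 \<le> n ==> coface n i\<in>Ar Simplex" "Dom Simplex (coface n i) = n" "Cod Simplex (coface n i) = n + 1"
 unfolding coface_def by (auto intro!: Simplex_arI simp: Simplex_simps(3,4))

lemma codegen_ar: "1 \<le> n ==> i < n ==> codegen n i\<in>Ar Simplex" "Dom Simplex (codegen n i) = n + 1" "Cod Simplex (codegen n i) = n"
 unfolding codegen_def by (auto intro!: Simplex_arI simp: Simplex_simps(3,4))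

lemma gen3_map_ar:
 assumes "e\<in>gens3"
 shows "gen3_map e\<in>Ar Simplex" "Dom Simplex (gen3_map e) = gen3_src e" "Cod Simplex (gen3_map e) = gen3_tgt e"
 using assms by (auto simp: coface_ar codegen_ar)

lemma gen3_relations:
 "i < k ==> k \<le> 2 ==> coface 2 k\<cdot>\<^bsub>Simplex\<^esub>coface 1 i = coface 2 i\<cdot>\<^bsub>Simplex\<^esub>coface 1 (k - 1)"
 "codegen 1 0\<cdot>\<^bsub>Simplex\<^esub>coface 1 0 = Id Simplex 1" "codegen 1 0\<cdot>\<^bsub>Simplex\<^esub>coface 1 1 = Id Simplex 1"
 by (auto simp: Simplex_simps coface_def codegen_def compose_def fun_eq_iff)

lemma ev3_ar:
 assumes "path3 a p b" "ph\<in>Ar Simplex" "Cod Simplex ph = a"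
 shows "ev3 p ph\<in>Ar Simplex \<and> Dom Simplex (ev3 p ph) = Dom Simplex ph \<and> Cod Simplex (ev3 p ph) = b"
 using assms
proof (induction p arbitrary: a ph)
 case (Cons e p)
 have e: "e\<in>gens3" "gen3_src e = a" "path3 (gen3_tgt e) p b" using Cons.prems(1) by simp_all
 note g = gen3_map_ar[OF e(1)]
 have c: "gen3_map e\<cdot>\<^bsub>Simplex\<^esub>ph\<in>Ar Simplex" "Dom Simplex (gen3_map e\<cdot>\<^bsub>Simplex\<^esub>ph) = Dom Simplex ph"
  "Cod Simplex (gen3_map e\<cdot>\<^bsub>Simplex\<^esub>ph) = gen3_tgt e"
  using cat_comp[OF category_Simplex Cons.prems(2) g(1)] g e Cons.prems(3) by simp_all
 show ?case using Cons.IH[OF e(3) c(1,3)] c(2) by (simp add: ev3_def)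
qed (simp add: ev3_def)

lemma ev3_append: "ev3 (p @ q) ph = ev3 q (ev3 p ph)"
 by (simp add: ev3_def)

text \<open>The cofaces and the codegeneracy satisfy the defining relations. In the concatenation
  case the second path starts from the value of the first, which is why \<open>ph\<close> is
  arbitrary in the induction.\<close>

lemma ev3_cong:
 assumes "path_cong {1, 2, 3} gens3 gen3_src gen3_tgt rels3 a b p q"
 shows "ph\<in>Ar Simplex ==> Cod Simplex ph = a ==> ev3 p ph = ev3 q ph"
 using assms
proof (induction arbitrary: ph rule: path_cong.induct)
 case (rel p q a b)
 consider i k where "p = [Face1 i, Face2 k]" "q = [Face1 (k - 1), Face2 i]" "i < k" "k \<le> 2"
  | j where "p = [Face1 j, Degen1]" "q = []" "j = 0 \<or> j = 1"
  using rel(1) by blast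
 then show ?case
 proof cases
  case 1
  have a: "Cod Simplex ph = 1" using rel(2,5) 1 by simp
  have "(coface 2 k\<cdot>\<^bsub>Simplex\<^esub>coface 1 i)\<cdot>\<^bsub>Simplex\<^esub>ph = (coface 2 i\<cdot>\<^bsub>Simplex\<^esub>coface 1 (k - 1))\<cdot>\<^bsub>Simplex\<^esub>ph"
   using gen3_relations(1)[OF 1(3,4)] by simp
  then show ?thesis using cat_assoc[OF category_Simplex rel(4)] a coface_ar 1 by (simp add: ev3_def)
 next
  case 2
  have a: "Cod Simplex ph = 1" using rel(2,5) 2 by simp
  have "(codegen 1 0\<cdot>\<^bsub>Simplex\<^esub>coface 1 j)\<cdot>\<^bsub>Simplex\<^esub>ph = Id Simplex 1\<cdot>\<^bsub>Simplex\<^esub>ph"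
   using gen3_relations(2,3) 2(3) by auto
  then show ?thesis using cat_assoc[OF category_Simplex rel(4), of "coface 1 j" "codegen 1 0"] a coface_ar[of 1 j] codegen_ar[of 1 0] 2 rel(4)
   by (simp add: ev3_def)
 qed
next
 case (append a b p p' c q q')
 have "ppath {1, 2, 3} gens3 gen3_src gen3_tgt a p b" using path_cong_path[OF append(1)] by simp
 from ev3_ar[OF this append(5,6)] have "ev3 q (ev3 p ph) = ev3 q' (ev3 p ph)" using append(4) by simp
 then show ?case using append(3)[OF append(5,6)] by (simp add: ev3_append)
qed simp_all

text \<open>The representative picked in \<open>t3_arr\<close> is congruent to \<open>p\<close>, and
  evaluation respects the congruence.\<close>

lemma t3_arr_cls: assumes "path3 a p b" shows "t3_arr (a, b, cls3 a b p) = ev3 p (Id Simplex a)"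
proof -
 let ?q = "SOME q. q\<in>cls3 a b p"
 have "?q\<in>cls3 a b p" using cls_self[OF assms] by (rule someI)
 then have "path_cong {1, 2, 3} gens3 gen3_src gen3_tgt rels3 a b p ?q" unfolding cls_def by simp
 moreover have "a\<in>Ob Simplex" using is_path_V[OF assms] by (auto simp: Simplex_simps)
 ultimately have "ev3 p (Id Simplex a) = ev3 ?q (Id Simplex a)" by (intro ev3_cong) simp_all
 then show ?thesis by (simp add: t3_arr_def ev3_def)
qed

text \<open>This turns the evaluation of a concatenated path into a composite of evaluations, the
  functor law of \<open>t3_arr\<close>.\<close>

lemma ev3_id: assumes "path3 a p b" "ph\<in>Ar Simplex" "Cod Simplex ph = a" shows "ev3 p ph = ev3 p (Id Simplex a)\<cdot>\<^bsub>Simplex\<^esub>ph"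
 using assms
proof (induction p arbitrary: b rule: rev_induct)
 case Nil
 then show ?case by (simp add: ev3_def)
next
 case (snoc e p)
 then obtain c where c: "path3 a p c" "e\<in>gens3" "gen3_src e = c" by (auto simp: is_path_append)
 have a: "a\<in>Ob Simplex" using snoc.prems(2,3) cat_ob(2)[OF category_Simplex snoc.prems(2)] by simp
 note g = gen3_map_ar[OF c(2)]
 have i: "Id Simplex a\<in>Ar Simplex" "Cod Simplex (Id Simplex a) = a" "Dom Simplex (Id Simplex a) = a" using cat_id[OF category_Simplex a] by simp_all
 note v = ev3_ar[OF c(1) i(1,2)]
 have "gen3_map e\<cdot>\<^bsub>Simplex\<^esub>(ev3 p (Id Simplex a)\<cdot>\<^bsub>Simplex\<^esub>ph) = (gen3_map e\<cdot>\<^bsub>Simplex\<^esub>ev3 p (Id Simplex a))\<cdot>\<^bsub>Simplex\<^esub>ph"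
  using cat_assoc[OF category_Simplex snoc.prems(2), of "ev3 p (Id Simplex a)" "gen3_map e"] v g c i snoc.prems(3) by simp
 then show ?case using snoc.IH[OF c(1) snoc.prems(2,3)] by (simp add: ev3_def)
qed

lemma t3_functor:
 "a\<in>Ob Simplex3 ==> a\<in>Ob Simplex"
 "f\<in>Ar Simplex3 ==> t3_arr f\<in>Ar Simplex \<and> Dom Simplex (t3_arr f) = Dom Simplex3 f \<and> Cod Simplex (t3_arr f) = Cod Simplex3 f"
 "a\<in>Ob Simplex3 ==> t3_arr (Id Simplex3 a) = Id Simplex a"
 "f\<in>Ar Simplex3 ==> g\<in>Ar Simplex3 ==> Cod Simplex3 f = Dom Simplex3 g ==> t3_arr (g\<cdot>\<^bsub>Simplex3\<^esub>f) = t3_arr g\<cdot>\<^bsub>Simplex\<^esub>t3_arr f"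
proof -
 show o: "a\<in>Ob Simplex3 ==> a\<in>Ob Simplex" for a by (auto simp: Simplex3_simps Simplex_simps)
 have i: "Id Simplex a\<in>Ar Simplex" "Cod Simplex (Id Simplex a) = a" "Dom Simplex (Id Simplex a) = a" if "path3 a p b" for a p b
 proof -
  have "a\<in>Ob Simplex" using is_path_V[OF that] by (auto simp: Simplex_simps)
  from cat_id[OF category_Simplex this] show "Id Simplex a\<in>Ar Simplex" "Cod Simplex (Id Simplex a) = a" "Dom Simplex (Id Simplex a) = a" by simp_all
 qed
 show t: "t3_arr f\<in>Ar Simplex \<and> Dom Simplex (t3_arr f) = Dom Simplex3 f \<and> Cod Simplex (t3_arr f) = Cod Simplex3 f" if fa: "f\<in>Ar Simplex3" for f
 proof -
  obtain a b p where f: "f = (a, b, cls3 a b p)" "path3 a p b" by (rule Simplex3_arE[OF fa])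
  show ?thesis using ev3_ar[OF f(2) i(1,2)[OF f(2)]] i(3)[OF f(2)] t3_arr_cls[OF f(2)] f(1) by (simp add: Simplex3_simps)
 qed
 show "a\<in>Ob Simplex3 ==> t3_arr (Id Simplex3 a) = Id Simplex a"
  using t3_arr_cls[of a "[]" a] by (auto simp: Simplex3_simps ev3_def)
 assume h: "f\<in>Ar Simplex3" "g\<in>Ar Simplex3" "Cod Simplex3 f = Dom Simplex3 g"
 obtain a b p where f: "f = (a, b, cls3 a b p)" "path3 a p b" by (rule Simplex3_arE[OF h(1)])
 obtain b' c q where g': "g = (b', c, cls3 b' c q)" "path3 b' q c" by (rule Simplex3_arE[OF h(2)])
 have "b' = b" using h(3) f(1) g'(1) by (simp add: Simplex3_simps(3,4))
 note g = g'[unfolded this]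
 have pq: "path3 a (p @ q) c" using f g by (auto simp: is_path_append)
 have "g\<cdot>\<^bsub>Simplex3\<^esub>f = (a, c, cls3 a c (p @ q))" unfolding f g Simplex3_def by (rule presented_comp[OF f(2) g(2)])
 then have "t3_arr (g\<cdot>\<^bsub>Simplex3\<^esub>f) = ev3 q (ev3 p (Id Simplex a))" using t3_arr_cls[OF pq] by (simp add: ev3_append)
 also have "... = ev3 q (Id Simplex b)\<cdot>\<^bsub>Simplex\<^esub>ev3 p (Id Simplex a)"
  using ev3_id[OF g(2)] ev3_ar[OF f(2) i(1,2)[OF f(2)]] by simp
 finally show "t3_arr (g\<cdot>\<^bsub>Simplex3\<^esub>f) = t3_arr g\<cdot>\<^bsub>Simplex\<^esub>t3_arr f"
  using t3_arr_cls[OF f(2)] t3_arr_cls[OF g(2)] f g by simp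
qed

lemma gen_arr:
 assumes "e\<in>gens3"
 shows "gen_arr e\<in>Ar Simplex3" "Dom Simplex3 (gen_arr e) = gen3_src e" "Cod Simplex3 (gen_arr e) = gen3_tgt e" "t3_arr (gen_arr e) = gen3_map e"
proof -
 have p: "path3 (gen3_src e) [e] (gen3_tgt e)" using assms by auto
 show "gen_arr e\<in>Ar Simplex3" "Dom Simplex3 (gen_arr e) = gen3_src e" "Cod Simplex3 (gen_arr e) = gen3_tgt e"
  using p unfolding gen_arr_def Simplex3_simps by auto
 show "t3_arr (gen_arr e) = gen3_map e"
  using t3_arr_cls[OF p] gen3_map_ar[OF assms] by (simp add: gen_arr_def ev3_def)
qed

lemma gen_arr_relations:
 "i < k ==> k \<le> 2 ==> gen_arr (Face2 k)\<cdot>\<^bsub>Simplex3\<^esub>gen_arr (Face1 i) = gen_arr (Face2 i)\<cdot>\<^bsub>Simplex3\<^esub>gen_arr (Face1 (k - 1))"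
 "i < 2 ==> gen_arr Degen1\<cdot>\<^bsub>Simplex3\<^esub>gen_arr (Face1 i) = Id Simplex3 1"
proof -
 have comp: "gen_arr e'\<cdot>\<^bsub>Simplex3\<^esub>gen_arr e = (gen3_src e, gen3_tgt e', cls3 (gen3_src e) (gen3_tgt e') [e, e'])"
  if "e\<in>gens3" "e'\<in>gens3" "gen3_tgt e = gen3_src e'" for e e'
 proof -
  have "path3 (gen3_src e) [e] (gen3_src e')" "path3 (gen3_src e') [e'] (gen3_tgt e')" using that by auto
  from presented_comp[OF this, of rels3] show ?thesis using that(3) by (simp add: gen_arr_def Simplex3_def)
 qed
 show "gen_arr (Face2 k)\<cdot>\<^bsub>Simplex3\<^esub>gen_arr (Face1 i) = gen_arr (Face2 i)\<cdot>\<^bsub>Simplex3\<^esub>gen_arr (Face1 (k - 1))" if h: "i < k" "k \<le> 2"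
 proof -
  have e: "Face1 i\<in>gens3" "Face1 (k - 1)\<in>gens3" "Face2 i\<in>gens3" "Face2 k\<in>gens3" using h by auto
  have "path_cong {1, 2, 3} gens3 gen3_src gen3_tgt rels3 1 3 [Face1 i, Face2 k] [Face1 (k - 1), Face2 i]"
   by (rule path_cong.rel) (use h e in auto)
  from cls_eq[OF this] show ?thesis using comp[OF e(1,4)] comp[OF e(2,3)] by simp
 qed
 show "gen_arr Degen1\<cdot>\<^bsub>Simplex3\<^esub>gen_arr (Face1 i) = Id Simplex3 1" if h: "i < 2"
 proof -
  have i: "i = 0 \<or> i = 1" using h by auto
  have e: "Face1 i\<in>gens3" "Degen1\<in>gens3" using i by auto
  have "path_cong {1, 2, 3} gens3 gen3_src gen3_tgt rels3 1 1 [Face1 i, Degen1] []"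
   by (rule path_cong.rel) (use i in auto)
  from cls_eq[OF this] show ?thesis using comp[OF e] by (simp add: Simplex3_simps)
 qed
qed

text \<open>An arrow is the class of a path of generators, built up by appending edges at the end.
  This reduces naturality over Simplex3 to the six generators.\<close>

lemma Simplex3_induct [consumes 1, case_names id gen]:
 assumes "f\<in>Ar Simplex3" and "!!a. a\<in>Ob Simplex3 ==> P (Id Simplex3 a)"
  and "!!f e. f\<in>Ar Simplex3 ==> e\<in>gens3 ==> Cod Simplex3 f = gen3_src e ==> P f ==> P (gen_arr e\<cdot>\<^bsub>Simplex3\<^esub>f)"
 shows "P f"
proof -
 obtain a b p where f: "f = (a, b, cls3 a b p)" and p: "path3 a p b" by (rule Simplex3_arE[OF assms(1)])
 have "P (a, b, cls3 a b p)" using p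
 proof (induction p arbitrary: b rule: rev_induct)
  case Nil
  then show ?case using assms(2)[of a] by (auto simp: Simplex3_simps)
 next
  case (snoc e p)
  then obtain c where c: "path3 a p c" "e\<in>gens3" "gen3_src e = c" "gen3_tgt e = b" by (auto simp: is_path_append)
  have pe: "path3 c [e] b" using snoc.prems c by (auto simp: is_path_append)
  have "(a, c, cls3 a c p)\<in>Ar Simplex3" "Cod Simplex3 (a, c, cls3 a c p) = c" using c(1) unfolding Simplex3_simps by auto
  then have "P (gen_arr e\<cdot>\<^bsub>Simplex3\<^esub>(a, c, cls3 a c p))" using assms(3)[of "(a, c, cls3 a c p)" e] c snoc.IH[OF c(1)] by simp
  moreover have "gen_arr e\<cdot>\<^bsub>Simplex3\<^esub>(a, c, cls3 a c p) = (a, b, cls3 a b (p @ [e]))"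
   using presented_comp[OF c(1) pe, of rels3] c by (simp add: gen_arr_def Simplex3_def)
  ultimately show ?case by simp
 qed
 then show ?thesis using f by simp
qed

section \<open>The localizations of the ordinals\<close>

lemma ordinal_cat_simps [simp]: "Ob (ordinal_cat n) = {..<n}" "Ar (ordinal_cat n) = {(i, j). i \<le> j \<and> j < n}"
 "Dom (ordinal_cat n) = fst" "Cod (ordinal_cat n) = snd" "Id (ordinal_cat n) i = (i, i)" "(j', k)\<cdot>\<^bsub>ordinal_cat n\<^esub>(i, j) = (i, k)"
 by (simp_all add: ordinal_cat_def)

abbreviation "zedges n \<equiv> Fwd ` Ar (ordinal_cat n) \<union> Bwd ` Ar (ordinal_cat n)"

abbreviation "zpath n \<equiv> is_path {..<n} (zedges n) (case_zig fst snd) (case_zig snd fst)"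

abbreviation "zcong n \<equiv> path_cong {..<n} (zedges n) (case_zig fst snd) (case_zig snd fst) (loc_rels (ordinal_cat n) (Ar (ordinal_cat n)))"

text \<open>The ordinal has a least element, and every zigzag from \<open>a\<close> to
  \<open>b\<close> is congruent to the one that goes back from \<open>a\<close> to 0 and then
  forward to \<open>b\<close>.\<close>

lemma zcong_all:
 assumes "zpath n a p b" "zpath n a q b"
 shows "zcong n a b p q"
proof -
 let ?x = "ordinal_cat n"
 have rels: "zcong n i k [Fwd (i, j), Fwd (j, k)] [Fwd (i, k)]" "zcong n i i [Fwd (i, j), Bwd (i, j)] []" "zcong n j j [Bwd (i, j), Fwd (i, j)] []"
  if "i \<le> j" "j \<le> k" "k < n" for i j k
 proof -
  show "zcong n i k [Fwd (i, j), Fwd (j, k)] [Fwd (i, k)]"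
  proof (rule path_cong.rel)
   have "(i, j)\<in>Ar ?x" "(j, k)\<in>Ar ?x" "Cod ?x (i, j) = Dom ?x (j, k)"
    "(i, k) = (j, k)\<cdot>\<^bsub>ordinal_cat n\<^esub>(i, j)" using that by auto
   then show "([Fwd (i, j), Fwd (j, k)], [Fwd (i, k)])\<in>loc_rels ?x (Ar ?x)"
    unfolding loc_rels_def by blast
  qed (use that in auto)
  show "zcong n i i [Fwd (i, j), Bwd (i, j)] []"
   by (rule path_cong.rel) (use that in "auto simp: loc_rels_def")
  show "zcong n j j [Bwd (i, j), Fwd (i, j)] []"
   by (rule path_cong.rel) (use that in "auto simp: loc_rels_def")
 qed
 \<comment> \<open>Preceded by the arrow from 0, a path is absorbed edge by edge.\<close>
 have z: "zcong n 0 b (Fwd (0, a) # p) [Fwd (0, b)]" if "zpath n a p b" for a p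
  using that
 proof (induction p arbitrary: a)
  case Nil
  then show ?case by (auto intro!: path_cong.refl)
 next
  case (Cons e p)
  let ?c = "case_zig snd fst e"
  have c: "zpath n ?c p b" "a < n" using Cons.prems by simp_all
  then have cn: "?c < n" using is_path_V[OF c(1)] by simp
  have "zcong n 0 ?c [Fwd (0, a), e] [Fwd (0, ?c)]"
  proof (cases e)
   case (Fwd x)
   then obtain c where "e = Fwd (a, c)" "a \<le> c" "c < n" using Cons.prems by auto
   then show ?thesis using rels(1)[of 0 a c] by simp
  next
   case (Bwd x)
   then obtain c where e: "e = Bwd (c, a)" "c \<le> a" "a < n" using Cons.prems by auto
   \<comment> \<open>For a backward edge, the arrow from 0 to \<open>a\<close> is factored through
     \<open>c\<close>, and the second factor cancels.\<close>
   have "zpath n a [Bwd (c, a)] c" using e by auto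
   then have "zcong n 0 c ([Fwd (0, a)] @ [Bwd (c, a)]) ([Fwd (0, c), Fwd (c, a)] @ [Bwd (c, a)])"
    using e rels(1)[of 0 c a] by (intro path_cong.append[OF path_cong.sym path_cong.refl]) simp_all
   moreover have "zcong n 0 c ([Fwd (0, c)] @ [Fwd (c, a), Bwd (c, a)]) ([Fwd (0, c)] @ [])"
    using e rels(2)[of c a a] by (intro path_cong.append[OF path_cong.refl]) auto
   ultimately have "zcong n 0 c [Fwd (0, a), Bwd (c, a)] [Fwd (0, c)]"
    using path_cong.trans[of _ _ _ _ _ 0 c "[Fwd (0, a), Bwd (c, a)]" "[Fwd (0, c), Fwd (c, a), Bwd (c, a)]" "[Fwd (0, c)]"] by simp
   then show ?thesis using e by simp
  qed
  from path_cong.append[OF this path_cong.refl[OF c(1)]]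
  have "zcong n 0 b (Fwd (0, a) # e # p) (Fwd (0, ?c) # p)" by simp
  from path_cong.trans[OF this Cons.IH[OF c(1)]] show ?case .
 qed
 have an: "a < n" using is_path_V[OF assms(1)] by simp
 have k: "zcong n a b p [Bwd (0, a), Fwd (0, b)]" if "zpath n a p b" for p
 proof -
  have "zcong n a b ([Bwd (0, a), Fwd (0, a)] @ p) ([] @ p)"
   by (rule path_cong.append[OF _ path_cong.refl[OF that]]) (use rels(3)[of 0 a a] an in simp)
  moreover have "zcong n a b ([Bwd (0, a)] @ (Fwd (0, a) # p)) ([Bwd (0, a)] @ [Fwd (0, b)])"
   by (rule path_cong.append[OF path_cong.refl z[OF that]]) (use an in auto)
  ultimately show ?thesis
   using path_cong.trans[OF path_cong.sym, of _ _ _ _ _ a b "[Bwd (0, a), Fwd (0, a)] @ p" p "[Bwd (0, a), Fwd (0, b)]"] by simp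
 qed
 show ?thesis by (rule path_cong.trans[OF k[OF assms(1)] path_cong.sym[OF k[OF assms(2)]]])
qed

text \<open>The congruence class consists of all paths between the end points, as they are all
  congruent.\<close>

definition nab :: "nat => nat => nat => nabla_arr" where
 "nab n a b = (a, b, {q. zpath n a q b})"

lemma nabla_eq: "nabla n = presented {..<n} (zedges n) (case_zig fst snd) (case_zig snd fst) (loc_rels (ordinal_cat n) (Ar (ordinal_cat n)))"
 by (simp add: nabla_def localization_def)

lemma zcls: "zpath n a p b ==> cls {..<n} (zedges n) (case_zig fst snd) (case_zig snd fst) (loc_rels (ordinal_cat n) (Ar (ordinal_cat n))) a b p = {q. zpath n a q b}"
 unfolding cls_def
proof (rule Collect_cong)
 fix q assume p: "zpath n a p b"
 show "zcong n a b p q = zpath n a q b"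
 proof
  show "zpath n a q b" if "zcong n a b p q" using path_cong_path[OF that] by simp
 qed (rule zcong_all[OF p])
qed

lemma zpath_ex: "a < n ==> b < n ==> zpath n a [Bwd (0, a), Fwd (0, b)] b"
 by auto

lemma category_nabla [simp]: "category (nabla n)"
 unfolding nabla_eq by (rule category_presented)

lemma nabla_simps [simp]: "Ob (nabla n) = {..<n}" "Ar (nabla n) = {nab n a b |a b. a < n \<and> b < n}" "Dom (nabla n) = fst" "Cod (nabla n) = fst \<circ> snd"
proof -
 let ?x = "loc_rels (ordinal_cat n) (Ar (ordinal_cat n))"
 show "Ob (nabla n) = {..<n}" "Dom (nabla n) = fst" "Cod (nabla n) = fst \<circ> snd" unfolding nabla_eq by (simp_all add: presented_simps)
 show "Ar (nabla n) = {nab n a b |a b. a < n \<and> b < n}"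
  unfolding nabla_eq presented_simps
 proof (intro equalityI subsetI)
  fix x assume "x\<in>{(a, b, cls {..<n} (zedges n) (case_zig fst snd) (case_zig snd fst) ?x a b p) |a b p. zpath n a p b}"
  then obtain a b p where "x = (a, b, cls {..<n} (zedges n) (case_zig fst snd) (case_zig snd fst) ?x a b p)" "zpath n a p b" by auto
  then have "x = nab n a b" "a < n" "b < n" using zcls[of n a p b] is_path_V[of "{..<n}" _ _ _ a p b] unfolding nab_def by simp_all
  then show "x\<in>{nab n a b |a b. a < n \<and> b < n}" by blast
 next
  fix x assume "x\<in>{nab n a b |a b. a < n \<and> b < n}"
  then obtain a b where x: "x = nab n a b" "a < n" "b < n" by blast
  note p = zpath_ex[OF x(2,3)]
  have "x = (a, b, cls {..<n} (zedges n) (case_zig fst snd) (case_zig snd fst) ?x a b [Bwd (0, a), Fwd (0, b)])"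
   unfolding zcls[OF p] x(1) nab_def ..
  then show "x\<in>{(a, b, cls {..<n} (zedges n) (case_zig fst snd) (case_zig snd fst) ?x a b p) |a b p. zpath n a p b}"
   using p by blast
 qed
qed

lemma nab_simps [simp]: "fst (nab n a b) = a" "fst (snd (nab n a b)) = b"
 by (simp_all add: nab_def)

lemma nabla_eqI: "f\<in>Ar (nabla n) ==> g\<in>Ar (nabla n) ==> fst f = fst g ==> fst (snd f) = fst (snd g) ==> f = g"
 by auto

lemma zpath_map:
 assumes "(m, n, ph)\<in>Ar Simplex" "zpath m a p b"
 shows "zpath n (ph a) (map (map_zig (restrict (map_prod ph ph) (Ar (ordinal_cat m)))) p) (ph b)"
 using assms(2)
proof (induction p arbitrary: a)
 case Nil
 then show ?case using assms(1) by (auto simp: Simplex_simps)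
next
 case (Cons e p)
 have lt: "ph i < n" if "i < m" for i using assms(1) that by (auto simp: Simplex_simps)
 have le: "ph i \<le> ph j" if "i \<le> j" "j < m" for i j using assms(1) that by (auto simp: Simplex_simps mono_on_def)
 show ?case
 proof (cases e)
  case (Fwd x)
  then obtain c where c: "e = Fwd (a, c)" "a \<le> c" "c < m" "zpath m c p b" using Cons.prems by auto
  then show ?thesis using Cons.IH[OF c(4)] lt le by (auto intro!: image_eqI)
 next
  case (Bwd x)
  then obtain c where c: "e = Bwd (c, a)" "c \<le> a" "a < m" "zpath m c p b" using Cons.prems by auto
  then show ?thesis using Cons.IH[OF c(4)] lt le by (auto intro!: image_eqI)
 qed
qed

text \<open>An arrow of the localization is determined by its end points, so the functor laws reduce
  to equations between end points.\<close>

lemma nabla_map: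
 assumes "(m, n, ph)\<in>Ar Simplex"
 shows "FDom (nabla_map (m, n, ph)) = nabla m" "FCod (nabla_map (m, n, ph)) = nabla n" "FOb (nabla_map (m, n, ph)) = ph"
  "a < m ==> b < m ==> FAr (nabla_map (m, n, ph)) (nab m a b) = nab n (ph a) (ph b)" "is_functor (nabla_map (m, n, ph))"
proof -
 let ?x = "ordinal_cat n"
 let ?F = "nabla_map (m, n, ph)"
 show s: "FDom ?F = nabla m" "FCod ?F = nabla n" "FOb ?F = ph"
  by (simp_all add: nabla_map_def localization_map_def ordinal_functor_def nabla_def)
 have lt: "ph i < n" if "i < m" for i using assms(1) that by (auto simp: Simplex_simps)
 show ar: "FAr ?F (nab m a b) = nab n (ph a) (ph b)" if ab: "a < m" "b < m" for a b
 proof -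
  let ?M = "map (map_zig (restrict (map_prod ph ph) (Ar (ordinal_cat m))))"
  have "nab m a b\<in>Ar (localization (ordinal_cat m) (Ar (ordinal_cat m)))"
   using ab unfolding nabla_def[symmetric] by auto
  then have "FAr ?F (nab m a b) = (ph a, ph b, {q. \<exists>p\<in>{q. zpath m a q b}. loc_cong ?x (Ar ?x) (ph a) (ph b) (?M p) q})"
   by (simp add: nabla_map_def localization_map_def ordinal_functor_def nab_def)
  also have "{q. \<exists>p\<in>{q. zpath m a q b}. loc_cong ?x (Ar ?x) (ph a) (ph b) (?M p) q} = {q. zpath n (ph a) q (ph b)}"
  proof (intro equalityI subsetI)
   fix q assume "q\<in>{q. \<exists>p\<in>{q. zpath m a q b}. loc_cong ?x (Ar ?x) (ph a) (ph b) (?M p) q}"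
   then obtain p where "zcong n (ph a) (ph b) (?M p) q" unfolding loc_cong_def by auto
   from path_cong_path[OF this] show "q\<in>{q. zpath n (ph a) q (ph b)}" by simp
  next
   fix q assume "q\<in>{q. zpath n (ph a) q (ph b)}"
   then have "zpath n (ph a) q (ph b)" by (rule CollectD)
   from zcong_all[OF zpath_map[OF assms zpath_ex[OF ab]] this]
   have "zcong n (ph a) (ph b) (?M [Bwd (0, a), Fwd (0, b)]) q" .
   moreover have "[Bwd (0, a), Fwd (0, b)]\<in>{q. zpath m a q b}" using zpath_ex[OF ab] by (rule CollectI)
   ultimately have "\<exists>p\<in>{q. zpath m a q b}. zcong n (ph a) (ph b) (?M p) q" by (rule bexI)
   then show "q\<in>{q. \<exists>p\<in>{q. zpath m a q b}. loc_cong ?x (Ar ?x) (ph a) (ph b) (?M p) q}"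
    unfolding loc_cong_def ordinal_cat_simps(1,3,4) by (rule CollectI)
  qed
  finally show ?thesis by (simp add: nab_def)
 qed
 show "is_functor ?F"
 proof (rule functorI)
  show "FOb ?F\<in>extensional (Ob (FDom ?F))" using assms s by (auto simp: Simplex_simps PiE_iff)
  show "FAr ?F\<in>extensional (Ar (FDom ?F))" unfolding s(1) by (simp add: nabla_map_def localization_map_def nabla_def ordinal_functor_def del: nabla_simps)
  show "FOb ?F a\<in>Ob (FCod ?F)" if "a\<in>Ob (FDom ?F)" for a using that s lt by simp
  show fa: "FAr ?F f\<in>Ar (FCod ?F) \<and> Dom (FCod ?F) (FAr ?F f) = FOb ?F (Dom (FDom ?F) f) \<and> Cod (FCod ?F) (FAr ?F f) = FOb ?F (Cod (FDom ?F) f)"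
   if fa: "f\<in>Ar (FDom ?F)" for f
  proof -
   obtain a b where f: "f = nab m a b" "a < m" "b < m" using fa s by auto
   have "nab n (ph a) (ph b)\<in>Ar (nabla n)" using lt f by auto
   then show ?thesis using f s ar[OF f(2,3)] by (simp del: nabla_simps(2))
  qed
  show "FAr ?F (Id (FDom ?F) a) = Id (FCod ?F) (FOb ?F a)" if a: "a\<in>Ob (FDom ?F)" for a
  proof (rule nabla_eqI)
   have i: "Id (nabla m) a\<in>Ar (nabla m)" "Dom (nabla m) (Id (nabla m) a) = a" "Cod (nabla m) (Id (nabla m) a) = a" "Id (nabla n) (ph a)\<in>Ar (nabla n)"
    "Dom (nabla n) (Id (nabla n) (ph a)) = ph a" "Cod (nabla n) (Id (nabla n) (ph a)) = ph a"
    using cat_id[OF category_nabla, of a m] cat_id[OF category_nabla, of "ph a" n] a s lt by (simp_all del: nabla_simps(2-4))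
   show "FAr ?F (Id (FDom ?F) a)\<in>Ar (nabla n)" "Id (FCod ?F) (FOb ?F a)\<in>Ar (nabla n)"
    "fst (FAr ?F (Id (FDom ?F) a)) = fst (Id (FCod ?F) (FOb ?F a))" "fst (snd (FAr ?F (Id (FDom ?F) a))) = fst (snd (Id (FCod ?F) (FOb ?F a)))"
    using fa[of "Id (FDom ?F) a"] i unfolding s nabla_simps(3,4) by (simp_all del: nabla_simps(2))
  qed
  show "FAr ?F (g\<cdot>\<^bsub>FDom ?F\<^esub>f) = FAr ?F g\<cdot>\<^bsub>FCod ?F\<^esub>FAr ?F f"
   if h: "f\<in>Ar (FDom ?F)" "g\<in>Ar (FDom ?F)" "Cod (FDom ?F) f = Dom (FDom ?F) g" for f g
  proof (rule nabla_eqI)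
   have c1: "g\<cdot>\<^bsub>FDom ?F\<^esub>f\<in>Ar (FDom ?F)" "Dom (FDom ?F) (g\<cdot>\<^bsub>FDom ?F\<^esub>f) = Dom (FDom ?F) f" "Cod (FDom ?F) (g\<cdot>\<^bsub>FDom ?F\<^esub>f) = Cod (FDom ?F) g"
    using cat_comp[OF _ h] s by simp_all
   have c2: "FAr ?F g\<cdot>\<^bsub>FCod ?F\<^esub>FAr ?F f\<in>Ar (FCod ?F)" "Dom (FCod ?F) (FAr ?F g\<cdot>\<^bsub>FCod ?F\<^esub>FAr ?F f) = Dom (FCod ?F) (FAr ?F f)"
    "Cod (FCod ?F) (FAr ?F g\<cdot>\<^bsub>FCod ?F\<^esub>FAr ?F f) = Cod (FCod ?F) (FAr ?F g)"
    using cat_comp[of "FCod ?F" "FAr ?F f" "FAr ?F g"] fa[OF h(1)] fa[OF h(2)] h(3) s(2) by (simp_all del: nabla_simps)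
   show "FAr ?F (g\<cdot>\<^bsub>FDom ?F\<^esub>f)\<in>Ar (nabla n)" "FAr ?F g\<cdot>\<^bsub>FCod ?F\<^esub>FAr ?F f\<in>Ar (nabla n)"
    using fa[OF c1(1)] c2(1) s(2) by (simp_all del: nabla_simps)
   show "fst (FAr ?F (g\<cdot>\<^bsub>FDom ?F\<^esub>f)) = fst (FAr ?F g\<cdot>\<^bsub>FCod ?F\<^esub>FAr ?F f)"
    "fst (snd (FAr ?F (g\<cdot>\<^bsub>FDom ?F\<^esub>f))) = fst (snd (FAr ?F g\<cdot>\<^bsub>FCod ?F\<^esub>FAr ?F f))"
    using fa[OF c1(1)] fa[OF h(1)] fa[OF h(2)] c1 c2 s by simp_all
  qed
 qed (simp_all add: s del: nabla_simps)
qed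

lemma nabla_map_comp:
 assumes "(l, m, ph)\<in>Ar Simplex" "(m, n, ps)\<in>Ar Simplex"
 shows "nabla_map (l, n, compose {..<l} ps ph) = nabla_map (m, n, ps) \<circ>\<^sub>F nabla_map (l, m, ph)"
proof (rule functor_eqI)
 have c: "(l, n, compose {..<l} ps ph)\<in>Ar Simplex"
  using cat_comp(1)[OF category_Simplex assms] by (simp add: Simplex_simps)
 note F = nabla_map[OF assms(1)] nabla_map[OF assms(2)] nabla_map[OF c]
 have lt: "ph i < m" if "i < l" for i using assms(1) that by (auto simp: Simplex_simps)
 show "is_functor (nabla_map (l, n, compose {..<l} ps ph))" "is_functor (nabla_map (m, n, ps) \<circ>\<^sub>F nabla_map (l, m, ph))"
  "FDom (nabla_map (l, n, compose {..<l} ps ph)) = FDom (nabla_map (m, n, ps) \<circ>\<^sub>F nabla_map (l, m, ph))"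
  "FCod (nabla_map (l, n, compose {..<l} ps ph)) = FCod (nabla_map (m, n, ps) \<circ>\<^sub>F nabla_map (l, m, ph))"
  using F by simp_all
 show "FOb (nabla_map (l, n, compose {..<l} ps ph)) a = FOb (nabla_map (m, n, ps) \<circ>\<^sub>F nabla_map (l, m, ph)) a"
  if "a\<in>Ob (FDom (nabla_map (l, n, compose {..<l} ps ph)))" for a using that F by (simp add: compose_def)
 show "FAr (nabla_map (l, n, compose {..<l} ps ph)) f = FAr (nabla_map (m, n, ps) \<circ>\<^sub>F nabla_map (l, m, ph)) f"
  if f: "f\<in>Ar (FDom (nabla_map (l, n, compose {..<l} ps ph)))" for f
 proof -
  obtain a b where ab: "f = nab l a b" "a < l" "b < l" using f F(11) by auto
  have "f\<in>Ar (nabla l)" using ab by auto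
  then show ?thesis using F lt ab by (simp add: compose_def del: nabla_simps)
 qed
qed

lemma nabla_map_id: assumes "1 \<le> n" shows "nabla_map (n, n, \<lambda>i\<in>{..<n}. i) = fid (nabla n)"
proof (rule functor_eqI)
 have c: "(n, n, \<lambda>i\<in>{..<n}. i)\<in>Ar Simplex" using assms by (intro Simplex_arI) auto
 note F = nabla_map[OF c]
 show "is_functor (nabla_map (n, n, \<lambda>i\<in>{..<n}. i))" "is_functor (fid (nabla n))" "FDom (nabla_map (n, n, \<lambda>i\<in>{..<n}. i)) = FDom (fid (nabla n))"
  "FCod (nabla_map (n, n, \<lambda>i\<in>{..<n}. i)) = FCod (fid (nabla n))" using F by simp_all
 show "FOb (nabla_map (n, n, \<lambda>i\<in>{..<n}. i)) a = FOb (fid (nabla n)) a" if "a\<in>Ob (FDom (nabla_map (n, n, \<lambda>i\<in>{..<n}. i)))" for a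
  using that F by simp
 show "FAr (nabla_map (n, n, \<lambda>i\<in>{..<n}. i)) f = FAr (fid (nabla n)) f" if f: "f\<in>Ar (FDom (nabla_map (n, n, \<lambda>i\<in>{..<n}. i)))" for f
 proof -
  obtain a b where "f = nab n a b" "a < n" "b < n" using f F(1) by auto
  moreover have "f\<in>Ar (nabla n)" using f F(1) by simp
  ultimately show ?thesis using F by (simp del: nabla_simps)
 qed
qed

lemma pseudofunctor_weight_W: "pseudofunctor (LD Simplex3) CAT weight_W"
 unfolding weight_W_def
proof (rule pseudofunctor_strict)
 let ?x = "LD Simplex3"
 have n: "FDom (nabla_map f) = nabla (Dom Simplex f)" "FCod (nabla_map f) = nabla (Cod Simplex f)" "is_functor (nabla_map f)" if "f\<in>Ar Simplex" for f
  using that nabla_map[of "fst f" "fst (snd f)" "snd (snd f)"] by (simp_all add: Simplex_simps(3,4))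
 have ncomp: "nabla_map (g\<cdot>\<^bsub>Simplex\<^esub>f) = nabla_map g \<circ>\<^sub>F nabla_map f" if "f\<in>Ar Simplex" "g\<in>Ar Simplex" "Cod Simplex f = Dom Simplex g" for f g
  using that nabla_map_comp[of "fst f" "fst (snd f)" "snd (snd f)" "fst (snd g)" "snd (snd g)"]
  by (cases f; cases g) (simp add: Simplex_simps(3,4,6))
 show "nabla_map (t3_arr f)\<in>Hom1 CAT (nabla (Src ?x f)) (nabla (Tgt ?x f))" if "f\<in>Arr ?x" for f
  using that t3_functor(2)[of f] n[of "t3_arr f"] by simp
 show "nid (nabla_map (t3_arr th))\<in>Hom2 CAT (nabla_map (t3_arr (Dm ?x th))) (nabla_map (t3_arr (Cd ?x th)))" if "th\<in>Cel ?x" for th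
  using that t3_functor(2)[of th] n[of "t3_arr th"] by simp
 show "nid (nabla_map (t3_arr (xi\<bullet>\<^bsub>LD Simplex3\<^esub>th))) = nid (nabla_map (t3_arr xi))\<bullet>\<^bsub>CAT\<^esub>nid (nabla_map (t3_arr th))"
  if "th\<in>Cel ?x" "xi\<in>Cel ?x" "Cd ?x th = Dm ?x xi" for th xi
  using that t3_functor(2)[of th] n[of "t3_arr th"] by simp
 show c: "nabla_map (t3_arr (g\<odot>\<^bsub>LD Simplex3\<^esub>f)) = nabla_map (t3_arr g)\<odot>\<^bsub>CAT\<^esub>nabla_map (t3_arr f)"
  if "f\<in>Arr ?x" "g\<in>Arr ?x" "Tgt ?x f = Src ?x g" for f g
  using that t3_functor(2)[of f] t3_functor(2)[of g] t3_functor(4)[of f g] ncomp[of "t3_arr f" "t3_arr g"] by simp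
 show "nid (nabla_map (t3_arr (xi\<star>\<^bsub>LD Simplex3\<^esub>th))) = nid (nabla_map (t3_arr xi))\<star>\<^bsub>CAT\<^esub>nid (nabla_map (t3_arr th))"
  if "th\<in>Cel ?x" "xi\<in>Cel ?x" "Tgt ?x (Dm ?x th) = Src ?x (Dm ?x xi)" for th xi
  using that c[of th xi] t3_functor(2)[of th] t3_functor(2)[of xi] n[of "t3_arr th"] n[of "t3_arr xi"] by simp
 show "nabla_map (t3_arr (One ?x X)) = One CAT (nabla X)" if "X\<in>Obj ?x" for X
  using that t3_functor(1,3)[of X] nabla_map_id[of X] by (simp add: Simplex_simps)
qed simp_all

lemma weight_W_ob [simp]: "a\<in>Ob Simplex3 ==> PO weight_W a = nabla a"
 by (simp add: weight_W_def)

text \<open>The ordinals 1, 2 and 3 are nonempty, and \<open>nab\<close> supplies the one arrow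
  between two elements.\<close>

lemma indiscrete_weight_W:
 assumes "two_category H" "pseudofunctor (LD Simplex3) H B"
 shows "indiscrete_weighted Simplex3 H weight_W B"
proof -
 interpret weighted Simplex3 H weight_W B
  using assms pseudofunctor_weight_W by (simp add: weighted_def)
 show ?thesis
 proof
  fix a assume a: "a\<in>Ob Simplex3"
  then have "1 \<le> a" by (auto simp: Simplex3_simps)
  then show "Ob (PO weight_W a) \<noteq> {}" using a by (auto simp: lessThan_empty_iff)
  fix x y assume "x\<in>Ob (PO weight_W a)" "y\<in>Ob (PO weight_W a)"
  then have "x < a" "y < a" using a by simp_all
  then show "\<exists>!m. m\<in>Hom (PO weight_W a) x y" using a by (intro ex1I[of _ "nab a x y"]) auto
 qed
qed

section \<open>Reindexing cones\<close>

locale cat_map = C: category C + D: category D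
 for C :: "('o, 'm) cat" and D :: "('q, 'n) cat" and fo :: "'o => 'q" and fa :: "'m => 'n" +
 assumes fo: "a\<in>Ob C ==> fo a\<in>Ob D"
  and fa: "f\<in>Ar C ==> fa f\<in>Ar D \<and> Dom D (fa f) = fo (Dom C f) \<and> Cod D (fa f) = fo (Cod C f)"
  and fid: "a\<in>Ob C ==> fa (Id C a) = Id D (fo a)"
  and fcomp: "f\<in>Ar C ==> g\<in>Ar C ==> Cod C f = Dom C g ==> fa (g\<cdot>\<^bsub>C\<^esub>f) = fa g\<cdot>\<^bsub>D\<^esub>fa f"
begin

lemma cats [simp]: "category C" "category D" by unfold_locales

lemma fa_simps [simp]: "f\<in>Ar C ==> fa f\<in>Ar D" "f\<in>Ar C ==> Dom D (fa f) = fo (Dom C f)" "f\<in>Ar C ==> Cod D (fa f) = fo (Cod C f)"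
 using fa by simp_all

lemmas [simp] = fo fid fcomp

abbreviation "J \<equiv> strict_psf (LD C) (LD D) fo fa fa"

lemma pseudofunctor_J: "pseudofunctor (LD C) (LD D) J"
 by (rule pseudofunctor_strict) simp_all

context
 fixes H :: "('p, 'b, 'd) twocat" and B :: "('q, 'n, 'n, 'p, 'b, 'd) psf"
 assumes H [simp]: "two_category H" and B: "pseudofunctor (LD D) H B"
begin

abbreviation "BJ \<equiv> psf_comp (LD C) H B J"

lemma pseudofunctor_BJ: "pseudofunctor (LD C) H BJ"
 by (rule pseudofunctor_comp[OF _ _ _ pseudofunctor_J B]) simp_all

text \<open>The constraints of \<open>J\<close> are identities, so those of \<open>B\<close> survive
  unchanged in the composite.\<close>

lemma BJ_simps [simp]: "a\<in>Ob C ==> PO BJ a = PO B (fo a)" "f\<in>Ar C ==> PA BJ f = PA B (fa f)" "f\<in>Ar C ==> PC BJ f = PC B (fa f)"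
 "a\<in>Ob C ==> PU BJ a = PU B (fo a)" "g\<in>Ar C ==> f\<in>Ar C ==> Cod C f = Dom C g ==> PM BJ g f = PM B (fa g) (fa f)"
proof -
 interpret B: pseudofunctor "LD D" H B by (rule B)
 have i: "PC B f = Idc H (PA B f)" if "f\<in>Ar D" for f using B.pc_idc[of f] that by simp
 show "a\<in>Ob C ==> PO BJ a = PO B (fo a)" "f\<in>Ar C ==> PA BJ f = PA B (fa f)" "f\<in>Ar C ==> PC BJ f = PC B (fa f)" by simp_all
 show "PU BJ a = PU B (fo a)" if "a\<in>Ob C" using that i[of "Id D (fo a)"] B.pu[of "fo a"] by simp
 show "PM BJ g f = PM B (fa g) (fa f)" if "g\<in>Ar C" "f\<in>Ar C" "Cod C f = Dom C g"
  using that i[of "fa g\<cdot>\<^bsub>D\<^esub>fa f"] B.pm[of "fa f" "fa g"] by simp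
qed

declare psf_comp_simps [simp del]

lemma pcone_reindex:
 assumes "pcone D H B X p P"
 shows "pcone C H BJ X (\<lambda>a. p (fo a)) (\<lambda>f. P (fa f))"
 unfolding pcone_def
proof (intro conjI ballI impI)
 note P = pconeD[OF assms]
 show "X\<in>Obj H" by (rule P)
 show "p (fo a)\<in>Hom1 H X (PO BJ a)" if "a\<in>Ob C" for a using P that by simp
 show "P (fa f)\<in>Hom2 H (PA BJ f\<odot>\<^bsub>H\<^esub>p (fo (Dom C f))) (p (fo (Cod C f)))" "inv_cell H (P (fa f))" if "f\<in>Ar C" for f using P that by simp_all
 show "P (fa (g\<cdot>\<^bsub>C\<^esub>f))\<bullet>\<^bsub>H\<^esub>(PM BJ g f\<star>\<^bsub>H\<^esub>Idc H (p (fo (Dom C f)))) = P (fa g)\<bullet>\<^bsub>H\<^esub>(Idc H (PA BJ g)\<star>\<^bsub>H\<^esub>P (fa f))"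
  if "f\<in>Ar C" "g\<in>Ar C" "Cod C f = Dom C g" for f g using pcone_comp[OF assms, of "fa f" "fa g"] that by simp
 show "P (fa (Id C a))\<bullet>\<^bsub>H\<^esub>(PU BJ a\<star>\<^bsub>H\<^esub>Idc H (p (fo a))) = Idc H (p (fo a))" if "a\<in>Ob C" for a
  using pcone_unit[OF assms, of "fo a"] that by simp
qed

lemma cone_mor_reindex:
 assumes "cone_mor D H B p P q Q gm"
 shows "cone_mor C H BJ (\<lambda>a. p (fo a)) (\<lambda>f. P (fa f)) (\<lambda>a. q (fo a)) (\<lambda>f. Q (fa f)) (\<lambda>a. gm (fo a))"
proof (rule cone_morI)
 note g = cone_morD[OF assms]
 show "gm (fo a)\<in>Cel H \<and> Dm H (gm (fo a)) = p (fo a) \<and> Cd H (gm (fo a)) = q (fo a)" if "a\<in>Ob C" for a using g that by simp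
 show "gm (fo (Cod C f))\<bullet>\<^bsub>H\<^esub>P (fa f) = Q (fa f)\<bullet>\<^bsub>H\<^esub>(Idc H (PA BJ f)\<star>\<^bsub>H\<^esub>gm (fo (Dom C f)))" if "f\<in>Ar C" for f
  using g(4)[of "fa f"] that by simp
qed

end

end

section \<open>Naturality squares\<close>

context diagram
begin

context
 fixes X p P q Q assumes p: "pcone C H B X p P" and q: "pcone C H B X q Q"
begin

text \<open>The condition on a cone map at a single arrow, isolated so that it can be propagated
  from some arrows to others before a cone map exists.\<close>

definition "sq f al be \<longleftrightarrow> be\<bullet>P f = Q f\<bullet>(Idc H (PA B f)\<star>al)"

text \<open>Squares over composable arrows paste, and the first one is invertible.\<close>

lemma sq_comp:
 assumes fg: "f\<in>Ar C" "g\<in>Ar C" "Cod C f = Dom C g"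
  and "al\<in>Cel H" "Dm H al = p (Dom C f)" "Cd H al = q (Dom C f)" "be\<in>Cel H" "Dm H be = p (Cod C f)" "Cd H be = q (Cod C f)"
   "gm\<in>Cel H" "Dm H gm = p (Cod C g)" "Cd H gm = q (Cod C g)"
  and s: "sq f al be"
 shows "sq (g\<cdot>\<^bsub>C\<^esub>f) al gm \<longleftrightarrow> sq g be gm"
proof -
 let ?x = "g\<cdot>\<^bsub>C\<^esub>f"
 let ?y = "Q g\<bullet>(Idc H (PA B g)\<star>be)"
 note [simp] = pconeD[OF p] pconeD[OF q] assms(1-12)
 let ?m = "PM B g f\<star>Idc H (p (Dom C f))" let ?n = "Idc H (PA B g)\<star>P f"
 \<comment> \<open>Pasting the invertible \<open>?m\<close> onto both sides of the composite square
   gives both sides of the square over \<open>g\<close> pasted with the invertible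
   \<open>?n\<close>; either cell can then be cancelled.\<close>
 have 1: "(gm\<bullet>P ?x)\<bullet>?m = (gm\<bullet>P g)\<bullet>?n" using pcone_comp[OF p fg] by simp
 have "(Q ?x\<bullet>(Idc H (PA B ?x)\<star>al))\<bullet>?m = (Q ?x\<bullet>(PM B g f\<star>Idc H (q (Dom C f))))\<bullet>(Idc H (PA B g\<odot>PA B f)\<star>al)"
  using tc_hc_whisker[OF HC2(1), of al "PM B g f"] by simp
 also have "... = Q g\<bullet>(Idc H (PA B g)\<star>(Q f\<bullet>(Idc H (PA B f)\<star>al)))" unfolding pcone_comp[OF q fg] by simp
 also have "... = ?y\<bullet>?n" unfolding s[unfolded sq_def, symmetric] by simp
 finally have 2: "(Q ?x\<bullet>(Idc H (PA B ?x)\<star>al))\<bullet>?m = ?y\<bullet>?n" .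
 show ?thesis
 proof
  assume "sq ?x al gm"
  then have "(gm\<bullet>P g)\<bullet>?n = ?y\<bullet>?n" unfolding sq_def 1[symmetric] 2[symmetric] by simp
  then show "sq g be gm" unfolding sq_def by - (rule vc_cancel_right[OF HC2(1), of ?n], simp_all)
 next
  assume "sq g be gm"
  then have "(gm\<bullet>P ?x)\<bullet>?m = (Q ?x\<bullet>(Idc H (PA B ?x)\<star>al))\<bullet>?m" unfolding sq_def 1 2 by simp
  then show "sq ?x al gm" unfolding sq_def by - (rule vc_cancel_right[OF HC2(1), of ?m], simp_all)
 qed
qed

text \<open>Both sides agree after pasting on the invertible unit constraint, where the unit axioms
  remove the cells of the two cones.\<close>

lemma sq_id:
 assumes "a\<in>Ob C" "al\<in>Cel H" "Dm H al = p a" "Cd H al = q a"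
 shows "sq (Id C a) al al"
proof -
 note [simp] = pconeD[OF p] pconeD[OF q] assms
 let ?u = "PU B a\<star>Idc H (p a)"
 have "(Q (Id C a)\<bullet>(Idc H (PA B (Id C a))\<star>al))\<bullet>?u = (Q (Id C a)\<bullet>(PU B a\<star>Idc H (q a)))\<bullet>al"
  using tc_hc_whisker[OF HC2(1), of al "PU B a"] by simp
 also have "... = al" unfolding pcone_unit[OF q assms(1)] by simp
 also have "... = (al\<bullet>P (Id C a))\<bullet>?u" using pcone_unit[OF p assms(1)] by simp
 finally show ?thesis unfolding sq_def by - (rule vc_cancel_right[OF HC2(1), of ?u], simp_all)
qed

end

end

section \<open>Points, edges and triangles\<close>

text \<open>Points, edges and triangles of \<open>n\<close> are the arrows from 1, 2 and 3: the
  elements of \<open>n\<close> as seen from Simplex3.\<close>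

definition "pt n i = (1::nat, n::nat, \<lambda>l\<in>{..<1::nat}. i::nat)"

definition "edge n i j = (2::nat, n::nat, \<lambda>l\<in>{..<2::nat}. if l = 0 then i else j::nat)"

definition "tri n i j k = (3::nat, n::nat, \<lambda>l\<in>{..<3::nat}. if l = 0 then i else if l = 1 then j else k::nat)"

lemma pt_ar [simp]: "i < n ==> pt n i\<in>Ar Simplex" "Dom Simplex (pt n i) = 1" "Cod Simplex (pt n i) = n"
 unfolding pt_def by (auto intro!: Simplex_arI split: if_splits simp: Simplex_simps(3,4))

lemma edge_ar [simp]: "i \<le> j ==> j < n ==> edge n i j\<in>Ar Simplex" "Dom Simplex (edge n i j) = 2" "Cod Simplex (edge n i j) = n"
 unfolding edge_def by (auto intro!: Simplex_arI split: if_splits simp: Simplex_simps(3,4))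

lemma tri_ar [simp]: "i \<le> j ==> j \<le> k ==> k < n ==> tri n i j k\<in>Ar Simplex" "Dom Simplex (tri n i j k) = 3" "Cod Simplex (tri n i j k) = n"
 unfolding tri_def by (auto intro!: Simplex_arI split: if_splits simp: Simplex_simps(3,4))

lemma less_2_3: "l < (2::nat) \<longleftrightarrow> l = 0 \<or> l = 1" "l < (3::nat) \<longleftrightarrow> l = 0 \<or> l = 1 \<or> l = 2"
 by auto

text \<open>\<open>coface 1 i\<close> omits \<open>i\<close>, so index 1 selects the first end point
  of an edge and index 0 the second. Likewise \<open>coface 2 k\<close> selects the edge opposite to
  the vertex \<open>k\<close>.\<close>

lemma face_comp:
 "edge n i j\<cdot>\<^bsub>Simplex\<^esub>coface 1 1 = pt n i" "edge n i j\<cdot>\<^bsub>Simplex\<^esub>coface 1 0 = pt n j"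
 "tri n i j k\<cdot>\<^bsub>Simplex\<^esub>coface 2 0 = edge n j k" "tri n i j k\<cdot>\<^bsub>Simplex\<^esub>coface 2 1 = edge n i k" "tri n i j k\<cdot>\<^bsub>Simplex\<^esub>coface 2 2 = edge n i j"
 "pt n i\<cdot>\<^bsub>Simplex\<^esub>codegen 1 0 = edge n i i"
 unfolding pt_def edge_def tri_def coface_def codegen_def
 by (auto simp: Simplex_simps compose_def fun_eq_iff less_2_3)

lemma comp_pt_edge:
 assumes "ph\<in>Ar Simplex" "Dom Simplex ph = m"
 shows "i < m ==> ph\<cdot>\<^bsub>Simplex\<^esub>pt m i = pt (Cod Simplex ph) (snd (snd ph) i)"
  "i < m ==> j < m ==> ph\<cdot>\<^bsub>Simplex\<^esub>edge m i j = edge (Cod Simplex ph) (snd (snd ph) i) (snd (snd ph) j)"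
 using assms unfolding pt_def edge_def by (cases ph; auto simp: Simplex_simps compose_def fun_eq_iff less_2_3)+

text \<open>In the low ordinals the identities and cofaces are themselves points and edges, which
  ties the generators of Simplex3 to the points and edges of 1, 2 and 3.\<close>

lemma special_pt_edge:
 "Id Simplex 1 = pt 1 0" "Id Simplex 2 = edge 2 0 1" "coface 1 1 = pt 2 0" "coface 1 0 = pt 2 1" "coface 2 2 = edge 3 0 1" "coface 2 0 = edge 3 1 2"
 unfolding pt_def edge_def coface_def by (auto simp: Simplex_simps fun_eq_iff less_2_3)

lemma Simplex_map_bound:
 assumes "ph\<in>Ar Simplex" "i \<le> j" "j < Dom Simplex ph"
 shows "snd (snd ph) i \<le> snd (snd ph) j" "snd (snd ph) j < Cod Simplex ph"
 using assms by (cases ph; auto simp: Simplex_simps mono_on_def)+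

lemma Simplex_dom_cod_pos: assumes "ph\<in>Ar Simplex" shows "0 < Dom Simplex ph" "0 < Cod Simplex ph"
 using assms by (auto simp: Simplex_simps)

section \<open>Cones over \<open>Simplex\<close> and over \<open>Simplex3\<close>\<close>

declare psf_comp_simps [simp del]

interpretation t3: cat_map Simplex3 Simplex "\<lambda>n. n" t3_arr
 using t3_functor by (intro cat_map.intro cat_map_axioms.intro category_Simplex3 category_Simplex) simp_all

lemma incl_t3_eq: "incl_t3 = t3.J"
 by (simp add: incl_t3_def)

abbreviation "D0 \<equiv> gen_arr (Face1 0)"
abbreviation "D1 \<equiv> gen_arr (Face1 1)"
abbreviation "S0 \<equiv> gen_arr Degen1"
abbreviation "E0 \<equiv> gen_arr (Face2 0)"
abbreviation "E1 \<equiv> gen_arr (Face2 1)"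
abbreviation "E2 \<equiv> gen_arr (Face2 2)"

lemma gens [simp]:
 "D0\<in>Ar Simplex3" "D1\<in>Ar Simplex3" "S0\<in>Ar Simplex3" "E0\<in>Ar Simplex3" "E1\<in>Ar Simplex3" "E2\<in>Ar Simplex3"
 "Dom Simplex3 D0 = 1" "Dom Simplex3 D1 = 1" "Dom Simplex3 S0 = 2" "Dom Simplex3 E0 = 2" "Dom Simplex3 E1 = 2" "Dom Simplex3 E2 = 2"
 "Cod Simplex3 D0 = 2" "Cod Simplex3 D1 = 2" "Cod Simplex3 S0 = 1" "Cod Simplex3 E0 = 3" "Cod Simplex3 E1 = 3" "Cod Simplex3 E2 = 3"
 "t3_arr D0 = coface 1 0" "t3_arr D1 = coface 1 1" "t3_arr S0 = codegen 1 0" "t3_arr E0 = coface 2 0" "t3_arr E1 = coface 2 1" "t3_arr E2 = coface 2 2"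
 using gen_arr[of "Face1 0"] gen_arr[of "Face1 1"] gen_arr[of Degen1] gen_arr[of "Face2 0"] gen_arr[of "Face2 1"] gen_arr[of "Face2 2"] by simp_all

lemma gens_relations:
 "S0\<cdot>\<^bsub>Simplex3\<^esub>D0 = Id Simplex3 1" "S0\<cdot>\<^bsub>Simplex3\<^esub>D1 = Id Simplex3 1"
 "E1\<cdot>\<^bsub>Simplex3\<^esub>D1 = E2\<cdot>\<^bsub>Simplex3\<^esub>D1" "E0\<cdot>\<^bsub>Simplex3\<^esub>D1 = E2\<cdot>\<^bsub>Simplex3\<^esub>D0" "E0\<cdot>\<^bsub>Simplex3\<^esub>D0 = E1\<cdot>\<^bsub>Simplex3\<^esub>D0"
 using gen_arr_relations(2)[of 0] gen_arr_relations(2)[of 1] gen_arr_relations(1)[of 1 2] gen_arr_relations(1)[of 0 2] gen_arr_relations(1)[of 0 1]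
 by (simp_all add: One_nat_def)

lemma Simplex3_ob [simp]: "1\<in>Ob Simplex3" "2\<in>Ob Simplex3" "3\<in>Ob Simplex3"
 by (auto simp: Simplex3_simps)

lemma Simplex_ob [simp]: "n\<in>Ob Simplex \<longleftrightarrow> 0 < n"
 by (auto simp: Simplex_simps)

locale simplex_diagram = diagram Simplex H A
 for H :: "('p, 'b, 'd) twocat" (structure) and A :: "(nat, omap, omap, 'p, 'b, 'd) psf"
begin

abbreviation "A3 \<equiv> psf_comp (LD Simplex3) H A incl_t3"

abbreviation compS (infixr "\<diamondop>" 70) where "g\<diamondop>f \<equiv> g\<cdot>\<^bsub>Simplex\<^esub>f"

lemmas A3_simps [simp] = t3.BJ_simps[OF HC2(1) B.pseudofunctor_axioms, folded incl_t3_eq]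

lemma A3_diagram: "diagram Simplex3 H A3"
 using t3.pseudofunctor_BJ[OF HC2(1) B.pseudofunctor_axioms, folded incl_t3_eq]
 by (simp add: diagram_def pseudofunctor_def)

interpretation A3: diagram Simplex3 H A3 by (rule A3_diagram)

lemmas A_simps = B.po_in B.arr B.pu B.pu_inv B.pm

text \<open>Squares paste along composites, and the six generators generate Simplex3.\<close>

lemma cone_mor_of_gens:
 assumes p: "pcone Simplex3 H A3 X p P" and q: "pcone Simplex3 H A3 X q Q"
  and g: "!!a. a\<in>Ob Simplex3 ==> gm a\<in>Cel H \<and> Dm H (gm a) = p a \<and> Cd H (gm a) = q a"
  and s: "!!e. e\<in>{D0, D1, S0, E0, E1, E2} ==> gm (Cod Simplex3 e)\<bullet>P e = Q e\<bullet>(Idc H (PA A (t3_arr e))\<star>gm (Dom Simplex3 e))"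
 shows "cone_mor Simplex3 H A3 p P q Q gm"
proof (rule cone_morI[OF g])
 fix f assume f: "f\<in>Ar Simplex3"
 then have "A3.sq P Q f (gm (Dom Simplex3 f)) (gm (Cod Simplex3 f))"
 proof (induction f rule: Simplex3_induct)
  case (id a)
  then show ?case using A3.sq_id[OF p q id, of "gm a"] g[OF id] by simp
 next
  case (gen f e)
  have e: "gen_arr e\<in>{D0, D1, S0, E0, E1, E2}" using gen(2) by auto
  note ge = gen_arr[OF gen(2)]
  have "A3.sq P Q (gen_arr e) (gm (Cod Simplex3 f)) (gm (gen3_tgt e))"
   using s[OF e] ge gen(3) unfolding A3.sq_def[OF p q] by simp
  moreover have "a\<in>Ob Simplex3" if "a\<in>{Dom Simplex3 f, Cod Simplex3 f, gen3_tgt e}" for a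
   using that gen(1) ge(1,3) cat_ob[OF category_Simplex3 gen(1)] cat_ob[OF category_Simplex3 ge(1)] by auto
  ultimately show ?case
   using A3.sq_comp[OF p q gen(1) ge(1), of "gm (Dom Simplex3 f)" "gm (Cod Simplex3 f)" "gm (gen3_tgt e)"] gen(1,3,4) ge g
   by simp
 qed
 then show "gm (Cod Simplex3 f)\<bullet>P f = Q f\<bullet>(Idc H (PA A3 f)\<star>gm (Dom Simplex3 f))"
  unfolding A3.sq_def[OF p q] .
qed

text \<open>A map of restricted cones extends: its component at \<open>n\<close> is forced by the square over the point \<open>0\<close> of \<open>n\<close>, and the edges
 give the squares over all other points.\<close>

lemma restricted_mor_extends:
 assumes p: "pcone Simplex H A X p P" and q: "pcone Simplex H A X q Q"
  and g: "cone_mor Simplex3 H A3 p (\<lambda>f. P (t3_arr f)) q (\<lambda>f. Q (t3_arr f)) gm"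
 shows "\<exists>de. cone_mor Simplex H A p P q Q de \<and> (\<forall>a\<in>Ob Simplex3. de a = gm a)"
proof -
 note [simp] = pconeD[OF p] pconeD[OF q] cone_morD(1-3)[OF g]
 note gs = cone_morD(4)[OF g]
 let ?sq = "sq P Q"
 \<comment> \<open>The square over the point 0 of \<open>n\<close>, solved for the component at
   \<open>n\<close>.\<close>
 define de where "de n = Q (pt n 0)\<bullet>(Idc H (PA A (pt n 0))\<star>gm 1)\<bullet>cinv H (P (pt n 0))" for n
 have d: "de n\<in>Cel H" "Dm H (de n) = p n" "Cd H (de n) = q n" if "0 < n" for n
  using that by (simp_all add: de_def A_simps)
 have s0: "?sq (pt n 0) (gm 1) (de n)" if "0 < n" for n
  using that unfolding sq_def[OF p q] by (simp add: de_def A_simps)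
 have s1: "?sq (coface 1 1) (gm 1) (gm 2)" "?sq (coface 1 0) (gm 1) (gm 2)"
  using gs[of D1] gs[of D0] unfolding sq_def[OF p q] by simp_all
 note c = coface_ar[of 1, simplified]
 have spt: "?sq (pt n i) (gm 1) (de n)" if "i < n" for i n
 proof -
  have e: "edge n 0 i\<in>Ar Simplex" using that by simp
  \<comment> \<open>The edge composed with its first face is the point 0, whose square holds.
    Cancelling gives the square over the edge, and pasting with the other face gives the one over
    the point \<open>i\<close>.\<close>
  have "?sq (edge n 0 i) (gm 2) (de n)"
   using sq_comp[OF p q c(1) e _ _ _ _ _ _ _ _ _ _ s1(1), of "de n"] that d s0[of n] c by (simp add: face_comp)
  then show ?thesis
   using sq_comp[OF p q c(1) e _ _ _ _ _ _ _ _ _ _ s1(2), of "de n"] that d s0[of n] c by (simp add: face_comp)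
 qed
 \<comment> \<open>\<open>f\<close> after the point 0 of its domain is some point of its codomain,
   whose square is known; the square over the point 0 is then cancelled.\<close>
 have sall: "?sq f (de (Dom Simplex f)) (de (Cod Simplex f))" if f: "f\<in>Ar Simplex" for f
 proof -
  note pos = Simplex_dom_cod_pos[OF f]
  show ?thesis
   using sq_comp[OF p q _ f _ _ _ _ _ _ _ _ _ _ s0[OF pos(1)], of "de (Cod Simplex f)"] d pos comp_pt_edge(1)[OF f HOL.refl pos(1)] spt Simplex_map_bound(2)[OF f _ pos(1)] f
   by simp
 qed
 have "cone_mor Simplex H A p P q Q de"
  by (rule cone_morI) (use d sall in "simp_all add: sq_def[OF p q]")
 moreover have "de a = gm a" if a: "a\<in>Ob Simplex3" for a
 proof -
  have g1: "gm a\<in>Cel H" "Dm H (gm a) = p a" "Cd H (gm a) = q a" "0 < a" using a t3.fo[OF a] by simp_all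
  \<comment> \<open>The points 0 of 1, 2 and 3 come from Simplex3, so \<open>gm a\<close> solves the
    equation that determines \<open>de a\<close>.\<close>
  have "?sq (pt a 0) (gm 1) (gm a)"
  proof -
   have "a = 1 \<or> a = 2 \<or> a = 3" using a by (simp add: Simplex3_simps)
   moreover have "?sq (pt 1 0) (gm 1) (gm 1)" using sq_id[OF p q, of 1 "gm 1"] by (simp add: special_pt_edge)
   moreover have "?sq (pt 2 0) (gm 1) (gm 2)" using s1(1) by (simp add: special_pt_edge)
   moreover have "?sq (pt 3 0) (gm 1) (gm 3)"
    using gs[of "E2\<cdot>\<^bsub>Simplex3\<^esub>D1"] face_comp(1)[of 3 0 1] unfolding sq_def[OF p q] by (simp add: special_pt_edge(5))
   ultimately show ?thesis by auto
  qed
  then have "gm a\<bullet>P (pt a 0) = de a\<bullet>P (pt a 0)" using s0[of a] g1 unfolding sq_def[OF p q] by simp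
  then show ?thesis using g1 d[of a] by - (rule vc_cancel_right[OF HC2(1), of "P (pt a 0)"], simp_all)
 qed
 ultimately show ?thesis by blast
qed

text \<open>In the square over the point 0 of \<open>n\<close> the cell \<open>P (pt n 0)\<close> is
  invertible, so the component at \<open>n\<close> is determined by that at 1.\<close>

lemma restricted_mor_unique:
 assumes p: "pcone Simplex H A X p P" and q: "pcone Simplex H A X q Q"
  and g: "cone_mor Simplex H A p P q Q gm" "cone_mor Simplex H A p P q Q de" and e: "gm 1 = de 1" and n: "0 < n"
 shows "gm n = de n"
proof -
 note [simp] = pconeD[OF p] pconeD[OF q] cone_morD(1-3)[OF g(1)] cone_morD(1-3)[OF g(2)]
 have "gm n\<bullet>P (pt n 0) = de n\<bullet>P (pt n 0)" using cone_morD(4)[OF g(1), of "pt n 0"] cone_morD(4)[OF g(2), of "pt n 0"] n e by simp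
 then show ?thesis using n by - (rule vc_cancel_right[OF HC2(1), of "P (pt n 0)"], simp_all)
qed

text \<open>For a cone \<open>Q\<close> over \<open>Simplex3\<close>, the cells \<open>M e h\<close> form a functor from the category of elements
 of \<open>Simplex (t3 -, N)\<close> to the category of 1-cells \<open>X \<rightarrow> A N\<close>, natural in \<open>N\<close>.\<close>

context
 fixes X q Q assumes q: "pcone Simplex3 H A3 X q Q"
begin

definition "M e h = (Idc H (PA A e)\<star>Q h)\<bullet>(cinv H (PM A e (t3_arr h))\<star>Idc H (q (Dom Simplex3 h)))"

lemma Q_simps: "X\<in>Obj H" "a\<in>Ob Simplex3 ==> q a\<in>Arr H" "a\<in>Ob Simplex3 ==> Src H (q a) = X" "a\<in>Ob Simplex3 ==> Tgt H (q a) = PO A a"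
 "h\<in>Ar Simplex3 ==> Q h\<in>Cel H" "h\<in>Ar Simplex3 ==> Dm H (Q h) = PA A (t3_arr h)\<odot>q (Dom Simplex3 h)" "h\<in>Ar Simplex3 ==> Cd H (Q h) = q (Cod Simplex3 h)"
 "h\<in>Ar Simplex3 ==> inv_cell H (Q h)"
 using pconeD[OF q] by simp_all

lemma Q_comp: "f\<in>Ar Simplex3 ==> g\<in>Ar Simplex3 ==> Cod Simplex3 f = Dom Simplex3 g ==>
  Q (g\<cdot>\<^bsub>Simplex3\<^esub>f)\<bullet>(PM A (t3_arr g) (t3_arr f)\<star>Idc H (q (Dom Simplex3 f))) = Q g\<bullet>(Idc H (PA A (t3_arr g))\<star>Q f)"
 using pcone_comp[OF q, of f g] by simp

lemma t3_pos: "a\<in>Ob Simplex3 ==> 0 < a" using t3.fo by simp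

text \<open>The last equation is the working description: along the constraint
  \<open>PM A e (t3_arr h)\<close>, the cell \<open>M e h\<close> is \<open>Q h\<close> whiskered
  with \<open>A e\<close>.\<close>

lemma M: assumes "e\<in>Ar Simplex" "h\<in>Ar Simplex3" "Dom Simplex e = Cod Simplex3 h"
 shows "M e h\<in>Cel H" "Dm H (M e h) = PA A (e\<diamondop>t3_arr h)\<odot>q (Dom Simplex3 h)" "Cd H (M e h) = PA A e\<odot>q (Cod Simplex3 h)"
  "inv_cell H (M e h)" "M e h\<bullet>(PM A e (t3_arr h)\<star>Idc H (q (Dom Simplex3 h))) = Idc H (PA A e)\<star>Q h"
 using assms unfolding M_def by (simp_all add: Q_simps A_simps flip: tc_whisker(2))

text \<open>This is the composition axiom of \<open>Q\<close> under \<open>A e\<close>. Pasting with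
  \<open>?u\<close>, which associativity of \<open>A\<close> rewrites into its other form, turns
  every \<open>M\<close> into a whiskered cone cell.\<close>

lemma M_comp: assumes "e\<in>Ar Simplex" "h\<in>Ar Simplex3" "k\<in>Ar Simplex3" "Dom Simplex e = Cod Simplex3 k" "Cod Simplex3 h = Dom Simplex3 k"
 shows "M e (k\<cdot>\<^bsub>Simplex3\<^esub>h) = M e k\<bullet>M (e\<diamondop>t3_arr k) h"
proof -
 note [simp] = Q_simps A_simps M(1-4) assms
 let ?N = "PM A" let ?i = "Idc H" let ?h = "t3_arr h" let ?k = "t3_arr k" let ?q = "?i (q (Dom Simplex3 h))"
 let ?u = "(?N e (?k\<diamondop>?h)\<star>?q)\<bullet>(?i (PA A e)\<star>?N ?k ?h\<star>?q)"
 have a: "?u = (?N (e\<diamondop>?k) ?h\<star>?q)\<bullet>(?N e ?k\<star>?i (PA A ?h)\<star>?q)"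
  using arg_cong[OF B.assoc[of ?h ?k e], of "\<lambda>x. x\<star>?q"] by simp
 have m: "M e (k\<cdot>\<^bsub>Simplex3\<^esub>h)\<bullet>(?N e (?k\<diamondop>?h)\<star>?q) = ?i (PA A e)\<star>Q (k\<cdot>\<^bsub>Simplex3\<^esub>h)"
  using M(5)[of e "k\<cdot>\<^bsub>Simplex3\<^esub>h"] by simp
 have "M e (k\<cdot>\<^bsub>Simplex3\<^esub>h)\<bullet>?u = (M e (k\<cdot>\<^bsub>Simplex3\<^esub>h)\<bullet>(?N e (?k\<diamondop>?h)\<star>?q))\<bullet>(?i (PA A e)\<star>?N ?k ?h\<star>?q)"
  by simp
 also have "... = ?i (PA A e)\<star>(Q (k\<cdot>\<^bsub>Simplex3\<^esub>h)\<bullet>(?N ?k ?h\<star>?q))" unfolding m by simp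
 also have "... = (?i (PA A e)\<star>Q k)\<bullet>(?i (PA A e\<odot>PA A ?k)\<star>Q h)" unfolding Q_comp[OF assms(2,3,5)] by simp
 also have "... = M e k\<bullet>((?N e ?k\<star>?i (q (Dom Simplex3 k)))\<bullet>(?i (PA A e\<odot>PA A ?k)\<star>Q h))"
  using M(5)[of e k] by (simp flip: tc_vc_assoc)
 also have "... = M e k\<bullet>((?i (PA A (e\<diamondop>?k))\<star>Q h)\<bullet>(?N e ?k\<star>?i (PA A ?h)\<star>?q))"
  using tc_hc_whisker[OF HC2(1), of "Q h" "?N e ?k"] by simp
 also have "... = (M e k\<bullet>M (e\<diamondop>?k) h)\<bullet>?u"
  unfolding M(5)[of "e\<diamondop>?k" h, simplified, symmetric] a by simp
 finally show ?thesis by - (rule vc_cancel_right[OF HC2(1), of ?u], simp_all del: tc_vc_assoc)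
qed

text \<open>The left unit law of \<open>A\<close> inserts the constraint that \<open>M\<close>
  cancels; what remains is an interchange of \<open>Q h\<close> with the unit constraint.\<close>

lemma M_unit: assumes "h\<in>Ar Simplex3"
 shows "M (Id Simplex (Cod Simplex3 h)) h = (PU A (Cod Simplex3 h)\<star>Idc H (q (Cod Simplex3 h)))\<bullet>Q h"
proof -
 note [simp] = Q_simps A_simps M(1-4) assms
 let ?a = "Cod Simplex3 h" let ?i = "Idc H" let ?I = "Id Simplex ?a" let ?q = "?i (q (Dom Simplex3 h))"
 have p: "0 < ?a" using t3_pos by simp
 have "M ?I h = M ?I h\<bullet>((PM A ?I (t3_arr h)\<bullet>(PU A ?a\<star>?i (PA A (t3_arr h))))\<star>?q)"
  using B.unit_left[of "t3_arr h"] p M(1-4)[of ?I h] by simp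
 also have "... = (M ?I h\<bullet>(PM A ?I (t3_arr h)\<star>?q))\<bullet>(PU A ?a\<star>?i (PA A (t3_arr h))\<star>?q)" using p M(1-4)[of ?I h] by simp
 also have "M ?I h\<bullet>(PM A ?I (t3_arr h)\<star>?q) = ?i (PA A ?I)\<star>Q h" using M(5)[of ?I h] p by simp
 also have "(?i (PA A ?I)\<star>Q h)\<bullet>(PU A ?a\<star>?i (PA A (t3_arr h))\<star>?q) = (PU A ?a\<star>?i (q ?a))\<bullet>Q h"
  using tc_hc_whisker[OF HC2(1), of "Q h" "PU A ?a"] p by simp
 finally show ?thesis .
qed

text \<open>Associativity of the constraints of \<open>A\<close>, together with one interchange,
  relates \<open>M\<close> at \<open>ph\<diamondop>e\<close> to \<open>M\<close> at \<open>e\<close>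
  whiskered with \<open>A ph\<close>.\<close>

lemma M_nat: assumes "e\<in>Ar Simplex" "h\<in>Ar Simplex3" "Dom Simplex e = Cod Simplex3 h" "ph\<in>Ar Simplex" "Cod Simplex e = Dom Simplex ph"
 shows "M (ph\<diamondop>e) h\<bullet>(PM A ph (e\<diamondop>t3_arr h)\<star>Idc H (q (Dom Simplex3 h))) = (PM A ph e\<star>Idc H (q (Cod Simplex3 h)))\<bullet>(Idc H (PA A ph)\<star>M e h)"
proof -
 let ?x = "ph\<diamondop>e"
 note [simp] = Q_simps A_simps M(1-4) assms
 let ?N = "PM A" let ?i = "Idc H" let ?h = "t3_arr h" let ?q = "?i (q (Dom Simplex3 h))"
 let ?u = "?i (PA A ph)\<star>?N e ?h\<star>?q"
 have a: "(?N ph (e\<diamondop>?h)\<star>?q)\<bullet>?u = (?N ?x ?h\<star>?q)\<bullet>(?N ph e\<star>?i (PA A ?h)\<star>?q)"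
  using arg_cong[OF B.assoc[of ?h e ph], of "\<lambda>x. x\<star>?q"] by simp
 have "(M ?x h\<bullet>(?N ph (e\<diamondop>?h)\<star>?q))\<bullet>?u = (M ?x h\<bullet>(?N ?x ?h\<star>?q))\<bullet>(?N ph e\<star>?i (PA A ?h)\<star>?q)"
  using a by simp
 also have "M ?x h\<bullet>(?N ?x ?h\<star>?q) = ?i (PA A ?x)\<star>Q h" using M(5)[of "ph\<diamondop>e" h] by simp
 also have "(?i (PA A ?x)\<star>Q h)\<bullet>(?N ph e\<star>?i (PA A ?h)\<star>?q) = (?N ph e\<star>?i (q (Cod Simplex3 h)))\<bullet>(?i (PA A ph)\<star>(?i (PA A e)\<star>Q h))"
  using tc_hc_whisker[OF HC2(1), of "Q h" "?N ph e"] by simp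
 also have "... = ((?N ph e\<star>?i (q (Cod Simplex3 h)))\<bullet>(?i (PA A ph)\<star>M e h))\<bullet>?u"
  unfolding M(5)[OF assms(1-2), OF assms(3), symmetric] by simp
 finally show ?thesis by - (rule vc_cancel_right[OF HC2(1), of ?u], simp_all del: tc_vc_assoc)
qed

text \<open>The descent datum: \<open>tau e\<close> compares the two end points of the edge \<open>e\<close>.\<close>

definition "tau e = cinv H (M e D1)\<bullet>M e D0"

lemma tau: assumes "e\<in>Ar Simplex" "Dom Simplex e = 2"
 shows "tau e\<in>Cel H" "Dm H (tau e) = PA A (e\<diamondop>coface 1 0)\<odot>q 1" "Cd H (tau e) = PA A (e\<diamondop>coface 1 1)\<odot>q 1" "inv_cell H (tau e)"
  "M e D1\<bullet>tau e = M e D0"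
 using assms M[OF assms(1), of D0] M[OF assms(1), of D1] unfolding tau_def by simp_all

lemma coface_simps [simp]: "coface 1 i\<in>Ar Simplex" "coface 2 i\<in>Ar Simplex" "Dom Simplex (coface n i) = n" "Cod Simplex (coface 1 i) = 2" "Cod Simplex (coface 2 i) = 3"
 "codegen 1 0\<in>Ar Simplex" "Dom Simplex (codegen 1 0) = 2" "Cod Simplex (codegen 1 0) = 1"
 using coface_ar[of 1 i] coface_ar[of 2 i] coface_ar(2)[of n i] codegen_ar[of 1 0] by simp_all

text \<open>\<open>M_nat\<close> is applied at both ends of the edge, and the invertible cell at the
  first end is cancelled.\<close>

lemma tau_nat: assumes "e\<in>Ar Simplex" "Dom Simplex e = 2" "ph\<in>Ar Simplex" "Cod Simplex e = Dom Simplex ph"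
 shows "tau (ph\<diamondop>e)\<bullet>(PM A ph (e\<diamondop>coface 1 0)\<star>Idc H (q 1)) = (PM A ph (e\<diamondop>coface 1 1)\<star>Idc H (q 1))\<bullet>(Idc H (PA A ph)\<star>tau e)"
proof -
 let ?x = "ph\<diamondop>e"
 let ?y = "PM A ph (e\<diamondop>coface 1 1)\<star>Idc H (q 1)"
 let ?z = "PM A ph (e\<diamondop>coface 1 0)\<star>Idc H (q 1)"
 note [simp] = Q_simps A_simps assms
 have c: "ph\<diamondop>e\<in>Ar Simplex" "Dom Simplex ?x = 2" "?x\<diamondop>coface 1 i = ph\<diamondop>(e\<diamondop>coface 1 i)" for i by simp_all
 note t = tau[OF assms(1,2)] tau[OF c(1,2), unfolded c(3)]
 note m = M[OF assms(1), of D0] M[OF assms(1), of D1] M[OF c(1), of D0] M[OF c(1), of D1]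
 have n: "M ?x D1\<bullet>?y = (PM A ph e\<star>Idc H (q 2))\<bullet>(Idc H (PA A ph)\<star>M e D1)"
  "M ?x D0\<bullet>?z = (PM A ph e\<star>Idc H (q 2))\<bullet>(Idc H (PA A ph)\<star>M e D0)"
  using M_nat[OF assms(1), of D1 ph] M_nat[OF assms(1), of D0 ph] by simp_all
 have "M ?x D1\<bullet>(tau ?x\<bullet>?z) = (M ?x D1\<bullet>tau ?x)\<bullet>?z"
  using t(1-9) m by simp
 also have "... = (PM A ph e\<star>Idc H (q 2))\<bullet>(Idc H (PA A ph)\<star>(M e D1\<bullet>tau e))"
  unfolding t(5) t(10) n(2) ..
 also have "... = (M ?x D1\<bullet>?y)\<bullet>(Idc H (PA A ph)\<star>tau e)"
  unfolding n(1) using t(1-4) m by simp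
 also have "... = M ?x D1\<bullet>(?y\<bullet>(Idc H (PA A ph)\<star>tau e))"
  using t(1-4) m by simp
 finally show ?thesis using t(1-4,6-9) m by - (rule vc_cancel_left[OF HC2(1), of "M ?x D1"], simp_all)
qed

text \<open>Both faces of a degenerate edge equal \<open>x\<close>. By \<open>M_comp\<close> through
  \<open>S0\<close> the two cells agree after composition with the invertible
  \<open>M x S0\<close>.\<close>

lemma tau_degenerate: assumes "x\<in>Ar Simplex" "Dom Simplex x = 1"
 shows "tau (x\<diamondop>codegen 1 0) = Idc H (PA A x\<odot>q 1)"
proof -
 note [simp] = Q_simps A_simps assms
 let ?e = "x\<diamondop>codegen 1 0"
 have e: "?e\<in>Ar Simplex" "Dom Simplex ?e = 2" by simp_all
 have ee: "?e\<diamondop>coface 1 0 = x" "?e\<diamondop>coface 1 1 = x" using gen3_relations(2,3) by simp_all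
 note t = tau[OF e, unfolded ee]
 note m = M[OF e(1), of D0] M[OF e(1), of D1] M[OF assms(1), of S0]
 have "M x S0\<bullet>M ?e D0 = M x S0\<bullet>M ?e D1"
  using M_comp[OF assms(1), of D0 S0] M_comp[OF assms(1), of D1 S0] by (simp add: gens_relations)
 then have "M ?e D0 = M ?e D1" using m ee by - (rule vc_cancel_left[OF HC2(1), of "M x S0"], simp_all)
 then show ?thesis unfolding tau_def using m ee by simp
qed

text \<open>The cocycle condition. The relations between iterated cofaces say that two edges of the
  triangle meet in each corner and identify the cells there; the three comparisons then
  telescope.\<close>

lemma tau_comp: assumes "w\<in>Ar Simplex" "Dom Simplex w = 3"
 shows "tau (w\<diamondop>coface 2 1) = tau (w\<diamondop>coface 2 2)\<bullet>tau (w\<diamondop>coface 2 0)"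
proof -
 note [simp] = Q_simps A_simps assms
 let ?e = "\<lambda>i. w\<diamondop>coface 2 i"
 have e: "?e i\<in>Ar Simplex" "Dom Simplex (?e i) = 2" for i by simp_all
 have ee: "?e 1\<diamondop>coface 1 1 = ?e 2\<diamondop>coface 1 1" "?e 0\<diamondop>coface 1 1 = ?e 2\<diamondop>coface 1 0" "?e 0\<diamondop>coface 1 0 = ?e 1\<diamondop>coface 1 0"
 proof -
  have "coface 2 1\<diamondop>coface 1 1 = coface 2 2\<diamondop>coface 1 1" "coface 2 0\<diamondop>coface 1 1 = coface 2 2\<diamondop>coface 1 0" "coface 2 0\<diamondop>coface 1 0 = coface 2 1\<diamondop>coface 1 0"
   using gen3_relations(1)[of 1 2] gen3_relations(1)[of 0 2] gen3_relations(1)[of 0 1] by (simp_all add: One_nat_def)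
  then show "?e 1\<diamondop>coface 1 1 = ?e 2\<diamondop>coface 1 1" "?e 0\<diamondop>coface 1 1 = ?e 2\<diamondop>coface 1 0" "?e 0\<diamondop>coface 1 0 = ?e 1\<diamondop>coface 1 0"
   by simp_all
 qed
 note t = tau[OF e[of 0]] tau[OF e[of 1]] tau[OF e[of 2]]
 note m = M[OF e(1)[of 0], of D0] M[OF e(1)[of 0], of D1] M[OF e(1)[of 1], of D0] M[OF e(1)[of 1], of D1] M[OF e(1)[of 2], of D0] M[OF e(1)[of 2], of D1]
  M[OF assms(1), of E0] M[OF assms(1), of E1] M[OF assms(1), of E2]
 have r: "M w E1\<bullet>M (?e 1) D1 = M w E2\<bullet>M (?e 2) D1" "M w E0\<bullet>M (?e 0) D1 = M w E2\<bullet>M (?e 2) D0" "M w E0\<bullet>M (?e 0) D0 = M w E1\<bullet>M (?e 1) D0"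
  using M_comp[OF assms(1), of D1 E1] M_comp[OF assms(1), of D1 E2] M_comp[OF assms(1), of D1 E0] M_comp[OF assms(1), of D0 E2] M_comp[OF assms(1), of D0 E0]
   M_comp[OF assms(1), of D0 E1] by (simp_all add: gens_relations)
 have "(M w E1\<bullet>M (?e 1) D1)\<bullet>tau (?e 1) = M w E0\<bullet>M (?e 0) D0" unfolding r(3) t(10)[symmetric] using t(6-9) m ee by simp
 also have "... = (M w E0\<bullet>M (?e 0) D1)\<bullet>tau (?e 0)" unfolding t(5)[symmetric] using t(1-4) m ee by simp
 also have "... = (M w E2\<bullet>M (?e 2) D1)\<bullet>(tau (?e 2)\<bullet>tau (?e 0))" unfolding r(2) t(15)[symmetric] using t(1-4,11-14) m ee by simp
 finally have f: "(M w E1\<bullet>M (?e 1) D1)\<bullet>tau (?e 1) = (M w E1\<bullet>M (?e 1) D1)\<bullet>(tau (?e 2)\<bullet>tau (?e 0))" unfolding r(1) .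
 show ?thesis by (rule vc_cancel_left[OF HC2(1) _ _ _ _ _ f]) (use t(1-4,6-9,11-14) m ee in simp_all)
qed

text \<open>\<open>M\<close> at an identity is the cone cell up to the unit constraint, so
  \<open>M_comp\<close> expresses \<open>Q\<close> over both ends of \<open>k\<close> through the
  two cells that define the comparison.\<close>

lemma tau_Q: assumes "k\<in>Ar Simplex3" "Dom Simplex3 k = 2"
 shows "Q (k\<cdot>\<^bsub>Simplex3\<^esub>D0) = Q (k\<cdot>\<^bsub>Simplex3\<^esub>D1)\<bullet>tau (t3_arr k)"
proof -
 let ?n = "Cod Simplex3 k"
 have n: "?n\<in>Ob Simplex3" "0 < ?n" using t3_pos[of ?n] assms by simp_all
 note [simp] = Q_simps A_simps assms
 have e: "t3_arr k\<in>Ar Simplex" "Dom Simplex (t3_arr k) = 2" by simp_all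
 note t = tau[OF e]
 let ?u = "PU A ?n\<star>Idc H (q ?n)"
 have c: "M (Id Simplex ?n) (k\<cdot>\<^bsub>Simplex3\<^esub>d) = ?u\<bullet>Q (k\<cdot>\<^bsub>Simplex3\<^esub>d)"
  "M (Id Simplex ?n) (k\<cdot>\<^bsub>Simplex3\<^esub>d) = M (Id Simplex ?n) k\<bullet>M (t3_arr k) d" if "d = D0 \<or> d = D1" for d
  using M_unit[of "k\<cdot>\<^bsub>Simplex3\<^esub>d"] M_comp[of "Id Simplex ?n" d k] n that by auto
 note m = M[OF e(1), of D0] M[OF e(1), of D1] M[of "Id Simplex ?n" k]
 have "?u\<bullet>Q (k\<cdot>\<^bsub>Simplex3\<^esub>D0) = M (Id Simplex ?n) k\<bullet>M (t3_arr k) D0" using c[of D0] by simp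
 also have "... = (M (Id Simplex ?n) k\<bullet>M (t3_arr k) D1)\<bullet>tau (t3_arr k)" unfolding t(5)[symmetric] using t(1-4) m n by simp
 also have "... = (?u\<bullet>Q (k\<cdot>\<^bsub>Simplex3\<^esub>D1))\<bullet>tau (t3_arr k)" using c[of D1] by simp
 finally show ?thesis using t(1-4) n by - (rule vc_cancel_left[OF HC2(1), of ?u], simp_all)
qed

text \<open>The extension of the cone to \<open>Simplex\<close>: all points of \<open>n\<close> are compared with the point \<open>0\<close> along edges, and
 the cocycle condition on triangles gives functoriality.\<close>

definition "ext0 n = PA A (pt n 0)\<odot>q 1"

definition "ext1 ph = tau (edge (Cod Simplex ph) 0 (snd (snd ph) 0))\<bullet>(PM A ph (pt (Dom Simplex ph) 0)\<star>Idc H (q 1))"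

lemma tau_edge: assumes "i \<le> j" "j < n"
 shows "tau (edge n i j)\<in>Cel H" "Dm H (tau (edge n i j)) = PA A (pt n j)\<odot>q 1" "Cd H (tau (edge n i j)) = PA A (pt n i)\<odot>q 1" "inv_cell H (tau (edge n i j))"
 using tau[of "edge n i j"] assms by (simp_all add: face_comp)

lemma pcone_ext: "pcone Simplex H A X ext0 ext1"
 unfolding pcone_def
proof (intro conjI ballI impI)
 note [simp] = Q_simps A_simps
 show "X\<in>Obj H" by simp
 show "ext0 a\<in>Hom1 H X (PO A a)" if "a\<in>Ob Simplex" for a using that by (simp add: ext0_def)
 note pos = Simplex_dom_cod_pos note bd = Simplex_map_bound
 show "ext1 f\<in>Hom2 H (PA A f\<odot>ext0 (Dom Simplex f)) (ext0 (Cod Simplex f))" "inv_cell H (ext1 f)" if f: "f\<in>Ar Simplex" for f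
  using tau_edge[of 0 "snd (snd f) 0" "Cod Simplex f"] bd(2)[OF f _ pos(1)[OF f]] pos[OF f] comp_pt_edge(1)[OF f HOL.refl pos(1)[OF f]] f
  by (simp_all add: ext0_def ext1_def)
 show "ext1 (Id Simplex a)\<bullet>(PU A a\<star>Idc H (ext0 a)) = Idc H (ext0 a)" if a: "a\<in>Ob Simplex" for a
 proof -
  have 1: "snd (snd (Id Simplex a)) 0 = 0" using a by (simp add: Simplex_simps)
  \<comment> \<open>The edge from 0 to itself is degenerate.\<close>
  have "tau (edge a 0 0) = Idc H (PA A (pt a 0)\<odot>q 1)" using tau_degenerate[of "pt a 0"] a by (simp add: face_comp)
  then show ?thesis
   using arg_cong[OF B.unit_left[of "pt a 0"], of "\<lambda>x. x\<star>Idc H (q 1)"] a 1 by (simp add: ext0_def ext1_def)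
 qed
 show "ext1 (g\<diamondop>f)\<bullet>(PM A g f\<star>Idc H (ext0 (Dom Simplex f))) = ext1 g\<bullet>(Idc H (PA A g)\<star>ext1 f)"
  if h: "f\<in>Ar Simplex" "g\<in>Ar Simplex" "Cod Simplex f = Dom Simplex g" for f g
 proof -
  note [simp] = h
  \<comment> \<open>The composite sends 0 to \<open>?k\<close> by way of \<open>?i\<close>, and
    \<open>?j\<close> is the image of 0 under \<open>g\<close>; monotonicity gives
    \<open>?j \<le> ?k\<close>.\<close>
  let ?l = "Dom Simplex f" let ?m = "Dom Simplex g" let ?n = "Cod Simplex g" let ?q = "Idc H (q 1)"
  let ?i = "snd (snd f) 0" let ?j = "snd (snd g) 0" let ?k = "snd (snd g) ?i"
  have b: "0 < ?l" "0 < ?m" "0 < ?n" "?i < ?m" "?j \<le> ?k" "?k < ?n" "?j < ?n"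
   using pos[OF h(1)] pos[OF h(2)] bd(2)[OF h(1) _ pos(1)[OF h(1)]] bd[OF h(2), of 0 ?i] h(3) by auto
  have gf: "snd (snd (g\<diamondop>f)) 0 = ?k" using h b by (cases f; cases g) (simp add: Simplex_simps compose_def)
  have pf: "f\<diamondop>pt ?l 0 = pt ?m ?i" "g\<diamondop>pt ?m ?i = pt ?n ?k" "g\<diamondop>pt ?m 0 = pt ?n ?j" "g\<diamondop>edge ?m 0 ?i = edge ?n ?j ?k"
   using comp_pt_edge[OF h(1) HOL.refl, of 0] comp_pt_edge[OF h(2) HOL.refl] b by simp_all
  note t = tau_edge[of 0 ?k ?n] tau_edge[of 0 ?j ?n] tau_edge[of ?j ?k ?n] tau_edge[of 0 ?i ?m]
  \<comment> \<open>Cocycle on the triangle with vertices 0, \<open>?j\<close> and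
    \<open>?k\<close>.\<close>
  have tc: "tau (edge ?n 0 ?k) = tau (edge ?n 0 ?j)\<bullet>tau (edge ?n ?j ?k)"
   using tau_comp[of "tri ?n 0 ?j ?k"] b by (simp add: face_comp)
  \<comment> \<open>\<open>g\<close> carries the edge from 0 to \<open>?i\<close> to the edge from
    \<open>?j\<close> to \<open>?k\<close>.\<close>
  have tn: "tau (edge ?n ?j ?k)\<bullet>(PM A g (pt ?m ?i)\<star>?q) = (PM A g (pt ?m 0)\<star>?q)\<bullet>(Idc H (PA A g)\<star>tau (edge ?m 0 ?i))"
   using tau_nat[of "edge ?m 0 ?i" g] b pf by (simp add: face_comp)
  have as: "(PM A (g\<diamondop>f) (pt ?l 0)\<star>?q)\<bullet>(PM A g f\<star>Idc H (PA A (pt ?l 0))\<star>?q) =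
    (PM A g (pt ?m ?i)\<star>?q)\<bullet>(Idc H (PA A g)\<star>PM A f (pt ?l 0)\<star>?q)"
   using arg_cong[OF B.assoc[of "pt ?l 0" f g], of "\<lambda>x. x\<star>?q"] b pf by simp
  have pm: "Cd H (PM A f (pt ?l 0)) = PA A (pt ?m ?i)" "Cd H (PM A g (pt ?m ?i)) = PA A (pt ?n ?k)" "Cd H (PM A g (pt ?m 0)) = PA A (pt ?n ?j)"
   "Cd H (PM A (g\<diamondop>f) (pt ?l 0)) = PA A (pt ?n ?k)"
   using b pf by simp_all
  have "ext1 (g\<diamondop>f)\<bullet>(PM A g f\<star>Idc H (ext0 ?l)) =
    tau (edge ?n 0 ?k)\<bullet>((PM A (g\<diamondop>f) (pt ?l 0)\<star>?q)\<bullet>(PM A g f\<star>Idc H (PA A (pt ?l 0))\<star>?q))"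
   using b gf t pm pf by (simp add: ext1_def ext0_def)
  also have "... = tau (edge ?n 0 ?j)\<bullet>(tau (edge ?n ?j ?k)\<bullet>(PM A g (pt ?m ?i)\<star>?q))\<bullet>(Idc H (PA A g)\<star>PM A f (pt ?l 0)\<star>?q)"
   unfolding as tc using b t pm pf by simp
  also have "... = ext1 g\<bullet>(Idc H (PA A g)\<star>ext1 f)"
   unfolding tn using b t pm pf by (simp add: ext1_def ext0_def)
  finally show ?thesis .
 qed
qed

text \<open>The arrow \<open>1 \<rightarrow> n\<close> of Simplex3 that lies over the point
  0.\<close>

definition "u3 (n::nat) = (if n = 1 then Id Simplex3 1 else if n = 2 then D1 else E2\<cdot>\<^bsub>Simplex3\<^esub>D1)"

lemma u3: assumes "n\<in>Ob Simplex3"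
 shows "u3 n\<in>Ar Simplex3" "Dom Simplex3 (u3 n) = 1" "Cod Simplex3 (u3 n) = n" "t3_arr (u3 n) = pt n 0"
proof -
 have "n = 1 \<or> n = 2 \<or> n = 3" using assms by (simp add: Simplex3_simps)
 then show "u3 n\<in>Ar Simplex3" "Dom Simplex3 (u3 n) = 1" "Cod Simplex3 (u3 n) = n" "t3_arr (u3 n) = pt n 0"
  using face_comp(1)[of 3 0 1] by (auto simp: u3_def special_pt_edge)
qed

text \<open>The cone cells over the points 0 compare the extension with \<open>Q\<close>. On
  generators the squares follow from the composition axiom of \<open>Q\<close> and from
  \<open>tau_Q\<close>.\<close>

lemma ext_restricts: "cone_mor Simplex3 H A3 ext0 (\<lambda>f. ext1 (t3_arr f)) q Q (\<lambda>n. Q (u3 n))"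
proof (rule cone_mor_of_gens)
 note [simp] = Q_simps A_simps u3
 show "pcone Simplex3 H A3 X ext0 (\<lambda>f. ext1 (t3_arr f))"
  using t3.pcone_reindex[OF HC2(1) B.pseudofunctor_axioms pcone_ext, folded incl_t3_eq] .
 show "pcone Simplex3 H A3 X q Q" by (rule q)
 show "Q (u3 a)\<in>Cel H \<and> Dm H (Q (u3 a)) = ext0 a \<and> Cd H (Q (u3 a)) = q a" if "a\<in>Ob Simplex3" for a
  using that by (simp add: ext0_def)
 \<comment> \<open>The square over \<open>e\<close> is reduced to a statement about where
   \<open>e\<close> sends the point 0.\<close>
 have key: "Q (u3 (Cod Simplex3 e))\<bullet>ext1 (t3_arr e) = Q e\<bullet>(Idc H (PA A (t3_arr e))\<star>Q (u3 (Dom Simplex3 e)))"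
  if e: "e\<in>Ar Simplex3" and ek: "Q (e\<cdot>\<^bsub>Simplex3\<^esub>u3 (Dom Simplex3 e)) = Q (u3 (Cod Simplex3 e))\<bullet>tau (edge (Cod Simplex3 e) 0 (snd (snd (t3_arr e)) 0))" for e
 proof -
  note b = Simplex_dom_cod_pos[of "t3_arr e"] Simplex_map_bound(2)[of "t3_arr e" 0 0]
  have p: "t3_arr e\<diamondop>pt (Dom Simplex3 e) 0 = pt (Cod Simplex3 e) (snd (snd (t3_arr e)) 0)"
   using comp_pt_edge(1)[of "t3_arr e" "Dom Simplex3 e" 0] b e by simp
  show ?thesis
   using Q_comp[of "u3 (Dom Simplex3 e)" e] tau_edge[of 0 "snd (snd (t3_arr e)) 0" "Cod Simplex3 e"] e b p
   unfolding ek by (simp add: ext1_def)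
 qed
 have t0: "tau (edge n 0 0) = Idc H (PA A (pt n 0)\<odot>q 1)" if "0 < n" for n using tau_degenerate[of "pt n 0"] that by (simp add: face_comp)
 \<comment> \<open>Only the two faces with index 0 move the point 0, namely to 1; they are the cases
   for \<open>q2\<close> and \<open>q3\<close>. For the others the comparison is that of a
   degenerate edge.\<close>
 have v: "snd (snd (coface 1 0)) 0 = 1" "snd (snd (coface 1 1)) 0 = 0" "snd (snd (codegen 1 0)) 0 = 0" "snd (snd (coface 2 0)) 0 = 1"
  "snd (snd (coface 2 1)) 0 = 0" "snd (snd (coface 2 2)) 0 = 0" by (simp_all add: coface_def codegen_def)
 have uu: "u3 1 = Id Simplex3 1" "u3 2 = D1" "u3 3 = E2\<cdot>\<^bsub>Simplex3\<^esub>D1" by (simp_all add: u3_def)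
 have q2: "Q D0 = Q D1\<bullet>tau (edge 2 0 1)" using tau_Q[of "Id Simplex3 2"] by (simp add: special_pt_edge)
 have q3: "Q (E2\<cdot>\<^bsub>Simplex3\<^esub>D0) = Q (E2\<cdot>\<^bsub>Simplex3\<^esub>D1)\<bullet>tau (edge 3 0 1)" using tau_Q[of E2] by (simp add: special_pt_edge(5))
 have pe: "t3_arr (E2\<cdot>\<^bsub>Simplex3\<^esub>D1) = pt 3 0" "t3_arr (Id Simplex3 1) = pt 1 0" "t3_arr D1 = pt 2 0" using u3(4)[of 3] u3(4)[of 1] u3(4)[of 2] by (simp_all only: uu Simplex3_ob)
 have qr: "Q w\<bullet>Idc H (PA A (pt n 0)\<odot>q 1) = Q w" if "w\<in>Ar Simplex3" "Dom Simplex3 w = 1" "t3_arr w = pt n 0" for w n using that by simp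
 show "Q (u3 (Cod Simplex3 e))\<bullet>ext1 (t3_arr e) = Q e\<bullet>(Idc H (PA A (t3_arr e))\<star>Q (u3 (Dom Simplex3 e)))"
  if "e\<in>{D0, D1, S0, E0, E1, E2}" for e
 proof (rule key)
  show "e\<in>Ar Simplex3" using that by auto
  have "e = D0 \<or> e = D1 \<or> e = S0 \<or> e = E0 \<or> e = E1 \<or> e = E2" using that by simp
  then show "Q (e\<cdot>\<^bsub>Simplex3\<^esub>u3 (Dom Simplex3 e)) = Q (u3 (Cod Simplex3 e))\<bullet>tau (edge (Cod Simplex3 e) 0 (snd (snd (t3_arr e)) 0))"
   using t0[of 1] t0[of 2] t0[of 3] q2 q3 qr[of "Id Simplex3 1" 1, OF _ _ pe(2)] qr[of D1 2, OF _ _ pe(3)] qr[of "E2\<cdot>\<^bsub>Simplex3\<^esub>D1" 3, OF _ _ pe(1)]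
   by (elim disjE) (simp_all add: uu v gens_relations cat_unit)
 qed
qed

lemma ext_inv: "n\<in>Ob Simplex3 ==> inv_cell H (Q (u3 n))"
 by (simp add: Q_simps u3)

end

text \<open>Restriction to Simplex3 is an equivalence on pseudocones with a given vertex: cones
  extend up to isomorphism, and maps of restricted cones extend uniquely.\<close>

lemma universal_cone_restricts:
 assumes u: "universal_cone Simplex H A L p P"
 shows "universal_cone Simplex3 H A3 L p (\<lambda>f. P (t3_arr f))"
proof -
 have p: "pcone Simplex H A L p P" using u unfolding universal_cone_def by simp
 note re = t3.pcone_reindex[OF HC2(1) B.pseudofunctor_axioms, folded incl_t3_eq]
 note mre = t3.cone_mor_reindex[OF HC2(1) B.pseudofunctor_axioms, folded incl_t3_eq]
 show ?thesis
  unfolding universal_cone_def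
 proof (intro conjI allI impI ballI)
  show "pcone Simplex3 H A3 L p (\<lambda>f. P (t3_arr f))" using re[OF p] .
 next
  fix X q Q assume q: "pcone Simplex3 H A3 X q Q"
  note e = pcone_ext[OF q]
  obtain f sig where f: "f\<in>Hom1 H X L" "!!a. a\<in>Ob Simplex ==> inv_cell H (sig a)"
   and s: "cone_mor Simplex H A (\<lambda>a. p a\<odot>f) (\<lambda>h. P h\<star>Idc H f) (ext0 q) (ext1 q Q) sig"
   using u e unfolding universal_cone_def by blast
  have w: "pcone Simplex H A X (\<lambda>a. p a\<odot>f) (\<lambda>h. P h\<star>Idc H f)" using pcone_whisker[OF p, of f] f(1) by simp
  \<comment> \<open>The factorisation of the extended cone is restricted and followed by the
    comparison of the extension with \<open>Q\<close>.\<close>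
  have "cone_mor Simplex3 H A3 (\<lambda>a. p a\<odot>f) (\<lambda>h. P (t3_arr h)\<star>Idc H f) q Q (\<lambda>a. Q (u3 a)\<bullet>sig a)"
   by (rule A3.cone_mor_comp[OF mre[OF s] ext_restricts[OF q] re[OF w] re[OF e] q])
  moreover have "inv_cell H (Q (u3 a)\<bullet>sig a)" if a: "a\<in>Ob Simplex3" for a
   using ext_inv[OF q a] f(2)[of a] t3.fo[OF a] cone_morD(3)[OF s, of a] cone_morD(2)[OF ext_restricts[OF q] a] by simp
  ultimately show "\<exists>f\<in>Hom1 H X L. \<exists>sig. (\<forall>a\<in>Ob Simplex3. inv_cell H (sig a)) \<and>
    cone_mor Simplex3 H A3 (\<lambda>a. p a\<odot>f) (\<lambda>h. P (t3_arr h)\<star>Idc H f) q Q sig"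
   using f(1) by (intro bexI[of _ f] exI[of _ "\<lambda>a. Q (u3 a)\<bullet>sig a"]) simp_all
 next
  fix X f g gm assume X: "X\<in>Obj H" and f: "f\<in>Hom1 H X L" and g: "g\<in>Hom1 H X L"
   and c: "cone_mor Simplex3 H A3 (\<lambda>a. p a\<odot>f) (\<lambda>h. P (t3_arr h)\<star>Idc H f) (\<lambda>a. p a\<odot>g) (\<lambda>h. P (t3_arr h)\<star>Idc H g) gm"
  have w: "pcone Simplex H A X (\<lambda>a. p a\<odot>f) (\<lambda>h. P h\<star>Idc H f)" "pcone Simplex H A X (\<lambda>a. p a\<odot>g) (\<lambda>h. P h\<star>Idc H g)"
   using pcone_whisker[OF p, of f] pcone_whisker[OF p, of g] f g by simp_all
  obtain de where d: "cone_mor Simplex H A (\<lambda>a. p a\<odot>f) (\<lambda>h. P h\<star>Idc H f) (\<lambda>a. p a\<odot>g) (\<lambda>h. P h\<star>Idc H g) de" "!!a. a\<in>Ob Simplex3 ==> de a = gm a"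
   using restricted_mor_extends[OF w c] by blast
  have "\<exists>!al. al\<in>Hom2 H f g \<and> (\<forall>a\<in>Ob Simplex. Idc H (p a)\<star>al = de a)"
   using u X f g d(1) unfolding universal_cone_def by simp
  \<comment> \<open>Maps of cones over Simplex that agree at 1 agree everywhere, so the condition on
    the objects of Simplex3 is as strong as that on all objects.\<close>
  moreover have "(\<forall>a\<in>Ob Simplex. Idc H (p a)\<star>al = de a) \<longleftrightarrow> (\<forall>a\<in>Ob Simplex3. Idc H (p a)\<star>al = gm a)" if a: "al\<in>Hom2 H f g" for al
  proof
   assume "\<forall>a\<in>Ob Simplex. Idc H (p a)\<star>al = de a"
   then show "\<forall>a\<in>Ob Simplex3. Idc H (p a)\<star>al = gm a" using d(2) t3.fo by simp
  next
   assume h: "\<forall>a\<in>Ob Simplex3. Idc H (p a)\<star>al = gm a"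
   have "cone_mor Simplex H A (\<lambda>a. p a\<odot>f) (\<lambda>h. P h\<star>Idc H f) (\<lambda>a. p a\<odot>g) (\<lambda>h. P h\<star>Idc H g) (\<lambda>a. Idc H (p a)\<star>al)"
    using cone_mor_whisker[OF p, of al] a f by simp
   from restricted_mor_unique[OF w this d(1)] h d(2)[of 1] show "\<forall>a\<in>Ob Simplex. Idc H (p a)\<star>al = de a" by simp
  qed
  ultimately show "\<exists>!al. al\<in>Hom2 H f g \<and> (\<forall>a\<in>Ob Simplex3. Idc H (p a)\<star>al = gm a)" by (simp cong: conj_cong)
 qed
qed

end

section \<open>Universal cones over small categories\<close>

lemma pcone_cong:
 assumes "!!a. a\<in>Ob C ==> PO B a = PO B' a" "!!f. f\<in>Ar C ==> PA B f = PA B' f" "!!a. a\<in>Ob C ==> PU B a = PU B' a"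
  "!!f g. f\<in>Ar C ==> g\<in>Ar C ==> Cod C f = Dom C g ==> PM B g f = PM B' g f" "category C"
  "!!a. a\<in>Ob C ==> p a = p' a" "!!f. f\<in>Ar C ==> P f = P' f"
 shows "pcone C H B X p P \<longleftrightarrow> pcone C H B' X p' P'"
 unfolding pcone_def using assms by simp

lemma cone_mor_cong':
 assumes "category C" "!!f. f\<in>Ar C ==> PA B f = PA B' f"
  "!!a. a\<in>Ob C ==> p a = p' a" "!!f. f\<in>Ar C ==> P f = P' f" "!!a. a\<in>Ob C ==> q a = q' a" "!!f. f\<in>Ar C ==> Q f = Q' f" "!!a. a\<in>Ob C ==> gm a = gm' a"
 shows "cone_mor C H B p P q Q gm \<longleftrightarrow> cone_mor C H B' p' P' q' Q' gm'"
 unfolding cone_mor_def using assms by simp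

text \<open>Reindexing along mutually inverse functors is bijective on cones and their maps. The
  double reindexing of \<open>B\<close> agrees with \<open>B\<close> on objects, arrows and
  constraints, which is all that cones and their maps see.\<close>

lemma universal_cone_iso:
 assumes F: "cat_map C D fo fa" and G: "cat_map D C go ga" and H: "two_category H" and B: "pseudofunctor (LD C) H B"
  and io: "!!a. a\<in>Ob C ==> go (fo a) = a" "!!b. b\<in>Ob D ==> fo (go b) = b"
  and ia: "!!f. f\<in>Ar C ==> ga (fa f) = f" "!!g. g\<in>Ar D ==> fa (ga g) = g"
  and u: "universal_cone D H (psf_comp (LD D) H B (strict_psf (LD D) (LD C) go ga ga)) L p P"
 shows "universal_cone C H B L (\<lambda>a. p (fo a)) (\<lambda>f. P (fa f))"
proof -
 interpret F: cat_map C D fo fa by fact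
 interpret G: cat_map D C go ga by fact
 let ?B = "psf_comp (LD D) H B G.J" let ?B' = "psf_comp (LD C) H ?B F.J"
 note B' = G.pseudofunctor_BJ[OF H B]
 note [simp] = G.BJ_simps[OF H B] F.BJ_simps[OF H B'] io ia
 have cat: "category C" "category D" by simp_all
 note pF = F.pcone_reindex[OF H B'] and mF = F.cone_mor_reindex[OF H B'] and pG = G.pcone_reindex[OF H B] and mG = G.cone_mor_reindex[OF H B]
 have pC: "pcone C H ?B' X q Q = pcone C H B X q' Q'" if "!!a. a\<in>Ob C ==> q a = q' a" "!!f. f\<in>Ar C ==> Q f = Q' f" for X q Q q' Q'
  by (rule pcone_cong) (use that in simp_all)
 have p: "pcone D H ?B L p P" using u unfolding universal_cone_def by simp
 show ?thesis
  unfolding universal_cone_def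
 proof (intro conjI allI impI ballI)
  show "pcone C H B L (\<lambda>a. p (fo a)) (\<lambda>f. P (fa f))" using pF[OF p] pC by simp
 next
  fix X q Q assume q: "pcone C H B X q Q"
  then obtain f sig where f: "f\<in>Hom1 H X L" "!!a. a\<in>Ob D ==> inv_cell H (sig a)"
   and s: "cone_mor D H ?B (\<lambda>a. p a\<odot>\<^bsub>H\<^esub>f) (\<lambda>h. P h\<star>\<^bsub>H\<^esub>Idc H f) (\<lambda>a. q (go a)) (\<lambda>f. Q (ga f)) sig"
   using u pG[OF q] unfolding universal_cone_def by blast
  have "cone_mor C H B (\<lambda>a. p (fo a)\<odot>\<^bsub>H\<^esub>f) (\<lambda>h. P (fa h)\<star>\<^bsub>H\<^esub>Idc H f) q Q (\<lambda>a. sig (fo a))"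
   using mF[OF s] by (subst cone_mor_cong'[OF cat(1), where B' = ?B']) simp_all
  then show "\<exists>f\<in>Hom1 H X L. \<exists>sig. (\<forall>a\<in>Ob C. inv_cell H (sig a)) \<and>
    cone_mor C H B (\<lambda>a. p (fo a)\<odot>\<^bsub>H\<^esub>f) (\<lambda>h. P (fa h)\<star>\<^bsub>H\<^esub>Idc H f) q Q sig"
   using f by (intro bexI[of _ f] exI[of _ "\<lambda>a. sig (fo a)"]) simp_all
 next
  fix X f g gm assume X: "X\<in>Obj H" and f: "f\<in>Hom1 H X L" and g: "g\<in>Hom1 H X L"
   and c: "cone_mor C H B (\<lambda>a. p (fo a)\<odot>\<^bsub>H\<^esub>f) (\<lambda>h. P (fa h)\<star>\<^bsub>H\<^esub>Idc H f) (\<lambda>a. p (fo a)\<odot>\<^bsub>H\<^esub>g) (\<lambda>h. P (fa h)\<star>\<^bsub>H\<^esub>Idc H g) gm"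
  have "cone_mor D H ?B (\<lambda>a. p a\<odot>\<^bsub>H\<^esub>f) (\<lambda>h. P h\<star>\<^bsub>H\<^esub>Idc H f) (\<lambda>a. p a\<odot>\<^bsub>H\<^esub>g) (\<lambda>h. P h\<star>\<^bsub>H\<^esub>Idc H g) (\<lambda>a. gm (go a))"
   using mG[OF c] by (subst cone_mor_cong'[OF cat(2), where B' = ?B]) simp_all
  then have "\<exists>!al. al\<in>Hom2 H f g \<and> (\<forall>a\<in>Ob D. Idc H (p a)\<star>\<^bsub>H\<^esub>al = gm (go a))"
   using u X f g unfolding universal_cone_def by simp
  moreover have "(\<forall>a\<in>Ob D. Idc H (p a)\<star>\<^bsub>H\<^esub>al = gm (go a)) \<longleftrightarrow> (\<forall>a\<in>Ob C. Idc H (p (fo a))\<star>\<^bsub>H\<^esub>al = gm a)" for al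
  proof
   assume h: "\<forall>a\<in>Ob D. Idc H (p a)\<star>\<^bsub>H\<^esub>al = gm (go a)"
   show "\<forall>a\<in>Ob C. Idc H (p (fo a))\<star>\<^bsub>H\<^esub>al = gm a"
   proof
    fix a assume "a\<in>Ob C"
    then show "Idc H (p (fo a))\<star>\<^bsub>H\<^esub>al = gm a" using bspec[OF h, of "fo a"] by simp
   qed
  next
   assume h: "\<forall>a\<in>Ob C. Idc H (p (fo a))\<star>\<^bsub>H\<^esub>al = gm a"
   show "\<forall>a\<in>Ob D. Idc H (p a)\<star>\<^bsub>H\<^esub>al = gm (go a)"
   proof
    fix b assume "b\<in>Ob D"
    then show "Idc H (p b)\<star>\<^bsub>H\<^esub>al = gm (go b)" using bspec[OF h, of "go b"] by simp
   qed
  qed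
  ultimately show "\<exists>!al. al\<in>Hom2 H f g \<and> (\<forall>a\<in>Ob C. Idc H (p (fo a))\<star>\<^bsub>H\<^esub>al = gm a)" by simp
 qed
qed

text \<open>The copy of \<open>C\<close> obtained by renaming objects and arrows along maps
  injective on them.\<close>

definition "transport_cat C fo fa = \<lparr>Ob = fo ` Ob C, Ar = fa ` Ar C, Dom = (\<lambda>g. fo (Dom C (inv_into (Ar C) fa g))), Cod = (\<lambda>g. fo (Cod C (inv_into (Ar C) fa g))),
 Id = (\<lambda>b. fa (Id C (inv_into (Ob C) fo b))), Comp = (\<lambda>g f. fa (inv_into (Ar C) fa g\<cdot>\<^bsub>C\<^esub>inv_into (Ar C) fa f))\<rparr>"

lemma transport_cat_carriers: "Ob (transport_cat C fo fa) = fo ` Ob C" "Ar (transport_cat C fo fa) = fa ` Ar C"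
 by (simp_all add: transport_cat_def)

lemma transport_cat:
 assumes C [simp]: "category C" and fo: "inj_on fo (Ob C)" and fa: "inj_on fa (Ar C)"
 shows "cat_map C (transport_cat C fo fa) fo fa" "cat_map (transport_cat C fo fa) C (inv_into (Ob C) fo) (inv_into (Ar C) fa)"
proof -
 let ?x = "transport_cat C fo fa"
 note [simp] = inv_into_f_f[OF fo] inv_into_f_f[OF fa]
 have s [simp]: "Ob ?x = fo ` Ob C" "Ar ?x = fa ` Ar C" "!!f. f\<in>Ar C ==> Dom ?x (fa f) = fo (Dom C f)"
  "!!f. f\<in>Ar C ==> Cod ?x (fa f) = fo (Cod C f)" "!!a. a\<in>Ob C ==> Id ?x (fo a) = fa (Id C a)"
  "!!f g. f\<in>Ar C ==> g\<in>Ar C ==> fa g\<cdot>\<^bsub>transport_cat C fo fa\<^esub>fa f = fa (g\<cdot>\<^bsub>C\<^esub>f)"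
  by (simp_all add: transport_cat_def)
 note [simp] = inj_on_eq_iff[OF fo]
 have D: "category ?x" by (rule categoryI) auto
 show "cat_map C ?x fo fa" by (intro cat_map.intro cat_map_axioms.intro C D) simp_all
 show "cat_map ?x C (inv_into (Ob C) fo) (inv_into (Ar C) fa)" by (intro cat_map.intro cat_map_axioms.intro C D) auto
qed

definition "point_cat x = \<lparr>Ob = {x}, Ar = {x}, Dom = (\<lambda>_. x), Cod = (\<lambda>_. x), Id = (\<lambda>_. x), Comp = (\<lambda>_ _. x)\<rparr>"

lemma point_cat: "category (point_cat x)" "Ob (point_cat x) = {x}" "Hom (point_cat x) x x = {x}"
 by (rule categoryI) (auto simp: point_cat_def Hom_def)

text \<open>The weight constant at the terminal category; \<open>x\<close> names its single object
  and arrow.\<close>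

definition "point_weight C x = strict_psf (LD C) CAT (\<lambda>_. point_cat x) (\<lambda>_. fid (point_cat x)) (\<lambda>_. nid (fid (point_cat x)))"

lemma indiscrete_point_weight:
 assumes "category C" "two_category H" "pseudofunctor (LD C) H B"
 shows "indiscrete_weighted C H (point_weight C x) B"
proof -
 have "pseudofunctor (LD C) CAT (point_weight C x)"
  unfolding point_weight_def by (rule pseudofunctor_strict) (use assms(1) in "simp_all add: point_cat")
 then interpret weighted C H "point_weight C x" B using assms by (simp add: weighted_def)
 show ?thesis by unfold_locales (simp_all add: point_weight_def point_cat)
qed

text \<open>Completeness speaks of diagrams whose cells lie in \<open>'s\<close>. The diagram is
  renamed into \<open>'s\<close>, its conical bilimit is taken there, and the universal cone is
  renamed back.\<close>

lemma small_universal_cone: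
 fixes fo :: "'i => 's" and fa :: "'j => 's"
 assumes c: "bicategorically_complete TYPE('s) H" and H: "two_category H" and C: "category C" and B: "pseudofunctor (LD C) H B"
  and fo: "inj_on fo (Ob C)" and fa: "inj_on fa (Ar C)"
 shows "\<exists>L p P. universal_cone C H B L p P"
proof -
 let ?D = "transport_cat C fo fa"
 note F = transport_cat(1)[OF C fo fa] and G = transport_cat(2)[OF C fo fa]
 interpret F: cat_map C ?D fo fa by (rule F)
 interpret G: cat_map ?D C "inv_into (Ob C) fo" "inv_into (Ar C) fa" by (rule G)
 let ?B = "psf_comp (LD ?D) H B G.J" let ?W = "point_weight ?D (undefined :: 's)"
 interpret W: indiscrete_weighted ?D H ?W ?B by (rule indiscrete_point_weight[OF F.cats(2) H G.pseudofunctor_BJ[OF H B]])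
 have "\<exists>L. is_bilim (LD ?D) H ?W ?B L"
  by (rule c[unfolded bicategorically_complete_def, rule_format, OF two_category_LD[OF F.cats(2)] W.W.pseudofunctor_axioms G.pseudofunctor_BJ[OF H B]])
 then obtain L p P where u: "universal_cone ?D H ?B L p P" using W.universal_cone_of_is_bilim by blast
 have "universal_cone C H B L (\<lambda>a. p (fo a)) (\<lambda>f. P (fa f))"
  by (rule universal_cone_iso[OF F G H B inv_into_f_f[OF fo] _ inv_into_f_f[OF fa] _ u]) (simp_all only: transport_cat_carriers f_inv_into_f)
 then show ?thesis by (intro exI)
qed

text \<open>An order-preserving map is \<open>undefined\<close> outside its domain, hence determined
  by its list of values. This embeds the arrows into a countable type.\<close>

lemma inj_on_Simplex_arrows: "inj_on (\<lambda>(m, n, ph). (m, n, map ph [0..<m])) (Ar Simplex)"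
proof (rule inj_onI)
 fix f g assume a: "f\<in>Ar Simplex" "g\<in>Ar Simplex" "(\<lambda>(m, n, ph). (m, n, map ph [0..<m])) f = (\<lambda>(m, n, ph). (m, n, map ph [0..<m])) g"
 obtain m n ph where f: "f = (m, n, ph)" by (cases f)
 obtain ps where g: "g = (m, n, ps)" using a(3) f by (cases g) auto
 have "ph = ps"
 proof (rule extensionalityI)
  show "ph\<in>extensional {..<m}" "ps\<in>extensional {..<m}" using a f g by (auto simp: Simplex_simps PiE_iff)
  show "ph i = ps i" if "i\<in>{..<m}" for i using a(3) f g that by simp
 qed
 then show "f = g" using f g by simp
qed

text \<open>An infinite type contains a copy of the natural numbers, hence codes for all objects and
  arrows of Simplex.\<close>

lemma Simplex_universal_cone:
 assumes "infinite (UNIV :: 's set)" "bicategorically_complete TYPE('s) H" "two_category H" "pseudofunctor (LD Simplex) H A"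
 shows "\<exists>L p P. universal_cone Simplex H A L p P"
proof -
 obtain i :: "nat => 's" where i: "inj i" using infinite_countable_subset[OF assms(1)] by blast
 have "inj_on (i \<circ> to_nat \<circ> (\<lambda>(m, n, ph). (m, n, map ph [0..<m]))) (Ar Simplex)"
  by (intro comp_inj_on inj_on_Simplex_arrows) (auto intro: inj_on_subset[OF i] inj_on_subset[OF inj_to_nat])
 from small_universal_cone[OF assms(2,3) category_Simplex assms(4) inj_on_subset[OF i subset_UNIV] this] show ?thesis .
qed

section \<open>The augmented simplex category\<close>

declare Simplex_aug_simps [simp del]

text \<open>The unique arrow \<open>0 \<rightarrow> n\<close>; extensionality over the empty set
  makes its underlying function \<open>undefined\<close> everywhere.\<close>

definition "bang n = (0::nat, n::nat, \<lambda>i::nat. undefined::nat)"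

text \<open>A map out of a nonempty ordinal has nonempty codomain, so an arrow lies in Simplex as
  soon as its domain does. As simp rules these equations express Simplex through the augmented
  category from here on.\<close>

lemma Simplex_in_aug [simp]: "Ob DA = UNIV" "f\<in>Ar Simplex \<longleftrightarrow> f\<in>Ar DA \<and> 0 < Dom DA f"
 "Dom Simplex = Dom DA" "Cod Simplex = Cod DA" "Id Simplex = Id DA" "Comp Simplex = Comp DA"
proof -
 have "f\<in>Ar Simplex" if f: "f\<in>Ar DA" "0 < Dom DA f"
 proof -
  obtain m n ph where e: "f = (m, n, ph)" by (cases f)
  have "ph 0 < n" using f unfolding e by (auto simp: Simplex_aug_simps)
  then show ?thesis using f unfolding e by (auto simp: Simplex_simps Simplex_aug_simps)
 qed
 moreover have "f\<in>Ar DA" "0 < Dom DA f" if "f\<in>Ar Simplex" using that by (auto simp: Simplex_simps Simplex_aug_simps)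
 ultimately show "f\<in>Ar Simplex \<longleftrightarrow> f\<in>Ar DA \<and> 0 < Dom DA f" by blast
qed (simp_all add: Simplex_simps Simplex_aug_simps)

lemma aug_cod_pos [simp]: "f\<in>Ar DA ==> 0 < Dom DA f ==> 0 < Cod DA f"
 using Simplex_dom_cod_pos(2)[of f] by simp

lemma bang [simp]: "bang n\<in>Ar DA" "Dom DA (bang n) = 0" "Cod DA (bang n) = n"
 "g\<in>Ar DA ==> Dom DA g = n ==> g\<cdot>\<^bsub>DA\<^esub>bang n = bang (Cod DA g)" "Id DA 0 = bang 0"
 unfolding bang_def by (auto simp: Simplex_aug_simps mono_on_def) (cases g, auto simp: Simplex_aug_simps compose_def fun_eq_iff)

lemma bang_unique: "f\<in>Ar DA ==> Dom DA f = 0 ==> f = bang (Cod DA f)"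
 unfolding bang_def by (cases f) (auto simp: Simplex_aug_simps)

lemma aug_cases: assumes "f\<in>Ar DA" obtains "0 < Dom DA f" | n where "f = bang n"
 using bang_unique[OF assms] by (cases "Dom DA f = 0") auto

interpretation j: cat_map Simplex DA "\<lambda>n. n" "\<lambda>f. f"
 by (intro cat_map.intro cat_map_axioms.intro category_Simplex category_Simplex_aug) simp_all

declare j.fa_simps [simp del] j.fo [simp del] j.fid [simp del] j.fcomp [simp del]

lemma incl_j_eq: "incl_j = j.J"
 by (simp add: incl_j_def)

section \<open>Cones as pseudofunctors on the augmented simplex category\<close>

abbreviation (input) "SA \<equiv> LD DA"

context simplex_diagram
begin

text \<open>The vertex is the value at \<open>0\<close>, and the cone supplies the values at the arrows \<open>bang n : 0 \<rightarrow> n\<close>.\<close>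

definition "cone_psf L p P =
 (let ra = (\<lambda>f. if 0 < Dom DA f then PA A f else if Cod DA f = 0 then One H L else p (Cod DA f)) in
  \<lparr>PO = (\<lambda>n. if n = 0 then L else PO A n), PA = (\<lambda>f\<in>Ar DA. ra f), PC = (\<lambda>f\<in>Ar DA. Idc H (ra f)),
  PU = (\<lambda>n. if n = 0 then Idc H (One H L) else PU A n),
  PM = restrict2 SA (\<lambda>g f. if 0 < Dom DA f then PM A g f else if 0 < Dom DA g then P g else Idc H (ra g))\<rparr>)"

lemma cone_psf_simps [simp]: "PO (cone_psf L p P) 0 = L" "0 < n ==> PO (cone_psf L p P) n = PO A n"
 "f\<in>Ar DA ==> 0 < Dom DA f ==> PA (cone_psf L p P) f = PA A f" "PA (cone_psf L p P) (bang 0) = One H L" "0 < n ==> PA (cone_psf L p P) (bang n) = p n"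
 "f\<in>Ar DA ==> PC (cone_psf L p P) f = Idc H (PA (cone_psf L p P) f)" "PU (cone_psf L p P) 0 = Idc H (One H L)" "0 < n ==> PU (cone_psf L p P) n = PU A n"
 "f\<in>Ar DA ==> g\<in>Ar DA ==> Cod DA f = Dom DA g ==> 0 < Dom DA f ==> PM (cone_psf L p P) g f = PM A g f"
 "g\<in>Ar DA ==> 0 < n ==> Dom DA g = n ==> PM (cone_psf L p P) g (bang n) = P g"
 "PM (cone_psf L p P) (bang n) (bang 0) = Idc H (PA (cone_psf L p P) (bang n))"
 by (simp_all add: cone_psf_def Let_def restrict2_def)

context
 fixes L p P assumes p: "pcone Simplex H A L p P"
begin

lemmas pcD = pconeD[OF p]

abbreviation "R \<equiv> cone_psf L p P"

lemma cone_psf_PA: assumes "f\<in>Ar DA" shows "PA R f\<in>Arr H" "Src H (PA R f) = PO R (Dom DA f)" "Tgt H (PA R f) = PO R (Cod DA f)"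
proof -
 have "PA R f\<in>Arr H \<and> Src H (PA R f) = PO R (Dom DA f) \<and> Tgt H (PA R f) = PO R (Cod DA f)"
  using assms
 proof (cases f rule: aug_cases)
  case 1
  then show ?thesis using assms A_simps(2-4)[of f] by simp
 next
  case (2 n)
  then show ?thesis using pcD by (cases "n = 0") simp_all
 qed
 then show "PA R f\<in>Arr H" "Src H (PA R f) = PO R (Dom DA f)" "Tgt H (PA R f) = PO R (Cod DA f)" by simp_all
qed

lemma cone_psf_PM: assumes "f\<in>Ar DA" "g\<in>Ar DA" "Cod DA f = Dom DA g"
 shows "PM R g f\<in>Cel H" "Dm H (PM R g f) = PA R g\<odot>PA R f" "Cd H (PM R g f) = PA R (g\<cdot>\<^bsub>DA\<^esub>f)" "inv_cell H (PM R g f)"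
proof -
 have "PM R g f\<in>Cel H \<and> Dm H (PM R g f) = PA R g\<odot>PA R f \<and> Cd H (PM R g f) = PA R (g\<cdot>\<^bsub>DA\<^esub>f) \<and> inv_cell H (PM R g f)"
  using assms(1)
 proof (cases f rule: aug_cases)
  case 1
  then show ?thesis using assms B.pm[of f g] aug_cod_pos[OF assms(1)] by simp
 next
  case (2 m)
  show ?thesis
  proof (cases "m = 0")
   case True
   then have "g = bang (Cod DA g)" using assms 2 by (intro bang_unique) simp_all
   then obtain n where "g = bang n" by blast
   then show ?thesis using True 2 cone_psf_PA[of "bang n"] by simp
  next
   case False
   then show ?thesis using assms 2 pcD(5-8)[of g] by simp
  qed
 qed
 then show "PM R g f\<in>Cel H" "Dm H (PM R g f) = PA R g\<odot>PA R f" "Cd H (PM R g f) = PA R (g\<cdot>\<^bsub>DA\<^esub>f)" "inv_cell H (PM R g f)" by simp_all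
qed

lemma cone_psf_PU: "PU R n\<in>Cel H" "Dm H (PU R n) = One H (PO R n)" "Cd H (PU R n) = PA R (Id DA n)" "inv_cell H (PU R n)"
 using pcD(1) A_simps(5-8)[of n] by (cases "n = 0"; simp)+

lemma cone_psf_PO: "PO R n\<in>Obj H"
 using pcD(1) A_simps(1)[of n] by (cases "n = 0") simp_all

text \<open>If the first arrow lies in Simplex, the axioms are those of \<open>A\<close>; if it is
  \<open>bang m\<close> with \<open>m > 0\<close>, they are the cone axioms or unit laws in
  \<open>H\<close>; for the identity \<open>bang 0\<close> they are trivial.\<close>

lemma pseudofunctor_cone_psf: "pseudofunctor SA H R"
proof (rule pseudofunctorI)
 note [simp] = cone_psf_PA cone_psf_PM cone_psf_PU cone_psf_PO
 show "PO R\<in>extensional (Obj SA)" "PU R\<in>extensional (Obj SA)" by (simp_all add: extensional_def)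
 show "PA R\<in>extensional (Arr SA)" "PC R\<in>extensional (Cel SA)" "PM R = restrict2 SA (PM R)"
  by (simp_all add: cone_psf_def Let_def restrict2_def fun_eq_iff)
 show "PM R h (g\<odot>\<^bsub>SA\<^esub>f)\<bullet>(Idc H (PA R h)\<star>PM R g f) = PM R (h\<odot>\<^bsub>SA\<^esub>g) f\<bullet>(PM R h g\<star>Idc H (PA R f))"
  if h: "f\<in>Arr SA" "g\<in>Arr SA" "h\<in>Arr SA" "Tgt SA f = Src SA g" "Tgt SA g = Src SA h" for f g h
 proof -
  have a: "f\<in>Ar DA" "g\<in>Ar DA" "h\<in>Ar DA" "Cod DA f = Dom DA g" "Cod DA g = Dom DA h" using h by simp_all
  show ?thesis
   using a(1)
  proof (cases f rule: aug_cases)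
   case 1
   then have "0 < Dom DA g" "0 < Dom DA h" using a aug_cod_pos[of f] aug_cod_pos[of g] by simp_all
   then show ?thesis using a 1 B.assoc[of f g h] by simp
  next
   case (2 m)
   show ?thesis
   proof (cases "m = 0")
    case True
    then have g: "g = bang (Cod DA g)" using a 2 by (intro bang_unique) simp_all
    let ?n = "Cod DA g"
    have "PM R h g\<bullet>(Idc H (PA R h)\<star>Idc H (PA R g)) = PM R h g\<bullet>Idc H (PA R h\<odot>PA R g)" using a by simp
    moreover have "h\<cdot>\<^bsub>DA\<^esub>g = bang (Cod DA h)" using a g bang(4)[of h ?n] by simp
    moreover have "PM R g f = Idc H (PA R g)" "PA R f = One H L" "g\<cdot>\<^bsub>DA\<^esub>f = g" "PM R (h\<cdot>\<^bsub>DA\<^esub>g) f = Idc H (PA R (h\<cdot>\<^bsub>DA\<^esub>g))"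
     using 2 True g a calculation(2) cone_psf_simps(11)[of L p P ?n] bang(4)[of g 0] by simp_all
    ultimately show ?thesis using a 2 True cone_psf_PM[of g h] cone_psf_PA[of g] by simp
   next
    case False
    then have "0 < Dom DA g" "0 < Dom DA h" using a 2 aug_cod_pos[of g] by simp_all
    then show ?thesis using a 2 False pcone_comp[OF p, of g h] by simp
   qed
  qed
 qed
 show "PM R f (One SA (Src SA f))\<bullet>(Idc H (PA R f)\<star>PU R (Src SA f)) = Idc H (PA R f)" if f: "f\<in>Arr SA" for f
 proof -
  have f: "f\<in>Ar DA" using f by simp
  then show ?thesis
  proof (cases f rule: aug_cases)
   case 1
   then show ?thesis using f B.unit_right[of f] by simp
  next
   case (2 n)
   then show ?thesis using cone_psf_PA[of "bang n"] by simp
  qed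
 qed
 show "PM R (One SA (Tgt SA f)) f\<bullet>(PU R (Tgt SA f)\<star>Idc H (PA R f)) = Idc H (PA R f)" if f: "f\<in>Arr SA" for f
 proof -
  have f: "f\<in>Ar DA" using f by simp
  then show ?thesis
  proof (cases f rule: aug_cases)
   case 1
   then show ?thesis using f B.unit_left[of f] by simp
  next
   case (2 n)
   then show ?thesis using pcone_unit[OF p, of n] pcD(1) by (cases "n = 0") simp_all
  qed
 qed
qed (use cone_psf_PA cone_psf_PM cone_psf_PU cone_psf_PO in simp_all)

text \<open>This equality lets the identity transformation serve as counit of the Kan
  extension.\<close>

lemma cone_psf_restricts: "psf_comp (LD Simplex) H R incl_j = A"
proof (rule psf_eqI[OF _ B.pseudofunctor_axioms])
 let ?x = "LD Simplex"
 note s = j.BJ_simps[OF HC2(1) pseudofunctor_cone_psf, folded incl_j_eq]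
 show "pseudofunctor ?x H (psf_comp ?x H R incl_j)" using j.pseudofunctor_BJ[OF HC2(1) pseudofunctor_cone_psf, folded incl_j_eq] .
 show "PC (psf_comp ?x H R incl_j) th = PC A th" if "th\<in>Cel ?x" for th using that s(3)[of th] B.pc_idc[of th] by simp
 show "PM (psf_comp ?x H R incl_j) g f = PM A g f" if "g\<in>Arr ?x" "f\<in>Arr ?x" "Tgt ?x f = Src ?x g" for g f
  using that s(5)[of g f] by simp
qed (use j.BJ_simps[OF HC2(1) pseudofunctor_cone_psf, folded incl_j_eq] in simp_all)

end

end

section \<open>The right pseudo-Kan extension\<close>

lemma incl_j_simps [simp]: "0 < n ==> PO incl_j n = n" "f\<in>Ar DA ==> 0 < Dom DA f ==> PA incl_j f = f"
 by (simp_all add: incl_j_def)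

context simplex_diagram
begin

context
 fixes S assumes S: "pseudofunctor SA H S"
begin

interpretation S: pseudofunctor SA H S by (rule S)

abbreviation "Sj \<equiv> psf_comp (LD Simplex) H S incl_j"

lemmas Sj_simps = j.BJ_simps[OF HC2(1) S, folded incl_j_eq]

context
 fixes be assumes be: "psnat (LD Simplex) H be" and dc: "TDom be = Sj" "TCod be = A"
begin

interpretation b: psn_transf "LD Simplex" H be using be by (simp add: psnI)

declare b.to [simp del] b.ta [simp del]

lemma b_simps: "0 < n ==> TO be n\<in>Arr H" "0 < n ==> Src H (TO be n) = PO S n" "0 < n ==> Tgt H (TO be n) = PO A n"
 "f\<in>Ar DA ==> 0 < Dom DA f ==> TA be f\<in>Cel H" "f\<in>Ar DA ==> 0 < Dom DA f ==> Dm H (TA be f) = PA A f\<odot>TO be (Dom DA f)"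
 "f\<in>Ar DA ==> 0 < Dom DA f ==> Cd H (TA be f) = TO be (Cod DA f)\<odot>PA S f" "f\<in>Ar DA ==> 0 < Dom DA f ==> inv_cell H (TA be f)"
 using b.to[of n] b.ta[of f] Sj_simps(1)[of n] Sj_simps(2)[of f] by (simp_all add: dc)

lemma b_comp: assumes "f\<in>Ar DA" "0 < Dom DA f" "g\<in>Ar DA" "Cod DA f = Dom DA g"
 shows "TA be (g\<cdot>\<^bsub>DA\<^esub>f)\<bullet>(PM A g f\<star>Idc H (TO be (Dom DA f))) =
  (Idc H (TO be (Cod DA g))\<star>PM S g f)\<bullet>(TA be g\<star>Idc H (PA S f))\<bullet>(Idc H (PA A g)\<star>TA be f)"
 using b.comp[of f g] assms aug_cod_pos[of f] Sj_simps(2)[of f] Sj_simps(5)[of g f] by (simp add: dc)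

lemma b_unit: "0 < n ==> TA be (Id DA n)\<bullet>(PU A n\<star>Idc H (TO be n)) = Idc H (TO be n)\<star>PU S n"
 using b.unit[of n] Sj_simps(4)[of n] by (simp add: dc)

definition "bq n = TO be n\<odot>PA S (bang n)"

definition "bQ g = (Idc H (TO be (Cod DA g))\<star>PM S g (bang (Dom DA g)))\<bullet>(TA be g\<star>Idc H (PA S (bang (Dom DA g))))"

text \<open>The arrows \<open>S (bang n)\<close> with the constraints of \<open>S\<close> form a
  cone with vertex \<open>S 0\<close> over the restriction of \<open>S\<close>; pasting the squares
  of \<open>be\<close> onto it keeps the axioms.\<close>

lemma bcone: "pcone Simplex H A (PO S 0) bq bQ"
 unfolding pcone_def
proof (intro conjI ballI impI)
 note [simp] = b_simps
 show "PO S 0\<in>Obj H" by simp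
 show "bq a\<in>Hom1 H (PO S 0) (PO A a)" if "a\<in>Ob Simplex" for a using that by (simp add: bq_def)
 show "bQ f\<in>Hom2 H (PA A f\<odot>bq (Dom Simplex f)) (bq (Cod Simplex f))" "inv_cell H (bQ f)" if "f\<in>Ar Simplex" for f
  using that by (simp_all add: bq_def bQ_def)
 show "bQ (Id Simplex n)\<bullet>(PU A n\<star>Idc H (bq n)) = Idc H (bq n)" if n: "n\<in>Ob Simplex" for n
 proof -
  let ?s = "Idc H (PA S (bang n))" let ?I = "Id DA n"
  have n: "0 < n" using n by simp
  have "bQ (Id Simplex n)\<bullet>(PU A n\<star>Idc H (bq n)) = (Idc H (TO be n)\<star>PM S ?I (bang n))\<bullet>((TA be ?I\<bullet>(PU A n\<star>Idc H (TO be n)))\<star>?s)"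
   using n by (simp add: bq_def bQ_def)
  also have "... = Idc H (TO be n)\<star>(PM S ?I (bang n)\<bullet>(PU S n\<star>?s))" unfolding b_unit[OF n] using n by simp
  also have "... = Idc H (bq n)" using S.unit_left[of "bang n"] n by (simp add: bq_def)
  finally show ?thesis .
 qed
 show "bQ (h\<cdot>\<^bsub>Simplex\<^esub>g)\<bullet>(PM A h g\<star>Idc H (bq (Dom Simplex g))) = bQ h\<bullet>(Idc H (PA A h)\<star>bQ g)"
  if a: "g\<in>Ar Simplex" "h\<in>Ar Simplex" "Cod Simplex g = Dom Simplex h" for g h
 proof -
  have [simp]: "g\<in>Ar DA" "0 < Dom DA g" "h\<in>Ar DA" "0 < Dom DA h" "Cod DA g = Dom DA h" using a by simp_all
  have pos: "0 < Cod DA h" by simp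
  let ?l = "Dom DA g" let ?m = "Dom DA h" let ?i = "Idc H" let ?b = "?i (TO be (Cod DA h))" let ?s = "?i (PA S (bang ?l))"
  have "bQ (h\<cdot>\<^bsub>Simplex\<^esub>g)\<bullet>(PM A h g\<star>?i (bq ?l)) =
    (?b\<star>PM S (h\<cdot>\<^bsub>DA\<^esub>g) (bang ?l))\<bullet>((TA be (h\<cdot>\<^bsub>DA\<^esub>g)\<bullet>(PM A h g\<star>?i (TO be ?l)))\<star>?s)"
   by (simp add: bq_def bQ_def)
  also have "... = (?b\<star>(PM S (h\<cdot>\<^bsub>DA\<^esub>g) (bang ?l)\<bullet>(PM S h g\<star>?s)))\<bullet>(TA be h\<star>?i (PA S g\<odot>PA S (bang ?l)))\<bullet>(?i (PA A h)\<star>TA be g\<star>?s)"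
   unfolding b_comp[of g h, simplified] by simp
  also have "PM S (h\<cdot>\<^bsub>DA\<^esub>g) (bang ?l)\<bullet>(PM S h g\<star>?s) = PM S h (bang ?m)\<bullet>(?i (PA S h)\<star>PM S g (bang ?l))"
   using S.assoc[of "bang ?l" g h] by simp
  also have "(?b\<star>(PM S h (bang ?m)\<bullet>(?i (PA S h)\<star>PM S g (bang ?l))))\<bullet>(TA be h\<star>?i (PA S g\<odot>PA S (bang ?l)))\<bullet>(?i (PA A h)\<star>TA be g\<star>?s) =
    (?b\<star>PM S h (bang ?m))\<bullet>((?i (TO be (Cod DA h)\<odot>PA S h)\<star>PM S g (bang ?l))\<bullet>(TA be h\<star>?i (PA S g\<odot>PA S (bang ?l))))\<bullet>(?i (PA A h)\<star>TA be g\<star>?s)"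
   by simp
  \<comment> \<open>Interchange of the square of \<open>be\<close> over \<open>h\<close> with the
    constraint of \<open>S\<close> at \<open>g\<close> and \<open>bang ?l\<close>.\<close>
  also have "(?i (TO be (Cod DA h)\<odot>PA S h)\<star>PM S g (bang ?l))\<bullet>(TA be h\<star>?i (PA S g\<odot>PA S (bang ?l))) =
    (TA be h\<star>?i (PA S (bang ?m)))\<bullet>(?i (PA A h\<odot>TO be ?m)\<star>PM S g (bang ?l))"
   using tc_hc_whisker[OF HC2(1), of "PM S g (bang ?l)" "TA be h"] by simp
  also have "(?b\<star>PM S h (bang ?m))\<bullet>((TA be h\<star>?i (PA S (bang ?m)))\<bullet>(?i (PA A h\<odot>TO be ?m)\<star>PM S g (bang ?l)))\<bullet>(?i (PA A h)\<star>TA be g\<star>?s) =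
    bQ h\<bullet>(?i (PA A h)\<star>bQ g)"
   by (simp add: bQ_def)
  finally show ?thesis by simp
 qed
qed

text \<open>The component at 0 is the 1-cell that the universal cone assigns to the cone of
  \<open>be\<close>, and the squares over \<open>bang n\<close> for \<open>n > 0\<close> are the
  comparison cells \<open>sig n\<close>. Over Simplex \<open>al\<close> is \<open>be\<close>, so the
  restriction is \<open>be\<close> itself.\<close>

lemma psnat_extends:
 assumes u: "universal_cone Simplex H A L p P"
 shows "\<exists>al. psnat SA H al \<and> TDom al = S \<and> TCod al = cone_psf L p P \<and> psn_pre (LD Simplex) H incl_j al = be"
proof -
 have p: "pcone Simplex H A L p P" using u unfolding universal_cone_def by simp
 let ?R = "cone_psf L p P"
 obtain f sig where f': "f\<in>Hom1 H (PO S 0) L" and si': "\<forall>a\<in>Ob Simplex. inv_cell H (sig a)"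
  and sc: "cone_mor Simplex H A (\<lambda>a. p a\<odot>f) (\<lambda>h. P h\<star>Idc H f) bq bQ sig"
  using u bcone unfolding universal_cone_def by blast
 have f: "f\<in>Arr H" "Src H f = PO S 0" "Tgt H f = L" and si: "!!a. 0 < a ==> inv_cell H (sig a)" using f' si' by simp_all
 \<comment> \<open>At \<open>bang 0\<close> the value is forced by the unit axiom of a
   transformation, as the unit constraint of the target at 0 is an identity.\<close>
 define al where "al = \<lparr>TDom = S, TCod = ?R, TO = (\<lambda>n. if n = 0 then f else TO be n),
  TA = (\<lambda>g\<in>Ar DA. if 0 < Dom DA g then TA be g else if Cod DA g = 0 then Idc H f\<star>PU S 0 else sig (Cod DA g))\<rparr>"
 have D: "TDom al = S" "TCod al = ?R" by (simp_all add: al_def)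
 have [simp]: "TO al 0 = f" "0 < n ==> TO al n = TO be n" "g\<in>Ar DA ==> 0 < Dom DA g ==> TA al g = TA be g"
  "TA al (bang 0) = Idc H f\<star>PU S 0" "0 < n ==> TA al (bang n) = sig n" for n g by (simp_all add: al_def)
 note [simp] = f si b_simps pconeD[OF p]
 have s [simp]: "sig n\<in>Cel H" "Dm H (sig n) = p n\<odot>f" "Cd H (sig n) = TO be n\<odot>PA S (bang n)" if "0 < n" for n
  using cone_morD(1-3)[OF sc, of n] that by (simp_all add: bq_def)
 have to: "TO al n\<in>Arr H" "Src H (TO al n) = PO S n" "Tgt H (TO al n) = PO ?R n" for n by (cases "n = 0"; simp)+
 have ta: "TA al g\<in>Hom2 H (PA ?R g\<odot>TO al (Dom DA g)) (TO al (Cod DA g)\<odot>PA S g) \<and> inv_cell H (TA al g)"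
  if g: "g\<in>Ar DA" for g using g
 proof (cases g rule: aug_cases)
  case 1
  then show ?thesis using g by simp
 next
  case (2 n)
  then show ?thesis using S.pu[of 0] S.pu_inv[of 0] by (cases "n = 0") simp_all
 qed
 have "psnat SA H al"
 proof (rule psnatI)
  note R = cone_psf_PA[OF p] cone_psf_PM[OF p] cone_psf_PU[OF p] cone_psf_PO[OF p]
  show "pseudofunctor SA H (TDom al)" "pseudofunctor SA H (TCod al)" unfolding D by (rule S, rule pseudofunctor_cone_psf[OF p])
  show "TO al\<in>extensional (Obj SA)" "TA al\<in>extensional (Arr SA)" by (simp_all add: al_def extensional_def)
  show "TO al X\<in>Hom1 H (PO (TDom al) X) (PO (TCod al) X)" if "X\<in>Obj SA" for X unfolding D using to by simp
  show "TA al g\<in>Hom2 H (PA (TCod al) g\<odot>TO al (Src SA g)) (TO al (Tgt SA g)\<odot>PA (TDom al) g) \<and> inv_cell H (TA al g)" if "g\<in>Arr SA" for g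
   unfolding D using ta[of g] that by simp
  show "(Idc H (TO al (Tgt SA (Dm SA th)))\<star>PC (TDom al) th)\<bullet>TA al (Dm SA th) = TA al (Cd SA th)\<bullet>(PC (TCod al) th\<star>Idc H (TO al (Src SA (Dm SA th))))"
   if "th\<in>Cel SA" for th unfolding D using that to ta[of th] R(1-3)[of th] S.pc_idc[of th] by simp
  show "TA al (One SA n)\<bullet>(PU (TCod al) n\<star>Idc H (TO al n)) = Idc H (TO al n)\<star>PU (TDom al) n" if "n\<in>Obj SA" for n
   unfolding D using b_unit[of n] S.pu[of 0] by (cases "n = 0") simp_all
  show "TA al (g\<odot>\<^bsub>SA\<^esub>h)\<bullet>(PM (TCod al) g h\<star>Idc H (TO al (Src SA h))) =
    (Idc H (TO al (Tgt SA g))\<star>PM (TDom al) g h)\<bullet>(TA al g\<star>Idc H (PA (TDom al) h))\<bullet>(Idc H (PA (TCod al) g)\<star>TA al h)"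
   if a: "h\<in>Arr SA" "g\<in>Arr SA" "Tgt SA h = Src SA g" for h g
  proof -
   have h: "h\<in>Ar DA" "g\<in>Ar DA" "Cod DA h = Dom DA g" using a by simp_all
   note [simp] = D
   show ?thesis using h(1)
   proof (cases h rule: aug_cases)
    case 1
    then show ?thesis using h b_comp[of h g] aug_cod_pos[of h] by simp
   next
    case (2 m)
    show ?thesis
    proof (cases "m = 0")
     case False
     then have "0 < Dom DA g" "Dom DA g = m" using h 2 by simp_all
     \<comment> \<open>The composition axiom at \<open>bang m\<close> and \<open>g\<close> is the
       square of the cone map \<open>sig\<close> over \<open>g\<close>.\<close>
     then show ?thesis using cone_morD(4)[OF sc, of g] h 2 by (simp add: bQ_def)
    next
     case True
     then have "g = bang (Cod DA g)" using h 2 by (intro bang_unique) simp_all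
     then obtain n where g: "g = bang n" by blast
     let ?i = "Idc H"
     show ?thesis
     proof (cases "n = 0")
      case n: True
      have "?i f\<star>(PM S (bang 0) (bang 0)\<bullet>(PU S 0\<star>?i (PA S (bang 0)))) = ?i f\<star>?i (PA S (bang 0))"
       using S.unit_left[of "bang 0"] by simp
      then have "(?i f\<star>PM S (bang 0) (bang 0))\<bullet>(?i f\<star>PU S 0\<star>?i (PA S (bang 0))) = ?i (f\<odot>PA S (bang 0))"
       using S.pu[of 0] S.pm[of "bang 0" "bang 0"] by simp
      note e = vc_reassoc[OF this HC2(1), of "?i f\<star>PU S 0"]
      show ?thesis unfolding g 2 n True using S.pu[of 0] S.pm[of "bang 0" "bang 0"] e by simp
     next
      case n: False
      \<comment> \<open>The unit constraint of \<open>S\<close> slides past \<open>sig n\<close>,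
        after which the right unit law of \<open>S\<close> absorbs it.\<close>
      have w: "(sig n\<star>?i (PA S (bang 0)))\<bullet>(?i (p n\<odot>f)\<star>PU S 0) = (?i (TO be n\<odot>PA S (bang n))\<star>PU S 0)\<bullet>sig n"
       using tc_hc_whisker[OF HC2(1), of "PU S 0" "sig n"] n S.pu[of 0] by simp
      have "(?i (TO be n)\<star>PM S (bang n) (bang 0))\<bullet>((sig n\<star>?i (PA S (bang 0)))\<bullet>(?i (p n\<odot>f)\<star>PU S 0)) =
        (?i (TO be n)\<star>(PM S (bang n) (bang 0)\<bullet>(?i (PA S (bang n))\<star>PU S 0)))\<bullet>sig n"
       unfolding w using n S.pu[of 0] S.pm[of "bang 0" "bang n"] by simp
      also have "... = sig n" using S.unit_right[of "bang n"] n by simp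
      finally show ?thesis unfolding g 2 True using n S.pu[of 0] by simp
     qed
    qed
   qed
  qed
 qed
 moreover from this have "psnat (LD Simplex) H (psn_pre (LD Simplex) H incl_j al)"
  by (intro psnat_pre[where A' = SA]) (simp_all add: incl_j_eq j.pseudofunctor_J)
 then have "psn_pre (LD Simplex) H incl_j al = be"
  by (rule psnat_eqI[OF _ be]) (simp_all add: D dc cone_psf_restricts[OF p])
 ultimately show ?thesis using D by blast
qed

end

text \<open>The modification axiom over \<open>bang n\<close>, solved for the component at 0
  whiskered with the cone.\<close>

definition "cone_gamma al al' Dl n = cinv H (TA al' (bang n))\<bullet>(MO Dl n\<star>Idc H (PA S (bang n)))\<bullet>TA al (bang n)"

context
 fixes L p P assumes p: "pcone Simplex H A L p P"
begin

context
 fixes al assumes al: "psnat SA H al" and da: "TDom al = S" "TCod al = cone_psf L p P"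
begin

interpretation a: psn_transf SA H al using al by (simp add: psnI)

declare a.to [simp del] a.ta [simp del]

lemma into_cone: "TO al n\<in>Arr H" "Src H (TO al n) = PO S n" "Tgt H (TO al n) = PO (cone_psf L p P) n"
 "f\<in>Ar DA ==> TA al f\<in>Cel H" "f\<in>Ar DA ==> Dm H (TA al f) = PA (cone_psf L p P) f\<odot>TO al (Dom DA f)"
 "f\<in>Ar DA ==> Cd H (TA al f) = TO al (Cod DA f)\<odot>PA S f" "f\<in>Ar DA ==> inv_cell H (TA al f)"
 using a.to[of n] a.ta[of f] by (simp_all add: da)

lemma into_cone_bang: assumes "g\<in>Ar DA" "Dom DA g = m" "0 < m"
 shows "TA al (bang (Cod DA g))\<bullet>(P g\<star>Idc H (TO al 0)) =
  (Idc H (TO al (Cod DA g))\<star>PM S g (bang m))\<bullet>(TA al g\<star>Idc H (PA S (bang m)))\<bullet>(Idc H (PA A g)\<star>TA al (bang m))"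
 using a.comp[of "bang m" g] assms by (simp add: da)

lemma into_cone_id: "TA al (bang 0) = Idc H (TO al 0)\<star>PU S 0"
 using a.unit[of 0] into_cone pconeD(1)[OF p] by (simp add: da)

end

context
 fixes al al' Dl assumes al: "psnat SA H al" "TDom al = S" "TCod al = cone_psf L p P"
  and al': "psnat SA H al'" "TDom al' = S" "TCod al' = cone_psf L p P"
  and Dl: "modification (LD Simplex) H Dl" "MDom Dl = psn_pre (LD Simplex) H incl_j al" "MCod Dl = psn_pre (LD Simplex) H incl_j al'"
begin

lemma D_simps: "0 < n ==> MO Dl n\<in>Cel H" "0 < n ==> Dm H (MO Dl n) = TO al n" "0 < n ==> Cd H (MO Dl n) = TO al' n"
 using mdf_mo[OF _ Dl(1), of n] by (simp_all add: Dl(2,3))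

lemma D_natural: "f\<in>Ar DA ==> 0 < Dom DA f ==>
  (MO Dl (Cod DA f)\<star>Idc H (PA S f))\<bullet>TA al f = TA al' f\<bullet>(Idc H (PA A f)\<star>MO Dl (Dom DA f))"
 using mdf_natural[OF _ Dl(1), of f] Sj_simps(2)[of f] by (simp add: Dl(2) Dl(3) al cone_psf_restricts[OF p])

text \<open>Both sides are compared after composition with the invertible cell of \<open>al'\<close>
  over \<open>bang\<close>. There the composition axioms of \<open>al\<close> and \<open>al'\<close>
  reduce the claim to the modification axiom of \<open>Dl\<close> over \<open>f\<close>.\<close>

lemma cone_gamma: "cone_mor Simplex H A (\<lambda>n. p n\<odot>TO al 0) (\<lambda>h. P h\<star>Idc H (TO al 0)) (\<lambda>n. p n\<odot>TO al' 0) (\<lambda>h. P h\<star>Idc H (TO al' 0)) (cone_gamma al al' Dl)"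
proof (rule cone_morI)
 note [simp] = into_cone[OF al] into_cone[OF al'] D_simps pconeD[OF p]
 show g: "cone_gamma al al' Dl n\<in>Cel H \<and> Dm H (cone_gamma al al' Dl n) = p n\<odot>TO al 0 \<and> Cd H (cone_gamma al al' Dl n) = p n\<odot>TO al' 0" if "n\<in>Ob Simplex" for n
  using that by (simp add: cone_gamma_def)
 have ga: "TA al' (bang n)\<bullet>cone_gamma al al' Dl n = (MO Dl n\<star>Idc H (PA S (bang n)))\<bullet>TA al (bang n)" if "0 < n" for n
  using that by (simp add: cone_gamma_def)
 fix f assume "f\<in>Ar Simplex"
 then have [simp]: "f\<in>Ar DA" "0 < Dom DA f" by simp_all
 let ?m = "Dom DA f" let ?n = "Cod DA f" let ?s = "Idc H (PA S (bang ?m))" let ?i = "Idc H" let ?g = "cone_gamma al al' Dl"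
 have g1 [simp]: "?g ?m\<in>Cel H" "Dm H (?g ?m) = p ?m\<odot>TO al 0" "Cd H (?g ?m) = p ?m\<odot>TO al' 0" "?g ?n\<in>Cel H" "Dm H (?g ?n) = p ?n\<odot>TO al 0" "Cd H (?g ?n) = p ?n\<odot>TO al' 0"
  using g[of ?m] g[of ?n] by simp_all
 have w: "(MO Dl ?n\<star>?i (PA S (bang ?n)))\<bullet>(?i (TO al ?n)\<star>PM S f (bang ?m)) = (?i (TO al' ?n)\<star>PM S f (bang ?m))\<bullet>(MO Dl ?n\<star>?i (PA S f\<odot>PA S (bang ?m)))"
  using tc_hc_whisker[OF HC2(1), of "PM S f (bang ?m)" "MO Dl ?n"] by simp
 have "TA al' (bang ?n)\<bullet>(?g ?n\<bullet>(P f\<star>?i (TO al 0))) = (TA al' (bang ?n)\<bullet>?g ?n)\<bullet>(P f\<star>?i (TO al 0))" by simp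
 also have "... = (MO Dl ?n\<star>?i (PA S (bang ?n)))\<bullet>(TA al (bang ?n)\<bullet>(P f\<star>?i (TO al 0)))" unfolding ga[OF aug_cod_pos[OF \<open>f\<in>Ar DA\<close> \<open>0 < Dom DA f\<close>]] by simp
 also have "... = ((MO Dl ?n\<star>?i (PA S (bang ?n)))\<bullet>(?i (TO al ?n)\<star>PM S f (bang ?m)))\<bullet>(TA al f\<star>?s)\<bullet>(?i (PA A f)\<star>TA al (bang ?m))"
  unfolding into_cone_bang[OF al \<open>f\<in>Ar DA\<close> HOL.refl \<open>0 < Dom DA f\<close>] by simp
 also have "... = (?i (TO al' ?n)\<star>PM S f (bang ?m))\<bullet>(((MO Dl ?n\<star>?i (PA S f))\<bullet>TA al f)\<star>?s)\<bullet>(?i (PA A f)\<star>TA al (bang ?m))"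
  unfolding w by simp
 also have "... = (?i (TO al' ?n)\<star>PM S f (bang ?m))\<bullet>(TA al' f\<star>?s)\<bullet>(?i (PA A f)\<star>((MO Dl ?m\<star>?s)\<bullet>TA al (bang ?m)))"
  unfolding D_natural[OF \<open>f\<in>Ar DA\<close> \<open>0 < Dom DA f\<close>] by simp
 also have "... = ((?i (TO al' ?n)\<star>PM S f (bang ?m))\<bullet>(TA al' f\<star>?s)\<bullet>(?i (PA A f)\<star>TA al' (bang ?m)))\<bullet>(?i (PA A f)\<star>?g ?m)"
  unfolding ga[OF \<open>0 < Dom DA f\<close>, symmetric] by simp
 also have "... = TA al' (bang ?n)\<bullet>((P f\<star>?i (TO al' 0))\<bullet>(?i (PA A f)\<star>?g ?m))"
  unfolding into_cone_bang[OF al' \<open>f\<in>Ar DA\<close> HOL.refl \<open>0 < Dom DA f\<close>, symmetric] by simp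
 finally show "?g (Cod Simplex f)\<bullet>(P f\<star>?i (TO al 0)) = (P f\<star>?i (TO al' 0))\<bullet>(?i (PA A f)\<star>?g (Dom Simplex f))"
  by - (rule vc_cancel_left[OF HC2(1), of "TA al' (bang ?n)"], simp_all)
qed

lemma component_at_0:
 assumes u: "universal_cone Simplex H A L p P"
 shows "\<exists>!x. x\<in>Hom2 H (TO al 0) (TO al' 0) \<and> (\<forall>n\<in>Ob Simplex. Idc H (p n)\<star>x = cone_gamma al al' Dl n)"
proof -
 have "PO S 0\<in>Obj H" by simp
 moreover have "TO al 0\<in>Hom1 H (PO S 0) L" "TO al' 0\<in>Hom1 H (PO S 0) L" using into_cone[OF al] into_cone[OF al'] by simp_all
 ultimately show ?thesis using u[unfolded universal_cone_def, THEN conjunct2, THEN conjunct2, rule_format, OF _ _ _ cone_gamma] by blast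
qed

text \<open>Over arrows of Simplex the axiom is that of \<open>Dl\<close>. Over
  \<open>bang n\<close> with \<open>n > 0\<close> it is the defining property of the new component
  at 0, and over \<open>bang 0\<close> an interchange with the unit constraint of
  \<open>S\<close>.\<close>

lemma mdf_extends:
 assumes u: "universal_cone Simplex H A L p P"
 shows "\<exists>Gm. modification SA H Gm \<and> MDom Gm = al \<and> MCod Gm = al' \<and> mdf_pre (LD Simplex) H incl_j Gm = Dl"
proof -
 obtain x where x': "x\<in>Hom2 H (TO al 0) (TO al' 0)" and xn': "\<forall>n\<in>Ob Simplex. Idc H (p n)\<star>x = cone_gamma al al' Dl n"
  using component_at_0[OF u] by (elim ex1E conjE)
 have x: "x\<in>Cel H" "Dm H x = TO al 0" "Cd H x = TO al' 0" and xn: "!!n. 0 < n ==> Idc H (p n)\<star>x = cone_gamma al al' Dl n" using x' xn' by simp_all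
 define Gm where "Gm = \<lparr>MDom = al, MCod = al', MO = (\<lambda>n. if n = 0 then x else MO Dl n)\<rparr>"
 have [simp]: "MDom Gm = al" "MCod Gm = al'" "MO Gm 0 = x" "0 < n ==> MO Gm n = MO Dl n" for n by (simp_all add: Gm_def)
 note [simp] = into_cone[OF al] into_cone[OF al'] D_simps x al(2,3) al'(2,3) pconeD[OF p]
 have m: "modification SA H Gm"
 proof (rule modificationI)
  show "MO Gm n\<in>Hom2 H (TO (MDom Gm) n) (TO (MCod Gm) n)" if "n\<in>Obj SA" for n by (cases "n = 0") simp_all
  show "(MO Gm (Tgt SA f)\<star>Idc H (PA (TDom (MDom Gm)) f))\<bullet>TA (MDom Gm) f = TA (MCod Gm) f\<bullet>(Idc H (PA (TCod (MDom Gm)) f)\<star>MO Gm (Src SA f))"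
   if "f\<in>Arr SA" for f
  proof -
   have f: "f\<in>Ar DA" using that by simp
   then show ?thesis
   proof (cases f rule: aug_cases)
    case 1
    then show ?thesis using D_natural[of f] f aug_cod_pos[OF f 1] by simp
   next
    case (2 n)
    show ?thesis
    proof (cases "n = 0")
     case True
     then show ?thesis
      using tc_hc_whisker[OF HC2(1), of "PU S 0" x] S.pu[of 0] unfolding 2 by (simp add: into_cone_id[OF al] into_cone_id[OF al'])
    next
     case False
     then show ?thesis unfolding 2 using xn[of n] by (simp add: cone_gamma_def)
    qed
   qed
  qed
 qed (use al(1) al'(1) in "simp_all add: Gm_def extensional_def")
 then have "modification (LD Simplex) H (mdf_pre (LD Simplex) H incl_j Gm)"
  by (intro modification_pre[where A' = SA]) (simp_all add: incl_j_eq j.pseudofunctor_J)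
 then have "mdf_pre (LD Simplex) H incl_j Gm = Dl"
  by (rule mdf_eqI[OF _ _ Dl(1), rotated]) (simp_all add: Dl(2,3))
 then show ?thesis using m by (intro exI[of _ Gm]) simp
qed

text \<open>The modification axiom over \<open>bang n\<close> forces the whiskered component at 0;
  the universal cone then leaves one choice for the component itself.\<close>

lemma mdf_component_gamma:
 assumes G: "modification SA H Gm" "MDom Gm = al" "MCod Gm = al'" "mdf_pre (LD Simplex) H incl_j Gm = Dl"
 shows "MO Gm 0\<in>Hom2 H (TO al 0) (TO al' 0) \<and> (\<forall>n\<in>Ob Simplex. Idc H (p n)\<star>MO Gm 0 = cone_gamma al al' Dl n)"
  "0 < n ==> MO Gm n = MO Dl n"
proof -
 note [simp] = into_cone[OF al] into_cone[OF al'] D_simps al(2,3) al'(2,3) pconeD[OF p]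
 have g: "MO Gm n\<in>Cel H" "Dm H (MO Gm n) = TO al n" "Cd H (MO Gm n) = TO al' n" for n using mdf_mo[OF _ G(1), of n] G by simp_all
 show d: "MO Gm n = MO Dl n" if "0 < n" for n unfolding G(4)[symmetric] using that by simp
 have "Idc H (p n)\<star>MO Gm 0 = cone_gamma al al' Dl n" if n: "0 < n" for n
 proof -
  have "(MO Dl n\<star>Idc H (PA S (bang n)))\<bullet>TA al (bang n) = TA al' (bang n)\<bullet>(Idc H (p n)\<star>MO Gm 0)"
   using mdf_natural[OF _ G(1), of "bang n"] n d[OF n] by (simp add: G)
  then show ?thesis using n g[of 0] by (simp add: cone_gamma_def)
 qed
 then show "MO Gm 0\<in>Hom2 H (TO al 0) (TO al' 0) \<and> (\<forall>n\<in>Ob Simplex. Idc H (p n)\<star>MO Gm 0 = cone_gamma al al' Dl n)" using g[of 0] by simp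
qed

lemma mdf_unique:
 assumes u: "universal_cone Simplex H A L p P"
  and G: "modification SA H Gm" "MDom Gm = al" "MCod Gm = al'" "mdf_pre (LD Simplex) H incl_j Gm = Dl"
  and G': "modification SA H Gm'" "MDom Gm' = al" "MCod Gm' = al'" "mdf_pre (LD Simplex) H incl_j Gm' = Dl"
 shows "Gm = Gm'"
proof (rule mdf_eqI[OF _ G(1) G'(1)])
 fix n
 have "MO Gm 0 = MO Gm' 0"
  by (rule the1_equality[OF component_at_0[OF u] mdf_component_gamma(1)[OF G], THEN HOL.sym, THEN HOL.trans, OF the1_equality[OF component_at_0[OF u] mdf_component_gamma(1)[OF G']]])
 then show "MO Gm n = MO Gm' n" using mdf_component_gamma(2)[OF G, of n] mdf_component_gamma(2)[OF G', of n] by (cases "n = 0") simp_all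
qed (use G G' in simp_all)

end

end

end

end

section \<open>Equivalences in a 2-category\<close>

lemma equivalent_in_trans:
 fixes H :: "('o, 'a, 'c) twocat" (structure)
 assumes H [simp]: "two_category H" and "equivalent_in H X Y" "equivalent_in H Y Z"
 shows "equivalent_in H X Z"
proof -
 from assms(2) obtain f g et \<epsilon> where ob: "X\<in>Obj H" "Y\<in>Obj H" and fg: "f\<in>Hom1 H X Y" "g\<in>Hom1 H Y X"
  and e: "et\<in>Hom2 H (One H X) (g\<odot>f)" "inv_cell H et" "\<epsilon>\<in>Hom2 H (f\<odot>g) (One H Y)" "inv_cell H \<epsilon>"
  unfolding equivalent_in_def by blast
 from assms(3) obtain f' g' et' \<epsilon>' where ob': "Z\<in>Obj H" and fg': "f'\<in>Hom1 H Y Z" "g'\<in>Hom1 H Z Y"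
  and e': "et'\<in>Hom2 H (One H Y) (g'\<odot>f')" "inv_cell H et'" "\<epsilon>'\<in>Hom2 H (f'\<odot>g') (One H Z)" "inv_cell H \<epsilon>'"
  unfolding equivalent_in_def by blast
 have F: "f'\<odot>f\<in>Hom1 H X Z" "g\<odot>g'\<in>Hom1 H Z X" using fg fg' by simp_all
 let ?h = "(Idc H g\<star>et'\<star>Idc H f)\<bullet>et" let ?e = "\<epsilon>'\<bullet>(Idc H f'\<star>\<epsilon>\<star>Idc H g')"
 have h: "?h\<in>Hom2 H (One H X) ((g\<odot>g')\<odot>(f'\<odot>f))" "inv_cell H ?h"
  using ob ob' fg fg' e e' by simp_all
 have k: "?e\<in>Hom2 H ((f'\<odot>f)\<odot>(g\<odot>g')) (One H Z)" "inv_cell H ?e"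
  using ob ob' fg fg' e e' by simp_all
 show ?thesis unfolding equivalent_in_def
  by (intro conjI ob ob' bexI[OF _ F(1)] bexI[OF _ F(2)] bexI[where P = "inv_cell H", OF h(2) h(1)] bexI[where P = "inv_cell H", OF k(2) k(1)])
qed

text \<open>Evaluation at \<open>X\<close> preserves all operations of \<open>PsFun\<close>
  strictly, hence equivalences. At 0 it passes from Kan extensions to their values.\<close>

lemma equivalent_in_component:
 fixes A :: "('o, 'a, 'c) twocat" and B :: "('p, 'b, 'd) twocat" and F G :: "('o, 'a, 'c, 'p, 'b, 'd) psf"
 assumes A [simp]: "two_category A" and B [simp]: "two_category B" and e: "equivalent_in (PsFun A B) F G" and X: "X\<in>Obj A"
 shows "equivalent_in B (PO F X) (PO G X)"
proof -
 let ?K = "PsFun A B"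
 from e obtain f g et \<epsilon> where ob: "F\<in>Obj ?K" "G\<in>Obj ?K" and fg: "f\<in>Hom1 ?K F G" "g\<in>Hom1 ?K G F"
  and e: "et\<in>Hom2 ?K (One ?K F) (g\<odot>\<^bsub>?K\<^esub>f)" "inv_cell ?K et" "\<epsilon>\<in>Hom2 ?K (f\<odot>\<^bsub>?K\<^esub>g) (One ?K G)" "inv_cell ?K \<epsilon>"
  unfolding equivalent_in_def by blast
 have inv: "inv_cell B (MO Gm X)" "MO Gm X\<in>Hom2 B (TO (MDom Gm) X) (TO (MCod Gm) X)" if "inv_cell ?K Gm" for Gm
 proof -
  note c = cinv[OF that]
  have m: "modification A B Gm" "modification A B (cinv ?K Gm)" using c by simp_all
  note mo = mdf_mo[OF A m(1) X] mdf_mo[OF A m(2) X]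
  have d: "MDom (cinv ?K Gm) = MCod Gm" "MCod (cinv ?K Gm) = MDom Gm" using c by simp_all
  show "inv_cell B (MO Gm X)"
   by (rule inv_cellI[OF B, of _ "MO (cinv ?K Gm) X"])
    (use arg_cong[OF c(5), of "\<lambda>Gm. MO Gm X"] arg_cong[OF c(6), of "\<lambda>Gm. MO Gm X"] X mo d in simp_all)
  show "MO Gm X\<in>Hom2 B (TO (MDom Gm) X) (TO (MCod Gm) X)" using mo by simp
 qed
 have t: "psnat A B f" "psnat A B g" "TDom f = F" "TCod f = G" "TDom g = G" "TCod g = F" using fg by simp_all
 interpret f: psn_transf A B f using t by (simp add: psnI)
 interpret g: psn_transf A B g using t by (simp add: psnI)
 have o: "PO F X\<in>Obj B" "PO G X\<in>Obj B" using f.F.po_in[OF X] f.G.po_in[OF X] by (simp_all add: t)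
 have F: "TO f X\<in>Hom1 B (PO F X) (PO G X)" "TO g X\<in>Hom1 B (PO G X) (PO F X)" using f.to[OF X] g.to[OF X] by (simp_all add: t)
 have h: "MO et X\<in>Hom2 B (One B (PO F X)) (TO g X\<odot>\<^bsub>B\<^esub>TO f X)" using inv(2)[OF e(2)] e(1) X by simp
 have k: "MO \<epsilon> X\<in>Hom2 B (TO f X\<odot>\<^bsub>B\<^esub>TO g X) (One B (PO G X))" using inv(2)[OF e(4)] e(3) X by simp
 show ?thesis unfolding equivalent_in_def
  by (intro conjI o bexI[OF _ F(1)] bexI[OF _ F(2)] bexI[where P = "inv_cell B", OF inv(1)[OF e(2)] h] bexI[where P = "inv_cell B", OF inv(1)[OF e(4)] k])
qed

section \<open>The Kan extension as a universal element\<close>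

definition "pre_psf A A' H J = strict_psf (OpT (PsFun A' H)) (OpT (PsFun A H)) (\<lambda>S. psf_comp A H S J) (psn_pre A H J) (mdf_pre A H J)"

text \<open>The codomain of \<open>ran_transf\<close>, that is
  \<open>[A, H](- \<circ> J, B)\<close>, separated from the transformation so that one can speak of
  its universal elements.\<close>

definition "restr_psf A A' H J B = psf_comp (OpT (PsFun A' H)) CAT (yo (OpT (PsFun A H)) B) (pre_psf A A' H J)"

context
 fixes A :: "('o, 'a, 'c) twocat" and A' :: "('q, 'e, 'k) twocat" and H :: "('p, 'b, 'd) twocat" and J :: "('o, 'a, 'c, 'q, 'e, 'k) psf"
  and B :: "('o, 'a, 'c, 'p, 'b, 'd) psf"
 assumes A [simp]: "two_category A" and A' [simp]: "two_category A'" and H [simp]: "two_category H"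
  and J: "pseudofunctor A A' J" and B: "pseudofunctor A H B"
begin

abbreviation "K \<equiv> PsFun A H"
abbreviation "K' \<equiv> PsFun A' H"
abbreviation "G \<equiv> restr_psf A A' H J B"

interpretation pre: pseudofunctor "OpT K'" "OpT K" "pre_psf A A' H J"
 unfolding pre_psf_def by (rule pseudofunctor_pre[OF A A' H J])

interpretation yo: pseudofunctor "OpT K" CAT "yo (OpT K) B"
 using B by simp

lemma pseudofunctor_restr: "pseudofunctor (OpT K') CAT G"
 unfolding restr_psf_def by (rule pseudofunctor_comp[OF _ _ _ pre.pseudofunctor_axioms yo.pseudofunctor_axioms]) simp_all

lemma pre_strict: "X\<in>Obj K' ==> psf_comp A H X J\<in>Obj K" "f\<in>Arr K' ==> psn_pre A H J f\<in>Arr K"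
 "Gm\<in>Cel K' ==> mdf_pre A H J Gm\<in>Cel K"
 "X\<in>Obj K' ==> psn_pre A H J (One K' X) = One K (psf_comp A H X J)"
 "f\<in>Arr K' ==> g\<in>Arr K' ==> Src K' f = Tgt K' g ==> psn_pre A H J (f\<odot>\<^bsub>K'\<^esub>g) = psn_pre A H J f\<odot>\<^bsub>K\<^esub>psn_pre A H J g"
proof -
 show "X\<in>Obj K' ==> psf_comp A H X J\<in>Obj K" "f\<in>Arr K' ==> psn_pre A H J f\<in>Arr K" "Gm\<in>Cel K' ==> mdf_pre A H J Gm\<in>Cel K"
  using pre.po_in[of X] pre.arr(1)[of f] pre.cel(1)[of Gm] by (simp_all add: pre_psf_def)
 show "X\<in>Obj K' ==> psn_pre A H J (One K' X) = One K (psf_comp A H X J)"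
  using pre.pu(2)[of X] by (simp add: pre_psf_def)
 show "f\<in>Arr K' ==> g\<in>Arr K' ==> Src K' f = Tgt K' g ==> psn_pre A H J (f\<odot>\<^bsub>K'\<^esub>g) = psn_pre A H J f\<odot>\<^bsub>K\<^esub>psn_pre A H J g"
  using pre.pm(2)[of f g] by (simp add: pre_psf_def)
qed

lemma restr_simps: "X\<in>Obj K' ==> PO G X = HomC K (psf_comp A H X J) B" "f\<in>Arr K' ==> PA G f = yo_arr (OpT K) B (psn_pre A H J f)"
 "Gm\<in>Cel K' ==> PC G Gm = yo_cel (OpT K) B (mdf_pre A H J Gm)"
 using pre_strict(1)[of X] pre_strict(2)[of f] pre_strict(3)[of Gm] by (simp_all add: restr_psf_def pre_psf_def psf_comp_simps yo_eq)

text \<open>Precomposition and the representable are both strict, so the constraints of the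
  composite are pasted from identities.\<close>

lemma restr_strict: "X\<in>Obj K' ==> PU G X = nid (PA G (One K' X))"
 "f\<in>Arr K' ==> g\<in>Arr K' ==> Src K' f = Tgt K' g ==> PM G g f = nid (PA G (f\<odot>\<^bsub>K'\<^esub>g))"
proof -
 let ?x = "psf_comp A H X J"
 have yf: "is_functor (yo_arr (OpT K) B t)" if "t\<in>Arr K" for t using that B by (intro yo_arr_functor) simp_all
 have yi: "PC (yo (OpT K) B) (Idc K t) = nid (yo_arr (OpT K) B t)" if "t\<in>Arr K" for t using yo.pc_idc[of t] that by (simp add: yo_eq)
 show "PU G X = nid (PA G (One K' X))" if X: "X\<in>Obj K'"
 proof -
  note y = pre_strict(1)[OF X]
  have o: "One K ?x\<in>Arr K" "One K' X\<in>Arr K'" using tc_one(1)[OF _ y] tc_one(1)[OF _ X] by simp_all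
  have "PU G X = PC (yo (OpT K) B) (Idc K (psn_pre A H J (One K' X))) \<bullet>\<^sub>N PU (yo (OpT K) B) ?x"
   using X by (simp add: restr_psf_def pre_psf_def psf_comp_simps)
  also have "PU (yo (OpT K) B) ?x = nid (yo_arr (OpT K) B (One K ?x))"
   using y by (simp add: yo_eq)
  also have "PC (yo (OpT K) B) (Idc K (psn_pre A H J (One K' X))) = nid (yo_arr (OpT K) B (One K ?x))"
   unfolding pre_strict(4)[OF X] by (rule yi[OF o(1)])
  also have "nid (yo_arr (OpT K) B (One K ?x)) \<bullet>\<^sub>N nid (yo_arr (OpT K) B (One K ?x)) = nid (PA G (One K' X))"
   unfolding restr_simps(2)[OF o(2)] pre_strict(4)[OF X] using yf[OF o(1)] by simp
  finally show ?thesis .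
 qed
 show "PM G g f = nid (PA G (f\<odot>\<^bsub>K'\<^esub>g))" if h: "f\<in>Arr K'" "g\<in>Arr K'" "Src K' f = Tgt K' g"
 proof -
  let ?f = "psn_pre A H J f" let ?g = "psn_pre A H J g"
  have fg: "f\<odot>\<^bsub>K'\<^esub>g\<in>Arr K'" using tc_cmp(1)[OF _ h(2,1)] h(3) by simp
  note y = pre_strict(2)[OF h(1)] pre_strict(2)[OF h(2)] pre_strict(2)[OF fg]
  have s: "Src K ?f = Tgt K ?g" using h by simp
  have "PM G g f = PC (yo (OpT K) B) (Idc K (psn_pre A H J (f\<odot>\<^bsub>K'\<^esub>g))) \<bullet>\<^sub>N PM (yo (OpT K) B) ?g ?f"
   using h by (simp add: restr_psf_def pre_psf_def psf_comp_simps)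
  also have "PM (yo (OpT K) B) ?g ?f = nid (yo_arr (OpT K) B (?f\<odot>\<^bsub>K\<^esub>?g))"
   unfolding yo_eq by (subst strict_psf_simps(5)) (use y s in simp_all)
  also have "PC (yo (OpT K) B) (Idc K (psn_pre A H J (f\<odot>\<^bsub>K'\<^esub>g))) = nid (yo_arr (OpT K) B (?f\<odot>\<^bsub>K\<^esub>?g))"
   unfolding pre_strict(5)[OF h] by (rule yi[OF y(3), unfolded pre_strict(5)[OF h]])
  also have "nid (yo_arr (OpT K) B (?f\<odot>\<^bsub>K\<^esub>?g)) \<bullet>\<^sub>N nid (yo_arr (OpT K) B (?f\<odot>\<^bsub>K\<^esub>?g)) = nid (PA G (f\<odot>\<^bsub>K'\<^esub>g))"
   unfolding restr_simps(2)[OF fg] pre_strict(5)[OF h] using yf[OF y(3)] unfolding pre_strict(5)[OF h] by simp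
  finally show ?thesis .
 qed
qed

context
 fixes R \<epsilon> assumes R: "pseudofunctor A' H R" and \<epsilon>: "\<epsilon>\<in>Hom1 K (psf_comp A H R J) B"
begin

lemma restr_at: "al\<in>Hom1 K' S R ==> FOb (PA G al) \<epsilon> = \<epsilon>\<odot>\<^bsub>K\<^esub>psn_pre A H J al"
 "Gm\<in>Cel K' ==> TCod (MDom Gm) = R ==> NAt (PC G Gm) \<epsilon> = Idc K \<epsilon>\<star>\<^bsub>K\<^esub>mdf_pre A H J Gm"
 using \<epsilon> by (simp_all add: restr_simps)

text \<open>Sending \<open>al\<close> to \<open>\<epsilon>\<close> after the restriction of
  \<open>al\<close> is evaluation of the restricted representable at \<open>\<epsilon>\<close>.
  Being a Kan extension is thus an instance of having a universal element.\<close>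

lemma ran_transf_eq: "ran_transf A A' H J B R \<epsilon> = yoneda_tr K' G R \<epsilon>"
proof -
 define Ph where "Ph = (\<lambda>S. \<lparr>FDom = PO (yo (OpT K') R) S, FCod = PO G S,
          FOb = (\<lambda>al\<in>Ob (PO (yo (OpT K') R) S). \<epsilon>\<odot>\<^bsub>K\<^esub>psn_pre A H J al),
          FAr = (\<lambda>Gm\<in>Ar (PO (yo (OpT K') R) S). Idc K \<epsilon>\<star>\<^bsub>K\<^esub>mdf_pre A H J Gm)\<rparr>)"
 have r: "ran_transf A A' H J B R \<epsilon> = \<lparr>TDom = yo (OpT K') R, TCod = G, TO = restrict Ph (Obj K'), TA = (\<lambda>be\<in>Arr K'. nid (PA G be \<circ>\<^sub>F Ph (TCod be)))\<rparr>"
  by (simp add: ran_transf_def Let_def Ph_def restr_psf_def pre_psf_def)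
 have P: "Ph S = yoneda_fun K' G R \<epsilon> S" if S: "S\<in>Obj K'" for S
 proof -
  have o: "PO (yo (OpT K') R) S = HomC K' S R" using S by (simp add: yo_eq)
  have "(\<lambda>al\<in>Ob (HomC K' S R). \<epsilon>\<odot>\<^bsub>K\<^esub>psn_pre A H J al) = (\<lambda>f\<in>Ob (HomC K' S R). FOb (PA G f) \<epsilon>)"
   by (rule restrict_ext) (use restr_at(1) in simp)
  moreover have "(\<lambda>Gm\<in>Ar (HomC K' S R). Idc K \<epsilon>\<star>\<^bsub>K\<^esub>mdf_pre A H J Gm) = (\<lambda>Gm\<in>Ar (HomC K' S R). NAt (PC G Gm) \<epsilon>)"
   by (rule restrict_ext) (use restr_at(2) in simp)
  ultimately show ?thesis unfolding Ph_def yoneda_fun_def o by simp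
 qed
 have t: "TCod be\<in>Obj K'" if "be\<in>Arr K'" for be using tc_ob(2)[OF _ that] by simp
 have "restrict Ph (Obj K') = restrict (yoneda_fun K' G R \<epsilon>) (Obj K')" by (rule restrict_ext) (rule P)
 moreover have "(\<lambda>be\<in>Arr K'. nid (PA G be \<circ>\<^sub>F Ph (TCod be))) = (\<lambda>be\<in>Arr K'. nid (PA G be \<circ>\<^sub>F yoneda_fun K' G R \<epsilon> (Tgt K' be)))"
  by (rule restrict_ext) (use P t in simp)
 ultimately show ?thesis unfolding r yoneda_tr_def by simp
qed

lemma is_PsRan_of_universal_elt:
 assumes "universal_elt K' G R \<epsilon>"
 shows "is_PsRan A A' H J B R \<epsilon>"
 unfolding is_PsRan_def ran_transf_eq
 using R \<epsilon> by (intro conjI yoneda_tr_equivalence[OF _ pseudofunctor_restr assms] restr_strict) simp_all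

end

text \<open>The existence of some universal element is enough, because the later comparison concerns
  the representing pseudofunctors.\<close>

lemma universal_elt_of_is_PsRan:
 assumes "is_PsRan A A' H J B R \<epsilon>"
 shows "\<exists>c. universal_elt K' G R c"
proof (rule universal_elt_of_equivalence)
 let ?x = "ran_transf A A' H J B R \<epsilon>"
 show "R\<in>Obj K'" "cat_psnat_equivalence (OpT K') ?x" using assms unfolding is_PsRan_def by simp_all
 show "TDom ?x = yo (OpT K') R" "TCod ?x = G"
  by (simp_all add: ran_transf_def Let_def restr_psf_def pre_psf_def)
qed simp

end

lemma pseudofunctor_incl_j: "pseudofunctor (LD Simplex) SA incl_j"
 unfolding incl_j_eq by (rule j.pseudofunctor_J)

context simplex_diagram
begin

text \<open>With the identity as counit, evaluation is plain restriction along
  \<open>incl_j\<close>. Extension of transformations gives surjectivity on objects; extension and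
  uniqueness of modifications give the bijection on homs.\<close>

lemma universal_elt_cone_psf:
 assumes u: "universal_cone Simplex H A L p P"
 shows "universal_elt (PsFun SA H) (restr_psf (LD Simplex) SA H incl_j A) (cone_psf L p P) (One (PsFun (LD Simplex) H) A)"
proof -
 let ?x = "LD Simplex"
 have p: "pcone Simplex H A L p P" using u unfolding universal_cone_def by simp
 let ?R = "cone_psf L p P" let ?K = "PsFun ?x H" let ?K' = "PsFun SA H" let ?G = "restr_psf ?x SA H incl_j A" let ?e = "One ?K A"
 have tc: "two_category ?x" "two_category SA" "two_category H" by simp_all
 note R = pseudofunctor_cone_psf[OF p]
 note As = B.pseudofunctor_axioms
 have o1: "psnat ?x H ?e" using psnat_one[OF tc(1,3) As] .
 then have e: "?e\<in>Hom1 ?K (psf_comp ?x H ?R incl_j) A" by (simp add: cone_psf_restricts[OF p])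
 note rs = restr_simps[OF tc pseudofunctor_incl_j As] and ra = restr_at[OF tc pseudofunctor_incl_j As R e]
 have pn: "psnat ?x H (psn_pre ?x H incl_j al)" if "psnat SA H al" for al using psnat_pre[OF tc pseudofunctor_incl_j that] .
 have pm: "modification ?x H (mdf_pre ?x H incl_j Gm)" if "modification SA H Gm" for Gm using modification_pre[OF tc pseudofunctor_incl_j that] .
 have at: "FOb (PA ?G al) ?e = psn_pre ?x H incl_j al" if "al\<in>Hom1 ?K' S ?R" for al S
  using ra(1)[OF that] psn_comp_one(2)[OF tc(1,3) pn[of al]] that by (simp add: cone_psf_restricts[OF p])
 have atm: "NAt (PC ?G Gm) ?e = mdf_pre ?x H incl_j Gm" if "Gm\<in>Hom2 ?K' al al'" "al\<in>Hom1 ?K' S ?R" for Gm al al' S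
 proof -
  have m: "mdf_pre ?x H incl_j Gm\<in>Cel ?K" "Tgt ?K (Dm ?K (mdf_pre ?x H incl_j Gm)) = A"
   using that pm[of Gm] by (simp_all add: cone_psf_restricts[OF p])
  show ?thesis using ra(2)[of Gm] that tc_hc_one(2)[OF two_category_PsFun[OF tc(1,3)] m] by simp
 qed
 show ?thesis
  unfolding universal_elt_def
 proof (intro conjI ballI)
  show "?R\<in>Obj ?K'" using R by simp
  show "?e\<in>Ob (PO ?G ?R)" using rs(1)[of ?R] R e by simp
 next
  fix S z assume S: "S\<in>Obj ?K'" and z: "z\<in>Ob (PO ?G S)"
  have S': "pseudofunctor SA H S" using S by simp
  have z': "psnat ?x H z" "TDom z = psf_comp ?x H S incl_j" "TCod z = A" using z rs(1)[OF S] by simp_all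
  obtain al where a: "psnat SA H al" "TDom al = S" "TCod al = ?R" "psn_pre ?x H incl_j al = z"
   using psnat_extends[OF S' z' u] by (elim exE conjE)
  then have ah: "al\<in>Hom1 ?K' S ?R" by simp
  have "category (PO ?G S)" using pseudofunctor.po_in[OF pseudofunctor_restr[OF tc pseudofunctor_incl_j As]] S by simp
  \<comment> \<open>Essential surjectivity holds with an equality, as \<open>al\<close> restricts
    exactly to \<open>z\<close>.\<close>
  from isomorphic_refl[OF this z] have "isomorphic_in (PO ?G S) (FOb (PA ?G al) ?e) z" unfolding at[OF ah] a(4) .
  then show "\<exists>f\<in>Hom1 ?K' S ?R. isomorphic_in (PO ?G S) (FOb (PA ?G f) ?e) z" using ah by (rule bexI)
 next
  fix S al al' assume S: "S\<in>Obj ?K'" and a: "al\<in>Hom1 ?K' S ?R" and a': "al'\<in>Hom1 ?K' S ?R"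
  have S': "pseudofunctor SA H S" using S by simp
  have a1: "psnat SA H al" "TDom al = S" "TCod al = ?R" and a2: "psnat SA H al'" "TDom al' = S" "TCod al' = ?R" using a a' by simp_all
  let ?p = "mdf_pre ?x H incl_j" let ?q = "psn_pre ?x H incl_j"
  have hom: "Hom (PO ?G S) (FOb (PA ?G al) ?e) (FOb (PA ?G al') ?e) = {Dl. modification ?x H Dl \<and> MDom Dl = ?q al \<and> MCod Dl = ?q al'}"
   unfolding at[OF a] at[OF a'] rs(1)[OF S] Hom_def using a1 pn[OF a1(1)] by (auto simp: cone_psf_restricts[OF p])
  have "bij_betw ?p (Hom2 ?K' al al') {Dl. modification ?x H Dl \<and> MDom Dl = ?q al \<and> MCod Dl = ?q al'}"
   unfolding bij_betw_def
  proof (intro conjI equalityI subsetI inj_onI)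
   fix Gm Gm' assume g: "Gm\<in>Hom2 ?K' al al'" "Gm'\<in>Hom2 ?K' al al'" "?p Gm = ?p Gm'"
   have g1: "modification SA H Gm" "MDom Gm = al" "MCod Gm = al'" and g2: "modification SA H Gm'" "MDom Gm' = al" "MCod Gm' = al'" using g(1,2) by simp_all
   have d: "modification ?x H (?p Gm)" "MDom (?p Gm) = ?q al" "MCod (?p Gm) = ?q al'" using pm[OF g1(1)] g1 by simp_all
   show "Gm = Gm'" by (rule mdf_unique[OF S' p a1 a2 d u g1 HOL.refl g2 g(3)[symmetric]])
  next
   fix Dl assume "Dl\<in>?p ` Hom2 ?K' al al'"
   then obtain Gm where g: "Gm\<in>Hom2 ?K' al al'" "Dl = ?p Gm" by (elim imageE)
   then show "Dl\<in>{Dl. modification ?x H Dl \<and> MDom Dl = ?q al \<and> MCod Dl = ?q al'}" using pm[of Gm] by simp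
  next
   fix Dl assume "Dl\<in>{Dl. modification ?x H Dl \<and> MDom Dl = ?q al \<and> MCod Dl = ?q al'}"
   then have d: "modification ?x H Dl" "MDom Dl = ?q al" "MCod Dl = ?q al'" by simp_all
   obtain Gm where g: "modification SA H Gm" "MDom Gm = al" "MCod Gm = al'" "?p Gm = Dl" using mdf_extends[OF S' p a1 a2 d u] by (elim exE conjE)
   show "Dl\<in>?p ` Hom2 ?K' al al'" by (rule image_eqI[where x = Gm]) (use g in simp_all)
  qed
  then show "bij_betw (\<lambda>Gm. NAt (PC ?G Gm) ?e) (Hom2 ?K' al al') (Hom (PO ?G S) (FOb (PA ?G al) ?e) (FOb (PA ?G al') ?e))"
   unfolding hom by (subst bij_betw_cong[OF atm[OF _ a]])
 qed
qed

end

theorem theorem4p11: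
  fixes H :: "('o, 'a, 'c) twocat" and \<A> :: "(nat, omap, omap, 'o, 'a, 'c) psf"
  assumes "infinite (UNIV :: 's set)"
    and "two_category H"
    and "bicategorically_complete TYPE('s) H"
    and "pseudofunctor (LD Simplex) H \<A>"
  shows "(\<exists>D. is_Desc H \<A> D) \<and>
    (\<exists>R \<epsilon>. is_PsRan (LD Simplex) (LD Simplex_aug) H incl_j \<A> R \<epsilon>) \<and>
    (\<forall>D R \<epsilon>. is_Desc H \<A> D \<longrightarrow> is_PsRan (LD Simplex) (LD Simplex_aug) H incl_j \<A> R \<epsilon> \<longrightarrow>
      equivalent_in H D (PO R 0))"
proof -
 \<comment> \<open>The vertex \<open>L\<close> will be both a descent object and the value at 0 of a
   Kan extension.\<close>
 obtain L p P where u: "universal_cone Simplex H \<A> L p P"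
  using Simplex_universal_cone[OF assms(1,3,2,4)] by blast
 interpret simplex_diagram H \<A>
  using assms(2,4) by (simp add: simplex_diagram_def diagram_def)
 have tc: "two_category (LD Simplex)" "two_category SA" by simp_all
 let ?R = "cone_psf L p P" let ?e = "One (PsFun (LD Simplex) H) \<A>"
 have p: "pcone Simplex H \<A> L p P" using u unfolding universal_cone_def by simp
 note univ = universal_elt_cone_psf[OF u]
 have e: "?e\<in>Hom1 (PsFun (LD Simplex) H) (psf_comp (LD Simplex) H ?R incl_j) \<A>"
  using psnat_one[OF tc(1) assms(2,4)] by (simp add: cone_psf_restricts[OF p])
 have ran: "is_PsRan (LD Simplex) SA H incl_j \<A> ?R ?e"
  by (rule is_PsRan_of_universal_elt[OF tc assms(2) pseudofunctor_incl_j assms(4) pseudofunctor_cone_psf[OF p] e univ])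
 interpret W: indiscrete_weighted Simplex3 H weight_W A3
  using A3_diagram by (intro indiscrete_weight_W assms(2)) (simp add: diagram_def)
 have desc: "is_Desc H \<A> L"
  unfolding is_Desc_def by (rule W.is_bilim_of_universal_cone[OF universal_cone_restricts[OF u]])
 have elt: "\<exists>c. universal_elt H (weighted_cones (LD Simplex3) H weight_W A3) D c" if D: "is_Desc H \<A> D" for D
  using D universal_elt_of_equivalence[OF assms(2)] unfolding is_Desc_def is_bilim_def by blast
 \<comment> \<open>Any descent object is compared with \<open>L\<close>, and any Kan extension with
   the one built from the cone, whose value at 0 is \<open>L\<close>. The second equivalence lives
   in the 2-category of pseudofunctors and is evaluated at 0.\<close>
 have "equivalent_in H D (PO R 0)" if D: "is_Desc H \<A> D" and R: "is_PsRan (LD Simplex) SA H incl_j \<A> R \<epsilon>" for D R \<epsilon>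
 proof -
  obtain c d where "universal_elt H (weighted_cones (LD Simplex3) H weight_W A3) D c" "universal_elt H (weighted_cones (LD Simplex3) H weight_W A3) L d"
   using elt[OF D] elt[OF desc] by blast
  then have DL: "equivalent_in H D L" by (rule universal_elt_unique[OF assms(2) W.pseudofunctor_weighted_cones])
  obtain c' where "universal_elt (PsFun SA H) (restr_psf (LD Simplex) SA H incl_j \<A>) R c'"
   using universal_elt_of_is_PsRan[OF tc assms(2) pseudofunctor_incl_j assms(4) R] by blast
  from universal_elt_unique[OF two_category_PsFun[OF tc(2) assms(2)] pseudofunctor_restr[OF tc assms(2) pseudofunctor_incl_j assms(4)] univ this]
  have "equivalent_in H (PO ?R 0) (PO R 0)" by (rule equivalent_in_component[OF tc(2) assms(2)]) simp
  then have "equivalent_in H L (PO R 0)" by simp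
  then show ?thesis by (rule equivalent_in_trans[OF assms(2) DL])
 qed
 then show ?thesis using desc ran by blast
qed

end
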